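(* Let $\gamma>\alpha>\beta\ge1$ and let $f$ satisfy the assumptions in the context (including (G1)–(G4)). Consider, for $\lambda>0$, the problem $$s^{-(\gamma-1)}(s^{\alpha}|v'|^{\beta-1}v')'+\frac{\lambda}{f(1-v)}=0,\quad v(s)>0\ \text{ for } 0<s<1,\qquad v(1)=0. \qquad (\ast)$$ The following hold. (i) Problem $(\ast)$ has a unique degenerate solution $(\bar\lambda,\bar v)$. Let $\mathcal C:=\{(\lambda(\tau),v(s,\tau))\mid v(0,\tau)=\tau,\ 0<\tau<1\}$ be the bifurcation curve of regular solutions. Then, as $\tau\to1$, $$\lambda(\tau)\to\bar\lambda\quad\text{and}\quad v(s,\tau)\to\bar v(s)\ \text{ in } C[0,1].$$ (ii) Let $$q_c:=\frac12+\frac{\theta(\beta+1)^2}{4(\sqrt{\tau_0}-\sqrt{\theta})^2-2\theta(\beta+1)^2},\qquad \theta=1+\frac{\gamma-\alpha}{\beta},\quad \tau_0:=\beta\gamma+\alpha-\beta .$$ If $q<q_c$, then the curve $\mathcal C$ has infinitely many turning points around $\bar\lambda$ (i.e. $\lambda(\tau)$ oscillates infinitely many times around $\bar\lambda$ as $\tau\to1$), and hence $(\ast)$ with $\lambda=\bar\lambda$ has infinitely many regular solutions.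
   Context: Standing assumptions: $f\in C^2(0,\infty)\cap C[0,\infty)$, $f(0)=0$, $f>0$ on $(0,\infty)$, and $g:=f^{1/\beta}$ satisfies, for some $\bar u>0$: (G1) $g'(u)>0$ and $g''(u)>0$ for all $u\in(0,\bar u)$; (G2) the (finite) limit $q:=\lim_{u\to0}\frac{g'(u)^2}{g(u)g''(u)}$ exists (then $q\ge 1$); (G3) if $q=1$, then $\frac{g'(u)^2}{g(u)g''(u)}\ge1$ for small $u>0$; (G4) $g'(u)>0$ for all $0<u<\infty$. A regular solution of $(\ast)$ is a pair $(\lambda,v)$ (or the function $v$, if $\lambda$ is fixed) with $v\in C^2(0,1)\cap C[0,1]$ solving $(\ast)$ and $0\le v<1$ on $[0,1]$. It is known that the set of regular solutions is parametrized by $\tau=v(0)\in(0,1)$: for each $\tau\in(0,1)$ there is exactly one regular solution $(\lambda(\tau),v(\cdot,\tau))$ with $v(0,\tau)=\tau$. A degenerate solution of $(\ast)$ is a pair $(\bar\lambda,\bar v)$ with $\bar\lambda>0$ such that $\bar v\in C^2(0,1)\cap C[0,1]$ solves $(\ast)$ with $\lambda=\bar\lambda$ and $\bar v(0)=1$ (and $\bar v<1$ on $(0,1]$). The quantity $q_c$ is defined when the denominator in its formula is nonzero. *)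

theory Defs
  imports "HOL-Analysis.Analysis"
begin

text \<open>To be used for open \<open>S\<close>, where the two-sided derivatives are the right ones.\<close>

definition C2_on :: "real set \<Rightarrow> (real \<Rightarrow> real) \<Rightarrow> bool" where
  "C2_on S h \<longleftrightarrow>
     (\<forall>x\<in>S. h differentiable (at x)) \<and>
     (\<forall>x\<in>S. deriv h differentiable (at x)) \<and>
     continuous_on S (deriv (deriv h))"

text \<open>The flux \<open>s\<^sup>\<alpha> |v'|\<^sup>\<beta>\<^sup>-\<^sup>1 v'\<close>.  Since \<open>0 powr 0 = 0\<close>, for \<open>\<beta> = 1\<close> the middle factor
  is \<open>0\<close> instead of \<open>1\<close> where \<open>v'\<close> vanishes; the product is \<open>0\<close> there either way.\<close>

definition flux :: "real \<Rightarrow> real \<Rightarrow> (real \<Rightarrow> real) \<Rightarrow> real \<Rightarrow> real" where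
  "flux \<alpha> \<beta> v s = s powr \<alpha> * \<bar>deriv v s\<bar> powr (\<beta> - 1) * deriv v s"

text \<open>A function on \<open>[0,1]\<close> is represented by its extensional extension to the real line, so that
  equality and cardinality of sets of solutions refer to the values on \<open>[0,1]\<close> only.\<close>

definition solves_problem ::
    "real \<Rightarrow> real \<Rightarrow> real \<Rightarrow> (real \<Rightarrow> real) \<Rightarrow> real \<Rightarrow> (real \<Rightarrow> real) \<Rightarrow> bool" where
  "solves_problem \<alpha> \<beta> \<gamma> f lam v \<longleftrightarrow>
     v \<in> extensional {0..1} \<and>
     C2_on {0<..<1} v \<and> continuous_on {0..1} v \<and>
     (\<forall>s\<in>{0<..<1}. flux \<alpha> \<beta> v differentiable (at s) \<and>
        s powr (- (\<gamma> - 1)) * deriv (flux \<alpha> \<beta> v) s + lam / f (1 - v s) = 0) \<and>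
     (\<forall>s\<in>{0<..<1}. v s > 0) \<and> v 1 = 0"

definition regular_solution ::
    "real \<Rightarrow> real \<Rightarrow> real \<Rightarrow> (real \<Rightarrow> real) \<Rightarrow> real \<Rightarrow> (real \<Rightarrow> real) \<Rightarrow> bool" where
  "regular_solution \<alpha> \<beta> \<gamma> f lam v \<longleftrightarrow>
     lam > 0 \<and> solves_problem \<alpha> \<beta> \<gamma> f lam v \<and> (\<forall>s\<in>{0..1}. 0 \<le> v s \<and> v s < 1)"

definition degenerate_solution ::
    "real \<Rightarrow> real \<Rightarrow> real \<Rightarrow> (real \<Rightarrow> real) \<Rightarrow> real \<Rightarrow> (real \<Rightarrow> real) \<Rightarrow> bool" where
  "degenerate_solution \<alpha> \<beta> \<gamma> f lam v \<longleftrightarrow>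
     lam > 0 \<and> solves_problem \<alpha> \<beta> \<gamma> f lam v \<and> v 0 = 1 \<and> (\<forall>s\<in>{0<..1}. v s < 1)"

text \<open>The bifurcation curve \<open>\<tau> \<mapsto> (\<lambda>(\<tau>), v(\<cdot>,\<tau>))\<close>, meaningful for \<open>0 < \<tau> < 1\<close>: for such \<open>\<tau>\<close>
  there is exactly one regular solution with \<open>v(0) = \<tau>\<close>.\<close>

definition curve_point ::
    "real \<Rightarrow> real \<Rightarrow> real \<Rightarrow> (real \<Rightarrow> real) \<Rightarrow> real \<Rightarrow> real \<times> (real \<Rightarrow> real)" where
  "curve_point \<alpha> \<beta> \<gamma> f \<tau> =
     (THE p. regular_solution \<alpha> \<beta> \<gamma> f (fst p) (snd p) \<and> snd p 0 = \<tau>)"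

definition curve_lambda :: "real \<Rightarrow> real \<Rightarrow> real \<Rightarrow> (real \<Rightarrow> real) \<Rightarrow> real \<Rightarrow> real" where
  "curve_lambda \<alpha> \<beta> \<gamma> f \<tau> = fst (curve_point \<alpha> \<beta> \<gamma> f \<tau>)"

definition curve_v :: "real \<Rightarrow> real \<Rightarrow> real \<Rightarrow> (real \<Rightarrow> real) \<Rightarrow> real \<Rightarrow> real \<Rightarrow> real" where
  "curve_v \<alpha> \<beta> \<gamma> f \<tau> = snd (curve_point \<alpha> \<beta> \<gamma> f \<tau>)"

text \<open>\<open>L \<tau> - c\<close> changes sign infinitely many times as \<open>\<tau> \<rightarrow> 1\<close>.\<close>

definition oscillates_around :: "(real \<Rightarrow> real) \<Rightarrow> real \<Rightarrow> bool" where
  "oscillates_around L c \<longleftrightarrow>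
     (\<exists>\<^sub>F \<tau> in at_left 1. L \<tau> < c) \<and> (\<exists>\<^sub>F \<tau> in at_left 1. L \<tau> > c)"

text \<open>A curve parametrized by \<open>\<tau>\<close> turns, with respect to its \<open>\<lambda>\<close>-component \<open>L\<close>, where \<open>L\<close> has a
  local extremum.  The extrema are required to lie on both sides of \<open>c\<close>, arbitrarily close to
  \<open>\<tau> = 1\<close>.\<close>

definition infinitely_many_turning_points_around :: "(real \<Rightarrow> real) \<Rightarrow> real \<Rightarrow> bool" where
  "infinitely_many_turning_points_around L c \<longleftrightarrow>
     (\<exists>\<^sub>F \<tau> in at_left 1. L \<tau> > c \<and> (\<forall>\<^sub>F t in at \<tau>. L t \<le> L \<tau>)) \<and>
     (\<exists>\<^sub>F \<tau> in at_left 1. L \<tau> < c \<and> (\<forall>\<^sub>F t in at \<tau>. L t \<ge> L \<tau>))"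

definition theta :: "real \<Rightarrow> real \<Rightarrow> real \<Rightarrow> real" where
  "theta \<alpha> \<beta> \<gamma> = 1 + (\<gamma> - \<alpha>) / \<beta>"

definition tau0 :: "real \<Rightarrow> real \<Rightarrow> real \<Rightarrow> real" where
  "tau0 \<alpha> \<beta> \<gamma> = \<beta> * \<gamma> + \<alpha> - \<beta>"

definition qc_denom :: "real \<Rightarrow> real \<Rightarrow> real \<Rightarrow> real" where
  "qc_denom \<alpha> \<beta> \<gamma> =
     4 * (sqrt (tau0 \<alpha> \<beta> \<gamma>) - sqrt (theta \<alpha> \<beta> \<gamma>))\<^sup>2 - 2 * theta \<alpha> \<beta> \<gamma> * (\<beta> + 1)\<^sup>2"

text \<open>Meaningful only if the denominator is nonzero.\<close>

definition qc :: "real \<Rightarrow> real \<Rightarrow> real \<Rightarrow> real" where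
  "qc \<alpha> \<beta> \<gamma> = 1 / 2 + theta \<alpha> \<beta> \<gamma> * (\<beta> + 1)\<^sup>2 / qc_denom \<alpha> \<beta> \<gamma>"

end

theory Submission
  imports Defs
begin

text \<open>Write \<open>w = 1 - v\<close>, let \<open>P\<close> be minus the flux and take \<open>w\<close> as the independent variable. The quantities
  \<open>X = s w'(s) g'(w) / g(w)\<close> and \<open>Z = s P'(s) / P(s)\<close> solve a Lotka--Volterra system with time \<open>ln g(w)\<close> that is
  autonomous up to the factor \<open>g g'' / g'\<^sup>2\<close>, which tends to \<open>1/q\<close>. A Lyapunov function shows that all solutions,
  regular or degenerate, are close to the interior equilibrium once \<open>ln g(w)\<close> is far from its initial value;
  there, the difference of two solutions decays exponentially. As a degenerate solution has existed for an infinite time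
  at every \<open>w > 0\<close>, it is unique, and regular solutions converge to it as \<open>w(0) \<rightarrow> 0\<close>.

  After scaling \<open>s\<close> by a power of \<open>\<lambda>\<close>, regular solutions and the degenerate one satisfy the same equation, which
  contains no parameter, so that the planar vector of differences of \<open>(ln r, ln (r w'(r)))\<close> as functions of \<open>w\<close> never
  vanishes. At \<open>w = 1\<close> its first component is a positive multiple of
  \<open>ln \<lambda>(\<tau>) - ln \<lambda>\<close>, where \<open>\<lambda>\<close> belongs to the degenerate solution. The condition \<open>q < q\<^sub>c\<close> says that the
  equilibrium is a spiral; then the angle of this vector at \<open>w = 1\<close> tends to infinity, continuously, as
  \<open>\<tau> \<rightarrow> 1\<close>.\<close>

text \<open>The decay of the Lyapunov function is quantified only on a compact box in the open
  quadrant, and the rates must be the same for all solutions, whatever their starting value; hence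
  the constants \<open>M1\<close>, \<open>mZ\<close>, \<open>mX\<close>, which depend on \<alpha>,
  \<beta>, \<gamma> alone. Age is measured by \<open>N\<close>: because \<open>f 0 = 0\<close>, the
  past is infinite exactly when \<open>a = 0\<close>. The nonautonomous coefficient \<open>e\<close>
  cancels in the difference of the logarithms of two solutions, which therefore obeys an autonomous
  linear system up to a relative error. Fast rotation is known only near the equilibrium. Elsewhere
  it suffices that the angle crosses the vertical axis in one direction only, because
  \<open>T' = exp (- y)\<close>: it never loses as much as pi. Existence, uniqueness and continuity
  in the starting value for regular solutions come from a fixed point argument in the variable
  \<open>r\<close>. This argument breaks down at \<open>a = 0\<close>, where the degenerate solution
  is obtained as a limit of regular ones.\<close>

lemma last_time_at_level:
  fixes \<phi> :: "real \<Rightarrow> real"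
  assumes cont: "continuous_on {s..t} \<phi>" and "s \<le> t" "\<phi> s \<le> c" "c < \<phi> t"
  obtains t0 where "s \<le> t0" "t0 < t" "\<phi> t0 = c" "\<And>u. t0 \<le> u \<Longrightarrow> u \<le> t \<Longrightarrow> c \<le> \<phi> u"
proof -
  define K where "K = {u \<in> {s..t}. \<phi> u \<le> c}"
  have "closed K" unfolding K_def by (rule continuous_on_closed_Collect_le[OF cont continuous_on_const closed_atLeastAtMost])
  moreover have "bounded K" unfolding K_def by (rule bounded_subset[of "{s..t}"]) auto
  ultimately have "compact K" by (simp add: compact_eq_bounded_closed)
  moreover have "K \<noteq> {}" using assms by (auto simp: K_def)
  ultimately obtain t0 where t0: "t0 \<in> K" "\<And>u. u \<in> K \<Longrightarrow> u \<le> t0"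
    using compact_attains_sup[of K] by auto
  have t0': "s \<le> t0" "t0 \<le> t" "\<phi> t0 \<le> c" using t0(1) by (auto simp: K_def)
  have lt: "t0 < t" using t0' assms(4) by (cases "t0 = t") auto
  have above: "c < \<phi> u" if "t0 < u" "u \<le> t" for u
    using t0(2)[of u] that t0' by (auto simp: K_def not_le[symmetric])
  obtain u where u: "t0 \<le> u" "u \<le> t" "\<phi> u = c"
    using IVT'[of \<phi> t0 c t] t0' assms(4) continuous_on_subset[OF cont, of "{t0..t}"] by force
  have "u = t0" using above[of u] u by (cases "u = t0") auto
  with u have "\<phi> t0 = c" by simp
  with that[of t0] t0' lt above show ?thesis by (metis less_eq_real_def)
qed

lemma has_derivative_imp_continuous_on:
  assumes "\<And>w. w \<in> S \<Longrightarrow> (h has_real_derivative h' w) (at w)"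
  shows "continuous_on S h"
  using assms by (meson DERIV_isCont continuous_at_imp_continuous_on)

lemma le_by_deriv:
  fixes h :: "real \<Rightarrow> real"
  assumes "s \<le> t" and "\<And>w. s \<le> w \<Longrightarrow> w \<le> t \<Longrightarrow> (h has_real_derivative h' w) (at w)"
    and "\<And>w. s < w \<Longrightarrow> w < t \<Longrightarrow> 0 \<le> h' w"
  shows "h s \<le> h t"
  using assms(1)
proof (rule DERIV_nonneg_imp_increasing_open)
  show "continuous_on {s..t} h" using assms(2) by (intro has_derivative_imp_continuous_on) auto
qed (use assms in \<open>meson less_imp_le\<close>)

lemma ge_by_deriv:
  fixes h :: "real \<Rightarrow> real"
  assumes "s \<le> t" and "\<And>w. s \<le> w \<Longrightarrow> w \<le> t \<Longrightarrow> (h has_real_derivative h' w) (at w)"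
    and "\<And>w. s < w \<Longrightarrow> w < t \<Longrightarrow> h' w \<le> 0"
  shows "h t \<le> h s"
proof -
  have "- h s \<le> - h t"
    by (rule le_by_deriv[where h = "\<lambda>w. - h w" and h' = "\<lambda>w. - h' w"]) (auto intro!: DERIV_minus assms)
  thus ?thesis by simp
qed

text \<open>\<open>N\<close> is the time and \<open>m\<close> its speed; with the integrating factor
  \<open>exp (c * N w)\<close> the quantity \<open>V - b / c\<close> becomes nonincreasing. After a
  long time \<open>V\<close> is at most about \<open>b / c\<close>.\<close>

lemma exp_decay:
  fixes V N :: "real \<Rightarrow> real"
  assumes "s \<le> t" and c: "c > 0"
    and N: "\<And>w. s \<le> w \<Longrightarrow> w \<le> t \<Longrightarrow> (N has_real_derivative m w) (at w)"
    and V: "\<And>w. s \<le> w \<Longrightarrow> w \<le> t \<Longrightarrow> (V has_real_derivative V' w) (at w)"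
    and le: "\<And>w. s < w \<Longrightarrow> w < t \<Longrightarrow> V' w \<le> m w * (b - c * V w)"
  shows "V t \<le> exp (- c * (N t - N s)) * (V s - b / c) + b / c"
proof -
  have "(V t - b / c) * exp (c * N t) \<le> (V s - b / c) * exp (c * N s)"
  proof (rule ge_by_deriv[OF assms(1), where h = "\<lambda>w. (V w - b / c) * exp (c * N w)"
        and h' = "\<lambda>w. (V' w + m w * (c * V w - b)) * exp (c * N w)"])
    fix w assume w: "s \<le> w" "w \<le> t"
    show "((\<lambda>w. (V w - b / c) * exp (c * N w)) has_real_derivative
          (V' w + m w * (c * V w - b)) * exp (c * N w)) (at w)"
      using c by (auto intro!: derivative_eq_intros N[OF w] V[OF w] simp: field_simps)
  next
    fix w assume w: "s < w" "w < t"
    have "V' w + m w * (c * V w - b) \<le> 0" using le[OF w] by (simp add: algebra_simps)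
    thus "(V' w + m w * (c * V w - b)) * exp (c * N w) \<le> 0"
      by (simp add: mult_le_0_iff)
  qed
  hence "(V t - b / c) * exp (c * N t) * exp (- c * N t) \<le> (V s - b / c) * exp (c * N s) * exp (- c * N t)"
    by (rule mult_right_mono) simp
  thus ?thesis by (simp add: mult.assoc exp_add[symmetric] algebra_simps flip: exp_add)
qed

text \<open>\<open>u - u0 - u0 * ln (u / u0)\<close> is the convex entropy of Lotka-Volterra theory
  in one variable, with minimum 0 at \<open>u0\<close>. The bound is \<open>ln x \<le> x - 1\<close>
  at \<open>x = u0 / u\<close>.\<close>

lemma diff_ln_upper:
  fixes u u0 :: real
  assumes "u > 0" "u0 > 0"
  shows "u - u0 - u0 * ln (u / u0) \<le> (u - u0)\<^sup>2 / u"
proof -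
  have "ln (u0 / u) \<le> u0 / u - 1" using assms by (intro ln_le_minus_one) auto
  hence "1 - u0 / u \<le> ln (u / u0)" using assms by (simp add: ln_div)
  hence "u0 * (1 - u0 / u) \<le> u0 * ln (u / u0)" using assms by (intro mult_left_mono) auto
  moreover have "u - u0 - u0 * (1 - u0 / u) = (u - u0)\<^sup>2 / u"
    using assms by (simp add: field_simps power2_eq_square)
  ultimately show ?thesis by linarith
qed

text \<open>\<open>ln x \<le> x - 1\<close> at \<open>x = u / u0\<close> would give only
  nonnegativity. Applied to the square root \<open>r\<close> of \<open>u / u0\<close> it gives the
  bound \<open>u0 * (r - 1)^2\<close>, which is quadratic at \<open>u0\<close>.\<close>

lemma diff_ln_lower:
  fixes u u0 :: real
  assumes "u > 0" "u0 > 0"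
  shows "(u - u0)\<^sup>2 / (2 * (u + u0)) \<le> u - u0 - u0 * ln (u / u0)"
proof -
  define r where "r = sqrt (u / u0)"
  have r: "r > 0" "u = u0 * r\<^sup>2" using assms by (auto simp: r_def)
  have "ln (u / u0) = 2 * ln r" using assms by (simp add: r_def ln_sqrt)
  moreover have "ln r \<le> r - 1" using r by (intro ln_le_minus_one)
  ultimately have "u0 * ln (u / u0) \<le> u0 * (2 * (r - 1))" using assms by (intro mult_left_mono) auto
  hence 1: "u0 * (r - 1)\<^sup>2 \<le> u - u0 - u0 * ln (u / u0)" by (simp add: r(2) power2_eq_square algebra_simps)
  have "(u - u0)\<^sup>2 = u0 * (r - 1)\<^sup>2 * (u0 * (r + 1)\<^sup>2)" unfolding r(2) by (simp add: power2_eq_square algebra_simps)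
  also have "\<dots> \<le> u0 * (r - 1)\<^sup>2 * (2 * (u + u0))"
  proof (rule mult_left_mono)
    have "0 \<le> u0 * (r - 1)\<^sup>2" using assms by simp
    moreover have "2 * (u + u0) - u0 * (r + 1)\<^sup>2 = u0 * (r - 1)\<^sup>2"
      unfolding r(2) by (simp add: power2_eq_square algebra_simps)
    ultimately show "u0 * (r + 1)\<^sup>2 \<le> 2 * (u + u0)" by linarith
  qed (use assms in simp)
  finally have "(u - u0)\<^sup>2 / (2 * (u + u0)) \<le> u0 * (r - 1)\<^sup>2" using assms by (simp add: field_simps)
  with 1 show ?thesis by linarith
qed

lemma abs_mult_le_half_squares: "\<bar>a * b\<bar> \<le> (a\<^sup>2 + b\<^sup>2) / (2::real)"
proof -
  have "0 \<le> (\<bar>a\<bar> - \<bar>b\<bar>)\<^sup>2" by simp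
  thus ?thesis by (simp add: power2_diff abs_mult)
qed

section \<open>Asymptotically autonomous Lotka--Volterra systems\<close>

locale pars =
  fixes \<alpha> \<beta> \<gamma> :: real
  assumes params: "\<gamma> > \<alpha>" "\<alpha> > \<beta>" "\<beta> \<ge> 1"
begin

text \<open>The substitution \<open>r = R * s\<close> turns the equation with
  \<open>lam = R powr \<kappa>\<close> into the one with \<open>lam = 1\<close>.
  \<open>\<theta>\<close> is the \<open>theta\<close> of the statement; on a regular solution
  \<open>w - a\<close> vanishes like \<open>s powr \<theta>\<close> at 0. \<open>\<sigma>\<close> is
  the exponent left over when \<open>P\<close> is written as \<open>s powr \<sigma>\<close> times
  the power \<open>\<beta>\<close> of \<open>s * w'\<close>.\<close>

definition "\<sigma> = \<alpha> - \<beta>"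
definition "\<kappa> = \<gamma> - \<alpha> + \<beta>"
definition "\<theta> = \<kappa> / \<beta>"

lemma par_facts: "\<beta> > 0" "\<sigma> > 0" "\<gamma> > 0" "\<gamma> > \<sigma>" "\<kappa> > 0" "\<kappa> + \<sigma> = \<gamma>" "\<beta> * \<theta> = \<kappa>" "\<theta> > 1" "\<theta> > 0"
  "(\<gamma> - \<sigma>) / \<beta> = \<theta>" "\<kappa> > \<beta>"
  using params by (auto simp: \<sigma>_def \<kappa>_def \<theta>_def field_simps)

lemma drift_le: "z \<le> \<gamma> \<Longrightarrow> (z - \<sigma>) / \<beta> \<le> \<theta>"
  using divide_right_mono[of "z - \<sigma>" "\<gamma> - \<sigma>" \<beta>] par_facts by auto

text \<open>The equations satisfied by \<open>X = s w'(s) N'(w)\<close> and \<open>Z = s P'(s) / P(s)\<close> (with \<open>P\<close> minus the flux),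
  with \<open>w\<close> as the independent variable; \<open>N = ln g\<close> serves as the time of an almost autonomous
  Lotka--Volterra system.\<close>

definition LV :: "(real \<Rightarrow> real) \<Rightarrow> (real \<Rightarrow> real) \<Rightarrow> (real \<Rightarrow> real) \<Rightarrow> (real \<Rightarrow> real) \<Rightarrow> (real \<Rightarrow> real) \<Rightarrow> real set \<Rightarrow> bool" where
  "LV N m e X Z I \<longleftrightarrow> (\<forall>w\<in>I. m w > 0 \<and> (N has_real_derivative m w) (at w) \<and>
     0 < X w \<and> 0 < Z w \<and> Z w \<le> \<gamma> \<and> 0 \<le> e w \<and> e w \<le> 1 \<and>
     (X has_real_derivative m w * ((Z w - \<sigma>) / \<beta> - e w * X w)) (at w) \<and>
     (Z has_real_derivative m w * (Z w * (\<gamma> - \<beta> * X w - Z w) / X w)) (at w))"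

section \<open>A priori bounds that do not depend on the solution\<close>

lemma LV_subset: "LV N m e X Z I \<Longrightarrow> J \<subseteq> I \<Longrightarrow> LV N m e X Z J"
  unfolding LV_def by blast

lemma LV_cont: assumes "LV N m e X Z I" shows "continuous_on I X" "continuous_on I Z" "continuous_on I N"
  using assms unfolding LV_def by (auto intro!: has_derivative_imp_continuous_on)

text \<open>Beyond \<open>M0\<close> one has \<open>2 * \<gamma> \<le> \<beta> * X\<close>, so that
  \<open>ln Z\<close> falls at rate at least \<open>\<beta> / 2\<close> in the time
  \<open>N\<close>; the surcharge in \<open>M1\<close> is what \<open>X\<close> can gain while
  \<open>Z\<close> falls from \<open>\<gamma>\<close> to \<open>\<sigma>\<close>. In the same spirit
  \<open>mZ\<close> and \<open>mX\<close> limit the losses of \<open>Z\<close> below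
  \<open>\<sigma> / 2\<close> and of \<open>X\<close> below \<open>\<theta> / 4\<close>.\<close>

definition "M0 = 2 * \<gamma> / \<beta>"
definition "M1 = M0 + 2 * \<theta> / \<beta> * ln (\<gamma> / \<sigma>)"
definition "mZ = \<sigma> / 2 * exp (- (2 * \<beta>\<^sup>2 / \<sigma> * M1))"
definition "mX = exp (ln (\<theta> / 4) + (ln mZ - ln \<gamma>) / \<beta>)"

lemma M_facts: "0 < M0" "M0 \<le> M1" "0 < M1" "0 < mZ" "mZ < \<sigma>" "0 < mX"
proof -
  show M0: "0 < M0" using par_facts by (simp add: M0_def)
  have "0 \<le> ln (\<gamma> / \<sigma>)" using par_facts by (intro ln_ge_zero) auto
  thus "M0 \<le> M1" using par_facts by (auto simp: M1_def)
  thus M1: "0 < M1" using M0 by linarith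
  show "0 < mZ" "0 < mX" using par_facts by (auto simp: mZ_def mX_def)
  have "exp (- (2 * \<beta>\<^sup>2 / \<sigma> * M1)) \<le> 1" using par_facts M1 by simp
  hence "mZ \<le> \<sigma> / 2 * 1" unfolding mZ_def using par_facts by (intro mult_left_mono) auto
  thus "mZ < \<sigma>" using par_facts by linarith
qed

text \<open>\<open>X\<close> can grow only while \<open>Z \<ge> \<sigma>\<close>. Above
  \<open>M0\<close> the sum \<open>X + c * ln Z\<close> does not increase, because the fall of
  \<open>ln Z\<close> outweighs the drift of \<open>X\<close>, which is at most
  \<open>\<theta>\<close>. Evaluated at a maximum of \<open>X\<close>, where
  \<open>Z \<ge> \<sigma>\<close>, this yields \<open>M1\<close>.\<close>

lemma X_upper:
  assumes LV: "LV N m e X Z {s..t}" and st: "s \<le> t" "X s \<le> M0"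
  shows "X t \<le> M1"
proof (rule ccontr)
  assume "\<not> X t \<le> M1"
  hence gt: "M1 < X t" by simp
  obtain t0 where t0: "s \<le> t0" "t0 < t" "X t0 = M0" "\<And>u. t0 \<le> u \<Longrightarrow> u \<le> t \<Longrightarrow> M0 \<le> X u"
    using last_time_at_level[OF LV_cont(1)[OF LV] st] gt M_facts by (metis le_less_trans)
  define c where "c = 2 * \<theta> / \<beta>"
  have c: "c > 0" using par_facts by (simp add: c_def)
  have L: "\<And>w. t0 \<le> w \<Longrightarrow> w \<le> t \<Longrightarrow> m w > 0 \<and> X w > 0 \<and> 0 < Z w \<and> Z w \<le> \<gamma> \<and> 0 \<le> e w \<and> e w \<le> 1 \<and>
     (X has_real_derivative m w * ((Z w - \<sigma>) / \<beta> - e w * X w)) (at w) \<and>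
     (Z has_real_derivative m w * (Z w * (\<gamma> - \<beta> * X w - Z w) / X w)) (at w)"
    using LV t0 unfolding LV_def by auto
  have W: "X u + c * ln (Z u) \<le> X t0 + c * ln (Z t0)" if u: "t0 \<le> u" "u \<le> t" for u
  proof (rule ge_by_deriv[OF u(1), where h = "\<lambda>w. X w + c * ln (Z w)" and
        h' = "\<lambda>w. m w * ((Z w - \<sigma>) / \<beta> - e w * X w + c * (\<gamma> - \<beta> * X w - Z w) / X w)"])
    fix w assume w: "t0 \<le> w" "w \<le> u"
    hence L': "m w > 0 \<and> X w > 0 \<and> 0 < Z w \<and> Z w \<le> \<gamma> \<and> 0 \<le> e w \<and> e w \<le> 1 \<and>
     (X has_real_derivative m w * ((Z w - \<sigma>) / \<beta> - e w * X w)) (at w) \<and>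
     (Z has_real_derivative m w * (Z w * (\<gamma> - \<beta> * X w - Z w) / X w)) (at w)" using L u by auto
    show "((\<lambda>w. X w + c * ln (Z w)) has_real_derivative
       m w * ((Z w - \<sigma>) / \<beta> - e w * X w + c * (\<gamma> - \<beta> * X w - Z w) / X w)) (at w)"
      using L' by (auto intro!: derivative_eq_intros simp: field_simps)
  next
    fix w assume w: "t0 < w" "w < u"
    hence L': "m w > 0" "X w > 0" "0 < Z w" "Z w \<le> \<gamma>" "0 \<le> e w" using L u by auto
    have X: "M0 \<le> X w" using t0(4)[of w] w u by simp
    have "(Z w - \<sigma>) / \<beta> \<le> \<theta>" using L' by (intro drift_le)
    moreover have "0 \<le> e w * X w" using L' by simp
    moreover have "c * (\<gamma> - \<beta> * X w - Z w) / X w \<le> - \<theta>"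
    proof -
      have "2 * \<gamma> \<le> \<beta> * X w" using X par_facts by (simp add: M0_def field_simps)
      hence "\<gamma> - \<beta> * X w - Z w \<le> - (\<beta> * X w / 2)" using L' by linarith
      hence "c * (\<gamma> - \<beta> * X w - Z w) \<le> c * (- (\<beta> * X w / 2))" using c by (intro mult_left_mono) auto
      also have "\<dots> = - \<theta> * X w" using par_facts by (simp add: c_def)
      finally show ?thesis using L' by (simp add: pos_divide_le_eq)
    qed
    ultimately have "(Z w - \<sigma>) / \<beta> - e w * X w + c * (\<gamma> - \<beta> * X w - Z w) / X w \<le> 0" by linarith
    thus "m w * ((Z w - \<sigma>) / \<beta> - e w * X w + c * (\<gamma> - \<beta> * X w - Z w) / X w) \<le> 0"
      using L' by (simp add: mult_le_0_iff)
  qed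
  obtain t1 where t1: "t1 \<in> {t0..t}" "\<And>u. u \<in> {t0..t} \<Longrightarrow> X u \<le> X t1"
    using continuous_attains_sup[of "{t0..t}" X] continuous_on_subset[OF LV_cont(1)[OF LV], of "{t0..t}"] t0 by auto
  have t1': "t0 < t1" "M1 < X t1" using t1(2)[of t] gt t0 t1(1) M_facts by (auto simp: less_le)
  have L1: "m t1 > 0" "X t1 > 0" "0 < Z t1" "Z t1 \<le> \<gamma>" "0 \<le> e t1"
     "(X has_real_derivative m t1 * ((Z t1 - \<sigma>) / \<beta> - e t1 * X t1)) (at t1)" using L[of t1] t1 by auto
  \<comment> \<open>The maximum may sit at the right end point, so only comparison with points to
    the left of \<open>t1\<close> is available.\<close>
  have "0 \<le> m t1 * ((Z t1 - \<sigma>) / \<beta> - e t1 * X t1)"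
  proof (rule ccontr)
    assume "\<not> ?thesis"
    then obtain d where d: "d > 0" "\<And>h. 0 < h \<Longrightarrow> h < d \<Longrightarrow> X t1 < X (t1 - h)"
      using DERIV_neg_dec_left[OF L1(6)] by auto
    define h where "h = min (d / 2) (t1 - t0)"
    have "0 < h" "h < d" "t1 - h \<in> {t0..t}" using d t1' t1(1) by (auto simp: h_def)
    thus False using d(2)[of h] t1(2)[of "t1 - h"] by simp
  qed
  hence "0 \<le> (Z t1 - \<sigma>) / \<beta> - e t1 * X t1" using L1 by (simp add: zero_le_mult_iff)
  moreover have "0 \<le> e t1 * X t1" using L1 by simp
  ultimately have "0 \<le> (Z t1 - \<sigma>) / \<beta>" by linarith
  hence Z1: "\<sigma> \<le> Z t1" using par_facts by (simp add: zero_le_divide_iff)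
  have "X t1 + c * ln (Z t1) \<le> M0 + c * ln (Z t0)" using W[of t1] t1(1) t0 by auto
  moreover have "c * ln \<sigma> \<le> c * ln (Z t1)" using Z1 c par_facts by auto
  moreover have "c * ln (Z t0) \<le> c * ln \<gamma>" using L[of t0] t0 c by auto
  moreover have "M1 = M0 + c * (ln \<gamma> - ln \<sigma>)" using par_facts by (simp add: M1_def c_def ln_div)
  hence "M1 = M0 + c * ln \<gamma> - c * ln \<sigma>" by (simp add: right_diff_distrib)
  ultimately show False using t1' by linarith
qed

text \<open>While \<open>Z\<close> is below \<open>\<sigma> / 2\<close>, \<open>X\<close> falls at
  rate at least \<open>\<sigma> / (2 * \<beta>)\<close>, whereas \<open>ln Z\<close> falls at rate
  at most \<open>\<beta>\<close>. Hence \<open>ln Z - c * X\<close> does not decrease, and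
  \<open>X\<close> has at most \<open>M1\<close> to spend.\<close>

lemma Z_lower:
  assumes LV: "LV N m e X Z {s..t}" and st: "s \<le> t" "\<sigma> / 2 \<le> Z s"
    and XM: "\<And>w. w \<in> {s..t} \<Longrightarrow> X w \<le> M1"
  shows "mZ \<le> Z t"
proof (cases "\<sigma> / 2 \<le> Z t")
  case True
  have "exp (- (2 * \<beta>\<^sup>2 / \<sigma> * M1)) \<le> 1" using par_facts M_facts by simp
  hence "mZ \<le> \<sigma> / 2 * 1" unfolding mZ_def using par_facts by (intro mult_left_mono) auto
  with True show ?thesis by simp
next
  case False
  have "continuous_on {s..t} (\<lambda>w. - Z w)" by (intro continuous_intros LV_cont(2)[OF LV])
  then obtain t0 where t0: "s \<le> t0" "t0 < t" "- Z t0 = - (\<sigma> / 2)" "\<And>u. t0 \<le> u \<Longrightarrow> u \<le> t \<Longrightarrow> - (\<sigma> / 2) \<le> - Z u"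
    using last_time_at_level[of s t "\<lambda>w. - Z w" "- (\<sigma> / 2)"] st False by auto
  define c where "c = 2 * \<beta>\<^sup>2 / \<sigma>"
  have c: "c > 0" using par_facts by (simp add: c_def)
  have L: "\<And>w. t0 \<le> w \<Longrightarrow> w \<le> t \<Longrightarrow> m w > 0 \<and> X w > 0 \<and> 0 < Z w \<and> Z w \<le> \<gamma> \<and> 0 \<le> e w \<and> e w \<le> 1 \<and>
     (X has_real_derivative m w * ((Z w - \<sigma>) / \<beta> - e w * X w)) (at w) \<and>
     (Z has_real_derivative m w * (Z w * (\<gamma> - \<beta> * X w - Z w) / X w)) (at w)"
    using LV t0 unfolding LV_def by auto
  have "ln (Z t0) - c * X t0 \<le> ln (Z t) - c * X t"
  proof (rule le_by_deriv[where h = "\<lambda>w. ln (Z w) - c * X w" and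
        h' = "\<lambda>w. m w * ((\<gamma> - \<beta> * X w - Z w) / X w - c * ((Z w - \<sigma>) / \<beta> - e w * X w))"])
    fix w assume w: "t0 \<le> w" "w \<le> t"
    show "((\<lambda>w. ln (Z w) - c * X w) has_real_derivative
       m w * ((\<gamma> - \<beta> * X w - Z w) / X w - c * ((Z w - \<sigma>) / \<beta> - e w * X w))) (at w)"
      using L[OF w] by (auto intro!: derivative_eq_intros simp: field_simps)
  next
    fix w assume w: "t0 < w" "w < t"
    hence L': "m w > 0" "X w > 0" "0 < Z w" "Z w \<le> \<gamma>" "0 \<le> e w" using L by auto
    have "- \<beta> * X w \<le> \<gamma> - \<beta> * X w - Z w" using L' by simp
    hence "- \<beta> \<le> (\<gamma> - \<beta> * X w - Z w) / X w" using L' by (subst pos_le_divide_eq) auto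
    moreover have "Z w \<le> \<sigma> / 2" using t0(4)[of w] w by simp
    hence "(Z w - \<sigma>) / \<beta> \<le> (- (\<sigma> / 2)) / \<beta>" using par_facts by (intro divide_right_mono) auto
    moreover have "0 \<le> e w * X w" using L' by simp
    ultimately have "(Z w - \<sigma>) / \<beta> - e w * X w \<le> (- (\<sigma> / 2)) / \<beta>" by linarith
    hence "c * ((Z w - \<sigma>) / \<beta> - e w * X w) \<le> c * ((- (\<sigma> / 2)) / \<beta>)" using c by (intro mult_left_mono) auto
    moreover have "c * ((- (\<sigma> / 2)) / \<beta>) = - \<beta>" using par_facts by (simp add: c_def field_simps power2_eq_square)
    ultimately have "0 \<le> (\<gamma> - \<beta> * X w - Z w) / X w - c * ((Z w - \<sigma>) / \<beta> - e w * X w)"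
      using \<open>- \<beta> \<le> (\<gamma> - \<beta> * X w - Z w) / X w\<close> by linarith
    thus "0 \<le> m w * ((\<gamma> - \<beta> * X w - Z w) / X w - c * ((Z w - \<sigma>) / \<beta> - e w * X w))"
      using L' by simp
  qed (use t0 in simp)
  moreover have "c * X t0 \<le> c * M1" using XM[of t0] t0 c by simp
  moreover have "0 \<le> c * X t" using L[of t] t0 c by simp
  moreover have "Z t0 = \<sigma> / 2" using t0 by simp
  ultimately have "ln (\<sigma> / 2) - c * M1 \<le> ln (Z t)" by simp
  hence fin: "exp (ln (\<sigma> / 2) - c * M1) \<le> Z t" using L[of t] t0 by (metis exp_le_cancel_iff exp_ln less_imp_le order_refl)
  have "exp (ln (\<sigma> / 2) - c * M1) = exp (ln (\<sigma> / 2)) * exp (- (c * M1))" by (simp flip: exp_add)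
  with fin par_facts show ?thesis unfolding mZ_def c_def by simp
qed

text \<open>The weight \<open>1 / \<beta>\<close> makes the terms with \<open>Z\<close> cancel and
  leaves an expression in \<open>X\<close> alone. It also shows where \<open>X\<close> comes to
  rest: at \<open>\<theta> / (1 + e)\<close>.\<close>

lemma XZ_entropy_deriv:
  assumes "LV N m e X Z {s..t}" "s \<le> w" "w \<le> t"
  shows "((\<lambda>w. ln (X w) + ln (Z w) / \<beta>) has_real_derivative m w * (\<theta> / X w - e w - 1)) (at w)"
proof -
  have L: "m w > 0 \<and> X w > 0 \<and> 0 < Z w \<and>
     (X has_real_derivative m w * ((Z w - \<sigma>) / \<beta> - e w * X w)) (at w) \<and>
     (Z has_real_derivative m w * (Z w * (\<gamma> - \<beta> * X w - Z w) / X w)) (at w)"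
    using assms unfolding LV_def by auto
  have 1: "((\<lambda>w. ln (X w) + ln (Z w) / \<beta>) has_real_derivative
     1 / X w * (m w * ((Z w - \<sigma>) / \<beta> - e w * X w)) + 1 / Z w * (m w * (Z w * (\<gamma> - \<beta> * X w - Z w) / X w)) / \<beta>) (at w)"
    using L par_facts by (auto intro!: derivative_eq_intros)
  have "1 / X w * (m w * ((Z w - \<sigma>) / \<beta> - e w * X w)) + 1 / Z w * (m w * (Z w * (\<gamma> - \<beta> * X w - Z w) / X w)) / \<beta>
     = m w * (((\<gamma> - \<sigma>) / \<beta>) / X w - e w - 1)"
    using L par_facts(1) by (simp add: field_simps)
  thus ?thesis using 1 unfolding par_facts(10) by simp
qed

text \<open>Below \<open>\<theta> / 4\<close> the combination \<open>ln X + ln Z / \<beta>\<close>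
  increases, because \<open>e \<le> 1\<close>; the variation of \<open>ln Z\<close> is already
  controlled by \<open>mZ\<close> and \<open>\<gamma>\<close>.\<close>

lemma X_lower:
  assumes LV: "LV N m e X Z {s..t}" and st: "s \<le> t" "\<theta> / 4 \<le> X s"
    and Zm: "\<And>w. w \<in> {s..t} \<Longrightarrow> mZ \<le> Z w"
  shows "mX \<le> X t"
proof -
  have *: "ln (\<theta> / 4) + (ln mZ - ln \<gamma>) / \<beta> \<le> ln (X t)"
  proof (cases "\<theta> / 4 \<le> X t")
    case True
    have "ln mZ \<le> ln \<gamma>" using M_facts par_facts by (subst ln_le_cancel_iff) auto
    hence "(ln mZ - ln \<gamma>) / \<beta> \<le> 0" using par_facts by (simp add: divide_le_0_iff)
    moreover have "ln (\<theta> / 4) \<le> ln (X t)" using True par_facts by (subst ln_le_cancel_iff) auto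
    ultimately show ?thesis by linarith
  next
    case False
    have "continuous_on {s..t} (\<lambda>w. - X w)" by (intro continuous_intros LV_cont(1)[OF LV])
    then obtain t0 where t0: "s \<le> t0" "t0 < t" "- X t0 = - (\<theta> / 4)" "\<And>u. t0 \<le> u \<Longrightarrow> u \<le> t \<Longrightarrow> - (\<theta> / 4) \<le> - X u"
      using last_time_at_level[of s t "\<lambda>w. - X w" "- (\<theta> / 4)"] st False by auto
    have "ln (X t0) + ln (Z t0) / \<beta> \<le> ln (X t) + ln (Z t) / \<beta>"
    proof (rule le_by_deriv[OF less_imp_le[OF t0(2)], where h = "\<lambda>w. ln (X w) + ln (Z w) / \<beta>"])
      fix w assume "t0 \<le> w" "w \<le> t"
      thus "((\<lambda>w. ln (X w) + ln (Z w) / \<beta>) has_real_derivative m w * (\<theta> / X w - e w - 1)) (at w)"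
        using t0 by (intro XZ_entropy_deriv[OF LV]) auto
    next
      fix w assume w: "t0 < w" "w < t"
      have L: "m w > 0" "X w > 0" "e w \<le> 1" using LV w t0 unfolding LV_def by auto
      have "X w \<le> \<theta> / 4" using t0(4)[of w] w by simp
      hence "4 \<le> \<theta> / X w" using L by (simp add: field_simps)
      thus "0 \<le> m w * (\<theta> / X w - e w - 1)" using L by simp
    qed
    moreover have "ln (Z t) / \<beta> \<le> ln \<gamma> / \<beta>"
      using LV st par_facts unfolding LV_def by (intro divide_right_mono) auto
    moreover have "ln mZ / \<beta> \<le> ln (Z t0) / \<beta>"
      using Zm[of t0] t0 M_facts par_facts by (intro divide_right_mono) auto
    moreover have "X t0 = \<theta> / 4" using t0 by simp
    ultimately show ?thesis by (simp add: diff_divide_distrib)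
  qed
  have "X t > 0" using LV st unfolding LV_def by auto
  with * show ?thesis unfolding mX_def by (metis exp_le_cancel_iff exp_ln)
qed

text \<open>\<open>E\<close> is \<open>X * Z powr (1 / \<beta>)\<close>. It grows at least linearly
  in \<open>N\<close> with slope \<open>c\<close>, but stays bounded while
  \<open>X \<le> \<theta> / 4\<close>. The growth of \<open>E\<close> is used rather than that of
  \<open>ln E\<close>, so that the bound does not depend on how small \<open>X\<close> is at the
  start.\<close>

lemma X_small_duration:
  assumes LV: "LV N m e X Z {s..t}" and st: "s \<le> t"
    and Zm: "\<And>w. w \<in> {s..t} \<Longrightarrow> mZ \<le> Z w" and Xs: "\<And>w. w \<in> {s..t} \<Longrightarrow> X w \<le> \<theta> / 4"
  shows "N t - N s \<le> exp (ln \<gamma> / \<beta> - ln mZ / \<beta>)"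
proof -
  define E where "E w = exp (ln (X w) + ln (Z w) / \<beta>)" for w
  define c where "c = exp (ln mZ / \<beta>) * (\<theta> / 4)"
  have c: "c > 0" using par_facts by (simp add: c_def)
  have L: "m w > 0" "X w > 0" "Z w > 0" "e w \<le> 1" "Z w \<le> \<gamma>" "(N has_real_derivative m w) (at w)" if "s \<le> w" "w \<le> t" for w
    using LV that unfolding LV_def by auto
  have "E s - c * N s \<le> E t - c * N t"
  proof (rule le_by_deriv[OF st, where h = "\<lambda>w. E w - c * N w" and h' = "\<lambda>w. E w * (m w * (\<theta> / X w - e w - 1)) - c * m w"])
    fix w assume w: "s \<le> w" "w \<le> t"
    show "((\<lambda>w. E w - c * N w) has_real_derivative E w * (m w * (\<theta> / X w - e w - 1)) - c * m w) (at w)"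
      unfolding E_def by (rule derivative_eq_intros XZ_entropy_deriv[OF LV w] L[OF w] refl)+ simp
  next
    fix w assume w: "s < w" "w < t"
    note L' = L[of w, OF less_imp_le less_imp_le, OF w]
    have X: "X w \<le> \<theta> / 4" using Xs[of w] w by simp
    have "E w = X w * exp (ln (Z w) / \<beta>)" using L' by (simp add: E_def exp_add)
    hence "E w * (\<theta> / X w - e w - 1) = exp (ln (Z w) / \<beta>) * (\<theta> - (1 + e w) * X w)"
      using L' by (simp add: field_simps)
    also have "\<dots> \<ge> exp (ln mZ / \<beta>) * (\<theta> / 4)"
    proof (rule mult_mono)
      show "exp (ln mZ / \<beta>) \<le> exp (ln (Z w) / \<beta>)"
        using Zm[of w] w M_facts par_facts by (auto intro!: divide_right_mono)
      have "(1 + e w) * X w \<le> 2 * (\<theta> / 4)" using L' X by (intro mult_mono) auto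
      thus "\<theta> / 4 \<le> \<theta> - (1 + e w) * X w" using par_facts by linarith
    qed (use par_facts in auto)
    finally have "c \<le> E w * (\<theta> / X w - e w - 1)" by (simp add: c_def)
    hence "m w * c \<le> m w * (E w * (\<theta> / X w - e w - 1))" using L' by (intro mult_left_mono) auto
    thus "0 \<le> E w * (m w * (\<theta> / X w - e w - 1)) - c * m w" by (simp add: algebra_simps)
  qed
  moreover have "0 \<le> E s" by (simp add: E_def)
  moreover have "E t \<le> \<theta> / 4 * exp (ln \<gamma> / \<beta>)"
  proof -
    have "E t = X t * exp (ln (Z t) / \<beta>)" using L[of t] st by (simp add: E_def exp_add)
    also have "\<dots> \<le> \<theta> / 4 * exp (ln \<gamma> / \<beta>)"
      using Xs[of t] st L[of t] par_facts by (intro mult_mono) (auto intro!: divide_right_mono)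
    finally show ?thesis .
  qed
  ultimately have "c * (N t - N s) \<le> \<theta> / 4 * exp (ln \<gamma> / \<beta>)" by (simp add: algebra_simps)
  hence "N t - N s \<le> (\<theta> / 4 * exp (ln \<gamma> / \<beta>)) / c" using c by (simp add: field_simps)
  also have "\<dots> = exp (ln \<gamma> / \<beta> - ln mZ / \<beta>)" using par_facts by (simp add: c_def exp_diff)
  finally show ?thesis .
qed

end

section \<open>The interior equilibrium\<close>

text \<open>In logarithmic variables the nonlinear terms \<open>1 / X\<close> and
  \<open>Z / X\<close> are exponentials of linear functions, so this estimate linearizes the system,
  with an error proportional to the difference of the two solutions.\<close>

lemma exp_linearization:
  fixes A B A0 r :: real
  assumes "\<bar>A - A0\<bar> \<le> r" "\<bar>B - A0\<bar> \<le> r"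
  shows "\<bar>exp A - exp B - exp A0 * (A - B)\<bar> \<le> exp A0 * (exp r - 1) * \<bar>A - B\<bar>"
proof -
  have r: "0 \<le> r" using assms by linarith
  have gen: "\<bar>exp A - exp B - exp A0 * (A - B)\<bar> \<le> exp A0 * (exp r - 1) * \<bar>A - B\<bar>"
    if AB: "B < A" and le: "\<bar>A - A0\<bar> \<le> r" "\<bar>B - A0\<bar> \<le> r" for A B
  proof -
    obtain z where z: "B < z" "z < A" "exp A - exp B = (A - B) * exp z"
      using MVT2[OF AB, of exp exp] by (auto intro: DERIV_exp)
    have "exp A - exp B - exp A0 * (A - B) = exp A0 * (exp (z - A0) - 1) * (A - B)"
      unfolding z(3) by (simp add: exp_diff algebra_simps)
    hence "\<bar>exp A - exp B - exp A0 * (A - B)\<bar> = exp A0 * \<bar>exp (z - A0) - 1\<bar> * \<bar>A - B\<bar>"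
      by (simp add: abs_mult)
    also have "\<dots> \<le> exp A0 * (exp r - 1) * \<bar>A - B\<bar>"
    proof (intro mult_right_mono mult_left_mono)
      have "z - A0 \<le> r" "- r \<le> z - A0" using z le by linarith+
      hence "exp (z - A0) \<le> exp r" "exp (- r) \<le> exp (z - A0)" by auto
      \<comment> \<open>This means \<open>1 - exp (- r) \<le> exp r - 1\<close>: the deviation
        downwards is no larger than the one upwards.\<close>
      moreover have "2 \<le> exp r + exp (- r)"
        using exp_ge_add_one_self[of r] exp_ge_add_one_self[of "- r"] by linarith
      ultimately show "\<bar>exp (z - A0) - 1\<bar> \<le> exp r - 1" by linarith
    qed auto
    finally show ?thesis .
  qed
  consider "B < A" | "A < B" | "A = B" by linarith
  thus ?thesis
  proof cases
    case 2
    have "exp A - exp B - exp A0 * (A - B) = - (exp B - exp A - exp A0 * (B - A))" by (simp add: algebra_simps)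
    thus ?thesis using gen[OF 2 assms(2,1)] by (simp add: abs_minus_commute)
  qed (use gen assms in auto)
qed

locale equilibrium = pars +
  fixes \<delta> :: real
  assumes \<delta>: "0 \<le> \<delta>" "\<delta> < 1"
begin

text \<open>The zero of the vector field with \<open>e\<close> frozen at its limit
  \<open>\<delta>\<close>. The quotient \<open>k\<close>, together with \<open>\<beta>\<close> and
  \<open>\<delta>\<close>, determines the linearization there.\<close>

definition "X0 = \<theta> / (1 + \<delta>)"
definition "Z0 = \<gamma> - \<beta> * X0"
definition "k = Z0 / X0"

lemma eq_facts: "X0 > 0" "Z0 > 0" "Z0 < \<gamma>" "(Z0 - \<sigma>) / \<beta> = \<delta> * X0" "\<gamma> = \<beta> * X0 + Z0" "k > 0"
proof -
  show X0: "X0 > 0" using par_facts \<delta> by (simp add: X0_def)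
  show "\<gamma> = \<beta> * X0 + Z0" by (simp add: Z0_def)
  show "Z0 < \<gamma>" using X0 par_facts by (simp add: Z0_def)
  have "(1 + \<delta>) * X0 = \<theta>" using \<delta> by (simp add: X0_def)
  hence "\<beta> * ((1 + \<delta>) * X0) = \<gamma> - \<sigma>" using par_facts by simp
  hence e: "Z0 - \<sigma> = \<beta> * (\<delta> * X0)" by (simp add: Z0_def algebra_simps)
  thus "(Z0 - \<sigma>) / \<beta> = \<delta> * X0" using par_facts by simp
  have "0 \<le> \<beta> * (\<delta> * X0)" using par_facts \<delta> X0 by simp
  thus "Z0 > 0" using e par_facts by linarith
  thus "k > 0" using X0 by (simp add: k_def)
qed

text \<open>If \<open>q = 1\<close>, then \<open>\<delta> = 0\<close> and the standard Lotka--Volterra entropy does not decay in the direction of \<open>X\<close>; the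
  cross term with the small coefficient \<open>\<mu>\<close> makes up for this.\<close>

definition "k1 = \<beta> * mZ / M1"
definition "K1 = 1 + \<gamma> / mX"
definition "\<mu> = min (min (1 / (2 * (M1 + X0))) (1 / (2 * (\<gamma> + Z0)))) (1 / (2 * M1) / (1 / \<beta> + K1\<^sup>2 / (2 * k1)))"
definition "Lyap x z = \<beta>\<^sup>2 * (x - X0 - X0 * ln (x / X0)) + (z - Z0 - Z0 * ln (z / Z0)) + \<mu> * (x - X0) * (z - Z0)"

text \<open>On the box, \<open>k1\<close> bounds \<open>\<beta> * Z / X\<close> from below and
  \<open>K1\<close> bounds \<open>\<delta> + Z / X\<close> from above. The first two bounds on
  \<open>\<mu>\<close> keep \<open>Lyap\<close> definite in spite of the cross term; the third lets
  half of the dissipation \<open>(Z - Z0)^2 / M1\<close> absorb what the cross term contributes to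
  \<open>(Z - Z0)^2\<close> after Young's inequality.\<close>

lemma \<mu>_facts: "k1 > 0" "K1 > 0" "\<mu> > 0" "\<mu> \<le> 1 / (2 * (M1 + X0))" "\<mu> \<le> 1 / (2 * (\<gamma> + Z0))"
  "\<mu> * (1 / \<beta> + K1\<^sup>2 / (2 * k1)) \<le> 1 / (2 * M1)"
proof -
  show k1: "k1 > 0" and K1: "K1 > 0" using par_facts M_facts by (auto simp: k1_def K1_def add_pos_pos)
  have d: "1 / \<beta> + K1\<^sup>2 / (2 * k1) > 0" using par_facts k1 by (intro add_pos_nonneg) auto
  thus "\<mu> > 0" using par_facts M_facts eq_facts by (auto simp: \<mu>_def add_pos_pos)
  show "\<mu> \<le> 1 / (2 * (M1 + X0))" "\<mu> \<le> 1 / (2 * (\<gamma> + Z0))" by (auto simp: \<mu>_def)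
  have "\<mu> \<le> 1 / (2 * M1) / (1 / \<beta> + K1\<^sup>2 / (2 * k1))" by (simp add: \<mu>_def)
  thus "\<mu> * (1 / \<beta> + K1\<^sup>2 / (2 * k1)) \<le> 1 / (2 * M1)" using d by (simp only: pos_le_divide_eq)
qed

definition "c3 = min (1 / (2 * (M1 + X0))) (1 / (2 * (\<gamma> + Z0))) / 2"

lemma c3_pos: "c3 > 0"
  using M_facts eq_facts par_facts by (simp add: c3_def add_pos_pos)

text \<open>With \<open>D = 2 * c3\<close>, each entropy is at least \<open>D\<close> times the
  corresponding square, and the cross term takes away at most half of the sum because
  \<open>\<mu> \<le> D\<close>.\<close>

lemma Lyap_lower:
  assumes "0 < x" "x \<le> M1" "0 < z" "z \<le> \<gamma>"
  shows "c3 * ((x - X0)\<^sup>2 + (z - Z0)\<^sup>2) \<le> Lyap x z"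
proof -
  define a b where "a = x - X0" and "b = z - Z0"
  define D where "D = 2 * c3"
  have D: "D \<le> 1 / (2 * (M1 + X0))" "D \<le> 1 / (2 * (\<gamma> + Z0))" by (auto simp: D_def c3_def)
  have "\<mu> \<le> D" using \<mu>_facts by (simp add: D_def c3_def)
  have 1: "D * a\<^sup>2 \<le> \<beta>\<^sup>2 * (x - X0 - X0 * ln (x / X0))"
  proof -
    have "1 / (2 * (M1 + X0)) \<le> 1 / (2 * (x + X0))" using assms eq_facts by (intro divide_left_mono) auto
    hence "D * a\<^sup>2 \<le> 1 / (2 * (x + X0)) * a\<^sup>2" using D(1) by (intro mult_right_mono) auto
    also have "\<dots> \<le> x - X0 - X0 * ln (x / X0)" using diff_ln_lower[of x X0] assms eq_facts by (simp add: a_def)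
    also have "\<dots> = 1 * (x - X0 - X0 * ln (x / X0))" by simp
    also have "\<dots> \<le> \<beta>\<^sup>2 * (x - X0 - X0 * ln (x / X0))"
    proof (rule mult_right_mono)
      have "0 \<le> (x - X0)\<^sup>2 / (2 * (x + X0))" using assms eq_facts by simp
      thus "0 \<le> x - X0 - X0 * ln (x / X0)" using diff_ln_lower[of x X0] assms eq_facts by linarith
    qed (use params in auto)
    finally show ?thesis .
  qed
  have 2: "D * b\<^sup>2 \<le> z - Z0 - Z0 * ln (z / Z0)"
  proof -
    have "1 / (2 * (\<gamma> + Z0)) \<le> 1 / (2 * (z + Z0))" using assms eq_facts by (intro divide_left_mono) auto
    hence "D * b\<^sup>2 \<le> 1 / (2 * (z + Z0)) * b\<^sup>2" using D(2) by (intro mult_right_mono) auto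
    also have "\<dots> \<le> z - Z0 - Z0 * ln (z / Z0)" using diff_ln_lower[of z Z0] assms eq_facts by (simp add: b_def)
    finally show ?thesis .
  qed
  have "\<bar>\<mu> * (a * b)\<bar> \<le> D * ((a\<^sup>2 + b\<^sup>2) / 2)"
    using \<mu>_facts \<open>\<mu> \<le> D\<close> abs_mult_le_half_squares[of a b] unfolding abs_mult[of \<mu>] by (intro mult_mono) auto
  hence 3: "- (D * ((a\<^sup>2 + b\<^sup>2) / 2)) \<le> \<mu> * a * b" by (simp add: mult.assoc abs_le_iff)
  have "c3 * (a\<^sup>2 + b\<^sup>2) = D * a\<^sup>2 + D * b\<^sup>2 - D * ((a\<^sup>2 + b\<^sup>2) / 2)" by (simp add: D_def algebra_simps)
  thus ?thesis using 1 2 3 unfolding Lyap_def a_def[symmetric] b_def[symmetric] by linarith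
qed

definition "C2 = \<beta>\<^sup>2 / mX + 1 / mZ + \<mu> / 2"
definition "Vm = C2 * ((M1 + X0)\<^sup>2 + (\<gamma> + Z0)\<^sup>2)"

lemma C2_pos: "C2 > 0" using par_facts M_facts \<mu>_facts by (simp add: C2_def add_pos_pos)

lemma Lyap_upper:
  assumes "mX \<le> x" "x \<le> M1" "mZ \<le> z" "z \<le> \<gamma>"
  shows "Lyap x z \<le> C2 * ((x - X0)\<^sup>2 + (z - Z0)\<^sup>2)" "Lyap x z \<le> Vm"
proof -
  define a b where "a = x - X0" and "b = z - Z0"
  have pos: "x > 0" "z > 0" using assms M_facts by auto
  have "\<beta>\<^sup>2 * (x - X0 - X0 * ln (x / X0)) \<le> \<beta>\<^sup>2 * (a\<^sup>2 / x)"
    using diff_ln_upper[of x X0] pos eq_facts by (intro mult_left_mono) (auto simp: a_def)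
  also have "\<dots> \<le> \<beta>\<^sup>2 * (a\<^sup>2 / mX)"
    using assms M_facts by (intro mult_left_mono divide_left_mono) auto
  finally have 1: "\<beta>\<^sup>2 * (x - X0 - X0 * ln (x / X0)) \<le> \<beta>\<^sup>2 / mX * a\<^sup>2" by simp
  have "z - Z0 - Z0 * ln (z / Z0) \<le> b\<^sup>2 / z"
    using diff_ln_upper[of z Z0] pos eq_facts by (auto simp: b_def)
  also have "\<dots> \<le> b\<^sup>2 / mZ" using assms M_facts by (intro divide_left_mono) auto
  finally have 2: "z - Z0 - Z0 * ln (z / Z0) \<le> 1 / mZ * b\<^sup>2" by simp
  have "\<mu> * (a * b) \<le> \<mu> * ((a\<^sup>2 + b\<^sup>2) / 2)"
    using \<mu>_facts abs_mult_le_half_squares[of a b] by (intro mult_left_mono) auto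
  hence 3: "\<mu> * a * b \<le> \<mu> / 2 * (a\<^sup>2 + b\<^sup>2)" by (simp add: mult.assoc)
  have "0 \<le> 1 / mZ * a\<^sup>2" "0 \<le> \<beta>\<^sup>2 / mX * b\<^sup>2" using M_facts by auto
  thus le: "Lyap x z \<le> C2 * ((x - X0)\<^sup>2 + (z - Z0)\<^sup>2)"
    using 1 2 3 unfolding Lyap_def a_def[symmetric] b_def[symmetric] C2_def by (simp add: algebra_simps)
  have "\<bar>x - X0\<bar> \<le> \<bar>M1 + X0\<bar>" "\<bar>z - Z0\<bar> \<le> \<bar>\<gamma> + Z0\<bar>" using pos assms eq_facts M_facts by auto
  hence "(x - X0)\<^sup>2 \<le> (M1 + X0)\<^sup>2" "(z - Z0)\<^sup>2 \<le> (\<gamma> + Z0)\<^sup>2" by (auto simp: abs_le_square_iff)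
  hence "C2 * ((x - X0)\<^sup>2 + (z - Z0)\<^sup>2) \<le> Vm" unfolding Vm_def using C2_pos by (intro mult_left_mono) auto
  with le show "Lyap x z \<le> Vm" by linarith
qed

definition "c1 = min (1 / (2 * M1)) (\<mu> * k1 / 2)"
definition "C1 = \<beta>\<^sup>2 * (M1 + X0) + \<mu> * M1 * (\<gamma> + Z0)"

text \<open>The weight \<open>\<beta>^2\<close> makes the products
  \<open>(X - X0) * (Z - Z0)\<close> coming from the two entropies cancel; those that remain come
  from the cross term. Everything nonautonomous is collected in the factor
  \<open>e w - \<delta>\<close>.\<close>

lemma Lyap_deriv:
  assumes LV: "LV N m e X Z {w}"
  shows "((\<lambda>w. Lyap (X w) (Z w)) has_real_derivative
      m w * (- (Z w - Z0)\<^sup>2 / X w - \<beta>\<^sup>2 * \<delta> * (X w - X0)\<^sup>2 / X w - \<mu> * \<beta> * (Z w / X w) * (X w - X0)\<^sup>2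
        + \<mu> * (Z w - Z0)\<^sup>2 / \<beta> - \<mu> * (\<delta> + Z w / X w) * ((X w - X0) * (Z w - Z0))
        - (e w - \<delta>) * (\<beta>\<^sup>2 * (X w - X0) + \<mu> * X w * (Z w - Z0)))) (at w)"
proof -
  define a b x z where abxz: "a = X w - X0" "b = Z w - Z0" "x = X w" "z = Z w"
  have L: "X w > 0" "Z w > 0"
     "(X has_real_derivative m w * ((Z w - \<sigma>) / \<beta> - e w * X w)) (at w)"
     "(Z has_real_derivative m w * (Z w * (\<gamma> - \<beta> * X w - Z w) / X w)) (at w)"
    using LV unfolding LV_def by auto
  have X': "(Z w - \<sigma>) / \<beta> - e w * X w = b / \<beta> - \<delta> * a - (e w - \<delta>) * x"
  proof -
    have "(Z w - \<sigma>) / \<beta> = b / \<beta> + (Z0 - \<sigma>) / \<beta>" by (simp add: abxz diff_divide_distrib)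
    thus ?thesis unfolding eq_facts(4) by (simp add: abxz algebra_simps)
  qed
  have Z': "\<gamma> - \<beta> * X w - Z w = - \<beta> * a - b" using eq_facts(5) by (simp add: abxz algebra_simps)
  define x' z' where "x' = m w * (b / \<beta> - \<delta> * a - (e w - \<delta>) * x)" and "z' = m w * (z * (- \<beta> * a - b) / x)"
  have D: "(X has_real_derivative x') (at w)" "(Z has_real_derivative z') (at w)"
    using L(3,4) unfolding X' Z' by (simp_all add: x'_def z'_def abxz)
  have lx: "((\<lambda>w. ln (X w / X0)) has_real_derivative x' / x) (at w)"
    using L(1) eq_facts(1) D(1) by (auto intro!: derivative_eq_intros simp: abxz)
  have lz: "((\<lambda>w. ln (Z w / Z0)) has_real_derivative z' / z) (at w)"
    using L(2) eq_facts(2) D(2) by (auto intro!: derivative_eq_intros simp: abxz)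
  have "((\<lambda>w. Lyap (X w) (Z w)) has_real_derivative
     \<beta>\<^sup>2 * (x' - X0 * (x' / x)) + (z' - Z0 * (z' / z)) + \<mu> * (x' * b + a * z')) (at w)"
    unfolding Lyap_def by (rule lx lz D derivative_eq_intros refl)+ (simp add: abxz algebra_simps)
  hence "((\<lambda>w. Lyap (X w) (Z w)) has_real_derivative
     \<beta>\<^sup>2 * (m w * (b / \<beta> - \<delta> * a - (e w - \<delta>) * x) - X0 * (m w * (b / \<beta> - \<delta> * a - (e w - \<delta>) * x) / x))
     + (m w * (z * (- \<beta> * a - b) / x) - Z0 * (m w * (z * (- \<beta> * a - b) / x) / z))
     + \<mu> * (m w * (b / \<beta> - \<delta> * a - (e w - \<delta>) * x) * b + a * (m w * (z * (- \<beta> * a - b) / x)))) (at w)"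
    by (simp only: x'_def z'_def)
  moreover have "\<beta>\<^sup>2 * (m w * (b / \<beta> - \<delta> * a - (e w - \<delta>) * x) - X0 * (m w * (b / \<beta> - \<delta> * a - (e w - \<delta>) * x) / x))
     + (m w * (z * (- \<beta> * a - b) / x) - Z0 * (m w * (z * (- \<beta> * a - b) / x) / z))
     + \<mu> * (m w * (b / \<beta> - \<delta> * a - (e w - \<delta>) * x) * b + a * (m w * (z * (- \<beta> * a - b) / x)))
    = m w * (- b\<^sup>2 / x - \<beta>\<^sup>2 * \<delta> * a\<^sup>2 / x - \<mu> * \<beta> * (z / x) * a\<^sup>2
        + \<mu> * b\<^sup>2 / \<beta> - \<mu> * (\<delta> + z / x) * (a * b) - (e w - \<delta>) * (\<beta>\<^sup>2 * a + \<mu> * x * b))"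
  proof -
    have xz: "X0 = x - a" "Z0 = z - b" "x > 0" "z > 0" "\<beta> > 0" using L par_facts by (auto simp: abxz)
    show ?thesis unfolding xz(1,2) using xz(3-5) by (simp add: field_simps power2_eq_square)
  qed
  ultimately show ?thesis by (simp add: abxz)
qed

text \<open>Decay in the direction of \<open>X\<close> is supplied by \<open>\<mu> * k1\<close>,
  which stays positive when \<open>\<delta> = 0\<close>. The mixed product is split by Young's
  inequality between half of this and half of \<open>(Z - Z0)^2 / M1\<close>; the deviation of
  \<open>e\<close> from its limit costs at most \<open>C1 * \<nu>\<close>.\<close>

lemma Lyap_deriv_le:
  assumes LV: "LV N m e X Z {w}" and \<nu>: "\<bar>e w - \<delta>\<bar> \<le> \<nu>"
    and box: "mX \<le> X w" "X w \<le> M1" "mZ \<le> Z w"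
  shows "m w * (- (Z w - Z0)\<^sup>2 / X w - \<beta>\<^sup>2 * \<delta> * (X w - X0)\<^sup>2 / X w - \<mu> * \<beta> * (Z w / X w) * (X w - X0)\<^sup>2
        + \<mu> * (Z w - Z0)\<^sup>2 / \<beta> - \<mu> * (\<delta> + Z w / X w) * ((X w - X0) * (Z w - Z0))
        - (e w - \<delta>) * (\<beta>\<^sup>2 * (X w - X0) + \<mu> * X w * (Z w - Z0)))
    \<le> m w * (C1 * \<nu> - c1 / C2 * Lyap (X w) (Z w))"
proof -
  define a b x z where abxz: "a = X w - X0" "b = Z w - Z0" "x = X w" "z = Z w"
  have L: "m w > 0" "x > 0" "z > 0" "z \<le> \<gamma>" using LV unfolding LV_def by (auto simp: abxz)
  have \<nu>0: "0 \<le> \<nu>" using \<nu> by linarith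
  have t1: "- b\<^sup>2 / x \<le> - (b\<^sup>2 / M1)"
    using box L by (auto simp: abxz intro!: divide_left_mono)
  have t2: "0 \<le> \<beta>\<^sup>2 * \<delta> * a\<^sup>2 / x" using \<delta> L by simp
  have zx: "mZ / M1 \<le> z / x" "z / x \<le> \<gamma> / mX"
    using box L M_facts by (auto simp: abxz intro!: frac_le)
  have t3: "\<mu> * k1 * a\<^sup>2 \<le> \<mu> * \<beta> * (z / x) * a\<^sup>2"
  proof -
    have "\<mu> * \<beta> * (mZ / M1) \<le> \<mu> * \<beta> * (z / x)" using zx \<mu>_facts par_facts by (intro mult_left_mono) auto
    hence "\<mu> * \<beta> * (mZ / M1) * a\<^sup>2 \<le> \<mu> * \<beta> * (z / x) * a\<^sup>2" by (rule mult_right_mono) simp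
    thus ?thesis by (simp add: k1_def mult.assoc)
  qed
  have t4: "- (\<mu> * (\<delta> + z / x) * (a * b)) \<le> \<mu> * (k1 / 2 * a\<^sup>2 + K1\<^sup>2 / (2 * k1) * b\<^sup>2)"
  proof -
    have "\<bar>(\<delta> + z / x) * (a * b)\<bar> = (\<delta> + z / x) * \<bar>a * b\<bar>" using \<delta> L by (simp add: abs_mult)
    also have "\<dots> \<le> K1 * \<bar>a * b\<bar>" using zx \<delta> by (intro mult_right_mono) (auto simp: K1_def)
    also have "\<dots> \<le> k1 / 2 * a\<^sup>2 + K1\<^sup>2 / (2 * k1) * b\<^sup>2"
    proof -
      have "0 \<le> (k1 * \<bar>a\<bar> - K1 * \<bar>b\<bar>)\<^sup>2" by simp
      hence "2 * k1 * (K1 * \<bar>a * b\<bar>) \<le> k1\<^sup>2 * a\<^sup>2 + K1\<^sup>2 * b\<^sup>2"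
        by (simp add: power2_diff power_mult_distrib abs_mult algebra_simps)
      hence "K1 * \<bar>a * b\<bar> \<le> (k1\<^sup>2 * a\<^sup>2 + K1\<^sup>2 * b\<^sup>2) / (2 * k1)" using \<mu>_facts by (simp add: field_simps)
      also have "\<dots> = k1 / 2 * a\<^sup>2 + K1\<^sup>2 / (2 * k1) * b\<^sup>2"
        using \<mu>_facts by (simp add: field_simps power2_eq_square)
      finally show ?thesis .
    qed
    finally have "- ((\<delta> + z / x) * (a * b)) \<le> k1 / 2 * a\<^sup>2 + K1\<^sup>2 / (2 * k1) * b\<^sup>2" by linarith
    hence "\<mu> * - ((\<delta> + z / x) * (a * b)) \<le> \<mu> * (k1 / 2 * a\<^sup>2 + K1\<^sup>2 / (2 * k1) * b\<^sup>2)"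
      using \<mu>_facts by (intro mult_left_mono) auto
    thus ?thesis by (simp add: mult.assoc)
  qed
  have t5: "- ((e w - \<delta>) * (\<beta>\<^sup>2 * a + \<mu> * x * b)) \<le> C1 * \<nu>"
  proof -
    have ab: "\<bar>a\<bar> \<le> M1 + X0" "\<bar>b\<bar> \<le> \<gamma> + Z0" using box L eq_facts M_facts by (auto simp: abxz)
    have "\<bar>\<beta>\<^sup>2 * a + \<mu> * x * b\<bar> \<le> \<beta>\<^sup>2 * \<bar>a\<bar> + \<mu> * x * \<bar>b\<bar>"
      using abs_triangle_ineq[of "\<beta>\<^sup>2 * a" "\<mu> * x * b"] L \<mu>_facts by (simp add: abs_mult)
    also have "\<dots> \<le> \<beta>\<^sup>2 * (M1 + X0) + \<mu> * M1 * (\<gamma> + Z0)"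
      using ab box L \<mu>_facts M_facts by (intro add_mono mult_mono) (auto simp: abxz)
    finally have "\<bar>(e w - \<delta>) * (\<beta>\<^sup>2 * a + \<mu> * x * b)\<bar> \<le> \<nu> * C1"
      unfolding abs_mult C1_def using \<nu> \<nu>0 by (intro mult_mono) auto
    thus ?thesis by (simp add: mult.commute abs_le_iff)
  qed
  have t6: "\<mu> * b\<^sup>2 / \<beta> + \<mu> * (K1\<^sup>2 / (2 * k1) * b\<^sup>2) \<le> 1 / (2 * M1) * b\<^sup>2"
    using mult_right_mono[OF \<mu>_facts(6), of "b\<^sup>2"] by (simp add: algebra_simps)
  have "c1 * (a\<^sup>2 + b\<^sup>2) \<le> \<mu> * k1 / 2 * a\<^sup>2 + 1 / (2 * M1) * b\<^sup>2"
    unfolding distrib_left by (intro add_mono mult_right_mono) (auto simp: c1_def)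
  moreover have "c1 / C2 * Lyap x z \<le> c1 / C2 * (C2 * (a\<^sup>2 + b\<^sup>2))"
    using Lyap_upper(1)[of x z] box L M_facts C2_pos \<mu>_facts
    by (intro mult_left_mono) (auto simp: abxz c1_def)
  hence "c1 / C2 * Lyap x z \<le> c1 * (a\<^sup>2 + b\<^sup>2)" using C2_pos by simp
  moreover have "b\<^sup>2 / M1 = 1 / (2 * M1) * b\<^sup>2 + 1 / (2 * M1) * b\<^sup>2" using M_facts by (simp add: field_simps)
  moreover have "\<mu> * (k1 / 2 * a\<^sup>2 + K1\<^sup>2 / (2 * k1) * b\<^sup>2) = \<mu> * k1 / 2 * a\<^sup>2 + \<mu> * (K1\<^sup>2 / (2 * k1) * b\<^sup>2)"
    "\<mu> * k1 * a\<^sup>2 = \<mu> * k1 / 2 * a\<^sup>2 + \<mu> * k1 / 2 * a\<^sup>2" by (simp_all add: algebra_simps)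
  ultimately have "- b\<^sup>2 / x - \<beta>\<^sup>2 * \<delta> * a\<^sup>2 / x - \<mu> * \<beta> * (z / x) * a\<^sup>2
        + \<mu> * b\<^sup>2 / \<beta> - \<mu> * (\<delta> + z / x) * (a * b) - (e w - \<delta>) * (\<beta>\<^sup>2 * a + \<mu> * x * b)
       \<le> C1 * \<nu> - c1 / C2 * Lyap x z"
    using t1 t2 t3 t4 t5 t6 by linarith
  thus ?thesis using L unfolding abxz by (intro mult_left_mono) auto
qed

lemma LV_N_mono:
  assumes "LV N m e X Z {s..t}" "s \<le> t"
  shows "N s \<le> N t"
proof (rule le_by_deriv[OF assms(2), where h = N and h' = m])
  fix w assume "s < w" "w < t"
  hence "m w > 0" using assms unfolding LV_def by auto
  thus "0 \<le> m w" by simp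
qed (use assms in \<open>auto simp: LV_def\<close>)

text \<open>\<open>S\<close> and \<open>\<nu>\<close> depend on \<open>\<rho>\<close> only. The time
  consists of at most \<open>S1 + 1\<close> until \<open>X\<close> has once reached
  \<open>\<theta> / 4\<close>, after which the box is not left, and of \<open>S2\<close>, in which
  the exponential factor reduces the maximum \<open>Vm\<close> of \<open>Lyap\<close> on the box to
  a quarter of \<open>c3 * \<rho>^2\<close>. The choice of \<open>\<nu>\<close> lets the
  perturbation contribute another quarter.\<close>

lemma attraction:
  assumes "\<rho> > 0"
  obtains S \<nu> where "S > 0" "\<nu> > 0" "\<And>N m e X Z s t. s \<le> t \<Longrightarrow> LV N m e X Z {s..t} \<Longrightarrow>
     (\<And>w. w \<in> {s..t} \<Longrightarrow> X w \<le> M1) \<Longrightarrow> \<sigma> / 2 \<le> Z s \<Longrightarrow> (\<And>w. w \<in> {s..t} \<Longrightarrow> \<bar>e w - \<delta>\<bar> \<le> \<nu>) \<Longrightarrow>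
     S \<le> N t - N s \<Longrightarrow> \<bar>X t - X0\<bar> < \<rho> \<and> \<bar>Z t - Z0\<bar> < \<rho>"
proof -
  define S1 where "S1 = exp (ln \<gamma> / \<beta> - ln mZ / \<beta>)"
  define c where "c = c1 / C2"
  have c: "c > 0" using C2_pos \<mu>_facts M_facts by (simp add: c_def c1_def)
  have C1: "C1 > 0" unfolding C1_def using par_facts M_facts eq_facts \<mu>_facts by (intro add_pos_pos) auto
  define \<nu> where "\<nu> = c * (c3 * \<rho>\<^sup>2 / 4) / C1"
  have \<nu>: "\<nu> > 0" using c c3_pos C1 assms by (simp add: \<nu>_def)
  have Vm: "Vm \<ge> 0" unfolding Vm_def using C2_pos by simp
  define S2 where "S2 = \<bar>ln ((c3 * \<rho>\<^sup>2 / 4) / (Vm + 1))\<bar> / c"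
  have S2: "exp (- c * S2) * Vm \<le> c3 * \<rho>\<^sup>2 / 4"
  proof -
    let ?q = "(c3 * \<rho>\<^sup>2 / 4) / (Vm + 1)"
    have q: "?q > 0" using c3_pos assms Vm by simp
    have "exp (- c * S2) = exp (- \<bar>ln ?q\<bar>)" using c by (simp add: S2_def)
    also have "\<dots> \<le> exp (ln ?q)" by (subst exp_le_cancel_iff) linarith
    also have "\<dots> = ?q" using q by simp
    finally have "exp (- c * S2) * Vm \<le> ?q * (Vm + 1)" using Vm q by (intro mult_mono) auto
    moreover have *: "B / d * d = B" if "d \<noteq> 0" for B d :: real using that by simp
    have "?q * (Vm + 1) = c3 * \<rho>\<^sup>2 / 4" using Vm by (intro *) linarith
    ultimately show ?thesis by linarith
  qed
  define S where "S = S1 + 1 + S2"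
  have S: "S > 0" using c by (simp add: S_def S1_def S2_def add_pos_nonneg)
  have S1: "S1 > 0" "S2 \<ge> 0" using c by (auto simp: S1_def S2_def)
  show thesis
  proof (rule that[OF S \<nu>])
    fix N m e X Z s t
    assume st: "s \<le> t" and LV: "LV N m e X Z {s..t}" and XM: "\<And>w. w \<in> {s..t} \<Longrightarrow> X w \<le> M1"
      and Zs: "\<sigma> / 2 \<le> Z s" and e: "\<And>w. w \<in> {s..t} \<Longrightarrow> \<bar>e w - \<delta>\<bar> \<le> \<nu>" and SN: "S \<le> N t - N s"
    have Zm: "mZ \<le> Z w" if "w \<in> {s..t}" for w
      using that Z_lower[OF LV_subset[OF LV], of s w] Zs XM by force
    obtain t' where t': "s \<le> t'" "t' \<le> t" "N t' = N s + S1 + 1"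
      using IVT'[of N s "N s + S1 + 1" t] st LV_cont(3)[OF LV] SN S1 by (force simp: S_def)
    \<comment> \<open>The extra 1 in the definition of \<open>t'\<close> makes the elapsed time
      exceed \<open>S1\<close> strictly.\<close>
    have "\<exists>s1. s \<le> s1 \<and> s1 \<le> t' \<and> \<theta> / 4 \<le> X s1"
    proof (rule ccontr)
      assume "\<not> ?thesis"
      hence "\<And>w. w \<in> {s..t'} \<Longrightarrow> X w \<le> \<theta> / 4" by force
      hence "N t' - N s \<le> S1" unfolding S1_def
        using t' Zm by (intro X_small_duration[OF LV_subset[OF LV]]) auto
      thus False using t' by simp
    qed
    then obtain s1 where s1: "s \<le> s1" "s1 \<le> t'" "\<theta> / 4 \<le> X s1" by blast
    have LV1: "LV N m e X Z {s1..t}" using s1 t' by (intro LV_subset[OF LV]) auto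
    have box: "mX \<le> X w" "X w \<le> M1" "mZ \<le> Z w" "Z w \<le> \<gamma>" if "w \<in> {s1..t}" for w
    proof -
      show "mX \<le> X w" using that s1 t' Zm by (intro X_lower[OF LV_subset[OF LV1], of s1 w]) auto
      show "X w \<le> M1" "mZ \<le> Z w" using that s1 t' XM Zm by auto
      show "Z w \<le> \<gamma>" using that LV1 unfolding LV_def by auto
    qed
    have NN: "N s1 \<le> N t'"
      using s1 t' by (intro LV_N_mono[OF LV_subset[OF LV]]) auto
    have sing: "LV N m e X Z {w}" if "w \<in> {s1..t}" for w by (rule LV_subset[OF LV1]) (use that in auto)
    have "Lyap (X t) (Z t) \<le> exp (- c * (N t - N s1)) * (Lyap (X s1) (Z s1) - (C1 * \<nu>) / c) + (C1 * \<nu>) / c"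
    proof (rule exp_decay[where V = "\<lambda>w. Lyap (X w) (Z w)" and N = N and m = m])
      show "s1 \<le> t" using s1 t' by simp
      fix w assume w: "s1 \<le> w" "w \<le> t"
      show "(N has_real_derivative m w) (at w)" using LV1 w unfolding LV_def by auto
      show "((\<lambda>w. Lyap (X w) (Z w)) has_real_derivative
      m w * (- (Z w - Z0)\<^sup>2 / X w - \<beta>\<^sup>2 * \<delta> * (X w - X0)\<^sup>2 / X w - \<mu> * \<beta> * (Z w / X w) * (X w - X0)\<^sup>2
        + \<mu> * (Z w - Z0)\<^sup>2 / \<beta> - \<mu> * (\<delta> + Z w / X w) * ((X w - X0) * (Z w - Z0))
        - (e w - \<delta>) * (\<beta>\<^sup>2 * (X w - X0) + \<mu> * X w * (Z w - Z0)))) (at w)"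
        using w by (intro Lyap_deriv[OF sing]) auto
    next
      fix w assume w: "s1 < w" "w < t"
      show "m w * (- (Z w - Z0)\<^sup>2 / X w - \<beta>\<^sup>2 * \<delta> * (X w - X0)\<^sup>2 / X w - \<mu> * \<beta> * (Z w / X w) * (X w - X0)\<^sup>2
        + \<mu> * (Z w - Z0)\<^sup>2 / \<beta> - \<mu> * (\<delta> + Z w / X w) * ((X w - X0) * (Z w - Z0))
        - (e w - \<delta>) * (\<beta>\<^sup>2 * (X w - X0) + \<mu> * X w * (Z w - Z0)))
       \<le> m w * (C1 * \<nu> - c * Lyap (X w) (Z w))"
        unfolding c_def using w s1 t' by (intro Lyap_deriv_le[OF sing] box e) auto
    qed (use c in auto)
    also have "\<dots> \<le> exp (- c * (N t - N s1)) * Vm + c3 * \<rho>\<^sup>2 / 4"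
    proof (intro add_mono mult_left_mono)
      have "0 \<le> C1 * \<nu> / c" using C1 \<nu> c by simp
      moreover have "Lyap (X s1) (Z s1) \<le> Vm" using box[of s1] s1 t' by (intro Lyap_upper) auto
      ultimately show "Lyap (X s1) (Z s1) - C1 * \<nu> / c \<le> Vm" by linarith
      show "C1 * \<nu> / c \<le> c3 * \<rho>\<^sup>2 / 4" using C1 c by (simp add: \<nu>_def)
    qed auto
    also have "\<dots> \<le> exp (- c * S2) * Vm + c3 * \<rho>\<^sup>2 / 4"
    proof (intro add_mono mult_right_mono)
      have "S2 \<le> N t - N s1" using SN NN t' by (simp add: S_def)
      hence "c * S2 \<le> c * (N t - N s1)" using c by (intro mult_left_mono) auto
      thus "exp (- c * (N t - N s1)) \<le> exp (- c * S2)" by simp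
    qed (use Vm in auto)
    also have "\<dots> \<le> c3 * \<rho>\<^sup>2 / 2" using S2 by linarith
    also have "\<dots> < c3 * \<rho>\<^sup>2" using c3_pos assms by simp
    finally have "c3 * ((X t - X0)\<^sup>2 + (Z t - Z0)\<^sup>2) < c3 * \<rho>\<^sup>2"
      using Lyap_lower[of "X t" "Z t"] box[of t] s1 t' M_facts by auto
    hence lt: "(X t - X0)\<^sup>2 + (Z t - Z0)\<^sup>2 < \<rho>\<^sup>2" using c3_pos by simp
    have "(X t - X0)\<^sup>2 < \<rho>\<^sup>2" using lt zero_le_power2[of "Z t - Z0"] by linarith
    moreover have "(Z t - Z0)\<^sup>2 < \<rho>\<^sup>2" using lt zero_le_power2[of "X t - X0"] by linarith
    ultimately show "\<bar>X t - X0\<bar> < \<rho> \<and> \<bar>Z t - Z0\<bar> < \<rho>"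
      using assms abs_le_square_iff[of \<rho> "X t - X0"] abs_le_square_iff[of \<rho> "Z t - Z0"] by fastforce
  qed
qed

section \<open>Differences of two solutions near the equilibrium\<close>

definition near :: "real \<Rightarrow> real \<Rightarrow> real \<Rightarrow> bool" where
  "near \<rho> x z \<longleftrightarrow> 0 < x \<and> 0 < z \<and> \<bar>ln x - ln X0\<bar> \<le> \<rho> \<and> \<bar>ln z - ln Z0\<bar> \<le> \<rho>"

lemma near_if_close:
  assumes "\<rho> > 0"
  obtains r where "r > 0" "\<And>x z. \<bar>x - X0\<bar> < r \<Longrightarrow> \<bar>z - Z0\<bar> < r \<Longrightarrow> near \<rho> x z"
proof -
  obtain r1 where r1: "r1 > 0" "\<And>x. \<bar>x - X0\<bar> < r1 \<Longrightarrow> \<bar>ln x - ln X0\<bar> < \<rho>"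
    using isCont_ln[of X0] eq_facts assms unfolding continuous_at_eps_delta dist_real_def by (metis less_irrefl)
  obtain r2 where r2: "r2 > 0" "\<And>z. \<bar>z - Z0\<bar> < r2 \<Longrightarrow> \<bar>ln z - ln Z0\<bar> < \<rho>"
    using isCont_ln[of Z0] eq_facts assms unfolding continuous_at_eps_delta dist_real_def by (metis less_irrefl)
  show thesis
  proof (rule that[of "min (min r1 r2) (min X0 Z0)"])
    fix x z assume xz: "\<bar>x - X0\<bar> < min (min r1 r2) (min X0 Z0)" "\<bar>z - Z0\<bar> < min (min r1 r2) (min X0 Z0)"
    have "x > 0" "z > 0" using xz by auto
    thus "near \<rho> x z" using r1(2)[of x] r2(2)[of z] xz by (auto simp: near_def)
  qed (use r1 r2 eq_facts in auto)
qed

definition "Cr = k + \<gamma> / X0"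

lemma LV_log_deriv:
  assumes "LV N m e X Z {w}"
  shows "((\<lambda>w. ln (X w)) has_real_derivative m w * ((Z w - \<sigma>) / \<beta> / X w - e w)) (at w)"
    "((\<lambda>w. ln (Z w)) has_real_derivative m w * ((\<gamma> - Z w) / X w - \<beta>)) (at w)"
  using assms unfolding LV_def by (auto intro!: derivative_eq_intros simp: field_simps)

text \<open>In the logarithmic derivative of \<open>X\<close> the coefficient \<open>e\<close> is an
  additive term and cancels in the difference, so the linear part has constant coefficients.
  \<open>r1\<close> and \<open>r2\<close> are the linearization errors of \<open>1 / X\<close> and
  \<open>Z / X\<close>; being proportional to the difference, they can be absorbed however small the
  difference is.\<close>

lemma log_diff:
  assumes LV1: "LV N m e X1 Z1 {w}" and LV2: "LV N m e X2 Z2 {w}"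
    and near1: "near \<rho> (X1 w) (Z1 w)" and near2: "near \<rho> (X2 w) (Z2 w)"
  defines "a \<equiv> \<lambda>w. ln (X1 w) - ln (X2 w)" and "b \<equiv> \<lambda>w. ln (Z1 w) - ln (Z2 w)"
  obtains ra rb where
    "(a has_real_derivative m w * (- \<delta> * a w + k / \<beta> * b w + ra)) (at w)"
    "(b has_real_derivative m w * (- \<beta> * a w - k * b w + rb)) (at w)"
    "\<bar>ra\<bar> \<le> (exp (2 * \<rho>) - 1) * Cr * (\<bar>a w\<bar> + \<bar>b w\<bar>)" "\<bar>rb\<bar> \<le> (exp (2 * \<rho>) - 1) * Cr * (\<bar>a w\<bar> + \<bar>b w\<bar>)"
proof -
  have pos: "X1 w > 0" "X2 w > 0" "Z1 w > 0" "Z2 w > 0" using LV1 LV2 unfolding LV_def by auto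
  define \<omega> where "\<omega> = exp (2 * \<rho>) - 1"
  define s where "s = \<bar>a w\<bar> + \<bar>b w\<bar>"
  define r1 where "r1 = 1 / X1 w - 1 / X2 w + a w / X0"
  define r2 where "r2 = Z1 w / X1 w - Z2 w / X2 w - k * (b w - a w)"
  have \<rho>: "\<rho> \<ge> 0" using near1 by (auto simp: near_def)
  hence "exp \<rho> \<le> exp (2 * \<rho>)" "1 \<le> exp \<rho>" by auto
  hence \<omega>: "exp \<rho> - 1 \<le> \<omega>" "0 \<le> \<omega>" by (auto simp: \<omega>_def)
  have r1: "\<bar>r1\<bar> \<le> 1 / X0 * \<omega> * s"
  proof -
    have "\<bar>exp (- ln (X1 w)) - exp (- ln (X2 w)) - exp (- ln X0) * (- ln (X1 w) - - ln (X2 w))\<bar>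
      \<le> exp (- ln X0) * (exp \<rho> - 1) * \<bar>- ln (X1 w) - - ln (X2 w)\<bar>"
      using near1 near2 by (intro exp_linearization) (auto simp: near_def)
    also have "\<bar>- ln (X1 w) - - ln (X2 w)\<bar> = \<bar>a w\<bar>" by (simp add: a_def)
    also have "exp (- ln X0) * (exp \<rho> - 1) * \<bar>a w\<bar> \<le> exp (- ln X0) * \<omega> * s"
      using \<omega> \<rho> by (intro mult_mono) (auto simp: s_def)
    finally show ?thesis using pos eq_facts(1)
      by (simp add: exp_minus r1_def a_def divide_inverse algebra_simps)
  qed
  have r2: "\<bar>r2\<bar> \<le> k * \<omega> * s"
  proof -
    have "\<bar>exp (ln (Z1 w) - ln (X1 w)) - exp (ln (Z2 w) - ln (X2 w)) - exp (ln Z0 - ln X0) * ((ln (Z1 w) - ln (X1 w)) - (ln (Z2 w) - ln (X2 w)))\<bar>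
      \<le> exp (ln Z0 - ln X0) * (exp (2 * \<rho>) - 1) * \<bar>(ln (Z1 w) - ln (X1 w)) - (ln (Z2 w) - ln (X2 w))\<bar>"
      using near1 near2 by (intro exp_linearization) (auto simp: near_def)
    moreover have "exp (ln Z0 - ln X0) = k" using eq_facts by (simp add: exp_diff k_def)
    moreover have "(ln (Z1 w) - ln (X1 w)) - (ln (Z2 w) - ln (X2 w)) = b w - a w" by (simp add: a_def b_def)
    moreover have "exp (ln (Z1 w) - ln (X1 w)) = Z1 w / X1 w" "exp (ln (Z2 w) - ln (X2 w)) = Z2 w / X2 w"
      using pos by (simp_all add: exp_diff)
    ultimately have "\<bar>r2\<bar> \<le> k * \<omega> * \<bar>b w - a w\<bar>" unfolding r2_def \<omega>_def by (simp only:)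
    also have "\<dots> \<le> k * \<omega> * s" using eq_facts \<omega> by (intro mult_left_mono) (auto simp: s_def)
    finally show ?thesis .
  qed
  define ra where "ra = (r2 - \<sigma> * r1) / \<beta>"
  define rb where "rb = \<gamma> * r1 - r2"
  have \<gamma>r1: "\<gamma> * \<bar>r1\<bar> \<le> \<gamma> / X0 * (\<omega> * s)" using mult_left_mono[OF r1, of \<gamma>] par_facts by (simp add: mult.assoc)
  have bnd: "\<bar>r2\<bar> + \<gamma> * \<bar>r1\<bar> \<le> \<omega> * Cr * s" using r2 \<gamma>r1 by (simp add: Cr_def algebra_simps)
  show thesis
  proof (rule that[of ra rb])
    have "\<bar>rb\<bar> \<le> \<bar>r2\<bar> + \<gamma> * \<bar>r1\<bar>" using abs_triangle_ineq4[of "\<gamma> * r1" r2] par_facts by (simp add: rb_def abs_mult)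
    thus "\<bar>rb\<bar> \<le> (exp (2 * \<rho>) - 1) * Cr * (\<bar>a w\<bar> + \<bar>b w\<bar>)" using bnd by (simp add: \<omega>_def s_def)
    have "\<bar>ra\<bar> = \<bar>r2 - \<sigma> * r1\<bar> / \<beta>" using par_facts by (simp add: ra_def)
    also have "\<dots> \<le> \<bar>r2 - \<sigma> * r1\<bar>" using params by (simp add: divide_le_eq mult_le_cancel_left1)
    also have "\<dots> \<le> \<bar>r2\<bar> + \<sigma> * \<bar>r1\<bar>" using abs_triangle_ineq4[of r2 "\<sigma> * r1"] par_facts by (simp add: abs_mult)
    also have "\<dots> \<le> \<bar>r2\<bar> + \<gamma> * \<bar>r1\<bar>" using par_facts by (intro add_mono mult_right_mono) auto
    finally show "\<bar>ra\<bar> \<le> (exp (2 * \<rho>) - 1) * Cr * (\<bar>a w\<bar> + \<bar>b w\<bar>)" using bnd by (simp add: \<omega>_def s_def)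
    have E: "1 / X1 w - 1 / X2 w = r1 - a w / X0" "Z1 w / X1 w - Z2 w / X2 w = r2 + k * (b w - a w)"
      by (simp_all add: r1_def r2_def)
    \<comment> \<open>\<open>kk\<close> and \<open>k2\<close> are the two equilibrium equations
      divided by \<open>X0\<close>; they reduce the coefficients of \<open>a\<close> to
      \<open>\<delta>\<close> and \<open>\<beta>\<close>.\<close>
    have kk: "k - \<sigma> / X0 = \<beta> * \<delta>"
    proof -
      have "Z0 - \<sigma> = \<beta> * (\<delta> * X0)" using eq_facts(4) par_facts(1) by (simp add: field_simps)
      hence "(Z0 - \<sigma>) / X0 = \<beta> * \<delta>" using eq_facts(1) by simp
      thus ?thesis by (simp add: k_def diff_divide_distrib)
    qed
    have k2: "\<gamma> / X0 - k = \<beta>"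
      using eq_facts(1,5) by (simp add: k_def field_simps)
    have "((Z1 w - \<sigma>) / \<beta> / X1 w - e w) - ((Z2 w - \<sigma>) / \<beta> / X2 w - e w)
       = ((Z1 w / X1 w - Z2 w / X2 w) - \<sigma> * (1 / X1 w - 1 / X2 w)) / \<beta>"
      by (simp add: diff_divide_distrib add_divide_distrib algebra_simps)
    also have "\<dots> = (r2 + k * (b w - a w) - \<sigma> * (r1 - a w / X0)) / \<beta>" unfolding E ..
    also have "\<dots> = (- (k - \<sigma> / X0) * a w + k * b w) / \<beta> + ra"
      by (simp add: ra_def algebra_simps add_divide_distrib diff_divide_distrib)
    also have "\<dots> = - \<delta> * a w + k / \<beta> * b w + ra" unfolding kk using par_facts(1) by (simp add: field_simps)
    finally have e1: "((Z1 w - \<sigma>) / \<beta> / X1 w - e w) - ((Z2 w - \<sigma>) / \<beta> / X2 w - e w) = - \<delta> * a w + k / \<beta> * b w + ra" .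
    show "(a has_real_derivative m w * (- \<delta> * a w + k / \<beta> * b w + ra)) (at w)"
      unfolding e1[symmetric] right_diff_distrib[of "m w" "(Z1 w - \<sigma>) / \<beta> / X1 w - e w"] unfolding a_def
      by (intro DERIV_diff LV_log_deriv[OF LV1] LV_log_deriv[OF LV2])
    have "((\<gamma> - Z1 w) / X1 w - \<beta>) - ((\<gamma> - Z2 w) / X2 w - \<beta>)
       = \<gamma> * (1 / X1 w - 1 / X2 w) - (Z1 w / X1 w - Z2 w / X2 w)"
      by (simp add: diff_divide_distrib algebra_simps)
    also have "\<dots> = \<gamma> * (r1 - a w / X0) - (r2 + k * (b w - a w))" unfolding E ..
    also have "\<dots> = - (\<gamma> / X0 - k) * a w - k * b w + rb" by (simp add: rb_def algebra_simps)
    also have "\<dots> = - \<beta> * a w - k * b w + rb" unfolding k2 ..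
    finally have e2: "((\<gamma> - Z1 w) / X1 w - \<beta>) - ((\<gamma> - Z2 w) / X2 w - \<beta>) = - \<beta> * a w - k * b w + rb" .
    show "(b has_real_derivative m w * (- \<beta> * a w - k * b w + rb)) (at w)"
      unfolding e2[symmetric] right_diff_distrib[of "m w" "(\<gamma> - Z1 w) / X1 w - \<beta>"] unfolding b_def
      by (intro DERIV_diff LV_log_deriv[OF LV1] LV_log_deriv[OF LV2])
  qed
qed

lemma Cr_pos: "Cr > 0" using eq_facts par_facts by (simp add: Cr_def add_pos_pos)

lemma small_exp_factor:
  assumes "c > 0"
  obtains \<rho> where "\<rho> > 0" "(exp (2 * \<rho>) - 1) * Cr \<le> c"
proof -
  define \<rho> where "\<rho> = ln (1 + c / Cr) / 2"
  have "1 + c / Cr > 1" using assms Cr_pos by simp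
  hence "\<rho> > 0" "exp (2 * \<rho>) = 1 + c / Cr" by (auto simp: \<rho>_def)
  thus thesis using that[of \<rho>] Cr_pos by simp
qed

lemma sum_abs_sq: "(\<bar>a\<bar> + \<bar>b\<bar>) * (\<bar>a\<bar> + \<bar>b\<bar>) \<le> 2 * (a\<^sup>2 + b\<^sup>2)" for a b :: real
  using abs_mult_le_half_squares[of a b] by (simp add: algebra_simps power2_eq_square abs_mult)

text \<open>\<open>Qf\<close> is, up to a factor and the size of the cross term, the quadratic part
  of \<open>Lyap\<close> in logarithmic variables, since \<open>X0 * (exp a - 1 - a)\<close> starts
  with \<open>X0 * a^2 / 2\<close>. The cross term has the same purpose as in \<open>Lyap\<close>:
  decay in \<open>a\<close> even when \<open>\<delta> = 0\<close>.\<close>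

definition "\<mu>2 = min (min (\<beta>\<^sup>2 / 2) (k / 2)) (k\<^sup>2 / 2 / (k / \<beta> + (k + \<delta>)\<^sup>2 / (2 * \<beta>)))"
definition "Qf a b = \<beta>\<^sup>2 * a\<^sup>2 + k * b\<^sup>2 + 2 * \<mu>2 * a * b"

text \<open>The linear system dissipates at least \<open>c0 * (a^2 + b^2)\<close>, and
  \<open>\<rho>\<close> is so small that the relative errors of \<open>log_diff\<close> consume at
  most half of it. \<open>C\<close> is uniform because the logarithms of two solutions near the
  equilibrium differ by at most \<open>2 * \<rho>\<close>.\<close>

lemma contraction:
  obtains \<rho> c C where "\<rho> > 0" "c > 0" "C > 0" "\<And>N m e X1 Z1 X2 Z2 s t. s \<le> t \<Longrightarrow> LV N m e X1 Z1 {s..t} \<Longrightarrow> LV N m e X2 Z2 {s..t} \<Longrightarrow>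
     (\<And>w. w \<in> {s..t} \<Longrightarrow> near \<rho> (X1 w) (Z1 w)) \<Longrightarrow> (\<And>w. w \<in> {s..t} \<Longrightarrow> near \<rho> (X2 w) (Z2 w)) \<Longrightarrow>
     (ln (X1 t) - ln (X2 t))\<^sup>2 + (ln (Z1 t) - ln (Z2 t))\<^sup>2 \<le> C * exp (- c * (N t - N s))"
proof -
  have d: "k / \<beta> + (k + \<delta>)\<^sup>2 / (2 * \<beta>) > 0" using par_facts eq_facts by (intro add_pos_nonneg) auto
  have \<mu>2: "\<mu>2 > 0" using d par_facts eq_facts by (auto simp: \<mu>2_def)
  have \<mu>2: "\<mu>2 > 0" "\<mu>2 \<le> \<beta>\<^sup>2 / 2" "\<mu>2 \<le> k / 2" using \<mu>2 unfolding \<mu>2_def by linarith+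
  have "\<mu>2 \<le> k\<^sup>2 / 2 / (k / \<beta> + (k + \<delta>)\<^sup>2 / (2 * \<beta>))" by (simp add: \<mu>2_def)
  hence \<mu>2': "\<mu>2 * (k / \<beta> + (k + \<delta>)\<^sup>2 / (2 * \<beta>)) \<le> k\<^sup>2 / 2" using d by (simp only: pos_le_divide_eq)
  define c0 where "c0 = min (\<mu>2 * \<beta> / 2) (k\<^sup>2 / 2)"
  have c0: "c0 > 0" using \<mu>2 par_facts eq_facts by (simp add: c0_def)
  define B where "B = \<beta>\<^sup>2 + k + \<mu>2"
  have B: "B > 0" using par_facts eq_facts \<mu>2 by (simp add: B_def add_pos_pos)
  define b0 where "b0 = min (\<beta>\<^sup>2 / 2) (k / 2)"
  have b0: "b0 > 0" using par_facts eq_facts by (simp add: b0_def)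
  have mm: "\<bar>2 * \<mu>2 * a * b\<bar> \<le> \<mu>2 * (a\<^sup>2 + b\<^sup>2)" for a b
    using mult_left_mono[OF abs_mult_le_half_squares[of a b], of "2 * \<mu>2"] \<mu>2 by (simp add: abs_mult mult.assoc)
  have Qlow: "b0 * (a\<^sup>2 + b\<^sup>2) \<le> Qf a b" for a b
  proof -
    have "\<mu>2 * a\<^sup>2 \<le> \<beta>\<^sup>2 / 2 * a\<^sup>2" "\<mu>2 * b\<^sup>2 \<le> k / 2 * b\<^sup>2" using mult_right_mono[OF \<mu>2(2), of "a\<^sup>2"] mult_right_mono[OF \<mu>2(3), of "b\<^sup>2"] by auto
    moreover have "b0 * a\<^sup>2 \<le> \<beta>\<^sup>2 / 2 * a\<^sup>2" "b0 * b\<^sup>2 \<le> k / 2 * b\<^sup>2" by (intro mult_right_mono; simp add: b0_def)+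
    ultimately show ?thesis using mm[of a b] by (simp add: Qf_def algebra_simps abs_le_iff)
  qed
  have Qup: "Qf a b \<le> B * (a\<^sup>2 + b\<^sup>2)" for a b
  proof -
    have "0 \<le> k * a\<^sup>2" "0 \<le> \<beta>\<^sup>2 * b\<^sup>2" using eq_facts by simp_all
    moreover have "B * (a\<^sup>2 + b\<^sup>2) = \<beta>\<^sup>2 * a\<^sup>2 + k * b\<^sup>2 + \<mu>2 * (a\<^sup>2 + b\<^sup>2) + k * a\<^sup>2 + \<beta>\<^sup>2 * b\<^sup>2"
      by (simp add: B_def algebra_simps)
    ultimately show ?thesis using mm[of a b] unfolding Qf_def abs_le_iff by linarith
  qed
  obtain \<rho> where \<rho>: "\<rho> > 0" "(exp (2 * \<rho>) - 1) * Cr \<le> c0 / (4 * B)"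
    using small_exp_factor[of "c0 / (4 * B)"] c0 B by auto
  define c where "c = c0 / B"
  have c: "c > 0" using c0 B by (simp add: c_def)
  \<comment> \<open>The left side is the derivative of \<open>Qf\<close> along the perturbed linear
    system, up to the speed \<open>m\<close>.\<close>
  have lin: "2 * (\<beta>\<^sup>2 * a * (- \<delta> * a + k / \<beta> * b + ra) + k * b * (- \<beta> * a - k * b + rb)
      + \<mu>2 * (a * (- \<beta> * a - k * b + rb) + b * (- \<delta> * a + k / \<beta> * b + ra))) \<le> - (c * Qf a b)"
    if ra: "\<bar>ra\<bar> \<le> c0 / (4 * B) * (\<bar>a\<bar> + \<bar>b\<bar>)" and rb: "\<bar>rb\<bar> \<le> c0 / (4 * B) * (\<bar>a\<bar> + \<bar>b\<bar>)" for a b ra rb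
  proof -
    let ?s = "\<bar>a\<bar> + \<bar>b\<bar>"
    have cross: "- (\<mu>2 * (k + \<delta>) * (a * b)) \<le> \<mu>2 * (\<beta> / 2 * a\<^sup>2 + (k + \<delta>)\<^sup>2 / (2 * \<beta>) * b\<^sup>2)"
    proof -
      have "0 \<le> (\<beta> * a + (k + \<delta>) * b)\<^sup>2" by simp
      hence "- ((k + \<delta>) * (a * b)) * (2 * \<beta>) \<le> \<beta>\<^sup>2 * a\<^sup>2 + (k + \<delta>)\<^sup>2 * b\<^sup>2"
        by (simp add: power2_eq_square algebra_simps)
      hence "- ((k + \<delta>) * (a * b)) \<le> (\<beta>\<^sup>2 * a\<^sup>2 + (k + \<delta>)\<^sup>2 * b\<^sup>2) / (2 * \<beta>)"
        using par_facts by (subst pos_le_divide_eq) auto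
      also have "\<dots> = \<beta> / 2 * a\<^sup>2 + (k + \<delta>)\<^sup>2 / (2 * \<beta>) * b\<^sup>2" using par_facts(1) by (simp add: field_simps power2_eq_square)
      finally have "\<mu>2 * - ((k + \<delta>) * (a * b)) \<le> \<mu>2 * (\<beta> / 2 * a\<^sup>2 + (k + \<delta>)\<^sup>2 / (2 * \<beta>) * b\<^sup>2)"
        using \<mu>2 by (intro mult_left_mono) auto
      thus ?thesis by (simp add: mult.assoc)
    qed
    have bb: "\<mu>2 * (k / \<beta> * b\<^sup>2) + \<mu>2 * ((k + \<delta>)\<^sup>2 / (2 * \<beta>) * b\<^sup>2) \<le> k\<^sup>2 / 2 * b\<^sup>2"
      using mult_right_mono[OF \<mu>2', of "b\<^sup>2"] by (simp add: algebra_simps)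
    have "\<beta>\<^sup>2 * a * (- \<delta> * a + k / \<beta> * b) + k * b * (- \<beta> * a - k * b)
      + \<mu>2 * (a * (- \<beta> * a - k * b) + b * (- \<delta> * a + k / \<beta> * b))
      = - (\<beta>\<^sup>2 * \<delta> * a\<^sup>2) - k\<^sup>2 * b\<^sup>2 - \<mu>2 * \<beta> * a\<^sup>2 - \<mu>2 * (k + \<delta>) * (a * b) + \<mu>2 * (k / \<beta> * b\<^sup>2)"
      using par_facts(1) by (simp add: field_simps power2_eq_square)
    also have "\<dots> \<le> - (\<mu>2 * \<beta> / 2 * a\<^sup>2) - k\<^sup>2 / 2 * b\<^sup>2"
    proof -
      have gen: "- v - w - p - x + y \<le> - p' - w'" if "- x \<le> p' + z" "y + z \<le> w'" "0 \<le> v" "w = 2 * w'" "p = 2 * p'"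
        for v w p x y z p' w' :: real using that by linarith
      have "- (\<mu>2 * (k + \<delta>) * (a * b)) \<le> \<mu>2 * \<beta> / 2 * a\<^sup>2 + \<mu>2 * ((k + \<delta>)\<^sup>2 / (2 * \<beta>) * b\<^sup>2)"
        using cross by (simp add: distrib_left)
      thus ?thesis by (rule gen[OF _ bb]) (use \<delta> in auto)
    qed
    also have "\<dots> \<le> - (c0 * (a\<^sup>2 + b\<^sup>2))"
    proof -
      have "c0 * a\<^sup>2 \<le> \<mu>2 * \<beta> / 2 * a\<^sup>2" "c0 * b\<^sup>2 \<le> k\<^sup>2 / 2 * b\<^sup>2" by (intro mult_right_mono; simp add: c0_def)+
      thus ?thesis by (simp add: algebra_simps)
    qed
    finally have 1: "\<beta>\<^sup>2 * a * (- \<delta> * a + k / \<beta> * b) + k * b * (- \<beta> * a - k * b)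
      + \<mu>2 * (a * (- \<beta> * a - k * b) + b * (- \<delta> * a + k / \<beta> * b)) \<le> - (c0 * (a\<^sup>2 + b\<^sup>2))" .
    have A: "\<bar>\<beta>\<^sup>2 * a + \<mu>2 * b\<bar> + \<bar>k * b + \<mu>2 * a\<bar> \<le> B * ?s"
    proof -
      have "\<bar>\<beta>\<^sup>2 * a + \<mu>2 * b\<bar> \<le> \<beta>\<^sup>2 * \<bar>a\<bar> + \<mu>2 * \<bar>b\<bar>" "\<bar>k * b + \<mu>2 * a\<bar> \<le> k * \<bar>b\<bar> + \<mu>2 * \<bar>a\<bar>"
        using abs_triangle_ineq[of "\<beta>\<^sup>2 * a" "\<mu>2 * b"] abs_triangle_ineq[of "k * b" "\<mu>2 * a"] \<mu>2 eq_facts by (auto simp: abs_mult)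
      moreover have "0 \<le> k * \<bar>a\<bar>" "0 \<le> \<beta>\<^sup>2 * \<bar>b\<bar>" using eq_facts by auto
      moreover have "B * ?s = \<beta>\<^sup>2 * \<bar>a\<bar> + \<mu>2 * \<bar>b\<bar> + (k * \<bar>b\<bar> + \<mu>2 * \<bar>a\<bar>) + k * \<bar>a\<bar> + \<beta>\<^sup>2 * \<bar>b\<bar>"
        by (simp add: B_def algebra_simps)
      ultimately show ?thesis by linarith
    qed
    have "(\<beta>\<^sup>2 * a + \<mu>2 * b) * ra + (k * b + \<mu>2 * a) * rb \<le> \<bar>\<beta>\<^sup>2 * a + \<mu>2 * b\<bar> * \<bar>ra\<bar> + \<bar>k * b + \<mu>2 * a\<bar> * \<bar>rb\<bar>"
      by (intro add_mono) (simp_all flip: abs_mult)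
    also have "\<dots> \<le> \<bar>\<beta>\<^sup>2 * a + \<mu>2 * b\<bar> * (c0 / (4 * B) * ?s) + \<bar>k * b + \<mu>2 * a\<bar> * (c0 / (4 * B) * ?s)"
      by (intro add_mono mult_left_mono ra rb) auto
    also have "\<dots> = (\<bar>\<beta>\<^sup>2 * a + \<mu>2 * b\<bar> + \<bar>k * b + \<mu>2 * a\<bar>) * (c0 / (4 * B) * ?s)" by (simp add: algebra_simps)
    also have "\<dots> \<le> (B * ?s) * (c0 / (4 * B) * ?s)" using c0 B by (intro mult_right_mono A) auto
    also have "\<dots> = c0 / 4 * (?s * ?s)" using B by simp
    also have "\<dots> \<le> c0 / 4 * (2 * (a\<^sup>2 + b\<^sup>2))" using c0 by (intro mult_left_mono sum_abs_sq) auto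
    also have "\<dots> = c0 / 2 * (a\<^sup>2 + b\<^sup>2)" by simp
    finally have 2: "(\<beta>\<^sup>2 * a + \<mu>2 * b) * ra + (k * b + \<mu>2 * a) * rb \<le> c0 / 2 * (a\<^sup>2 + b\<^sup>2)" .
    have "c * Qf a b \<le> c * (B * (a\<^sup>2 + b\<^sup>2))" using c by (intro mult_left_mono Qup) auto
    hence 3: "c * Qf a b \<le> c0 * (a\<^sup>2 + b\<^sup>2)" using B by (simp add: c_def)
    have "\<beta>\<^sup>2 * a * (- \<delta> * a + k / \<beta> * b + ra) + k * b * (- \<beta> * a - k * b + rb)
      + \<mu>2 * (a * (- \<beta> * a - k * b + rb) + b * (- \<delta> * a + k / \<beta> * b + ra))
      = (\<beta>\<^sup>2 * a * (- \<delta> * a + k / \<beta> * b) + k * b * (- \<beta> * a - k * b)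
      + \<mu>2 * (a * (- \<beta> * a - k * b) + b * (- \<delta> * a + k / \<beta> * b))) + ((\<beta>\<^sup>2 * a + \<mu>2 * b) * ra + (k * b + \<mu>2 * a) * rb)"
      by (simp add: algebra_simps)
    also have "\<dots> \<le> - (c0 / 2 * (a\<^sup>2 + b\<^sup>2))" using 1 2 by simp
    finally show ?thesis using 3 by simp
  qed
  define C where "C = (B * (8 * \<rho>\<^sup>2)) / b0"
  have C: "C > 0" using B b0 \<rho> by (simp add: C_def)
  show thesis
  proof (rule that[OF \<rho>(1) c C])
    fix N m e X1 Z1 X2 Z2 s t
    assume st: "s \<le> t" and LV1: "LV N m e X1 Z1 {s..t}" and LV2: "LV N m e X2 Z2 {s..t}"
      and near1: "\<And>w. w \<in> {s..t} \<Longrightarrow> near \<rho> (X1 w) (Z1 w)" and near2: "\<And>w. w \<in> {s..t} \<Longrightarrow> near \<rho> (X2 w) (Z2 w)"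
    define a b where "a w = ln (X1 w) - ln (X2 w)" and "b w = ln (Z1 w) - ln (Z2 w)" for w
    have "\<exists>V'. ((\<lambda>w. Qf (a w) (b w)) has_real_derivative V') (at w) \<and> V' \<le> m w * (0 - c * Qf (a w) (b w))"
      if w: "s \<le> w" "w \<le> t" for w
    proof -
      have s: "{w} \<subseteq> {s..t}" using w by auto
      obtain ra rb where d: "(a has_real_derivative m w * (- \<delta> * a w + k / \<beta> * b w + ra)) (at w)"
        "(b has_real_derivative m w * (- \<beta> * a w - k * b w + rb)) (at w)"
        "\<bar>ra\<bar> \<le> (exp (2 * \<rho>) - 1) * Cr * (\<bar>a w\<bar> + \<bar>b w\<bar>)" "\<bar>rb\<bar> \<le> (exp (2 * \<rho>) - 1) * Cr * (\<bar>a w\<bar> + \<bar>b w\<bar>)"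
        using log_diff[OF LV_subset[OF LV1 s] LV_subset[OF LV2 s] near1 near2] w unfolding a_def[abs_def] b_def[abs_def] by auto
      have rr: "\<bar>ra\<bar> \<le> c0 / (4 * B) * (\<bar>a w\<bar> + \<bar>b w\<bar>)" "\<bar>rb\<bar> \<le> c0 / (4 * B) * (\<bar>a w\<bar> + \<bar>b w\<bar>)"
        using d(3,4) mult_right_mono[OF \<rho>(2), of "\<bar>a w\<bar> + \<bar>b w\<bar>"] by linarith+
      let ?D = "2 * (\<beta>\<^sup>2 * a w * (- \<delta> * a w + k / \<beta> * b w + ra) + k * b w * (- \<beta> * a w - k * b w + rb)
      + \<mu>2 * (a w * (- \<beta> * a w - k * b w + rb) + b w * (- \<delta> * a w + k / \<beta> * b w + ra)))"
      have "((\<lambda>w. Qf (a w) (b w)) has_real_derivative m w * ?D) (at w)"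
        unfolding Qf_def by (rule d(1,2) derivative_eq_intros refl)+ (simp add: algebra_simps power2_eq_square)
      moreover have "m w * ?D \<le> m w * (0 - c * Qf (a w) (b w))"
        using lin[OF rr] LV1 w unfolding LV_def by (intro mult_left_mono) (auto intro: less_imp_le)
      ultimately show ?thesis by blast
    qed
    then obtain V' where V': "\<And>w. s \<le> w \<Longrightarrow> w \<le> t \<Longrightarrow> ((\<lambda>w. Qf (a w) (b w)) has_real_derivative V' w) (at w)"
       "\<And>w. s \<le> w \<Longrightarrow> w \<le> t \<Longrightarrow> V' w \<le> m w * (0 - c * Qf (a w) (b w))" by metis
    have "Qf (a t) (b t) \<le> exp (- c * (N t - N s)) * (Qf (a s) (b s) - 0 / c) + 0 / c"
    proof (rule exp_decay[OF st c, where m = m and V = "\<lambda>w. Qf (a w) (b w)"])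
      fix w assume "s \<le> w" "w \<le> t"
      thus "(N has_real_derivative m w) (at w)" using LV1 unfolding LV_def by auto
    qed (use V' in auto)
    also have "\<dots> \<le> exp (- c * (N t - N s)) * (B * (8 * \<rho>\<^sup>2))"
    proof -
      have "\<bar>a s\<bar> \<le> \<bar>2 * \<rho>\<bar>" "\<bar>b s\<bar> \<le> \<bar>2 * \<rho>\<bar>" using near1[of s] near2[of s] st by (auto simp: near_def a_def b_def)
      hence "(a s)\<^sup>2 \<le> (2 * \<rho>)\<^sup>2" "(b s)\<^sup>2 \<le> (2 * \<rho>)\<^sup>2" by (simp_all only: abs_le_square_iff)
      hence "B * ((a s)\<^sup>2 + (b s)\<^sup>2) \<le> B * (8 * \<rho>\<^sup>2)" using B by (intro mult_left_mono) (auto simp: power2_eq_square)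
      hence "Qf (a s) (b s) \<le> B * (8 * \<rho>\<^sup>2)" using Qup[of "a s" "b s"] by linarith
      thus ?thesis by simp
    qed
    finally have "b0 * ((a t)\<^sup>2 + (b t)\<^sup>2) \<le> exp (- c * (N t - N s)) * (B * (8 * \<rho>\<^sup>2))"
      using Qlow[of "a t" "b t"] by linarith
    hence "(a t)\<^sup>2 + (b t)\<^sup>2 \<le> exp (- c * (N t - N s)) * (B * (8 * \<rho>\<^sup>2)) / b0" using b0 by (simp add: pos_le_divide_eq mult.commute)
    thus "(ln (X1 t) - ln (X2 t))\<^sup>2 + (ln (Z1 t) - ln (Z2 t))\<^sup>2 \<le> C * exp (- c * (N t - N s))"
      by (simp add: a_def b_def C_def mult.commute)
  qed
qed

text \<open>The assumption says that the eigenvalues of the linearization at the equilibrium are not real.\<close>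

lemma winding_rate:
  assumes disc: "(k - \<delta>)\<^sup>2 < 4 * k"
  obtains \<rho> c where "\<rho> > 0" "c > 0" "\<And>N m e X1 Z1 X2 Z2 w. LV N m e X1 Z1 {w} \<Longrightarrow> LV N m e X2 Z2 {w} \<Longrightarrow>
     near \<rho> (X1 w) (Z1 w) \<Longrightarrow> near \<rho> (X2 w) (Z2 w) \<Longrightarrow>
     \<exists>a' b'. ((\<lambda>w. ln (X1 w) - ln (X2 w)) has_real_derivative a') (at w) \<and>
       ((\<lambda>w. ln (Z1 w) - ln (Z2 w)) has_real_derivative b') (at w) \<and>
       (let a = ln (X1 w) - ln (X2 w); D = (\<beta> * a + (ln (Z1 w) - ln (Z2 w))) / \<kappa> in
          m w * (c * (D\<^sup>2 + a\<^sup>2)) \<le> D * a' - a * ((\<beta> * a' + b') / \<kappa>))"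
proof -
  \<comment> \<open>The form bounded in \<open>P\<close> has the discriminant
    \<open>(k - \<delta>)^2 - 4 * k < 0\<close>. \<open>h\<close> and \<open>h2\<close> are the
    coefficients that completing the square in one variable leaves for the other; averaging both
    bounds gives definiteness in both variables.\<close>
  define h h2 where "h = (4 * k - (k - \<delta>)\<^sup>2) / (4 * \<beta>)" and "h2 = \<beta> * (4 * k - (k - \<delta>)\<^sup>2) / (4 * k)"
  have hh: "h > 0" "h2 > 0" using disc par_facts eq_facts by (auto simp: h_def h2_def)
  define p0 where "p0 = min h h2 / 2"
  have p0: "p0 > 0" using hh by (simp add: p0_def)
  have P: "p0 * (a\<^sup>2 + b\<^sup>2) \<le> \<beta> * a\<^sup>2 + (k - \<delta>) * (a * b) + k / \<beta> * b\<^sup>2" (is "_ \<le> ?P") for a b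
  proof -
    have "?P = \<beta> * (a + (k - \<delta>) / (2 * \<beta>) * b)\<^sup>2 + h * b\<^sup>2"
      using par_facts(1) by (simp add: h_def field_simps power2_eq_square)
    moreover have "0 \<le> \<beta> * (a + (k - \<delta>) / (2 * \<beta>) * b)\<^sup>2" using par_facts by simp
    ultimately have 1: "h * b\<^sup>2 \<le> ?P" by linarith
    have "?P = k / \<beta> * (b + (k - \<delta>) * \<beta> / (2 * k) * a)\<^sup>2 + h2 * a\<^sup>2"
      using par_facts(1) eq_facts(6) by (simp add: h2_def field_simps power2_eq_square)
    moreover have "0 \<le> k / \<beta> * (b + (k - \<delta>) * \<beta> / (2 * k) * a)\<^sup>2" using par_facts eq_facts by simp
    ultimately have 2: "h2 * a\<^sup>2 \<le> ?P" by linarith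
    have "2 * p0 * b\<^sup>2 \<le> h * b\<^sup>2" "2 * p0 * a\<^sup>2 \<le> h2 * a\<^sup>2" by (auto simp: p0_def intro!: mult_right_mono)
    moreover have "2 * (p0 * (a\<^sup>2 + b\<^sup>2)) = 2 * p0 * b\<^sup>2 + 2 * p0 * a\<^sup>2" by (simp add: algebra_simps)
    moreover have avg: "s \<le> p" if "x \<le> p" "y \<le> p" "u \<le> x" "v \<le> y" "2 * s = u + v" for x y u v s p :: real
      using that by linarith
    ultimately show ?thesis using avg[OF 1 2] by blast
  qed
  define CD where "CD = 2 * \<beta>\<^sup>2 / \<kappa>\<^sup>2 + 2 / \<kappa>\<^sup>2 + 1"
  have CD: "CD > 0" using par_facts by (simp add: CD_def add_nonneg_pos)
  have Dle: "((\<beta> * a + b) / \<kappa>)\<^sup>2 + a\<^sup>2 \<le> CD * (a\<^sup>2 + b\<^sup>2)" for a b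
  proof -
    have "(\<beta> * a + b)\<^sup>2 \<le> 2 * (\<beta>\<^sup>2 * a\<^sup>2 + b\<^sup>2)"
      using zero_le_power2[of "\<beta> * a - b"] by (simp add: power2_sum power2_diff power_mult_distrib)
    hence "((\<beta> * a + b) / \<kappa>)\<^sup>2 \<le> 2 * (\<beta>\<^sup>2 * a\<^sup>2 + b\<^sup>2) / \<kappa>\<^sup>2"
      unfolding power_divide by (rule divide_right_mono) simp
    also have "\<dots> = 2 * \<beta>\<^sup>2 / \<kappa>\<^sup>2 * a\<^sup>2 + 2 / \<kappa>\<^sup>2 * b\<^sup>2" by (simp add: add_divide_distrib)
    finally have "((\<beta> * a + b) / \<kappa>)\<^sup>2 \<le> 2 * \<beta>\<^sup>2 / \<kappa>\<^sup>2 * a\<^sup>2 + 2 / \<kappa>\<^sup>2 * b\<^sup>2" .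
    moreover have "0 \<le> 2 * \<beta>\<^sup>2 / \<kappa>\<^sup>2 * b\<^sup>2 + 2 / \<kappa>\<^sup>2 * a\<^sup>2 + b\<^sup>2" by simp
    moreover have "CD * (a\<^sup>2 + b\<^sup>2) = (2 * \<beta>\<^sup>2 / \<kappa>\<^sup>2 * a\<^sup>2 + 2 / \<kappa>\<^sup>2 * b\<^sup>2) + (2 * \<beta>\<^sup>2 / \<kappa>\<^sup>2 * b\<^sup>2 + 2 / \<kappa>\<^sup>2 * a\<^sup>2 + b\<^sup>2) + a\<^sup>2"
      unfolding CD_def by (simp only: distrib_left distrib_right mult_1)
    ultimately show ?thesis by linarith
  qed
  obtain \<rho> where \<rho>: "\<rho> > 0" "(exp (2 * \<rho>) - 1) * Cr \<le> p0 / 4"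
    using small_exp_factor[of "p0 / 4"] p0 by auto
  define c where "c = p0 / (2 * \<kappa> * CD)"
  have c: "c > 0" using p0 CD par_facts by (simp add: c_def)
  show thesis
  proof (rule that[OF \<rho>(1) c])
    fix N m e X1 Z1 X2 Z2 w
    assume LV1: "LV N m e X1 Z1 {w}" and LV2: "LV N m e X2 Z2 {w}"
      and near: "near \<rho> (X1 w) (Z1 w)" "near \<rho> (X2 w) (Z2 w)"
    define a b where "a = ln (X1 w) - ln (X2 w)" and "b = ln (Z1 w) - ln (Z2 w)"
    have mw: "m w > 0" using LV1 by (simp add: LV_def)
    obtain ra rb where d: "((\<lambda>w. ln (X1 w) - ln (X2 w)) has_real_derivative m w * (- \<delta> * a + k / \<beta> * b + ra)) (at w)"
        "((\<lambda>w. ln (Z1 w) - ln (Z2 w)) has_real_derivative m w * (- \<beta> * a - k * b + rb)) (at w)"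
        "\<bar>ra\<bar> \<le> (exp (2 * \<rho>) - 1) * Cr * (\<bar>a\<bar> + \<bar>b\<bar>)" "\<bar>rb\<bar> \<le> (exp (2 * \<rho>) - 1) * Cr * (\<bar>a\<bar> + \<bar>b\<bar>)"
      using log_diff[OF LV1 LV2 near] unfolding a_def b_def by auto
    have rr: "\<bar>ra\<bar> \<le> p0 / 4 * (\<bar>a\<bar> + \<bar>b\<bar>)" "\<bar>rb\<bar> \<le> p0 / 4 * (\<bar>a\<bar> + \<bar>b\<bar>)"
      using d(3,4) mult_right_mono[OF \<rho>(2), of "\<bar>a\<bar> + \<bar>b\<bar>"] by linarith+
    have "\<bar>b * ra - a * rb\<bar> \<le> \<bar>b\<bar> * \<bar>ra\<bar> + \<bar>a\<bar> * \<bar>rb\<bar>"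
      using abs_triangle_ineq4[of "b * ra" "a * rb"] by (simp add: abs_mult)
    also have "\<dots> \<le> \<bar>b\<bar> * (p0 / 4 * (\<bar>a\<bar> + \<bar>b\<bar>)) + \<bar>a\<bar> * (p0 / 4 * (\<bar>a\<bar> + \<bar>b\<bar>))"
      by (intro add_mono mult_left_mono rr) auto
    also have "\<dots> = p0 / 4 * ((\<bar>a\<bar> + \<bar>b\<bar>) * (\<bar>a\<bar> + \<bar>b\<bar>))"
      by (simp only: distrib_right mult.left_commute[of _ "p0 / 4"]) (simp add: distrib_left add.commute)
    also have "\<dots> \<le> p0 / 4 * (2 * (a\<^sup>2 + b\<^sup>2))" using p0 by (intro mult_left_mono sum_abs_sq) auto
    also have "\<dots> = p0 / 2 * (a\<^sup>2 + b\<^sup>2)" by simp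
    finally have res: "- (p0 / 2 * (a\<^sup>2 + b\<^sup>2)) \<le> b * ra - a * rb" by linarith
    \<comment> \<open>For solutions of the problem, \<open>D\<close> will be the difference of
      \<open>T\<close> and \<open>a\<close> that of \<open>y\<close>. The expression
      \<open>D * a' - a * D'\<close> is the squared radius times the angular velocity of this
      vector, so the claim is rotation at rate at least \<open>c\<close> in the time
      \<open>N\<close>.\<close>
    define D where "D = (\<beta> * a + b) / \<kappa>"
    let ?a' = "m w * (- \<delta> * a + k / \<beta> * b + ra)" and ?b' = "m w * (- \<beta> * a - k * b + rb)"
    have "D * ?a' - a * ((\<beta> * ?a' + ?b') / \<kappa>)
       = m w * (((\<beta> * a + b) * (- \<delta> * a + k / \<beta> * b + ra) - a * (\<beta> * (- \<delta> * a + k / \<beta> * b + ra) + (- \<beta> * a - k * b + rb))) / \<kappa>)"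
      using par_facts(5) by (simp add: D_def field_simps)
    also have "(\<beta> * a + b) * (- \<delta> * a + k / \<beta> * b + ra) - a * (\<beta> * (- \<delta> * a + k / \<beta> * b + ra) + (- \<beta> * a - k * b + rb))
      = (\<beta> * a\<^sup>2 + (k - \<delta>) * (a * b) + k / \<beta> * b\<^sup>2) + (b * ra - a * rb)"
      using par_facts(1) by (simp add: field_simps power2_eq_square)
    finally have e: "D * ?a' - a * ((\<beta> * ?a' + ?b') / \<kappa>)
      = m w * (((\<beta> * a\<^sup>2 + (k - \<delta>) * (a * b) + k / \<beta> * b\<^sup>2) + (b * ra - a * rb)) / \<kappa>)" .
    have "c * (D\<^sup>2 + a\<^sup>2) \<le> c * (CD * (a\<^sup>2 + b\<^sup>2))" using c Dle[of a b] unfolding D_def by (intro mult_left_mono) auto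
    also have "\<dots> = p0 / 2 * (a\<^sup>2 + b\<^sup>2) / \<kappa>" using CD by (simp add: c_def)
    also have "\<dots> \<le> ((\<beta> * a\<^sup>2 + (k - \<delta>) * (a * b) + k / \<beta> * b\<^sup>2) + (b * ra - a * rb)) / \<kappa>"
      using P[of a b] res par_facts(5) by (intro divide_right_mono) (auto simp: algebra_simps)
    finally have "m w * (c * (D\<^sup>2 + a\<^sup>2)) \<le> D * ?a' - a * ((\<beta> * ?a' + ?b') / \<kappa>)"
      unfolding e using mw by (intro mult_left_mono) auto
    with d(1,2) show "\<exists>a' b'. ((\<lambda>w. ln (X1 w) - ln (X2 w)) has_real_derivative a') (at w) \<and>
       ((\<lambda>w. ln (Z1 w) - ln (Z2 w)) has_real_derivative b') (at w) \<and>
       (let a = ln (X1 w) - ln (X2 w); D = (\<beta> * a + (ln (Z1 w) - ln (Z2 w))) / \<kappa> in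
          m w * (c * (D\<^sup>2 + a\<^sup>2)) \<le> D * a' - a * ((\<beta> * a' + b') / \<kappa>))"
      unfolding Let_def a_def[symmetric] b_def[symmetric] D_def[symmetric] by blast
  qed
qed

end

section \<open>The problem as a Lotka--Volterra system\<close>

lemma le_by_deriv_open:
  fixes h :: "real \<Rightarrow> real"
  assumes "s \<le> t" "continuous_on {s..t} h" and "\<And>w. s < w \<Longrightarrow> w < t \<Longrightarrow> (h has_real_derivative h' w) (at w)"
    and "\<And>w. s < w \<Longrightarrow> w < t \<Longrightarrow> 0 \<le> h' w"
  shows "h s \<le> h t"
  using assms by (intro DERIV_nonneg_imp_increasing_open[of s t h]) (auto intro: exI)

lemma ge_by_deriv_open:
  fixes h :: "real \<Rightarrow> real"
  assumes "s \<le> t" "continuous_on {s..t} h" and "\<And>w. s < w \<Longrightarrow> w < t \<Longrightarrow> (h has_real_derivative h' w) (at w)"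
    and "\<And>w. s < w \<Longrightarrow> w < t \<Longrightarrow> h' w \<le> 0"
  shows "h t \<le> h s"
proof -
  have "- h s \<le> - h t"
    by (rule le_by_deriv_open[where h = "\<lambda>w. - h w" and h' = "\<lambda>w. - h' w"])
       (auto intro!: DERIV_minus continuous_intros assms)
  thus ?thesis by simp
qed

text \<open>Bounding the absolute value of \<open>u'\<close> makes the estimate valid in both
  directions: forwards it propagates closeness, backwards it shows that two solutions that meet have
  coincided before.\<close>

lemma gronwall:
  fixes u :: "real \<Rightarrow> real"
  assumes "s \<le> t" "continuous_on {s..t} u" and d: "\<And>w. s < w \<Longrightarrow> w < t \<Longrightarrow> (u has_real_derivative u' w) (at w)"
    and le: "\<And>w. s < w \<Longrightarrow> w < t \<Longrightarrow> \<bar>u' w\<bar> \<le> K * u w"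
  shows "u t \<le> exp (K * (t - s)) * u s" "u s \<le> exp (K * (t - s)) * u t"
proof -
  have "u t * exp (- K * t) \<le> u s * exp (- K * s)"
  proof (rule ge_by_deriv_open[OF assms(1), where h = "\<lambda>w. u w * exp (- K * w)" and h' = "\<lambda>w. (u' w - K * u w) * exp (- K * w)"])
    fix w assume w: "s < w" "w < t"
    show "((\<lambda>w. u w * exp (- K * w)) has_real_derivative (u' w - K * u w) * exp (- K * w)) (at w)"
      by (rule d[OF w] derivative_eq_intros refl)+ (simp add: algebra_simps)
    show "(u' w - K * u w) * exp (- K * w) \<le> 0" using le[OF w] by (simp add: mult_le_0_iff)
  qed (intro continuous_intros assms)
  hence "u t * exp (- K * t) * exp (K * t) \<le> u s * exp (- K * s) * exp (K * t)" by (rule mult_right_mono) simp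
  thus "u t \<le> exp (K * (t - s)) * u s" by (simp add: mult.assoc algebra_simps flip: exp_add)
  have "u s * exp (K * s) \<le> u t * exp (K * t)"
  proof (rule le_by_deriv_open[OF assms(1), where h = "\<lambda>w. u w * exp (K * w)" and h' = "\<lambda>w. (u' w + K * u w) * exp (K * w)"])
    fix w assume w: "s < w" "w < t"
    show "((\<lambda>w. u w * exp (K * w)) has_real_derivative (u' w + K * u w) * exp (K * w)) (at w)"
      by (rule d[OF w] derivative_eq_intros refl)+ (simp add: algebra_simps)
    show "0 \<le> (u' w + K * u w) * exp (K * w)" using le[OF w] by (simp add: zero_le_mult_iff)
  qed (intro continuous_intros assms)
  hence "u s * exp (K * s) * exp (- K * s) \<le> u t * exp (K * t) * exp (- K * s)" by (rule mult_right_mono) simp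
  thus "u s \<le> exp (K * (t - s)) * u t" by (simp add: mult.assoc algebra_simps flip: exp_add)
qed

lemma exp_Lipschitz:
  fixes A B M :: real
  assumes "A \<le> M" "B \<le> M"
  shows "\<bar>exp A - exp B\<bar> \<le> exp M * \<bar>A - B\<bar>"
proof -
  have gen: "exp A - exp B \<le> exp M * (A - B)" if "B \<le> A" "A \<le> M" for A B
  proof -
    have "1 + (B - A) \<le> exp (B - A)" by (rule exp_ge_add_one_self)
    hence "1 - exp (B - A) \<le> A - B" by linarith
    hence "exp A * (1 - exp (B - A)) \<le> exp A * (A - B)" by (intro mult_left_mono) auto
    also have "\<dots> \<le> exp M * (A - B)" using that by (intro mult_right_mono) auto
    finally show ?thesis by (simp add: algebra_simps flip: exp_add)
  qed
  show ?thesis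
  proof (cases "B \<le> A")
    case True
    hence "exp B \<le> exp A" by simp
    thus ?thesis using gen[of B A] assms True by (simp add: abs_if)
  next
    case False
    hence "exp A \<le> exp B" by simp
    thus ?thesis using gen[of A B] assms False by (simp add: abs_if)
  qed
qed

section \<open>The behaviour of the nonlinearity near zero\<close>

locale mems = pars +
  fixes q ubar :: real and f g :: "real \<Rightarrow> real"
  assumes g_def: "g = (\<lambda>u. f u powr (1 / \<beta>))"
    and f_C2: "C2_on {0<..} f"
    and f_C0: "continuous_on {0..} f"
    and f_zero: "f 0 = 0"
    and f_pos: "\<And>u. u > 0 \<Longrightarrow> f u > 0"
    and ubar_pos: "ubar > 0"
    and G1: "\<And>u. 0 < u \<Longrightarrow> u < ubar \<Longrightarrow> deriv g u > 0 \<and> deriv (deriv g) u > 0"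
    and G2: "((\<lambda>u. (deriv g u)\<^sup>2 / (g u * deriv (deriv g) u)) \<longlongrightarrow> q) (at_right 0)"
    and G3: "q = 1 \<Longrightarrow>
               (\<forall>\<^sub>F u in at_right 0. (deriv g u)\<^sup>2 / (g u * deriv (deriv g) u) \<ge> 1)"
    and G4: "\<And>u. 0 < u \<Longrightarrow> deriv g u > 0"
begin

text \<open>For \<open>w > 0\<close>, \<open>N\<close> is \<open>ln g\<close> and \<open>m\<close>
  its derivative, written with \<open>f\<close> so that differentiability is inherited from
  \<open>C2_on\<close>. \<open>eps\<close> is the coefficient for which
  \<open>m' = - eps * m^2\<close>.\<close>

definition "N w = ln (f w) / \<beta>"
definition "m w = deriv f w / (\<beta> * f w)"
definition "eps w = 1 - g w * deriv (deriv g) w / (deriv g w)\<^sup>2"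

lemma f_deriv: "u > 0 \<Longrightarrow> (f has_real_derivative deriv f u) (at u)"
  using f_C2 by (auto simp: C2_on_def DERIV_deriv_iff_real_differentiable)

lemma f'_deriv: "u > 0 \<Longrightarrow> (deriv f has_real_derivative deriv (deriv f) u) (at u)"
  using f_C2 by (auto simp: C2_on_def DERIV_deriv_iff_real_differentiable)

lemma g_pos: "u > 0 \<Longrightarrow> g u > 0"
  using f_pos[of u] by (simp add: g_def)

lemma N_deriv: "u > 0 \<Longrightarrow> (N has_real_derivative m u) (at u)"
  unfolding N_def[abs_def] m_def using f_deriv[of u] f_pos[of u] par_facts
  by (auto intro!: derivative_eq_intros simp: field_simps)

lemma g_eq: "u > 0 \<Longrightarrow> g u = exp (N u)"
  using f_pos[of u] by (simp add: g_def N_def powr_def)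

lemma g_deriv: assumes "u > 0" shows "(g has_real_derivative g u * m u) (at u)"
proof (rule has_field_derivative_transform_within_open[of "\<lambda>u. exp (N u)" _ _ "{0<..}"])
  show "((\<lambda>u. exp (N u)) has_real_derivative g u * m u) (at u)"
    by (rule N_deriv[OF assms] derivative_eq_intros refl)+ (simp add: g_eq assms)
qed (use assms g_eq in auto)

lemma deriv_g: "u > 0 \<Longrightarrow> deriv g u = g u * m u"
  using g_deriv by (rule DERIV_imp_deriv)

lemma m_pos: "u > 0 \<Longrightarrow> m u > 0"
  using G4[of u] g_pos[of u] by (simp add: deriv_g zero_less_mult_iff)

text \<open>That \<open>m\<close> has some derivative follows from the regularity of
  \<open>f\<close>; its value is found by comparing the derivative of \<open>g * m\<close> with
  \<open>deriv (deriv g)\<close>.\<close>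

lemma m_deriv: assumes u: "u > 0" shows "(m has_real_derivative - eps u * (m u)\<^sup>2) (at u)"
proof -
  have "\<exists>m'. ((\<lambda>w. deriv f w / (\<beta> * f w)) has_real_derivative m') (at u)"
    by (rule exI, (rule f_deriv[OF u] f'_deriv[OF u] derivative_eq_intros refl)+) (use f_pos[OF u] par_facts in auto)
  then obtain m' where m': "(m has_real_derivative m') (at u)"
    unfolding m_def[abs_def] by blast
  have "(deriv g has_real_derivative g u * m u * m u + g u * m') (at u)"
  proof (rule has_field_derivative_transform_within_open[of "\<lambda>u. g u * m u" _ _ "{0<..}"])
    show "((\<lambda>u. g u * m u) has_real_derivative g u * m u * m u + g u * m') (at u)"
      by (rule g_deriv[OF u] m' derivative_eq_intros refl)+ (simp add: algebra_simps)
  qed (use u deriv_g in auto)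
  hence "deriv (deriv g) u = g u * m u * m u + g u * m'" by (rule DERIV_imp_deriv)
  hence "- eps u * (m u)\<^sup>2 = m'" using g_pos[OF u] m_pos[OF u]
    by (simp add: eps_def deriv_g[OF u] field_simps power2_eq_square)
  with m' show ?thesis by simp
qed

lemma f_strict_mono: assumes "0 \<le> u" "u < v" shows "f u < f v"
proof (cases "u = 0")
  case True thus ?thesis using f_zero f_pos[of v] assms by simp
next
  case False
  show ?thesis
  proof (rule DERIV_pos_imp_increasing[OF assms(2)])
    fix x assume "u \<le> x" "x \<le> v"
    hence x: "x > 0" using False assms by simp
    have "0 < \<beta> * f x" using f_pos[OF x] par_facts by simp
    hence "deriv f x > 0" using m_pos[OF x] by (simp only: m_def zero_less_divide_iff) linarith
    thus "\<exists>y. (f has_real_derivative y) (at x) \<and> 0 < y" using f_deriv[OF x] by blast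
  qed
qed

lemma f_mono: "0 \<le> u \<Longrightarrow> u \<le> v \<Longrightarrow> f u \<le> f v"
  using f_strict_mono[of u v] by (cases "u = v") auto

lemma f_isCont: "u > 0 \<Longrightarrow> isCont f u" using f_deriv DERIV_isCont by blast

lemma N_less: "0 < u \<Longrightarrow> u < v \<Longrightarrow> N u < N v"
  using f_strict_mono[of u v] f_pos[of u] f_pos[of v] par_facts by (auto simp: N_def divide_strict_right_mono)

lemma N_at_bot: "filterlim N at_bot (at_right 0)"
proof -
  have "(f \<longlongrightarrow> 0) (at 0 within {0..})"
    using f_C0 f_zero by (metis atLeast_iff continuous_on_def order_refl)
  hence "(f \<longlongrightarrow> 0) (at_right 0)" by (rule tendsto_within_subset) auto
  moreover have "\<forall>\<^sub>F u in at_right 0. f u \<in> {0<..}" using f_pos by (auto simp: eventually_at_filter)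
  ultimately have "filterlim f (at_right 0) (at_right 0)"
    by (auto simp: filterlim_at eventually_mono)
  from filterlim_compose[OF ln_at_0 this] have "filterlim (\<lambda>u. ln (f u)) at_bot (at_right 0)" .
  from filterlim_tendsto_pos_mult_at_bot[OF tendsto_const _ this, of "1 / \<beta>"]
  show ?thesis using par_facts by (simp add: N_def[abs_def])
qed

lemma N_small:
  assumes b: "b > 0"
  obtains w where "0 < w" "w < b" "N w \<le> B"
proof -
  have "\<forall>\<^sub>F w in at_right 0. N w \<le> B" using N_at_bot by (auto simp: filterlim_at_bot)
  moreover have "\<forall>\<^sub>F w in at_right 0. w \<in> {0<..<b}" using b by (rule eventually_at_right_real)
  ultimately have "\<forall>\<^sub>F w in at_right 0. N w \<le> B \<and> w \<in> {0<..<b}" by (rule eventually_conj)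
  from eventually_happens[OF this] have "\<exists>w. N w \<le> B \<and> w \<in> {0<..<b}" by (simp add: trivial_limit_at_right_real)
  thus thesis using that by auto
qed

text \<open>If \<open>q < 1\<close>, then \<open>eps \<le> 0\<close> near 0, so \<open>m\<close> is
  nondecreasing there and thus bounded above. Since \<open>m\<close> is the derivative of
  \<open>N\<close>, this contradicts that \<open>N\<close> tends to minus infinity at 0.\<close>

lemma q_ge_1: "q \<ge> 1"
proof (rule ccontr)
  assume "\<not> q \<ge> 1"
  then obtain q' where q': "q < q'" "q' < 1" using dense[of q 1] by auto
  have "\<forall>\<^sub>F u in at_right 0. (deriv g u)\<^sup>2 / (g u * deriv (deriv g) u) < q'"
    using order_tendstoD(2)[OF G2 q'(1)] .
  moreover have "\<forall>\<^sub>F w in at_right 0. w \<in> {0<..<ubar}" using ubar_pos by (rule eventually_at_right_real)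
  ultimately have "\<forall>\<^sub>F u in at_right 0. (deriv g u)\<^sup>2 / (g u * deriv (deriv g) u) < q' \<and> u \<in> {0<..<ubar}"
    by (rule eventually_conj)
  then obtain b where b: "b > 0" "\<And>u. 0 < u \<Longrightarrow> u < b \<Longrightarrow> (deriv g u)\<^sup>2 / (g u * deriv (deriv g) u) < q' \<and> u \<in> {0<..<ubar}"
    by (auto simp: eventually_at_right_field)
  have e: "eps u \<le> 0" if u: "0 < u" "u < b" for u
  proof -
    have p: "deriv g u > 0" "deriv (deriv g) u > 0" "g u > 0" using G1[of u] b(2)[OF u] g_pos u by auto
    have "(deriv g u)\<^sup>2 / (g u * deriv (deriv g) u) < 1" using b(2)[OF u] q' by simp
    hence "(deriv g u)\<^sup>2 < g u * deriv (deriv g) u" using p by (simp add: divide_less_eq)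
    hence "1 \<le> g u * deriv (deriv g) u / (deriv g u)\<^sup>2" using p by (simp add: le_divide_eq)
    thus ?thesis by (simp add: eps_def)
  qed
  define b' where "b' = b / 2"
  have b': "0 < b'" "b' < b" using b by (auto simp: b'_def)
  have mle: "m u \<le> m b'" if "0 < u" "u \<le> b'" for u
  proof (rule le_by_deriv[OF that(2), where h' = "\<lambda>u. - eps u * (m u)\<^sup>2"])
    fix w assume "u < w" "w < b'"
    hence "eps w \<le> 0" using that b' by (intro e) auto
    thus "0 \<le> - eps w * (m w)\<^sup>2" by (simp add: mult_nonpos_nonneg)
  qed (use that m_deriv in auto)
  obtain u where u: "0 < u" "u < b'" "N u \<le> N b' - m b' * b' - 1" using N_small[of b'] b' by metis
  have "m b' * u - N u \<le> m b' * b' - N b'"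
  proof (rule le_by_deriv[where h = "\<lambda>u. m b' * u - N u" and h' = "\<lambda>u. m b' - m u"])
    fix w assume "u \<le> w" "w \<le> b'"
    thus "((\<lambda>u. m b' * u - N u) has_real_derivative m b' - m w) (at w)"
      using N_deriv[of w] u by (auto intro!: derivative_eq_intros)
  qed (use u mle in auto)
  moreover have "0 < m b' * u" using m_pos u b' by simp
  ultimately show False using u by linarith
qed

lemma eps_tendsto: "(eps \<longlongrightarrow> 1 - 1 / q) (at_right 0)"
proof -
  have "((\<lambda>u. 1 - 1 / ((deriv g u)\<^sup>2 / (g u * deriv (deriv g) u))) \<longlongrightarrow> 1 - 1 / q) (at_right 0)"
    using q_ge_1 by (intro tendsto_intros G2) auto
  thus ?thesis by (simp add: eps_def[abs_def])
qed

text \<open>\<open>eps \<le> 1\<close> expresses convexity of \<open>g\<close>. For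
  \<open>q > 1\<close> the limit of \<open>eps\<close> is positive; for \<open>q = 1\<close> it is 0
  and the sign of \<open>eps\<close> is given by \<open>G3\<close>.\<close>

lemma eps_bounds: "\<forall>\<^sub>F u in at_right 0. 0 \<le> eps u \<and> eps u \<le> 1"
proof (intro eventually_conj)
  have ev: "\<forall>\<^sub>F w in at_right 0. w \<in> {0<..<ubar}" using ubar_pos by (rule eventually_at_right_real)
  thus "\<forall>\<^sub>F u in at_right 0. eps u \<le> 1"
  proof eventually_elim
    case (elim u)
    hence "deriv g u > 0" "deriv (deriv g) u > 0" "g u > 0" using G1[of u] g_pos[of u] by auto
    thus ?case by (simp add: eps_def)
  qed
  show "\<forall>\<^sub>F u in at_right 0. 0 \<le> eps u"
  proof (cases "q = 1")
    case True
    from G3[OF this] ev show ?thesis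
    proof eventually_elim
      case (elim u)
      hence p: "deriv g u > 0" "deriv (deriv g) u > 0" "g u > 0" using G1[of u] g_pos[of u] by auto
      hence "g u * deriv (deriv g) u \<le> (deriv g u)\<^sup>2" using elim by (simp add: le_divide_eq)
      thus ?case using p by (simp add: eps_def divide_le_eq)
    qed
  next
    case False
    hence "0 < 1 - 1 / q" using q_ge_1 by simp
    from order_tendstoD(1)[OF eps_tendsto this] show ?thesis by eventually_elim simp
  qed
qed

sublocale equilibrium \<alpha> \<beta> \<gamma> "1 - 1 / q"
  using q_ge_1 by unfold_locales auto

abbreviation "\<delta> \<equiv> 1 - 1 / q"

definition "w0 = (SOME w. 0 < w \<and> w < 1 \<and> (\<forall>u. 0 < u \<and> u \<le> w \<longrightarrow> 0 \<le> eps u \<and> eps u \<le> 1))"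

lemma w0: "0 < w0" "w0 < 1" "\<And>u. 0 < u \<Longrightarrow> u \<le> w0 \<Longrightarrow> 0 \<le> eps u \<and> eps u \<le> 1"
proof -
  obtain b where b: "b > 0" "\<And>u. 0 < u \<Longrightarrow> u < b \<Longrightarrow> 0 \<le> eps u \<and> eps u \<le> 1"
    using eps_bounds by (auto simp: eventually_at_right_field)
  have "\<exists>w. 0 < w \<and> w < 1 \<and> (\<forall>u. 0 < u \<and> u \<le> w \<longrightarrow> 0 \<le> eps u \<and> eps u \<le> 1)"
    by (rule exI[of _ "min (b / 2) (1 / 2)"]) (use b in auto)
  from someI_ex[OF this] show "0 < w0" "w0 < 1" "\<And>u. 0 < u \<Longrightarrow> u \<le> w0 \<Longrightarrow> 0 \<le> eps u \<and> eps u \<le> 1"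
    unfolding w0_def[symmetric] by auto
qed

lemma eps_close:
  assumes "\<nu> > 0"
  obtains w where "0 < w" "w \<le> w0" "\<And>u. 0 < u \<Longrightarrow> u \<le> w \<Longrightarrow> \<bar>eps u - \<delta>\<bar> \<le> \<nu>"
proof -
  have "\<forall>\<^sub>F u in at_right 0. dist (eps u) \<delta> < \<nu>" using eps_tendsto assms by (rule tendstoD)
  then obtain b where b: "b > 0" "\<And>u. 0 < u \<Longrightarrow> u < b \<Longrightarrow> dist (eps u) \<delta> < \<nu>"
    by (auto simp: eventually_at_right_field)
  show thesis using that[of "min (b / 2) w0"] b w0 by (force simp: dist_real_def)
qed

text \<open>With \<open>r = \<lambda>\<^sup>1\<^sup>/\<^sup>\<kappa> s\<close> and \<open>w = 1 - v\<close>, a solution of the problem is encoded by \<open>T = ln r\<close> and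
  \<open>y = ln (r w'(r))\<close> as functions of \<open>w \<in> (a, 1]\<close>, where \<open>a = 1 - v 0\<close>; the degenerate solution is the case
  \<open>a = 0\<close>.\<close>

definition ZZ :: "(real \<Rightarrow> real) \<Rightarrow> (real \<Rightarrow> real) \<Rightarrow> real \<Rightarrow> real" where
  "ZZ T y w = exp (\<kappa> * T w - \<beta> * y w) / f w"

definition XX :: "(real \<Rightarrow> real) \<Rightarrow> real \<Rightarrow> real" where "XX y w = exp (y w) * m w"

text \<open>The bounds on \<open>ZZ\<close> record that the flux vanishes at \<open>r = 0\<close>:
  as \<open>f\<close> is increasing, the integral of \<open>t powr (\<gamma> - 1) / f (w t)\<close>
  lies between the values obtained with \<open>f\<close> frozen at the end point and at
  \<open>a\<close>. For \<open>a > 0\<close> they force \<open>ZZ\<close> to tend to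
  \<open>\<gamma>\<close> at \<open>a\<close>. The equations hold on the open interval and are
  completed by continuity at \<open>w = 1\<close>, since the problem demands no derivatives at the
  boundary.\<close>

definition sol :: "real \<Rightarrow> (real \<Rightarrow> real) \<Rightarrow> (real \<Rightarrow> real) \<Rightarrow> bool" where
  "sol a T y \<longleftrightarrow> 0 \<le> a \<and> a < 1 \<and>
     (\<forall>w\<in>{a<..<1}. (T has_real_derivative exp (- y w)) (at w) \<and>
        (y has_real_derivative (ZZ T y w - \<sigma>) / \<beta> * exp (- y w)) (at w)) \<and>
     continuous_on {a<..1} T \<and> continuous_on {a<..1} y \<and>
     (\<forall>w\<in>{a<..1}. ZZ T y w \<le> \<gamma> \<and> \<gamma> * f a \<le> ZZ T y w * f w) \<and>
     filterlim T at_bot (at_right a)"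

lemma solD:
  assumes "sol a T y"
  shows "0 \<le> a" "a < 1" "\<And>w. a < w \<Longrightarrow> w < 1 \<Longrightarrow> (T has_real_derivative exp (- y w)) (at w)"
    "\<And>w. a < w \<Longrightarrow> w < 1 \<Longrightarrow> (y has_real_derivative (ZZ T y w - \<sigma>) / \<beta> * exp (- y w)) (at w)"
    "continuous_on {a<..1} T" "continuous_on {a<..1} y"
    "\<And>w. a < w \<Longrightarrow> w \<le> 1 \<Longrightarrow> ZZ T y w \<le> \<gamma>" "\<And>w. a < w \<Longrightarrow> w \<le> 1 \<Longrightarrow> \<gamma> * f a \<le> ZZ T y w * f w"
    "filterlim T at_bot (at_right a)"
  using assms unfolding sol_def by auto

lemma ZZ_pos: "w > 0 \<Longrightarrow> ZZ T y w > 0" using f_pos[of w] by (simp add: ZZ_def)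
lemma XX_pos: "w > 0 \<Longrightarrow> XX y w > 0" using m_pos[of w] by (simp add: XX_def)

lemma ln_XX: "w > 0 \<Longrightarrow> ln (XX y w) = y w + ln (m w)" using m_pos[of w] by (simp add: XX_def ln_mult)
lemma ln_ZZ: "w > 0 \<Longrightarrow> ln (ZZ T y w) = \<kappa> * T w - \<beta> * y w - ln (f w)" using f_pos[of w] by (simp add: ZZ_def ln_div)

text \<open>The factor \<open>exp (- y w)\<close> equals \<open>m w / XX y w\<close>, which turns
  derivatives in \<open>w\<close> into rates per unit of \<open>N\<close>; the identity
  \<open>\<kappa> + \<sigma> = \<gamma>\<close> closes the equation for \<open>ZZ\<close>.\<close>

lemma sol_LV_at:
  assumes sol: "sol a T y" and w: "a < w" "w \<le> w0"
  shows "LV N m eps (XX y) (ZZ T y) {w}"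
proof -
  have w': "0 < w" "w < 1" using solD(1)[OF sol] w w0 by auto
  note d = solD(3,4)[OF sol w(1) w'(2)]
  have "(XX y has_real_derivative m w * ((ZZ T y w - \<sigma>) / \<beta> - eps w * XX y w)) (at w)"
  proof -
    have "((\<lambda>w. exp (y w) * m w) has_real_derivative exp (y w) * ((ZZ T y w - \<sigma>) / \<beta> * exp (- y w)) * m w + exp (y w) * (- eps w * (m w)\<^sup>2)) (at w)"
      by (rule d m_deriv[OF w'(1)] derivative_eq_intros refl)+ (simp add: algebra_simps)
    moreover have "exp (y w) * ((ZZ T y w - \<sigma>) / \<beta> * exp (- y w)) * m w + exp (y w) * (- eps w * (m w)\<^sup>2)
       = m w * ((ZZ T y w - \<sigma>) / \<beta> * (exp (y w) * exp (- y w)) - eps w * XX y w)"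
      by (simp add: XX_def algebra_simps power2_eq_square)
    ultimately show ?thesis by (simp add: XX_def[abs_def] flip: exp_add)
  qed
  moreover have "(ZZ T y has_real_derivative m w * (ZZ T y w * (\<gamma> - \<beta> * XX y w - ZZ T y w) / XX y w)) (at w)"
  proof -
    have f': "deriv f w = \<beta> * f w * m w" using f_pos[OF w'(1)] par_facts by (simp add: m_def)
    have "((\<lambda>w. exp (\<kappa> * T w - \<beta> * y w) / f w) has_real_derivative
       (exp (\<kappa> * T w - \<beta> * y w) * (\<kappa> * exp (- y w) - \<beta> * ((ZZ T y w - \<sigma>) / \<beta> * exp (- y w))) * f w
        - exp (\<kappa> * T w - \<beta> * y w) * deriv f w) / (f w * f w)) (at w)"
      by (rule d f_deriv[OF w'(1)] derivative_eq_intros refl)+ (use f_pos[OF w'(1)] in \<open>auto simp: algebra_simps\<close>)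
    moreover have "(exp (\<kappa> * T w - \<beta> * y w) * (\<kappa> * exp (- y w) - \<beta> * ((ZZ T y w - \<sigma>) / \<beta> * exp (- y w))) * f w
        - exp (\<kappa> * T w - \<beta> * y w) * deriv f w) / (f w * f w)
       = ZZ T y w * ((\<kappa> + \<sigma> - ZZ T y w) * exp (- y w) - \<beta> * m w)"
      unfolding f' using f_pos[OF w'(1)] par_facts(1) by (simp add: ZZ_def field_simps)
    moreover have "exp (- y w) = m w / XX y w" using m_pos[OF w'(1)] by (simp add: XX_def exp_minus field_simps)
    ultimately have "(ZZ T y has_real_derivative ZZ T y w * ((\<kappa> + \<sigma> - ZZ T y w) * (m w / XX y w) - \<beta> * m w)) (at w)"
      by (simp add: ZZ_def[abs_def])
    moreover have "ZZ T y w * ((\<kappa> + \<sigma> - ZZ T y w) * (m w / XX y w) - \<beta> * m w) = m w * (ZZ T y w * (\<gamma> - \<beta> * XX y w - ZZ T y w) / XX y w)"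
      unfolding par_facts(6) using XX_pos[OF w'(1), of y] by (simp add: field_simps)
    ultimately show ?thesis by simp
  qed
  ultimately show ?thesis
    using m_pos[OF w'(1)] N_deriv[OF w'(1)] XX_pos[OF w'(1)] ZZ_pos[OF w'(1)] solD(7)[OF sol w(1)] w' w0(3)[OF w'(1) w(2)]
    by (simp add: LV_def)
qed

lemma sol_LV: "sol a T y \<Longrightarrow> a < s \<Longrightarrow> t \<le> w0 \<Longrightarrow> LV N m eps (XX y) (ZZ T y) {s..t}"
  using sol_LV_at[of a T y] unfolding LV_def by auto

text \<open>For \<open>a > 0\<close>, the lower bound on \<open>ZZ\<close> keeps it near
  \<open>\<gamma>\<close> close to \<open>a\<close>, while \<open>T\<close> goes to minus infinity
  and drags \<open>y\<close> along, so that \<open>XX\<close> is small. For \<open>a = 0\<close> the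
  past is infinite in \<open>N\<close>: if \<open>XX > M0\<close> held throughout,
  \<open>ln ZZ\<close> would grow without bound backwards, and if \<open>ZZ < \<sigma> / 2\<close>
  held throughout, \<open>XX\<close> would.\<close>

lemma sol_entry:
  assumes sol: "sol a T y" and b: "a < b" "b \<le> w0"
  obtains s where "a < s" "s < b" "\<sigma> / 2 \<le> ZZ T y s" "\<And>w. w \<in> {s..w0} \<Longrightarrow> XX y w \<le> M1"
proof (cases "a = 0")
  case False
  hence a: "a > 0" using solD(1)[OF sol] by simp
  have fa: "\<gamma> * f a > 0" using f_pos[OF a] par_facts by simp
  \<comment> \<open>The level of \<open>T\<close> below which
    \<open>\<beta> * y \<le> \<kappa> * T - ln (\<gamma> * f a)\<close> implies
    \<open>XX \<le> M0\<close>; \<open>m a + 1\<close> is a bound for \<open>m\<close> near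
    \<open>a\<close>.\<close>
  define Tb where "Tb = (\<beta> * (ln M0 - ln (m a + 1)) + ln (\<gamma> * f a)) / \<kappa>"
  have "isCont m a" using m_deriv[OF a] DERIV_isCont by blast
  hence "(m \<longlongrightarrow> m a) (at_right a)" by (simp add: isCont_def filterlim_at_split)
  hence e1: "\<forall>\<^sub>F s in at_right a. m s < m a + 1" by (rule order_tendstoD) simp
  have "(f \<longlongrightarrow> f a) (at_right a)" using f_isCont[OF a] by (simp add: isCont_def filterlim_at_split)
  hence e2: "\<forall>\<^sub>F s in at_right a. f s < 2 * f a" using f_pos[OF a] by (intro order_tendstoD(2)) auto
  have e3: "\<forall>\<^sub>F s in at_right a. T s \<le> Tb" using solD(9)[OF sol] by (auto simp: filterlim_at_bot)
  have e4: "\<forall>\<^sub>F s in at_right a. s \<in> {a<..<b}" using b by (intro eventually_at_right_real)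
  from e1 e2 e3 e4 have "\<forall>\<^sub>F s in at_right a. m s < m a + 1 \<and> f s < 2 * f a \<and> T s \<le> Tb \<and> s \<in> {a<..<b}"
    by eventually_elim auto
  from eventually_happens[OF this] obtain s where s: "m s < m a + 1" "f s < 2 * f a" "T s \<le> Tb" "a < s" "s < b"
    by (auto simp: trivial_limit_at_right_real)
  have s0: "s > 0" "s \<le> 1" "s \<le> w0" using s a b w0 by auto
  have Zf: "\<gamma> * f a \<le> ZZ T y s * f s" using solD(8)[OF sol s(4) s0(2)] .
  have "\<gamma> * f a \<le> ZZ T y s * (2 * f a)"
    using Zf mult_left_mono[of "f s" "2 * f a" "ZZ T y s"] s ZZ_pos[OF s0(1), of T y] by linarith
  hence "\<gamma> / 2 \<le> ZZ T y s" using f_pos[OF a] by (simp add: field_simps)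
  hence Z: "\<sigma> / 2 \<le> ZZ T y s" using par_facts by linarith
  have "ln (\<gamma> * f a) \<le> ln (ZZ T y s * f s)" using Zf fa by simp
  also have "\<dots> = \<kappa> * T s - \<beta> * y s" using f_pos[OF s0(1)] by (simp add: ZZ_def)
  finally have "\<beta> * y s \<le> \<kappa> * T s - ln (\<gamma> * f a)" by simp
  also have "\<kappa> * T s \<le> \<kappa> * Tb" using s par_facts by simp
  also have "\<kappa> * Tb = \<beta> * (ln M0 - ln (m a + 1)) + ln (\<gamma> * f a)" using par_facts by (simp add: Tb_def)
  finally have "\<beta> * y s \<le> \<beta> * (ln M0 - ln (m a + 1))" by simp
  hence "y s \<le> ln M0 - ln (m a + 1)" using par_facts by simp
  moreover have "ln (m s) \<le> ln (m a + 1)" using s m_pos[OF s0(1)] m_pos[OF a] by simp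
  ultimately have "ln (XX y s) \<le> ln M0" by (simp add: ln_XX s0)
  hence X: "XX y s \<le> M0" using XX_pos[OF s0(1)] M_facts by simp
  have "XX y w \<le> M1" if "w \<in> {s..w0}" for w
    using that X s by (intro X_upper[OF sol_LV[OF sol, of s w]]) auto
  with that[OF s(4,5) Z] show thesis .
next
  case a: True
  have LV: "LV N m eps (XX y) (ZZ T y) {s..t}" if "0 < s" "t \<le> w0" for s t
    using sol_LV[OF sol, of s t] that a by simp
  have LV1: "LV N m eps (XX y) (ZZ T y) {s}" if "0 < s" "s \<le> w0" for s
    using LV[of s s] that by simp
  have c1: "\<exists>s. 0 < s \<and> s < b \<and> XX y s \<le> M0" if b: "0 < b" "b \<le> w0" for b
  proof (rule ccontr)
    assume "\<not> ?thesis"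
    hence gt: "\<And>s. 0 < s \<Longrightarrow> s < b \<Longrightarrow> M0 < XX y s" by force
    define b' where "b' = b / 2"
    have b': "0 < b'" "b' < b" using b by (auto simp: b'_def)
    obtain s where s: "0 < s" "s < b'" "N s \<le> N b' - (2 / \<beta>) * (ln \<gamma> - ln (ZZ T y b') + 1)"
      using N_small[OF b'(1)] by metis
    have "ln (ZZ T y b') + \<beta> / 2 * N b' \<le> ln (ZZ T y s) + \<beta> / 2 * N s"
    proof (rule ge_by_deriv[where h = "\<lambda>w. ln (ZZ T y w) + \<beta> / 2 * N w" and
          h' = "\<lambda>w. m w * ((\<gamma> - ZZ T y w) / XX y w - \<beta>) + \<beta> / 2 * m w"])
      fix w assume w: "s \<le> w" "w \<le> b'"
      hence w': "0 < w" "w \<le> w0" using s b b' by auto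
      show "((\<lambda>w. ln (ZZ T y w) + \<beta> / 2 * N w) has_real_derivative
        m w * ((\<gamma> - ZZ T y w) / XX y w - \<beta>) + \<beta> / 2 * m w) (at w)"
        by (intro DERIV_add LV_log_deriv(2)[OF LV1[OF w']] DERIV_cmult N_deriv w')
    next
      fix w assume w: "s < w" "w < b'"
      hence w': "0 < w" "w \<le> w0" "w < b" using s b b' by auto
      have "\<gamma> - ZZ T y w \<le> \<beta> * M0 / 2" using ZZ_pos[OF w'(1)] par_facts by (simp add: M0_def less_imp_le)
      also have "\<dots> \<le> \<beta> * XX y w / 2" using gt[OF w'(1,3)] par_facts by simp
      finally have "(\<gamma> - ZZ T y w) / XX y w \<le> \<beta> / 2" using XX_pos[OF w'(1)] by (simp add: divide_le_eq mult.commute)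
      hence "m w * ((\<gamma> - ZZ T y w) / XX y w - \<beta> + \<beta> / 2) \<le> 0"
        using m_pos[OF w'(1)] by (simp add: mult_le_0_iff)
      thus "m w * ((\<gamma> - ZZ T y w) / XX y w - \<beta>) + \<beta> / 2 * m w \<le> 0" by (simp add: algebra_simps)
    qed (use s in auto)
    moreover have "ln (ZZ T y s) \<le> ln \<gamma>" using LV1[of s] s b b' par_facts by (auto simp: LV_def)
    moreover have "\<beta> / 2 * N s \<le> \<beta> / 2 * N b' - (ln \<gamma> - ln (ZZ T y b') + 1)"
    proof -
      have "\<beta> / 2 * ((2 / \<beta>) * A) = A" for A using par_facts by simp
      thus ?thesis using mult_left_mono[OF s(3), of "\<beta> / 2"] par_facts(1) by (simp only: right_diff_distrib)
    qed
    ultimately show False by linarith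
  qed
  have XM: "XX y w \<le> M1" if w: "0 < w" "w \<le> w0" for w
  proof -
    obtain s where "0 < s" "s < w" "XX y s \<le> M0" using c1[OF w] by blast
    thus ?thesis using w by (intro X_upper[OF LV[of s w]]) auto
  qed
  have "\<exists>s. 0 < s \<and> s < b \<and> \<sigma> / 2 \<le> ZZ T y s"
  proof (rule ccontr)
    assume "\<not> ?thesis"
    hence lt: "\<And>s. 0 < s \<Longrightarrow> s < b \<Longrightarrow> ZZ T y s < \<sigma> / 2" by force
    define b' where "b' = b / 2"
    have b': "0 < b'" "b' < b" using b a by (auto simp: b'_def)
    define c where "c = \<sigma> / 2 / \<beta>"
    have c: "c > 0" using par_facts by (simp add: c_def)
    obtain s where s: "0 < s" "s < b'" "N s \<le> N b' - (M1 + 1) / c"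
      using N_small[OF b'(1)] by metis
    have "XX y b' + c * N b' \<le> XX y s + c * N s"
    proof (rule ge_by_deriv[where h = "\<lambda>w. XX y w + c * N w" and
          h' = "\<lambda>w. m w * ((ZZ T y w - \<sigma>) / \<beta> - eps w * XX y w) + c * m w"])
      fix w assume w: "s \<le> w" "w \<le> b'"
      hence w': "0 < w" "w \<le> w0" using s b b' by auto
      have X': "(XX y has_real_derivative m w * ((ZZ T y w - \<sigma>) / \<beta> - eps w * XX y w)) (at w)"
        using LV1[OF w'] by (simp add: LV_def)
      show "((\<lambda>w. XX y w + c * N w) has_real_derivative
        m w * ((ZZ T y w - \<sigma>) / \<beta> - eps w * XX y w) + c * m w) (at w)"
        by (intro DERIV_add DERIV_cmult N_deriv w' X')
    next
      fix w assume w: "s < w" "w < b'"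
      hence w': "0 < w" "w \<le> w0" "w < b" using s b b' by auto
      have "(ZZ T y w - \<sigma>) / \<beta> \<le> (- (\<sigma> / 2)) / \<beta>"
        using lt[OF w'(1,3)] par_facts by (intro divide_right_mono) auto
      moreover have "0 \<le> eps w * XX y w" using w0(3)[OF w'(1,2)] XX_pos[OF w'(1)] by (simp add: less_imp_le)
      ultimately have "(ZZ T y w - \<sigma>) / \<beta> - eps w * XX y w + c \<le> 0" by (simp add: c_def)
      hence "m w * ((ZZ T y w - \<sigma>) / \<beta> - eps w * XX y w + c) \<le> 0"
        using m_pos[OF w'(1)] by (simp add: mult_le_0_iff)
      thus "m w * ((ZZ T y w - \<sigma>) / \<beta> - eps w * XX y w) + c * m w \<le> 0" by (simp add: algebra_simps)
    qed (use s in auto)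
    moreover have "XX y s \<le> M1" using XM[of s] s b b' by auto
    moreover have "0 < XX y b'" using XX_pos[OF b'(1)] .
    moreover have "c * N s \<le> c * N b' - (M1 + 1)"
      using mult_left_mono[OF s(3), of c] c by (simp add: right_diff_distrib)
    ultimately show False by linarith
  qed
  thus thesis using that XM a by (metis atLeastAtMost_iff less_le_trans)
qed

text \<open>\<open>S\<close> and \<open>w1\<close> serve all solutions at once. A regular solution
  must be older than \<open>S\<close>; if \<open>a = 0\<close>, any amount of time has passed before
  \<open>t\<close>.\<close>

lemma sol_near:
  assumes "\<rho> > 0"
  obtains S w1 where "S > 0" "0 < w1" "w1 \<le> w0"
    "\<And>a T y t. sol a T y \<Longrightarrow> a < t \<Longrightarrow> t \<le> w1 \<Longrightarrow> a = 0 \<or> S < N t - N a \<Longrightarrow> near \<rho> (XX y t) (ZZ T y t)"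
proof -
  obtain r where r: "r > 0" "\<And>x z. \<bar>x - X0\<bar> < r \<Longrightarrow> \<bar>z - Z0\<bar> < r \<Longrightarrow> near \<rho> x z"
    using near_if_close[OF assms] by blast
  obtain S \<nu> where S: "S > 0" "\<nu> > 0" "\<And>N m e X Z s t. s \<le> t \<Longrightarrow> LV N m e X Z {s..t} \<Longrightarrow>
     (\<And>w. w \<in> {s..t} \<Longrightarrow> X w \<le> M1) \<Longrightarrow> \<sigma> / 2 \<le> Z s \<Longrightarrow> (\<And>w. w \<in> {s..t} \<Longrightarrow> \<bar>e w - \<delta>\<bar> \<le> \<nu>) \<Longrightarrow>
     S \<le> N t - N s \<Longrightarrow> \<bar>X t - X0\<bar> < r \<and> \<bar>Z t - Z0\<bar> < r"
    using attraction[OF r(1)] by blast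
  obtain w1 where w1: "0 < w1" "w1 \<le> w0" "\<And>u. 0 < u \<Longrightarrow> u \<le> w1 \<Longrightarrow> \<bar>eps u - \<delta>\<bar> \<le> \<nu>"
    using eps_close[OF S(2)] by blast
  show thesis
  proof (rule that[OF S(1) w1(1,2)])
    fix a T y t assume sol: "sol a T y" and t: "a < t" "t \<le> w1" and alt: "a = 0 \<or> S < N t - N a"
    have a0: "0 \<le> a" using solD(1)[OF sol] .
    \<comment> \<open>\<open>sol_entry\<close> provides entry times below any bound greater than
      \<open>a\<close>; this \<open>b\<close> leaves at least the time \<open>S\<close> between them
      and \<open>t\<close>.\<close>
    have "\<exists>b. a < b \<and> b \<le> t \<and> (\<forall>s. a < s \<and> s < b \<longrightarrow> S \<le> N t - N s)"
    proof (cases "a = 0")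
      case True
      obtain b where b: "0 < b" "b < t" "N b \<le> N t - S" using N_small[of t] t a0 True by metis
      have "S \<le> N t - N s" if "0 < s" "s < b" for s using N_less[OF that] b by linarith
      thus ?thesis using b True by (intro exI[of _ b]) auto
    next
      case False
      hence a: "a > 0" using a0 by simp
      have "(N \<longlongrightarrow> N a) (at_right a)"
        using DERIV_isCont[OF N_deriv[OF a]] by (simp add: isCont_def filterlim_at_split)
      moreover have "N a < N t - S" using alt a by auto
      ultimately have "\<forall>\<^sub>F s in at_right a. N s < N t - S" by (rule order_tendstoD)
      then obtain b where b: "b > a" "\<And>s. a < s \<Longrightarrow> s < b \<Longrightarrow> N s < N t - S"
        by (auto simp: eventually_at_right_field)
      have "\<forall>s. a < s \<and> s < min b t \<longrightarrow> S \<le> N t - N s"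
      proof (intro allI impI)
        fix s assume "a < s \<and> s < min b t"
        hence "N s < N t - S" by (intro b(2)) auto
        thus "S \<le> N t - N s" by linarith
      qed
      thus ?thesis using b t by (intro exI[of _ "min b t"]) auto
    qed
    then obtain b where b: "a < b" "b \<le> t" "\<And>s. a < s \<Longrightarrow> s < b \<Longrightarrow> S \<le> N t - N s" by blast
    obtain s where s: "a < s" "s < b" "\<sigma> / 2 \<le> ZZ T y s" "\<And>w. w \<in> {s..w0} \<Longrightarrow> XX y w \<le> M1"
      using sol_entry[OF sol b(1)] b t w1 by auto
    have "\<bar>XX y t - X0\<bar> < r \<and> \<bar>ZZ T y t - Z0\<bar> < r"
    proof (rule S(3)[where N = N and m = m and e = eps and X = "XX y" and Z = "ZZ T y" and s = s and t = t])
      show "LV N m eps (XX y) (ZZ T y) {s..t}" using s t w1 by (intro sol_LV[OF sol]) auto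
      show "\<bar>eps w - \<delta>\<bar> \<le> \<nu>" if "w \<in> {s..t}" for w using that s t a0 by (intro w1(3)) auto
      show "XX y w \<le> M1" if "w \<in> {s..t}" for w using that t w1 by (intro s(4)) auto
    qed (use s b in auto)
    thus "near \<rho> (XX y t) (ZZ T y t)" using r(2) by blast
  qed
qed

lemma ZZ_diff: "w > 0 \<Longrightarrow> ln (ZZ T1 y1 w) - ln (ZZ T2 y2 w) = \<kappa> * (T1 w - T2 w) - \<beta> * (y1 w - y2 w)"
  by (simp add: ln_ZZ algebra_simps)

lemma XX_diff: "w > 0 \<Longrightarrow> ln (XX y1 w) - ln (XX y2 w) = y1 w - y2 w"
  by (simp add: ln_XX)

text \<open>Before \<open>w\<close> a point \<open>s\<close> is inserted such that the contraction
  acts for the time \<open>L\<close> from \<open>s\<close> to \<open>w\<close>, and before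
  \<open>s\<close> a point \<open>a0\<close> such that the attraction has the time \<open>S\<close>
  from \<open>a0\<close> to \<open>s\<close>. All solutions starting below \<open>a0\<close>,
  degenerate ones included, are therefore close to one another at \<open>w\<close>.\<close>

lemma sol_diff_small:
  obtains w1 \<rho> where "0 < w1" "w1 \<le> w0" "\<rho> > 0" "\<And>w \<eta>. 0 < w \<Longrightarrow> w \<le> w1 \<Longrightarrow> \<eta> > 0 \<Longrightarrow>
     \<exists>a0. 0 < a0 \<and> a0 < w \<and> (\<forall>a T1 y1. sol a T1 y1 \<and> a < a0 \<longrightarrow> near \<rho> (XX y1 w) (ZZ T1 y1 w) \<and>
        (\<forall>b T2 y2. sol b T2 y2 \<and> b < a0 \<longrightarrow> \<bar>T1 w - T2 w\<bar> \<le> \<eta> \<and> \<bar>y1 w - y2 w\<bar> \<le> \<eta>))"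
proof -
  obtain \<rho> c C where con: "\<rho> > 0" "c > 0" "C > 0" "\<And>N m e X1 Z1 X2 Z2 s t. s \<le> t \<Longrightarrow> LV N m e X1 Z1 {s..t} \<Longrightarrow> LV N m e X2 Z2 {s..t} \<Longrightarrow>
     (\<And>w. w \<in> {s..t} \<Longrightarrow> near \<rho> (X1 w) (Z1 w)) \<Longrightarrow> (\<And>w. w \<in> {s..t} \<Longrightarrow> near \<rho> (X2 w) (Z2 w)) \<Longrightarrow>
     (ln (X1 t) - ln (X2 t))\<^sup>2 + (ln (Z1 t) - ln (Z2 t))\<^sup>2 \<le> C * exp (- c * (N t - N s))"
    using contraction by blast
  obtain S w1 where S: "S > 0" "0 < w1" "w1 \<le> w0"
    "\<And>a T y t. sol a T y \<Longrightarrow> a < t \<Longrightarrow> t \<le> w1 \<Longrightarrow> a = 0 \<or> S < N t - N a \<Longrightarrow> near \<rho> (XX y t) (ZZ T y t)"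
    using sol_near[OF con(1)] by blast
  show thesis
  proof (rule that[OF S(2,3) con(1)])
    fix w \<eta> :: real assume w: "0 < w" "w \<le> w1" and \<eta>: "\<eta> > 0"
    \<comment> \<open>The contraction controls \<open>y1 - y2\<close> and
      \<open>\<kappa> * (T1 - T2) - \<beta> * (y1 - y2)\<close> by \<open>\<eta>'\<close>, hence
      \<open>T1 - T2\<close> by \<open>(1 + \<beta>) * \<eta>' / \<kappa>\<close>, which is at most
      \<open>\<eta>\<close> because \<open>\<kappa> > \<beta> \<ge> 1\<close>.\<close>
    define \<eta>' where "\<eta>' = \<eta> / (1 + \<beta>)"
    have \<eta>': "0 < \<eta>'" "\<eta>' \<le> \<eta>" using \<eta> par_facts by (auto simp: \<eta>'_def field_simps)
    have "((1 + \<beta>) * \<eta>') / \<kappa> \<le> \<eta>"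
    proof -
      have "(1 + \<beta>) * \<eta>' = \<eta>" using par_facts by (simp add: \<eta>'_def)
      moreover have "\<eta> * 1 \<le> \<eta> * \<kappa>" using \<eta> par_facts params by (intro mult_left_mono) auto
      ultimately show ?thesis using par_facts by (simp add: divide_le_eq)
    qed
    note \<eta>'2 = this
    define L where "L = \<bar>ln (\<eta>'\<^sup>2 / C)\<bar> / c"
    have L: "0 \<le> L" "C * exp (- c * L) \<le> \<eta>'\<^sup>2"
    proof -
      show "0 \<le> L" using con by (simp add: L_def)
      have q: "\<eta>'\<^sup>2 / C > 0" using con \<eta>' by simp
      have "exp (- c * L) \<le> exp (ln (\<eta>'\<^sup>2 / C))" using con by (simp only: L_def exp_le_cancel_iff) simp
      also have "\<dots> = \<eta>'\<^sup>2 / C" using q by simp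
      finally show "C * exp (- c * L) \<le> \<eta>'\<^sup>2" using con by (simp add: pos_le_divide_eq mult.commute)
    qed
    obtain s where s: "0 < s" "s < w" "N s \<le> N w - L" using N_small[OF w(1)] by metis
    obtain a0 where a0: "0 < a0" "a0 < s" "N a0 \<le> N s - S" using N_small[OF s(1)] by metis
    have near: "near \<rho> (XX y u) (ZZ T y u)" if sol: "sol a T y" "a < a0" and u: "u \<in> {s..w}" for a T y u
    proof (rule S(4)[OF sol(1)])
      show "a < u" "u \<le> w1" using that a0 w by auto
      show "a = 0 \<or> S < N u - N a"
      proof (cases "a = 0")
        case False
        hence "N a < N a0" using sol solD(1)[OF sol(1)] by (intro N_less) auto
        moreover have "N s \<le> N u" using u s N_less[of s u] by (cases "s = u") auto
        ultimately show ?thesis using a0 by linarith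
      qed simp
    qed
    have fin: "\<bar>T1 w - T2 w\<bar> \<le> \<eta> \<and> \<bar>y1 w - y2 w\<bar> \<le> \<eta>"
      if s1: "sol a T1 y1" "a < a0" and s2: "sol b T2 y2" "b < a0" for a T1 y1 b T2 y2
    proof -
      have "(ln (XX y1 w) - ln (XX y2 w))\<^sup>2 + (ln (ZZ T1 y1 w) - ln (ZZ T2 y2 w))\<^sup>2 \<le> C * exp (- c * (N w - N s))"
        using s w a0 S s1 s2 by (intro con(4)[of s w N m eps] sol_LV[OF s1(1)] sol_LV[OF s2(1)] near[OF s1] near[OF s2]) auto
      also have "\<dots> \<le> C * exp (- c * L)"
      proof -
        have "c * L \<le> c * (N w - N s)" using s con by (intro mult_left_mono) auto
        thus ?thesis using con by simp
      qed
      also have "\<dots> \<le> \<eta>'\<^sup>2" by (rule L(2))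
      finally have "(y1 w - y2 w)\<^sup>2 + (\<kappa> * (T1 w - T2 w) - \<beta> * (y1 w - y2 w))\<^sup>2 \<le> \<eta>'\<^sup>2"
        by (simp add: XX_diff ZZ_diff w)
      hence "(y1 w - y2 w)\<^sup>2 \<le> \<eta>'\<^sup>2" "(\<kappa> * (T1 w - T2 w) - \<beta> * (y1 w - y2 w))\<^sup>2 \<le> \<eta>'\<^sup>2"
        by (smt (verit) zero_le_power2)+
      hence d: "\<bar>y1 w - y2 w\<bar> \<le> \<eta>'" "\<bar>\<kappa> * (T1 w - T2 w) - \<beta> * (y1 w - y2 w)\<bar> \<le> \<eta>'"
        using \<eta>' by (simp_all add: abs_le_square_iff[symmetric])
      have "\<bar>\<beta> * (y1 w - y2 w)\<bar> \<le> \<beta> * \<eta>'" using d(1) par_facts by (simp add: abs_mult)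
      hence "\<bar>\<kappa> * (T1 w - T2 w)\<bar> \<le> (1 + \<beta>) * \<eta>'" using d(2) by (simp add: distrib_right)
      hence "\<bar>T1 w - T2 w\<bar> \<le> ((1 + \<beta>) * \<eta>') / \<kappa>" using par_facts by (simp add: abs_mult pos_le_divide_eq mult.commute)
      thus ?thesis using d(1) \<eta>' \<eta>'2 by linarith
    qed
    show "\<exists>a0. 0 < a0 \<and> a0 < w \<and> (\<forall>a T1 y1. sol a T1 y1 \<and> a < a0 \<longrightarrow> near \<rho> (XX y1 w) (ZZ T1 y1 w) \<and>
        (\<forall>b T2 y2. sol b T2 y2 \<and> b < a0 \<longrightarrow> \<bar>T1 w - T2 w\<bar> \<le> \<eta> \<and> \<bar>y1 w - y2 w\<bar> \<le> \<eta>))"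
      using a0 s fin near[of _ _ _ w] by (intro exI[of _ a0]) auto
  qed
qed

section \<open>Estimates away from \<open>w = 0\<close>, up to \<open>w = 1\<close>\<close>

definition "Lf B l = exp ((\<kappa> + \<beta> + 1) * B) * (\<kappa> + \<beta> + 1) / f l + (\<sigma> + 1) * exp B"

definition rhs :: "(real \<Rightarrow> real) \<Rightarrow> (real \<Rightarrow> real) \<Rightarrow> real \<Rightarrow> real" where
  "rhs T y w = (ZZ T y w - \<sigma>) / \<beta> * exp (- y w)"

text \<open>\<open>Lf\<close> adds up the Lipschitz constants of the two components of the vector
  field, with \<open>f w\<close> bounded below by \<open>f l\<close>, so that one constant serves
  both equations.\<close>

lemma rhs_Lipschitz:
  assumes l: "0 < l" and w: "l \<le> w" and b: "\<bar>T1 w\<bar> \<le> B \<and> \<bar>y1 w\<bar> \<le> B" "\<bar>T2 w\<bar> \<le> B \<and> \<bar>y2 w\<bar> \<le> B"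
  shows "\<bar>exp (- y1 w) - exp (- y2 w)\<bar> \<le> Lf B l * (\<bar>T1 w - T2 w\<bar> + \<bar>y1 w - y2 w\<bar>)"
    "\<bar>rhs T1 y1 w - rhs T2 y2 w\<bar> \<le> Lf B l * (\<bar>T1 w - T2 w\<bar> + \<bar>y1 w - y2 w\<bar>)"
proof -
    have w0: "w > 0" using l w by simp
    let ?S = "\<bar>T1 w - T2 w\<bar> + \<bar>y1 w - y2 w\<bar>"
    have e1: "\<bar>exp (- y1 w) - exp (- y2 w)\<bar> \<le> exp B * \<bar>y1 w - y2 w\<bar>"
    proof -
      have "- y1 w \<le> B" "- y2 w \<le> B" using b by auto
      thus ?thesis using exp_Lipschitz[of "- y1 w" B "- y2 w"] by (simp add: abs_minus_commute)
    qed
    have e2: "\<bar>exp (\<kappa> * T1 w - (\<beta> + 1) * y1 w) - exp (\<kappa> * T2 w - (\<beta> + 1) * y2 w)\<bar> \<le> exp ((\<kappa> + \<beta> + 1) * B) * ((\<kappa> + \<beta> + 1) * ?S)"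
    proof -
      have up: "\<kappa> * T - (\<beta> + 1) * y \<le> (\<kappa> + \<beta> + 1) * B" if "\<bar>T\<bar> \<le> B" "\<bar>y\<bar> \<le> B" for T y
      proof -
        have "T \<le> B" "- y \<le> B" using that by auto
        hence "\<kappa> * T \<le> \<kappa> * B" "(\<beta> + 1) * (- y) \<le> (\<beta> + 1) * B" using par_facts by (simp_all only: mult_left_mono)
        thus ?thesis by (simp add: algebra_simps)
      qed
      have "\<bar>exp (\<kappa> * T1 w - (\<beta> + 1) * y1 w) - exp (\<kappa> * T2 w - (\<beta> + 1) * y2 w)\<bar>
         \<le> exp ((\<kappa> + \<beta> + 1) * B) * \<bar>(\<kappa> * T1 w - (\<beta> + 1) * y1 w) - (\<kappa> * T2 w - (\<beta> + 1) * y2 w)\<bar>"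
        using up b by (intro exp_Lipschitz) auto
      also have "\<bar>(\<kappa> * T1 w - (\<beta> + 1) * y1 w) - (\<kappa> * T2 w - (\<beta> + 1) * y2 w)\<bar> \<le> (\<kappa> + \<beta> + 1) * ?S"
      proof -
        have "(\<kappa> * T1 w - (\<beta> + 1) * y1 w) - (\<kappa> * T2 w - (\<beta> + 1) * y2 w) = \<kappa> * (T1 w - T2 w) - (\<beta> + 1) * (y1 w - y2 w)"
          by (simp add: algebra_simps)
        also have "\<bar>\<dots>\<bar> \<le> \<kappa> * \<bar>T1 w - T2 w\<bar> + (\<beta> + 1) * \<bar>y1 w - y2 w\<bar>"
          using abs_triangle_ineq4[of "\<kappa> * (T1 w - T2 w)" "(\<beta> + 1) * (y1 w - y2 w)"] par_facts by (simp add: abs_mult)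
        also have "\<dots> \<le> (\<kappa> + \<beta> + 1) * \<bar>T1 w - T2 w\<bar> + (\<kappa> + \<beta> + 1) * \<bar>y1 w - y2 w\<bar>"
          using par_facts by (intro add_mono mult_right_mono) auto
        finally show ?thesis by (simp add: distrib_left)
      qed
      finally show ?thesis by simp
    qed
    have Feq: "rhs T y w = (exp (\<kappa> * T w - (\<beta> + 1) * y w) / f w - \<sigma> * exp (- y w)) / \<beta>" for T y
    proof -
      have "exp (\<kappa> * T w - (\<beta> + 1) * y w) = exp (\<kappa> * T w - \<beta> * y w) * exp (- y w)" by (simp add: algebra_simps flip: exp_add)
      thus ?thesis using f_pos[OF w0] par_facts(1) by (simp add: rhs_def ZZ_def field_simps)
    qed
    have e3: "\<bar>rhs T1 y1 w - rhs T2 y2 w\<bar> \<le> exp ((\<kappa> + \<beta> + 1) * B) * ((\<kappa> + \<beta> + 1) * ?S) / f l + \<sigma> * (exp B * ?S)"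
    proof -
      let ?E = "exp (\<kappa> * T1 w - (\<beta> + 1) * y1 w) - exp (\<kappa> * T2 w - (\<beta> + 1) * y2 w)"
      have "rhs T1 y1 w - rhs T2 y2 w = (?E / f w - \<sigma> * (exp (- y1 w) - exp (- y2 w))) / \<beta>"
        unfolding Feq by (simp add: diff_divide_distrib add_divide_distrib algebra_simps)
      hence "\<bar>rhs T1 y1 w - rhs T2 y2 w\<bar> = \<bar>?E / f w - \<sigma> * (exp (- y1 w) - exp (- y2 w))\<bar> / \<beta>" using par_facts by simp
      also have "\<dots> \<le> \<bar>?E / f w - \<sigma> * (exp (- y1 w) - exp (- y2 w))\<bar>" using params by (simp add: divide_le_eq mult_le_cancel_left1)
      also have "\<dots> \<le> \<bar>?E\<bar> / f w + \<sigma> * \<bar>exp (- y1 w) - exp (- y2 w)\<bar>"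
        using abs_triangle_ineq4[of "?E / f w" "\<sigma> * (exp (- y1 w) - exp (- y2 w))"] par_facts f_pos[OF w0] by (simp add: abs_mult)
      also have "\<dots> \<le> exp ((\<kappa> + \<beta> + 1) * B) * ((\<kappa> + \<beta> + 1) * ?S) / f l + \<sigma> * (exp B * ?S)"
      proof (intro add_mono frac_le mult_left_mono e2)
        show "0 < f l" using f_pos[OF l] .
        show "f l \<le> f w" using w l by (intro f_mono) auto
        have "exp B * \<bar>y1 w - y2 w\<bar> \<le> exp B * ?S" by (intro mult_left_mono) auto
        thus "\<bar>exp (- y1 w) - exp (- y2 w)\<bar> \<le> exp B * ?S" using e1 by linarith
      qed (use par_facts in auto)
      finally show ?thesis .
    qed
    have S0: "0 \<le> ?S" by simp
    have A0: "0 \<le> exp ((\<kappa> + \<beta> + 1) * B) * ((\<kappa> + \<beta> + 1) * ?S) / f l" using par_facts f_pos[OF l] by simp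
    have eq: "Lf B l * ?S = exp ((\<kappa> + \<beta> + 1) * B) * ((\<kappa> + \<beta> + 1) * ?S) / f l + \<sigma> * (exp B * ?S) + exp B * ?S"
      by (simp add: Lf_def algebra_simps add_divide_distrib)
    have B0: "0 \<le> exp B * ?S" "0 \<le> \<sigma> * (exp B * ?S)" using par_facts by simp_all
    show "\<bar>rhs T1 y1 w - rhs T2 y2 w\<bar> \<le> Lf B l * ?S" using e3 B0 unfolding eq by linarith
    have "exp B * \<bar>y1 w - y2 w\<bar> \<le> exp B * ?S" by (intro mult_left_mono) auto
    thus "\<bar>exp (- y1 w) - exp (- y2 w)\<bar> \<le> Lf B l * ?S" using e1 A0 B0 unfolding eq by linarith
qed

lemma Lf_nonneg: "0 < l \<Longrightarrow> Lf B l \<ge> 0"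
  unfolding Lf_def using f_pos[of l] par_facts by (intro add_nonneg_nonneg divide_nonneg_pos mult_nonneg_nonneg) auto

text \<open>The factor 4 is the 2 from differentiating squares times the 2 of
  \<open>sum_abs_sq\<close>; the length \<open>t - s\<close> is estimated by 1.\<close>

lemma sol_gronwall:
  assumes s1: "sol a T1 y1" "a < l" and s2: "sol b T2 y2" "b < l" and l: "0 < l" "l \<le> 1"
    and B1: "\<And>w. w \<in> {l..1} \<Longrightarrow> \<bar>T1 w\<bar> \<le> B \<and> \<bar>y1 w\<bar> \<le> B"
    and B2: "\<And>w. w \<in> {l..1} \<Longrightarrow> \<bar>T2 w\<bar> \<le> B \<and> \<bar>y2 w\<bar> \<le> B"
    and st: "l \<le> s" "s \<le> t" "t \<le> 1"
  defines "u \<equiv> \<lambda>w. (T1 w - T2 w)\<^sup>2 + (y1 w - y2 w)\<^sup>2"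
  shows "u t \<le> exp (4 * Lf B l) * u s" "u s \<le> exp (4 * Lf B l) * u t"
proof -
  have Lf: "Lf B l \<ge> 0" by (rule Lf_nonneg[OF l(1)])
  define u' where "u' w = 2 * (T1 w - T2 w) * (exp (- y1 w) - exp (- y2 w)) + 2 * (y1 w - y2 w) * (rhs T1 y1 w - rhs T2 y2 w)" for w
  have cont: "continuous_on {s..t} u"
    unfolding u_def using st s1 s2
    by (intro continuous_intros continuous_on_subset[OF solD(5)[OF s1(1)]] continuous_on_subset[OF solD(6)[OF s1(1)]]
        continuous_on_subset[OF solD(5)[OF s2(1)]] continuous_on_subset[OF solD(6)[OF s2(1)]]) auto
  have der: "(u has_real_derivative u' w) (at w)" if w: "s < w" "w < t" for w
  proof -
    have w': "a < w" "b < w" "w < 1" using w st s1 s2 by auto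
    show ?thesis unfolding u_def u'_def rhs_def
      by (rule solD(3)[OF s1(1) w'(1,3)] solD(4)[OF s1(1) w'(1,3)] solD(3)[OF s2(1) w'(2,3)] solD(4)[OF s2(1) w'(2,3)] derivative_eq_intros refl)+ (simp add: left_diff_distrib right_diff_distrib mult_ac)
  qed
  have le: "\<bar>u' w\<bar> \<le> 4 * Lf B l * u w" if w: "s < w" "w < t" for w
  proof -
    have wl: "w \<in> {l..1}" "w > 0" using w st l by auto
    note b = B1[OF wl(1)] B2[OF wl(1)]
    let ?S = "\<bar>T1 w - T2 w\<bar> + \<bar>y1 w - y2 w\<bar>"
    have lw: "l \<le> w" using wl by simp
    note lip = rhs_Lipschitz[where ?T1.0 = T1 and ?T2.0 = T2 and ?y1.0 = y1 and ?y2.0 = y2, OF l(1) lw b]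
    have "\<bar>u' w\<bar> \<le> 2 * (\<bar>T1 w - T2 w\<bar> * \<bar>exp (- y1 w) - exp (- y2 w)\<bar>) + 2 * (\<bar>y1 w - y2 w\<bar> * \<bar>rhs T1 y1 w - rhs T2 y2 w\<bar>)"
      unfolding u'_def using abs_triangle_ineq[of "2 * (T1 w - T2 w) * (exp (- y1 w) - exp (- y2 w))" "2 * (y1 w - y2 w) * (rhs T1 y1 w - rhs T2 y2 w)"]
      by (simp only: abs_mult mult.assoc abs_numeral)
    also have "\<dots> \<le> 2 * (\<bar>T1 w - T2 w\<bar> * (Lf B l * ?S)) + 2 * (\<bar>y1 w - y2 w\<bar> * (Lf B l * ?S))"
      by (intro add_mono mult_left_mono lip) auto
    also have "\<dots> = 2 * Lf B l * (?S * ?S)"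
    proof -
      have "2 * (A * (L * (A + C))) + 2 * (C * (L * (A + C))) = 2 * L * ((A + C) * (A + C))" for A C L :: real
        by (simp add: algebra_simps)
      thus ?thesis .
    qed
    also have "\<dots> \<le> 2 * Lf B l * (2 * u w)" unfolding u_def using Lf by (intro mult_left_mono sum_abs_sq) auto
    finally show ?thesis by simp
  qed
  have u0: "0 \<le> u w" for w by (simp add: u_def)
  have ex: "exp (4 * Lf B l * (t - s)) \<le> exp (4 * Lf B l)"
    using Lf st l mult_left_mono[of "t - s" 1 "4 * Lf B l"] by simp
  show "u t \<le> exp (4 * Lf B l) * u s"
    using gronwall(1)[OF st(2) cont der le] mult_right_mono[OF ex u0[of s]] by linarith
  show "u s \<le> exp (4 * Lf B l) * u t"
    using gronwall(2)[OF st(2) cont der le] mult_right_mono[OF ex u0[of t]] by linarith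
qed

definition "C0 = \<theta> * exp (ln (\<gamma> * f 1) / \<beta>)"

lemma C0_pos: "C0 > 0" using par_facts by (simp add: C0_def)

lemma sol_sub_cont:
  assumes "sol a T y" "a < l"
  shows "continuous_on {l..1} T" "continuous_on {l..1} y" "t \<le> 1 \<Longrightarrow> continuous_on {l..t} T" "t \<le> 1 \<Longrightarrow> continuous_on {l..t} y"
  using assms by (auto intro!: continuous_on_subset[OF solD(5)[OF assms(1)]] continuous_on_subset[OF solD(6)[OF assms(1)]])

text \<open>\<open>ZZ \<le> \<gamma>\<close> and \<open>f w \<le> f 1\<close> bound
  \<open>\<theta> * T - y\<close> from above, and the derivative of
  \<open>exp (\<theta> * T)\<close> is \<open>\<theta> * exp (\<theta> * T - y)\<close>. The value 0
  at \<open>a\<close> is attained only as a limit, hence the \<open>e\<close>. As the constant does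
  not depend on \<open>a\<close>, the behaviour of \<open>T\<close> at its singular end survives the
  limit \<open>a \<rightarrow> 0\<close>.\<close>

lemma sol_T_upper:
  assumes sol: "sol a T y" and w: "a < w" "w \<le> 1"
  shows "exp (\<theta> * T w) \<le> C0 * (w - a)"
proof (rule field_le_epsilon)
  fix e :: real assume e: "e > 0"
  have "\<forall>\<^sub>F s in at_right a. T s \<le> ln e / \<theta>" using solD(9)[OF sol] by (auto simp: filterlim_at_bot)
  moreover have "\<forall>\<^sub>F s in at_right a. s \<in> {a<..<w}" using w by (intro eventually_at_right_real)
  ultimately have "\<forall>\<^sub>F s in at_right a. T s \<le> ln e / \<theta> \<and> s \<in> {a<..<w}" by (rule eventually_conj)
  from eventually_happens[OF this] obtain s where s: "T s \<le> ln e / \<theta>" "a < s" "s < w"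
    by (auto simp: trivial_limit_at_right_real)
  have "exp (\<theta> * T w) - C0 * w \<le> exp (\<theta> * T s) - C0 * s"
  proof (rule ge_by_deriv_open[where h = "\<lambda>w. exp (\<theta> * T w) - C0 * w" and h' = "\<lambda>w. exp (\<theta> * T w) * (\<theta> * exp (- y w)) - C0"])
    show "continuous_on {s..w} (\<lambda>w. exp (\<theta> * T w) - C0 * w)"
      using w s by (intro continuous_intros sol_sub_cont[OF sol]) auto
    fix u assume u: "s < u" "u < w"
    hence u': "a < u" "u < 1" "0 < u" "u \<le> 1" using s w solD(1)[OF sol] by auto
    show "((\<lambda>w. exp (\<theta> * T w) - C0 * w) has_real_derivative exp (\<theta> * T u) * (\<theta> * exp (- y u)) - C0) (at u)"
      by (rule solD(3)[OF sol u'(1,2)] derivative_eq_intros refl)+ simp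
    have "\<kappa> * T u - \<beta> * y u - ln (f u) \<le> ln \<gamma>"
      using solD(7)[OF sol u'(1,4)] ZZ_pos[OF u'(3), of T y] par_facts by (simp flip: ln_ZZ[OF u'(3)])
    moreover have "ln (f u) \<le> ln (f 1)" using f_mono[of u 1] u' f_pos[of u] f_pos[of 1] by auto
    moreover have "ln (\<gamma> * f 1) = ln \<gamma> + ln (f 1)" using par_facts f_pos[of 1] by (simp add: ln_mult)
    ultimately have "(\<kappa> * T u - \<beta> * y u) / \<beta> \<le> ln (\<gamma> * f 1) / \<beta>" using par_facts by (intro divide_right_mono) auto
    moreover have "(\<kappa> * T u - \<beta> * y u) / \<beta> = \<theta> * T u - y u" using par_facts(1) by (simp add: \<theta>_def field_simps)
    ultimately have "exp (\<theta> * T u - y u) \<le> exp (ln (\<gamma> * f 1) / \<beta>)" by simp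
    hence "\<theta> * exp (\<theta> * T u - y u) \<le> C0" using par_facts by (simp add: C0_def)
    moreover have "exp (\<theta> * T u) * (\<theta> * exp (- y u)) = \<theta> * exp (\<theta> * T u - y u)" by (simp add: exp_diff exp_minus divide_inverse)
    ultimately show "exp (\<theta> * T u) * (\<theta> * exp (- y u)) - C0 \<le> 0" by linarith
  qed (use s in simp)
  moreover have "exp (\<theta> * T s) \<le> e"
  proof -
    have "\<theta> * T s \<le> ln e" using s par_facts by (simp add: pos_le_divide_eq mult.commute)
    hence "exp (\<theta> * T s) \<le> exp (ln e)" by (subst exp_le_cancel_iff)
    thus ?thesis using e by simp
  qed
  moreover have "C0 * a \<le> C0 * s" using C0_pos s by simp
  ultimately show "exp (\<theta> * T w) \<le> C0 * (w - a) + e" by (simp add: algebra_simps)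
qed

lemma sol_T_mono:
  assumes sol: "sol a T y" and w: "a < u" "u < w" "w \<le> 1"
  shows "T u < T w"
proof (rule DERIV_pos_imp_increasing_open[OF w(2)])
  fix x assume "u < x" "x < w"
  thus "\<exists>y. (T has_real_derivative y) (at x) \<and> 0 < y" using solD(3)[OF sol, of x] w by fastforce
qed (use sol_sub_cont[OF sol, of u] w in auto)

text \<open>At \<open>l\<close> both quantities are known from the equilibrium. Beyond
  \<open>l\<close>, \<open>T\<close> increases and is bounded above by \<open>sol_T_upper\<close>,
  \<open>exp y\<close> has slope at most \<open>\<theta>\<close>, and
  \<open>y + \<sigma> / \<beta> * T\<close> is nondecreasing, which bounds \<open>y\<close> from
  below.\<close>

lemma sol_bounds:
  assumes l: "0 < l" "l \<le> w0"
  obtains B where "\<And>a T y w. sol a T y \<Longrightarrow> a < l \<Longrightarrow> near \<rho> (XX y l) (ZZ T y l) \<Longrightarrow> w \<in> {l..1} \<Longrightarrow> \<bar>T w\<bar> \<le> B \<and> \<bar>y w\<bar> \<le> B"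
proof -
  define By where "By = \<bar>ln X0\<bar> + \<bar>\<rho>\<bar> + \<bar>ln (m l)\<bar>"
  define BT where "BT = (\<bar>ln Z0\<bar> + \<bar>\<rho>\<bar> + \<beta> * By + \<bar>ln (f l)\<bar>) / \<kappa>"
  define Tm where "Tm = ln C0 / \<theta>"
  define B where "B = By + BT + \<bar>Tm\<bar> + \<bar>ln (exp By + \<theta>)\<bar> + (\<sigma> / \<beta>) * (BT + \<bar>Tm\<bar>)"
  have nn: "0 \<le> By" "0 \<le> BT" using par_facts by (auto simp: By_def BT_def)
  have nn2: "0 \<le> (\<sigma> / \<beta>) * (BT + \<bar>Tm\<bar>)" using nn par_facts by simp
  show thesis
  proof (rule that[of B])
    fix a T y w assume sol: "sol a T y" and a: "a < l" and near: "near \<rho> (XX y l) (ZZ T y l)" and w: "w \<in> {l..1}"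
    have "\<bar>y l + ln (m l) - ln X0\<bar> \<le> \<rho>" using near by (simp add: near_def ln_XX[OF l(1)])
    hence yl: "\<bar>y l\<bar> \<le> By" unfolding By_def by linarith
    have "\<bar>\<kappa> * T l - \<beta> * y l - ln (f l) - ln Z0\<bar> \<le> \<rho>" using near by (simp add: near_def ln_ZZ[OF l(1)])
    moreover have "\<bar>\<beta> * y l\<bar> \<le> \<beta> * By" using yl par_facts by (simp add: abs_mult)
    ultimately have "\<bar>\<kappa> * T l\<bar> \<le> \<bar>ln Z0\<bar> + \<bar>\<rho>\<bar> + \<beta> * By + \<bar>ln (f l)\<bar>" by linarith
    hence Tl: "\<bar>T l\<bar> \<le> BT" using par_facts by (simp add: BT_def abs_mult pos_le_divide_eq mult.commute)
    have Tlow: "- BT \<le> T w" using Tl sol_T_mono[OF sol, of l w] a w by (cases "w = l") auto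
    have Tup: "T w \<le> Tm"
    proof -
      have "exp (\<theta> * T w) \<le> C0 * (w - a)" using sol_T_upper[OF sol] a w by auto
      also have "\<dots> \<le> C0 * 1" using C0_pos w solD(1)[OF sol] by (intro mult_left_mono) auto
      finally have "\<theta> * T w \<le> ln C0" using C0_pos by (simp add: ln_ge_iff)
      thus ?thesis using par_facts by (simp add: Tm_def pos_le_divide_eq mult.commute)
    qed
    have yup: "exp (y w) \<le> exp By + \<theta>"
    proof -
      have "exp (y w) - \<theta> * w \<le> exp (y l) - \<theta> * l"
      proof (rule ge_by_deriv_open[where h = "\<lambda>w. exp (y w) - \<theta> * w" and h' = "\<lambda>u. exp (y u) * ((ZZ T y u - \<sigma>) / \<beta> * exp (- y u)) - \<theta>"])
        show "continuous_on {l..w} (\<lambda>w. exp (y w) - \<theta> * w)"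
          using w a by (intro continuous_intros sol_sub_cont[OF sol]) auto
        fix u assume u: "l < u" "u < w"
        hence u': "a < u" "u < 1" "u \<le> 1" using a w by auto
        show "((\<lambda>w. exp (y w) - \<theta> * w) has_real_derivative exp (y u) * ((ZZ T y u - \<sigma>) / \<beta> * exp (- y u)) - \<theta>) (at u)"
          by (rule solD(4)[OF sol u'(1,2)] derivative_eq_intros refl)+ simp
        have e: "exp (y u) * ((ZZ T y u - \<sigma>) / \<beta> * exp (- y u)) = (ZZ T y u - \<sigma>) / \<beta>" by (simp add: exp_minus)
        show "exp (y u) * ((ZZ T y u - \<sigma>) / \<beta> * exp (- y u)) - \<theta> \<le> 0"
          unfolding e using drift_le[OF solD(7)[OF sol u'(1,3)]] by simp
      qed (use w in auto)
      moreover have "\<theta> * (w - l) \<le> \<theta> * 1" using w l par_facts by (intro mult_left_mono) auto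
      hence "\<theta> * w - \<theta> * l \<le> \<theta>" by (simp add: right_diff_distrib)
      moreover have "exp (y l) \<le> exp By" using yl by simp
      ultimately show ?thesis by linarith
    qed
    have "0 < exp By + \<theta>" using par_facts by (simp add: add_pos_pos)
    hence yup': "y w \<le> ln (exp By + \<theta>)" using yup by (simp add: ln_ge_iff)
    have ylow: "- By - (\<sigma> / \<beta>) * (BT + \<bar>Tm\<bar>) \<le> y w"
    proof -
      have "y l + \<sigma> / \<beta> * T l \<le> y w + \<sigma> / \<beta> * T w"
      proof (rule le_by_deriv_open[where h = "\<lambda>w. y w + \<sigma> / \<beta> * T w" and h' = "\<lambda>u. (ZZ T y u - \<sigma>) / \<beta> * exp (- y u) + \<sigma> / \<beta> * exp (- y u)"])
        show "continuous_on {l..w} (\<lambda>w. y w + \<sigma> / \<beta> * T w)"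
          using w a by (intro continuous_intros sol_sub_cont[OF sol]) auto
        fix u assume u: "l < u" "u < w"
        hence u': "a < u" "u < 1" "0 < u" using a w l by auto
        show "((\<lambda>w. y w + \<sigma> / \<beta> * T w) has_real_derivative (ZZ T y u - \<sigma>) / \<beta> * exp (- y u) + \<sigma> / \<beta> * exp (- y u)) (at u)"
          by (intro DERIV_add DERIV_cmult solD(3)[OF sol u'(1,2)] solD(4)[OF sol u'(1,2)])
        have "(ZZ T y u - \<sigma>) / \<beta> * exp (- y u) + \<sigma> / \<beta> * exp (- y u) = ZZ T y u / \<beta> * exp (- y u)"
          by (simp add: diff_divide_distrib left_diff_distrib)
        thus "0 \<le> (ZZ T y u - \<sigma>) / \<beta> * exp (- y u) + \<sigma> / \<beta> * exp (- y u)"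
          using ZZ_pos[OF u'(3), of T y] par_facts by (simp add: less_imp_le)
      qed (use w in auto)
      moreover have "\<sigma> / \<beta> * (T w - T l) \<le> \<sigma> / \<beta> * (BT + \<bar>Tm\<bar>)"
        using Tup Tl par_facts by (intro mult_left_mono) auto
      hence "\<sigma> / \<beta> * T w - \<sigma> / \<beta> * T l \<le> \<sigma> / \<beta> * (BT + \<bar>Tm\<bar>)" by (simp only: right_diff_distrib)
      ultimately show ?thesis using yl by linarith
    qed
    show "\<bar>T w\<bar> \<le> B \<and> \<bar>y w\<bar> \<le> B"
      using Tlow Tup yup' ylow nn nn2 unfolding B_def abs_le_iff by linarith
  qed
qed

text \<open>Closeness by attraction is available only below some \<open>w1\<close>. From
  \<open>l' = min w1 l\<close> it is carried up to 1 by \<open>sol_gronwall\<close>, with a bound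
  \<open>B\<close> common to all solutions that start early enough.\<close>

lemma sol_close:
  assumes l: "0 < l" "l \<le> 1" and \<eta>: "\<eta> > 0"
  obtains a0 B where "0 < a0" "a0 < l" "\<And>a T1 y1 w. sol a T1 y1 \<Longrightarrow> a < a0 \<Longrightarrow> w \<in> {l..1} \<Longrightarrow> \<bar>T1 w\<bar> \<le> B \<and> \<bar>y1 w\<bar> \<le> B"
    "\<And>a T1 y1 b T2 y2 w. sol a T1 y1 \<Longrightarrow> a < a0 \<Longrightarrow> sol b T2 y2 \<Longrightarrow> b < a0 \<Longrightarrow> w \<in> {l..1} \<Longrightarrow>
      \<bar>T1 w - T2 w\<bar> \<le> \<eta> \<and> \<bar>y1 w - y2 w\<bar> \<le> \<eta>"
proof -
  obtain w1 \<rho> where w1: "0 < w1" "w1 \<le> w0" "\<rho> > 0" "\<And>w \<eta>. 0 < w \<Longrightarrow> w \<le> w1 \<Longrightarrow> \<eta> > 0 \<Longrightarrow>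
     \<exists>a0. 0 < a0 \<and> a0 < w \<and> (\<forall>a T1 y1. sol a T1 y1 \<and> a < a0 \<longrightarrow> near \<rho> (XX y1 w) (ZZ T1 y1 w) \<and>
        (\<forall>b T2 y2. sol b T2 y2 \<and> b < a0 \<longrightarrow> \<bar>T1 w - T2 w\<bar> \<le> \<eta> \<and> \<bar>y1 w - y2 w\<bar> \<le> \<eta>))"
    using sol_diff_small by blast
  define l' where "l' = min w1 l"
  have l': "0 < l'" "l' \<le> w1" "l' \<le> w0" "l' \<le> l" "l' \<le> 1" using w1 l by (auto simp: l'_def)
  obtain B where B: "\<And>a T y w. sol a T y \<Longrightarrow> a < l' \<Longrightarrow> near \<rho> (XX y l') (ZZ T y l') \<Longrightarrow> w \<in> {l'..1} \<Longrightarrow> \<bar>T w\<bar> \<le> B \<and> \<bar>y w\<bar> \<le> B"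
    using sol_bounds[OF l'(1,3)] by blast
  define K where "K = exp (4 * Lf B l')"
  have K: "K \<ge> 1" using Lf_nonneg[OF l'(1)] by (simp add: K_def)
  \<comment> \<open>With this choice \<open>K * (2 * \<eta>'^2)\<close> is
    \<open>\<eta>^2 / (2 * K)\<close>, and \<open>K \<ge> 1\<close>.\<close>
  define \<eta>' where "\<eta>' = \<eta> / (2 * K)"
  have \<eta>': "\<eta>' > 0" using \<eta> K by (simp add: \<eta>'_def)
  obtain a0 where a0: "0 < a0" "a0 < l'" "\<And>a T1 y1. sol a T1 y1 \<Longrightarrow> a < a0 \<Longrightarrow> near \<rho> (XX y1 l') (ZZ T1 y1 l')"
     "\<And>a T1 y1 b T2 y2. sol a T1 y1 \<Longrightarrow> a < a0 \<Longrightarrow> sol b T2 y2 \<Longrightarrow> b < a0 \<Longrightarrow> \<bar>T1 l' - T2 l'\<bar> \<le> \<eta>' \<and> \<bar>y1 l' - y2 l'\<bar> \<le> \<eta>'"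
    using w1(4)[OF l'(1,2) \<eta>'] by blast
  show thesis
  proof (rule that[of a0 B])
    fix a T1 y1 w assume s1: "sol a T1 y1" "a < a0" and w: "w \<in> {l..1}"
    show "\<bar>T1 w\<bar> \<le> B \<and> \<bar>y1 w\<bar> \<le> B" using s1 w a0 l' by (intro B[OF s1(1)] a0(3)) auto
    fix b T2 y2 assume s2: "sol b T2 y2" "b < a0"
    have d: "\<bar>T1 l' - T2 l'\<bar> \<le> \<eta>'" "\<bar>y1 l' - y2 l'\<bar> \<le> \<eta>'" using a0(4)[OF s1 s2] by auto
    have "(T1 w - T2 w)\<^sup>2 + (y1 w - y2 w)\<^sup>2 \<le> K * ((T1 l' - T2 l')\<^sup>2 + (y1 l' - y2 l')\<^sup>2)"
      unfolding K_def
    proof (rule sol_gronwall(1)[OF s1(1) _ s2(1)])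
      show "\<bar>T1 w\<bar> \<le> B \<and> \<bar>y1 w\<bar> \<le> B" if "w \<in> {l'..1}" for w using that s1 a0 by (intro B[OF s1(1)] a0(3)) auto
      show "\<bar>T2 w\<bar> \<le> B \<and> \<bar>y2 w\<bar> \<le> B" if "w \<in> {l'..1}" for w using that s2 a0 by (intro B[OF s2(1)] a0(3)) auto
    qed (use s1 s2 a0 l' w in auto)
    also have "\<dots> \<le> K * (\<eta>'\<^sup>2 + \<eta>'\<^sup>2)"
      using d \<eta>' K by (intro mult_left_mono add_mono) (auto simp flip: abs_le_square_iff)
    also have "\<dots> = \<eta>\<^sup>2 / (2 * K)" using K by (simp add: \<eta>'_def power2_eq_square field_simps)
    also have "\<dots> \<le> \<eta>\<^sup>2" using K by (simp add: divide_le_eq mult_le_cancel_left1)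
    finally have "(T1 w - T2 w)\<^sup>2 + (y1 w - y2 w)\<^sup>2 \<le> \<eta>\<^sup>2" .
    hence "(T1 w - T2 w)\<^sup>2 \<le> \<eta>\<^sup>2" "(y1 w - y2 w)\<^sup>2 \<le> \<eta>\<^sup>2" by (smt (verit) zero_le_power2)+
    thus "\<bar>T1 w - T2 w\<bar> \<le> \<eta> \<and> \<bar>y1 w - y2 w\<bar> \<le> \<eta>" using \<eta> by (simp flip: abs_le_square_iff)
  qed (use a0 l' in auto)
qed

text \<open>If they met, backward uniqueness would make them agree all the way down to
  \<open>a\<close>. But there \<open>T1\<close> tends to minus infinity, whereas \<open>T2\<close>
  is finite since \<open>a > 0\<close>.\<close>

lemma sol_no_meet:
  assumes s1: "sol a T1 y1" "0 < a" and s2: "sol 0 T2 y2" and w: "a < w" "w \<le> 1"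
  shows "T1 w \<noteq> T2 w \<or> y1 w \<noteq> y2 w"
proof (rule ccontr)
  assume neg: "\<not> ?thesis"
  have eq: "T1 l = T2 l" if l: "a < l" "l < w" for l
  proof -
    have l0: "0 < l" "l \<le> 1" using l s1 w by auto
    have bd: "\<exists>B. \<forall>w\<in>{l..1}. \<bar>h w\<bar> \<le> B" if "continuous_on {l..1} h" for h :: "real \<Rightarrow> real"
    proof -
      have "bounded (h ` {l..1})" by (intro compact_imp_bounded compact_continuous_image that) auto
      thus ?thesis by (auto simp: bounded_real)
    qed
    obtain B1 B2 B3 B4 where B: "\<forall>w\<in>{l..1}. \<bar>T1 w\<bar> \<le> B1" "\<forall>w\<in>{l..1}. \<bar>y1 w\<bar> \<le> B2" "\<forall>w\<in>{l..1}. \<bar>T2 w\<bar> \<le> B3" "\<forall>w\<in>{l..1}. \<bar>y2 w\<bar> \<le> B4"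
      using bd[OF sol_sub_cont(1)[OF s1(1) l(1)]] bd[OF sol_sub_cont(2)[OF s1(1) l(1)]]
        bd[OF sol_sub_cont(1)[OF s2 l0(1)]] bd[OF sol_sub_cont(2)[OF s2 l0(1)]] by metis
    define B where "B = max (max B1 B2) (max B3 B4)"
    have "(T1 l - T2 l)\<^sup>2 + (y1 l - y2 l)\<^sup>2 \<le> exp (4 * Lf B l) * ((T1 w - T2 w)\<^sup>2 + (y1 w - y2 w)\<^sup>2)"
    proof (rule sol_gronwall(2)[OF s1(1) l(1) s2 l0(1) l0])
      have le: "B1 \<le> B" "B2 \<le> B" "B3 \<le> B" "B4 \<le> B" by (simp_all add: B_def)
      show "\<bar>T1 u\<bar> \<le> B \<and> \<bar>y1 u\<bar> \<le> B" if "u \<in> {l..1}" for u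
        using bspec[OF B(1) that] bspec[OF B(2) that] le by linarith
      show "\<bar>T2 u\<bar> \<le> B \<and> \<bar>y2 u\<bar> \<le> B" if "u \<in> {l..1}" for u
        using bspec[OF B(3) that] bspec[OF B(4) that] le by linarith
    qed (use l w in simp_all)
    also have "\<dots> = 0" using neg by simp
    finally have "(T1 l - T2 l)\<^sup>2 = 0" by (smt (verit) zero_le_power2)
    thus ?thesis by simp
  qed
  have a1: "0 < a" "a < 1" using s1(2) solD(2)[OF s1(1)] by auto
  have "(T2 \<longlongrightarrow> T2 a) (at_right a)"
    using DERIV_isCont[OF solD(3)[OF s2 a1]] by (simp add: isCont_def filterlim_at_split)
  hence "\<forall>\<^sub>F s in at_right a. T2 a - 1 < T2 s" by (rule order_tendstoD) simp
  moreover have "\<forall>\<^sub>F s in at_right a. T1 s \<le> T2 a - 1" using solD(9)[OF s1(1)] by (auto simp: filterlim_at_bot)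
  moreover have "\<forall>\<^sub>F s in at_right a. s \<in> {a<..<w}" using w by (intro eventually_at_right_real)
  ultimately have "\<forall>\<^sub>F s in at_right a. False" by eventually_elim (use eq in force)
  thus False by (simp add: trivial_limit_at_right_real)
qed

text \<open>By \<open>sol_close\<close>, regular solutions are uniformly Cauchy on every
  \<open>{l..1}\<close> as \<open>a \<rightarrow> 0\<close>. Their right-hand sides converge
  uniformly too, by \<open>rhs_Lipschitz\<close>, so the limit solves the equations.\<close>

lemma sol_limit:
  assumes ex: "\<And>a. 0 < a \<Longrightarrow> a < 1 \<Longrightarrow> \<exists>T y. sol a T y"
  obtains T y where "sol 0 T y"
proof -
  \<comment> \<open>The double \<open>Suc\<close> keeps every \<open>an n\<close> strictly below
    1.\<close>
  define an where "an n = inverse (real (Suc (Suc n)))" for n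
  have an: "0 < an n" "an n < 1" for n by (auto simp: an_def inverse_less_1_iff)
  have an0: "an \<longlonglongrightarrow> 0" unfolding an_def using LIMSEQ_Suc[OF LIMSEQ_inverse_real_of_nat] .
  obtain T y where sol: "\<And>n. sol (an n) (T n) (y n)" using ex[OF an] by metis
  have ev: "\<forall>\<^sub>F n in sequentially. an n < a0" if "a0 > 0" for a0 using order_tendstoD(2)[OF an0 that] .
  have close: "\<exists>M. \<forall>n\<ge>M. \<forall>k\<ge>M. \<forall>w\<in>{l..1}. \<bar>T n w - T k w\<bar> \<le> \<eta> \<and> \<bar>y n w - y k w\<bar> \<le> \<eta>"
    if l: "0 < l" "l \<le> 1" "\<eta> > 0" for l \<eta>
  proof -
    obtain a0 where a0: "0 < a0" "\<And>a T1 y1 b T2 y2 w. sol a T1 y1 \<Longrightarrow> a < a0 \<Longrightarrow> sol b T2 y2 \<Longrightarrow> b < a0 \<Longrightarrow> w \<in> {l..1} \<Longrightarrow>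
      \<bar>T1 w - T2 w\<bar> \<le> \<eta> \<and> \<bar>y1 w - y2 w\<bar> \<le> \<eta>" using sol_close[OF l] by metis
    obtain M where "\<And>n. n \<ge> M \<Longrightarrow> an n < a0" using ev[OF a0(1)] by (auto simp: eventually_sequentially)
    thus ?thesis using a0(2)[OF sol _ sol] by (intro exI[of _ M]) auto
  qed
  define Ts where "Ts w = lim (\<lambda>n. T n w)" for w
  define ys where "ys w = lim (\<lambda>n. y n w)" for w
  have unif: "uniform_limit {l..1} T Ts sequentially" "uniform_limit {l..1} y ys sequentially"
    if l: "0 < l" "l \<le> 1" for l
  proof -
    have "\<exists>M. \<forall>w\<in>{l..1}. \<forall>n\<ge>M. \<forall>k\<ge>M. dist (T n w) (T k w) < e \<and> dist (y n w) (y k w) < e" if e: "e > 0" for e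
    proof -
      obtain M where M: "\<forall>n\<ge>M. \<forall>k\<ge>M. \<forall>w\<in>{l..1}. \<bar>T n w - T k w\<bar> \<le> e / 2 \<and> \<bar>y n w - y k w\<bar> \<le> e / 2"
        using close[OF l half_gt_zero[OF e]] by blast
      have "dist (T n w) (T k w) < e \<and> dist (y n w) (y k w) < e" if n: "n \<ge> M" "k \<ge> M" "w \<in> {l..1}" for n k w
      proof -
        have "\<bar>T n w - T k w\<bar> \<le> e / 2 \<and> \<bar>y n w - y k w\<bar> \<le> e / 2" using M n by blast
        thus ?thesis using e by (simp add: dist_real_def)
      qed
      thus ?thesis by (intro exI[of _ M]) blast
    qed
    hence "uniformly_Cauchy_on {l..1} T" "uniformly_Cauchy_on {l..1} y"
      unfolding uniformly_Cauchy_on_def by blast+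
    hence "uniformly_convergent_on {l..1} T" "uniformly_convergent_on {l..1} y"
      by (simp_all add: Cauchy_uniformly_convergent)
    thus "uniform_limit {l..1} T Ts sequentially" "uniform_limit {l..1} y ys sequentially"
      unfolding Ts_def[abs_def] ys_def[abs_def] by (auto simp: uniformly_convergent_uniform_limit_iff)
  qed
  have ptw: "(\<lambda>n. T n w) \<longlonglongrightarrow> Ts w" "(\<lambda>n. y n w) \<longlonglongrightarrow> ys w" if "0 < w" "w \<le> 1" for w
    using tendsto_uniform_limitI[OF unif(1)[OF that]] tendsto_uniform_limitI[OF unif(2)[OF that]] that by auto
  have bds: "\<exists>B M. \<forall>n\<ge>M. \<forall>w\<in>{l..1}. \<bar>T n w\<bar> \<le> B \<and> \<bar>y n w\<bar> \<le> B" if l: "0 < l" "l \<le> 1" for l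
  proof -
    obtain a0 B where a0: "0 < a0" "\<And>a T1 y1 w. sol a T1 y1 \<Longrightarrow> a < a0 \<Longrightarrow> w \<in> {l..1} \<Longrightarrow> \<bar>T1 w\<bar> \<le> B \<and> \<bar>y1 w\<bar> \<le> B"
      using sol_close[OF l zero_less_one] by metis
    obtain M where "\<And>n. n \<ge> M \<Longrightarrow> an n < a0" using ev[OF a0(1)] by (auto simp: eventually_sequentially)
    thus ?thesis using a0(2)[OF sol] by blast
  qed
  have bds': "\<exists>B M. (\<forall>n\<ge>M. \<forall>w\<in>{l..1}. \<bar>T n w\<bar> \<le> B \<and> \<bar>y n w\<bar> \<le> B) \<and> (\<forall>w\<in>{l..1}. \<bar>Ts w\<bar> \<le> B \<and> \<bar>ys w\<bar> \<le> B)" if l: "0 < l" "l \<le> 1" for l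
  proof -
    obtain B M where B: "\<forall>n\<ge>M. \<forall>w\<in>{l..1}. \<bar>T n w\<bar> \<le> B \<and> \<bar>y n w\<bar> \<le> B" using bds[OF l] by blast
    have "\<bar>Ts w\<bar> \<le> B \<and> \<bar>ys w\<bar> \<le> B" if w: "w \<in> {l..1}" for w
    proof
      have w': "0 < w" "w \<le> 1" using w l by auto
      show "\<bar>Ts w\<bar> \<le> B" by (rule LIMSEQ_le_const2[OF tendsto_rabs[OF ptw(1)[OF w']]]) (use B w in blast)
      show "\<bar>ys w\<bar> \<le> B" by (rule LIMSEQ_le_const2[OF tendsto_rabs[OF ptw(2)[OF w']]]) (use B w in blast)
    qed
    with B show ?thesis by blast
  qed
  have der: "(Ts has_real_derivative exp (- ys w)) (at w) \<and> (ys has_real_derivative rhs Ts ys w) (at w)"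
    if w: "0 < w" "w < 1" for w
  proof -
    define l where "l = w / 2"
    have l: "0 < l" "l \<le> 1" "l < w" using w by (auto simp: l_def)
    obtain B M where B: "\<And>n w. n \<ge> M \<Longrightarrow> w \<in> {l..1} \<Longrightarrow> \<bar>T n w\<bar> \<le> B \<and> \<bar>y n w\<bar> \<le> B" "\<And>w. w \<in> {l..1} \<Longrightarrow> \<bar>Ts w\<bar> \<le> B \<and> \<bar>ys w\<bar> \<le> B"
      using bds'[OF l(1,2)] by blast
    let ?S = "{l<..<1}"
    obtain M1 where M1: "\<And>n. n \<ge> M1 \<Longrightarrow> an n < l" using ev[OF l(1)] by (auto simp: eventually_sequentially)
    define M2 where "M2 = max M M1"
    have lip: "\<bar>exp (- y n u) - exp (- ys u)\<bar> \<le> Lf B l * (\<bar>T n u - Ts u\<bar> + \<bar>y n u - ys u\<bar>)"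
       "\<bar>rhs (T n) (y n) u - rhs Ts ys u\<bar> \<le> Lf B l * (\<bar>T n u - Ts u\<bar> + \<bar>y n u - ys u\<bar>)" if "n \<ge> M2" "u \<in> ?S" for n u
      using that B(1)[of n u] B(2)[of u] l
        rhs_Lipschitz[where ?T1.0 = "T n" and ?y1.0 = "y n" and ?T2.0 = Ts and ?y2.0 = ys and w = u and l = l and B = B]
      by (auto simp: M2_def)
    have ud: "\<forall>\<^sub>F n in sequentially. \<forall>u\<in>?S. Lf B l * (\<bar>T n u - Ts u\<bar> + \<bar>y n u - ys u\<bar>) \<le> e" if "e > 0" for e
    proof -
      define e' where "e' = e / (2 * (Lf B l + 1))"
      have Lf: "0 \<le> Lf B l" using Lf_nonneg[OF l(1)] .
      have e': "e' > 0" using that Lf by (simp add: e'_def)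
      have "\<forall>\<^sub>F n in sequentially. \<forall>u\<in>{l..1}. dist (T n u) (Ts u) < e'" "\<forall>\<^sub>F n in sequentially. \<forall>u\<in>{l..1}. dist (y n u) (ys u) < e'"
        using uniform_limitD[OF unif(1)[OF l(1,2)] e'] uniform_limitD[OF unif(2)[OF l(1,2)] e'] by auto
      thus ?thesis
      proof eventually_elim
        case (elim n)
        show ?case
        proof
          fix u assume "u \<in> ?S"
          hence "u \<in> {l..1}" by auto
          hence "\<bar>T n u - Ts u\<bar> + \<bar>y n u - ys u\<bar> \<le> 2 * e'" using elim by (force simp: dist_real_def)
          hence "Lf B l * (\<bar>T n u - Ts u\<bar> + \<bar>y n u - ys u\<bar>) \<le> (Lf B l + 1) * (2 * e')" using Lf by (intro mult_mono) auto
          also have "\<dots> = e" using Lf by (simp add: e'_def field_simps)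
          finally show "Lf B l * (\<bar>T n u - Ts u\<bar> + \<bar>y n u - ys u\<bar>) \<le> e" .
        qed
      qed
    qed
    \<comment> \<open>The estimates hold only from index \<open>M2\<close> on, hence the shifted
      sequence. The theorem on derivatives of sequences yields some limit function, which
      \<open>conv\<close> then identifies with the pointwise limit.\<close>
    have seq: "\<exists>h. \<forall>u\<in>?S. (\<lambda>n. F (n + M2) u) \<longlonglongrightarrow> h u \<and> (h has_derivative (*) (h' u)) (at u within ?S)"
      if F: "\<And>n u. n \<ge> M2 \<Longrightarrow> u \<in> ?S \<Longrightarrow> (F n has_real_derivative F' n u) (at u)"
        and F': "\<And>n u. n \<ge> M2 \<Longrightarrow> u \<in> ?S \<Longrightarrow> \<bar>F' n u - h' u\<bar> \<le> Lf B l * (\<bar>T n u - Ts u\<bar> + \<bar>y n u - ys u\<bar>)"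
        and lim: "(\<lambda>n. F n w) \<longlonglongrightarrow> h0" for F F' h' h0
    proof -
      have "\<exists>g. \<forall>u\<in>?S. (\<lambda>n. F (n + M2) u) \<longlonglongrightarrow> g u \<and> (g has_derivative (\<lambda>x. h' u * x)) (at u within ?S)"
      proof (rule has_derivative_sequence[where f = "\<lambda>n. F (n + M2)" and f' = "\<lambda>n u x. F' (n + M2) u * x" and l = h0 and ?x0.0 = w])
        show "(F (n + M2) has_derivative (\<lambda>x. F' (n + M2) u * x)) (at u within ?S)" if "u \<in> ?S" for n u
          using F[of "n + M2" u] that by (auto intro: has_derivative_at_withinI simp: has_field_derivative_def)
        show "\<forall>\<^sub>F n in sequentially. \<forall>u\<in>?S. \<forall>h. norm (F' (n + M2) u * h - h' u * h) \<le> e * norm h" if "e > 0" for e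
        proof -
          have "\<forall>\<^sub>F n in sequentially. \<forall>u\<in>?S. Lf B l * (\<bar>T (n + M2) u - Ts u\<bar> + \<bar>y (n + M2) u - ys u\<bar>) \<le> e"
            using sequentially_offset[OF ud[OF that], of M2] .
          thus ?thesis
          proof eventually_elim
            case (elim n)
            show ?case
            proof (intro ballI allI)
              fix u h assume u: "u \<in> ?S"
              have "\<bar>F' (n + M2) u - h' u\<bar> \<le> e" using F'[of "n + M2" u] u elim by force
              hence "\<bar>F' (n + M2) u - h' u\<bar> * \<bar>h\<bar> \<le> e * \<bar>h\<bar>" by (rule mult_right_mono) simp
              thus "norm (F' (n + M2) u * h - h' u * h) \<le> e * norm h" by (simp add: abs_mult flip: left_diff_distrib)
            qed
          qed
        qed
        show "(\<lambda>n. F (n + M2) w) \<longlonglongrightarrow> h0" using lim by (rule LIMSEQ_ignore_initial_segment)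
      qed (use w l in auto)
      thus ?thesis by blast
    qed
    have conv: "(hs has_real_derivative h' w) (at w)"
      if F: "\<And>n u. n \<ge> M2 \<Longrightarrow> u \<in> ?S \<Longrightarrow> (F n has_real_derivative F' n u) (at u)"
        and F': "\<And>n u. n \<ge> M2 \<Longrightarrow> u \<in> ?S \<Longrightarrow> \<bar>F' n u - h' u\<bar> \<le> Lf B l * (\<bar>T n u - Ts u\<bar> + \<bar>y n u - ys u\<bar>)"
        and lim: "\<And>u. u \<in> ?S \<Longrightarrow> (\<lambda>n. F n u) \<longlonglongrightarrow> hs u" for F F' h' hs
    proof -
      have wS: "w \<in> ?S" using w l by auto
      obtain h where h: "\<And>u. u \<in> ?S \<Longrightarrow> (\<lambda>n. F (n + M2) u) \<longlonglongrightarrow> h u" "(h has_derivative times (h' w)) (at w within ?S)"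
        using seq[OF F F' lim[OF wS]] wS by blast
      have "h u = hs u" if "u \<in> ?S" for u
        using LIMSEQ_unique[OF h(1)[OF that] LIMSEQ_ignore_initial_segment[OF lim[OF that]]] .
      hence "(hs has_derivative times (h' w)) (at w within ?S)"
        using has_derivative_transform[OF wS _ h(2), of hs] by simp
      thus ?thesis using wS by (simp add: has_field_derivative_def at_within_open[OF wS])
    qed
    have sd: "(T n has_real_derivative exp (- y n u)) (at u)" "(y n has_real_derivative rhs (T n) (y n) u) (at u)"
      if "n \<ge> M2" "u \<in> ?S" for n u
      using solD(3,4)[OF sol[of n], of u] M1[of n] that by (auto simp: M2_def rhs_def)
    show ?thesis
      by (intro conjI conv[OF sd(1) lip(1)] conv[OF sd(2) lip(2)]) (use l ptw in auto)
  qed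
  have cont: "continuous_on {0<..1} Ts" "continuous_on {0<..1} ys"
  proof -
    have c: "continuous_on {l..1} Ts \<and> continuous_on {l..1} ys" if l: "0 < l" "l \<le> 1" for l
    proof -
      have "\<forall>\<^sub>F n in sequentially. continuous_on {l..1} (T n)" "\<forall>\<^sub>F n in sequentially. continuous_on {l..1} (y n)"
        using ev[OF l(1)] by (auto elim!: eventually_mono intro: sol_sub_cont[OF sol])
      thus ?thesis using uniform_limit_theorem[OF _ unif(1)[OF l]] uniform_limit_theorem[OF _ unif(2)[OF l]] by auto
    qed
    have "continuous (at w within {0<..1}) Ts \<and> continuous (at w within {0<..1}) ys" if w: "w \<in> {0<..1}" for w
    proof -
      have "w \<in> {w/2..1}" "0 < w/2" "w/2 \<le> 1" using w by auto
      hence "continuous (at w within {w/2..1}) Ts" "continuous (at w within {w/2..1}) ys"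
        using c[of "w/2"] by (auto simp: continuous_on_eq_continuous_within)
      moreover have "at w within {0<..1} = at w within {w/2..1}"
        by (rule at_within_nhd[of _ "{w/2<..}"]) (use w in auto)
      ultimately show ?thesis by simp
    qed
    thus "continuous_on {0<..1} Ts" "continuous_on {0<..1} ys" by (auto simp: continuous_on_eq_continuous_within)
  qed
  have Z: "ZZ Ts ys w \<le> \<gamma>" if w: "0 < w" "w \<le> 1" for w
  proof (rule LIMSEQ_le_const2)
    show "(\<lambda>n. ZZ (T n) (y n) w) \<longlonglongrightarrow> ZZ Ts ys w"
      unfolding ZZ_def using f_pos[OF w(1)] by (intro tendsto_intros ptw w) auto
    obtain M1 where M1: "\<And>n. n \<ge> M1 \<Longrightarrow> an n < w" using ev[OF w(1)] by (auto simp: eventually_sequentially)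
    show "\<exists>M. \<forall>n\<ge>M. ZZ (T n) (y n) w \<le> \<gamma>" using M1 solD(7)[OF sol] w by blast
  qed
  have bot: "filterlim Ts at_bot (at_right 0)"
  proof -
    have up: "exp (\<theta> * Ts w) \<le> C0 * w" if w: "0 < w" "w \<le> 1" for w
    proof (rule LIMSEQ_le_const2)
      show "(\<lambda>n. exp (\<theta> * T n w)) \<longlonglongrightarrow> exp (\<theta> * Ts w)" by (intro tendsto_intros ptw w)
      obtain M1 where M1: "\<And>n. n \<ge> M1 \<Longrightarrow> an n < w" using ev[OF w(1)] by (auto simp: eventually_sequentially)
      have "exp (\<theta> * T n w) \<le> C0 * w" if "n \<ge> M1" for n
      proof -
        have "exp (\<theta> * T n w) \<le> C0 * (w - an n)" using sol_T_upper[OF sol M1[OF that] w(2)] .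
        also have "\<dots> \<le> C0 * w" using C0_pos an[of n] by (intro mult_left_mono) auto
        finally show ?thesis .
      qed
      thus "\<exists>M. \<forall>n\<ge>M. exp (\<theta> * T n w) \<le> C0 * w" by blast
    qed
    show ?thesis unfolding filterlim_at_bot
    proof
      fix Q :: real
      have "0 < min 1 (exp (\<theta> * Q) / C0)" using C0_pos by simp
      hence "\<forall>\<^sub>F w in at_right 0. w \<in> {0<..<min 1 (exp (\<theta> * Q) / C0)}" by (rule eventually_at_right_real)
      thus "\<forall>\<^sub>F w in at_right 0. Ts w \<le> Q"
      proof eventually_elim
        case (elim w)
        hence "exp (\<theta> * Ts w) \<le> C0 * w" by (intro up) auto
        also have "\<dots> \<le> exp (\<theta> * Q)" using elim C0_pos by (simp add: pos_less_divide_eq mult.commute less_imp_le)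
        finally show ?case using par_facts by simp
      qed
    qed
  qed
  have "sol 0 Ts ys"
    unfolding sol_def using der cont Z bot f_zero f_pos ZZ_pos by (auto simp: rhs_def less_imp_le)
  thus thesis by (rule that)
qed

end

section \<open>Solutions and profiles\<close>

text \<open>Used in both directions, to invert \<open>s\<close> to \<open>w\<close> for a profile
  and \<open>w\<close> to \<open>s\<close> for a \<open>sol\<close>. Differentiability is claimed in
  the interior only, because nothing is assumed about derivatives at the ends.\<close>

lemma mono_inverse:
  fixes \<phi> :: "real \<Rightarrow> real"
  assumes lh: "l < h" and cont: "continuous_on {l..h} \<phi>"
    and der: "\<And>x. l < x \<Longrightarrow> x < h \<Longrightarrow> (\<phi> has_real_derivative \<phi>' x) (at x) \<and> 0 < \<phi>' x"
  shows "\<exists>\<psi>. (\<forall>x\<in>{l..h}. \<psi> (\<phi> x) = x) \<and> continuous_on {\<phi> l..\<phi> h} \<psi> \<and>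
    (\<forall>y\<in>{\<phi> l..\<phi> h}. \<psi> y \<in> {l..h} \<and> \<phi> (\<psi> y) = y) \<and>
    (\<forall>y\<in>{\<phi> l<..<\<phi> h}. l < \<psi> y \<and> \<psi> y < h \<and> (\<psi> has_real_derivative 1 / \<phi>' (\<psi> y)) (at y))"
proof -
  have mono: "\<phi> x < \<phi> y" if "l \<le> x" "x < y" "y \<le> h" for x y
  proof (rule DERIV_pos_imp_increasing_open[OF that(2)])
    show "continuous_on {x..y} \<phi>" using that by (intro continuous_on_subset[OF cont]) auto
    show "\<exists>d. (\<phi> has_real_derivative d) (at u) \<and> 0 < d" if "x < u" "u < y" for u
      using der[of u] that \<open>l \<le> x\<close> \<open>y \<le> h\<close> by force
  qed
  have inj: "inj_on \<phi> {l..h}"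
  proof (rule inj_onI)
    fix x y assume "x \<in> {l..h}" "y \<in> {l..h}" "\<phi> x = \<phi> y"
    thus "x = y" using mono[of x y] mono[of y x] by (cases x y rule: linorder_cases) auto
  qed
  have img: "\<phi> ` {l..h} = {\<phi> l..\<phi> h}"
  proof
    show "\<phi> ` {l..h} \<subseteq> {\<phi> l..\<phi> h}"
    proof
      fix y assume "y \<in> \<phi> ` {l..h}"
      then obtain x where x: "y = \<phi> x" "l \<le> x" "x \<le> h" by auto
      have "\<phi> l \<le> \<phi> x" using mono[of l x] x by (cases "l = x") auto
      moreover have "\<phi> x \<le> \<phi> h" using mono[of x h] x by (cases "x = h") auto
      ultimately show "y \<in> {\<phi> l..\<phi> h}" using x by auto
    qed
    show "{\<phi> l..\<phi> h} \<subseteq> \<phi> ` {l..h}"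
    proof
      fix y assume "y \<in> {\<phi> l..\<phi> h}"
      hence "\<exists>x\<ge>l. x \<le> h \<and> \<phi> x = y" using lh cont by (intro IVT') auto
      thus "y \<in> \<phi> ` {l..h}" by auto
    qed
  qed
  define \<psi> where "\<psi> = the_inv_into {l..h} \<phi>"
  have 1: "\<psi> (\<phi> x) = x" if "x \<in> {l..h}" for x unfolding \<psi>_def by (rule the_inv_into_f_f[OF inj that])
  have 2: "continuous_on {\<phi> l..\<phi> h} \<psi>" unfolding \<psi>_def using continuous_on_inv_into[OF cont _ inj] by (simp add: img)
  have 3: "\<psi> y \<in> {l..h} \<and> \<phi> (\<psi> y) = y" if "y \<in> {\<phi> l..\<phi> h}" for y
  proof -
    have "y \<in> \<phi> ` {l..h}" using that img by simp
    thus ?thesis using 1 by auto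
  qed
  have 4: "l < \<psi> y \<and> \<psi> y < h \<and> (\<psi> has_real_derivative 1 / \<phi>' (\<psi> y)) (at y)" if y: "\<phi> l < y" "y < \<phi> h" for y
  proof -
    have p: "\<psi> y \<in> {l..h}" "\<phi> (\<psi> y) = y" using 3[of y] y by auto
    have "\<psi> y \<noteq> l" "\<psi> y \<noteq> h" using p y by auto
    hence q: "l < \<psi> y" "\<psi> y < h" using p by auto
    have "(\<psi> has_real_derivative inverse (\<phi>' (\<psi> y))) (at y)"
    proof (rule DERIV_inverse_function[where f = \<phi> and a = "\<phi> l" and b = "\<phi> h"])
      show "isCont \<psi> y" using 2 y by (intro continuous_on_interior[OF 2]) auto
    qed (use der[OF q] y 3 in auto)
    with q show ?thesis by (simp add: inverse_eq_divide)
  qed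
  show ?thesis using 1 2 3 4 by (intro exI[of _ \<psi>] conjI ballI) auto
qed

context mems
begin

text \<open>\<open>w = 1 - v\<close>, and \<open>P\<close> is minus the flux; \<open>a > 0\<close> for regular solutions, \<open>a = 0\<close> for the degenerate one.\<close>

definition prof :: "real \<Rightarrow> real \<Rightarrow> (real \<Rightarrow> real) \<Rightarrow> (real \<Rightarrow> real) \<Rightarrow> bool" where
  "prof lam a w P \<longleftrightarrow> 0 < lam \<and> 0 \<le> a \<and> a < 1 \<and> continuous_on {0..1} w \<and> w 0 = a \<and> w 1 = 1 \<and>
     continuous_on {0..1} P \<and> P 0 = 0 \<and> (\<forall>s\<in>{0<..1}. P s > 0) \<and>
     (\<forall>s\<in>{0<..<1}. (w has_real_derivative exp ((ln (P s) - \<alpha> * ln s) / \<beta>)) (at s) \<and>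
        (P has_real_derivative lam * s powr (\<gamma> - 1) / f (w s)) (at s))"

lemma profD:
  assumes "prof lam a w P"
  shows "0 < lam" "0 \<le> a" "a < 1" "continuous_on {0..1} w" "w 0 = a" "w 1 = 1" "continuous_on {0..1} P" "P 0 = 0"
    "\<And>s. 0 < s \<Longrightarrow> s \<le> 1 \<Longrightarrow> P s > 0"
    "\<And>s. 0 < s \<Longrightarrow> s < 1 \<Longrightarrow> (w has_real_derivative exp ((ln (P s) - \<alpha> * ln s) / \<beta>)) (at s)"
    "\<And>s. 0 < s \<Longrightarrow> s < 1 \<Longrightarrow> (P has_real_derivative lam * s powr (\<gamma> - 1) / f (w s)) (at s)"
  using assms unfolding prof_def by auto

lemma prof_mono:
  assumes p: "prof lam a w P" and s: "0 \<le> s" "s < t" "t \<le> 1"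
  shows "w s < w t"
proof (rule DERIV_pos_imp_increasing_open[OF s(2)])
  show "continuous_on {s..t} w" using s by (intro continuous_on_subset[OF profD(4)[OF p]]) auto
  show "\<exists>d. (w has_real_derivative d) (at u) \<and> 0 < d" if "s < u" "u < t" for u
    using profD(10)[OF p, of u] that s by force
qed

lemma prof_range:
  assumes p: "prof lam a w P" and s: "0 < s" "s \<le> 1"
  shows "a < w s" "w s \<le> 1" "0 < w s" "s < 1 \<Longrightarrow> w s < 1"
proof -
  show "a < w s" using prof_mono[OF p, of 0 s] s profD(5)[OF p] by simp
  thus "0 < w s" using profD(2)[OF p] by simp
  show "w s \<le> 1" using prof_mono[OF p, of s 1] s profD(6)[OF p] by (cases "s = 1") auto
  show "s < 1 \<Longrightarrow> w s < 1" using prof_mono[OF p, of s 1] s profD(6)[OF p] by auto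
qed

lemma powr_deriv: "0 < s \<Longrightarrow> ((\<lambda>s. s powr c) has_real_derivative c * s powr (c - 1)) (at s)"
  by (rule has_real_derivative_powr)

text \<open>\<open>f (w t)\<close> increases with \<open>t\<close>, so comparing the derivatives of
  \<open>P\<close> and of \<open>t powr \<gamma>\<close> with \<open>f (w t)\<close> replaced by its
  value at \<open>s\<close> or at 0 gives the two estimates.\<close>

lemma prof_bounds:
  assumes p: "prof lam a w P" and s: "0 < s" "s \<le> 1"
  shows "lam * s powr \<gamma> \<le> \<gamma> * f (w s) * P s" "\<gamma> * f a * P s \<le> lam * s powr \<gamma>"
proof -
  note r = prof_range[OF p s]
  have cP: "continuous_on {0..s} P" using s by (intro continuous_on_subset[OF profD(7)[OF p]]) auto
  have cp: "continuous_on {0..s} (\<lambda>t. t powr \<gamma>)" using par_facts by (intro continuous_on_powr') (auto intro!: continuous_intros)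
  have "\<gamma> * f (w s) * P 0 - lam * 0 powr \<gamma> \<le> \<gamma> * f (w s) * P s - lam * s powr \<gamma>"
  proof (rule le_by_deriv_open[where h = "\<lambda>t. \<gamma> * f (w s) * P t - lam * t powr \<gamma>" and
        h' = "\<lambda>t. \<gamma> * f (w s) * (lam * t powr (\<gamma> - 1) / f (w t)) - lam * (\<gamma> * t powr (\<gamma> - 1))"])
    fix t assume t: "0 < t" "t < s"
    hence t1: "t < 1" using s by simp
    show "((\<lambda>t. \<gamma> * f (w s) * P t - lam * t powr \<gamma>) has_real_derivative \<gamma> * f (w s) * (lam * t powr (\<gamma> - 1) / f (w t)) - lam * (\<gamma> * t powr (\<gamma> - 1))) (at t)"
      by (intro DERIV_diff DERIV_cmult profD(11)[OF p] powr_deriv t t1)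
    have ft: "0 < f (w t)" "f (w t) \<le> f (w s)"
      using f_pos f_mono[of "w t" "w s"] prof_range[OF p t(1)] prof_mono[OF p, of t s] t t1 s by auto
    have "lam * (\<gamma> * t powr (\<gamma> - 1)) = \<gamma> * f (w t) * (lam * t powr (\<gamma> - 1) / f (w t))" using ft by simp
    also have "\<dots> \<le> \<gamma> * f (w s) * (lam * t powr (\<gamma> - 1) / f (w t))"
      using ft par_facts profD(1)[OF p] by (intro mult_right_mono) auto
    finally show "0 \<le> \<gamma> * f (w s) * (lam * t powr (\<gamma> - 1) / f (w t)) - lam * (\<gamma> * t powr (\<gamma> - 1))" by simp
  qed (use s cP cp in \<open>auto intro!: continuous_intros\<close>)
  thus "lam * s powr \<gamma> \<le> \<gamma> * f (w s) * P s" using profD(8)[OF p] by simp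
  show "\<gamma> * f a * P s \<le> lam * s powr \<gamma>"
  proof (cases "a = 0")
    case True thus ?thesis using f_zero profD(1)[OF p] by simp
  next
    case False
    hence a: "a > 0" using profD(2)[OF p] by simp
    have "lam * 0 powr \<gamma> - \<gamma> * f a * P 0 \<le> lam * s powr \<gamma> - \<gamma> * f a * P s"
    proof (rule le_by_deriv_open[where h = "\<lambda>t. lam * t powr \<gamma> - \<gamma> * f a * P t" and
          h' = "\<lambda>t. lam * (\<gamma> * t powr (\<gamma> - 1)) - \<gamma> * f a * (lam * t powr (\<gamma> - 1) / f (w t))"])
      fix t assume t: "0 < t" "t < s"
      hence t1: "t < 1" using s by simp
      show "((\<lambda>t. lam * t powr \<gamma> - \<gamma> * f a * P t) has_real_derivative lam * (\<gamma> * t powr (\<gamma> - 1)) - \<gamma> * f a * (lam * t powr (\<gamma> - 1) / f (w t))) (at t)"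
        by (intro DERIV_diff DERIV_cmult profD(11)[OF p] powr_deriv t t1)
      have ft: "0 < f (w t)" "f a \<le> f (w t)"
        using f_pos f_mono[of a "w t"] prof_range[OF p t(1)] t1 a by auto
      have "\<gamma> * f a * (lam * t powr (\<gamma> - 1) / f (w t)) \<le> \<gamma> * f (w t) * (lam * t powr (\<gamma> - 1) / f (w t))"
        using ft par_facts profD(1)[OF p] by (intro mult_right_mono) auto
      also have "\<dots> = lam * (\<gamma> * t powr (\<gamma> - 1))" using ft by simp
      finally show "0 \<le> lam * (\<gamma> * t powr (\<gamma> - 1)) - \<gamma> * f a * (lam * t powr (\<gamma> - 1) / f (w t))" by simp
    qed (use s cP cp in \<open>auto intro!: continuous_intros\<close>)
    thus ?thesis using profD(8)[OF p] by simp
  qed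
qed

text \<open>\<open>T\<close> and \<open>y\<close> are read off at the inverse \<open>u\<close> of
  \<open>w\<close>. The shift \<open>ln lam / \<kappa>\<close> enters \<open>T\<close> only:
  \<open>y\<close> is the logarithm of \<open>s * w'(s)\<close>, here expressed through
  \<open>P\<close>, and this product is invariant under scaling.\<close>

lemma prof_imp_sol:
  assumes p: "prof lam a w P"
  obtains T y where "sol a T y" "\<And>s. 0 < s \<Longrightarrow> s \<le> 1 \<Longrightarrow> T (w s) = ln s + ln lam / \<kappa>"
    "\<And>s. 0 < s \<Longrightarrow> s \<le> 1 \<Longrightarrow> y (w s) = (ln (P s) - \<sigma> * ln s) / \<beta>"
proof -
  note D = profD[OF p]
  have der: "(w has_real_derivative exp ((ln (P x) - \<alpha> * ln x) / \<beta>)) (at x) \<and> 0 < exp ((ln (P x) - \<alpha> * ln x) / \<beta>)"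
    if "0 < x" "x < 1" for x using D(10)[OF that] by simp
  obtain u where "\<forall>s\<in>{0..1}. u (w s) = s" and u2: "continuous_on {a..1} u" and "\<forall>x\<in>{a..1}. u x \<in> {0..1} \<and> w (u x) = x"
    "\<forall>x\<in>{a<..<1}. 0 < u x \<and> u x < 1 \<and> (u has_real_derivative 1 / exp ((ln (P (u x)) - \<alpha> * ln (u x)) / \<beta>)) (at x)"
    using mono_inverse[OF zero_less_one D(4) der, unfolded D(5,6)] by blast
  hence u: "\<And>s. s \<in> {0..1} \<Longrightarrow> u (w s) = s" "continuous_on {a..1} u" "\<And>x. x \<in> {a..1} \<Longrightarrow> u x \<in> {0..1} \<and> w (u x) = x"
    "\<And>x. a < x \<Longrightarrow> x < 1 \<Longrightarrow> 0 < u x \<and> u x < 1 \<and> (u has_real_derivative 1 / exp ((ln (P (u x)) - \<alpha> * ln (u x)) / \<beta>)) (at x)"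
    by auto
  have u0: "u a = 0" "u 1 = 1" using u(1)[of 0] u(1)[of 1] D(5,6) by auto
  have upos: "0 < u x" "u x \<le> 1" "w (u x) = x" if "a < x" "x \<le> 1" for x
    using u(4)[of x] u(3)[of x] u0 that by (cases "x = 1"; auto)+
  define T where "T x = ln (u x) + ln lam / \<kappa>" for x
  define y where "y x = (ln (P (u x)) - \<sigma> * ln (u x)) / \<beta>" for x
  have ZZ: "ZZ T y x = lam * u x powr \<gamma> / (P (u x) * f x)" if x: "a < x" "x \<le> 1" for x
  proof -
    note ux = upos[OF x]
    have Pu: "P (u x) > 0" using D(9) ux by auto
    have "\<kappa> * T x - \<beta> * y x = (\<kappa> + \<sigma>) * ln (u x) + ln lam - ln (P (u x))"
      using par_facts(1,5) by (simp add: T_def y_def field_simps)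
    hence "exp (\<kappa> * T x - \<beta> * y x) = exp (\<gamma> * ln (u x)) * lam / P (u x)"
      unfolding par_facts(6) using D(1) Pu by (simp add: exp_diff exp_add)
    thus ?thesis using ux by (simp add: ZZ_def powr_def mult.commute)
  qed
  have ey: "exp (- y x) = 1 / (u x * exp ((ln (P (u x)) - \<alpha> * ln (u x)) / \<beta>))" if x: "a < x" "x \<le> 1" for x
  proof -
    have "y x = ln (u x) + (ln (P (u x)) - \<alpha> * ln (u x)) / \<beta>"
      using par_facts(1) by (simp add: y_def \<sigma>_def field_simps)
    hence "exp (y x) = u x * exp ((ln (P (u x)) - \<alpha> * ln (u x)) / \<beta>)" using upos[OF x] by (simp add: exp_add)
    thus ?thesis by (simp add: exp_minus inverse_eq_divide)
  qed
  have contu: "continuous_on {a<..1} u" by (rule continuous_on_subset[OF u(2)]) auto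
  have contP: "continuous_on {a<..1} (\<lambda>x. P (u x))"
    by (rule continuous_on_compose2[OF D(7) contu]) (use u(3) in auto)
  have "sol a T y"
    unfolding sol_def
  proof (intro conjI ballI)
    fix x assume x: "x \<in> {a<..<1}"
    hence x': "a < x" "x < 1" "x \<le> 1" by auto
    note ux = u(4)[OF x'(1,2)]
    have Pu: "P (u x) > 0" using D(9) ux by auto
    define ex where "ex = exp ((ln (P (u x)) - \<alpha> * ln (u x)) / \<beta>)"
    have ex: "ex > 0" "(u has_real_derivative 1 / ex) (at x)" using ux by (auto simp: ex_def)
    have e: "exp (- y x) = 1 / (u x * ex)" using ey x' by (simp add: ex_def)
    have "(T has_real_derivative 1 / u x * (1 / ex)) (at x)"
      unfolding T_def[abs_def] using DERIV_add[OF DERIV_chain2[OF DERIV_ln_divide ex(2)] DERIV_const] ux by simp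
    thus "(T has_real_derivative exp (- y x)) (at x)" unfolding e by simp
    have dP: "((\<lambda>x. P (u x)) has_real_derivative lam * u x powr (\<gamma> - 1) / f (w (u x)) * (1 / ex)) (at x)"
      using ux by (intro DERIV_chain2[where f = P and g = u] D(11) ex) auto
    have wu: "w (u x) = x" using upos x' by simp
    have "(y has_real_derivative (1 / P (u x) * (lam * u x powr (\<gamma> - 1) / f x * (1 / ex)) - \<sigma> * (1 / u x * (1 / ex))) / \<beta>) (at x)"
      unfolding y_def[abs_def]
      by (intro DERIV_cdivide DERIV_diff DERIV_cmult DERIV_chain2[OF DERIV_ln_divide[OF Pu] dP[unfolded wu]]
          DERIV_chain2[OF DERIV_ln_divide ex(2)]) (use ux in auto)
    moreover have "(1 / P (u x) * (lam * u x powr (\<gamma> - 1) / f x * (1 / ex)) - \<sigma> * (1 / u x * (1 / ex))) / \<beta> = (ZZ T y x - \<sigma>) / \<beta> * exp (- y x)"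
    proof -
      have "u x powr \<gamma> = u x powr (\<gamma> - 1) * u x" using ux by (simp add: powr_diff)
      thus ?thesis unfolding ZZ[OF x'(1,3)] e using ux Pu ex f_pos[of x] x' D(2) by (simp add: field_simps)
    qed
    ultimately show "(y has_real_derivative (ZZ T y x - \<sigma>) / \<beta> * exp (- y x)) (at x)" by (simp only:)
  next
    show "continuous_on {a<..1} T" unfolding T_def using contu upos par_facts
      by (intro continuous_intros) force+
    have "\<forall>x\<in>{a<..1}. P (u x) \<noteq> 0" "\<forall>x\<in>{a<..1}. u x \<noteq> 0" using D(9) upos by force+
    thus "continuous_on {a<..1} y" unfolding y_def using contu contP par_facts
      by (intro continuous_intros) auto
  next
    fix x assume "x \<in> {a<..1}"
    hence x: "a < x" "x \<le> 1" by auto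
    note ux = upos[OF x]
    have Pu: "P (u x) > 0" using D(9) ux by auto
    have fx: "f x > 0" using f_pos x D(2) by auto
    note b = prof_bounds[OF p ux(1,2), unfolded ux(3)]
    show "ZZ T y x \<le> \<gamma>" unfolding ZZ[OF x] using b(1) Pu fx by (simp add: divide_le_eq mult_ac)
    show "\<gamma> * f a \<le> ZZ T y x * f x" unfolding ZZ[OF x] using b(2) Pu fx by (simp add: le_divide_eq mult_ac)
  next
    have "(u \<longlongrightarrow> u a) (at a within {a..1})" using u(2) D(3) by (auto simp: continuous_on_def)
    hence "(u \<longlongrightarrow> 0) (at a within {a<..<1})" unfolding u0(1) by (rule tendsto_within_subset) auto
    moreover have "at a within {a<..<1} = at_right a" by (rule at_within_nhd[of _ "{..<1}"]) (use D(3) in auto)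
    ultimately have "(u \<longlongrightarrow> 0) (at_right a)" by simp
    moreover have "\<forall>\<^sub>F x in at_right a. x \<in> {a<..<1}" using D(3) by (intro eventually_at_right_real)
    hence "\<forall>\<^sub>F x in at_right a. u x \<in> {0<..}" by eventually_elim (use u(4) in auto)
    ultimately have "filterlim u (at_right 0) (at_right a)" by (auto simp: filterlim_at eventually_mono)
    from filterlim_compose[OF ln_at_0 this] have "filterlim (\<lambda>x. ln (u x)) at_bot (at_right a)" .
    thus "filterlim T at_bot (at_right a)" unfolding T_def
      by (subst add.commute) (simp add: filterlim_tendsto_add_at_bot_iff[OF tendsto_const])
  qed (use D in auto)
  moreover have "T (w s) = ln s + ln lam / \<kappa>" "y (w s) = (ln (P s) - \<sigma> * ln s) / \<beta>" if "0 < s" "s \<le> 1" for s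
    using that u(1)[of s] by (auto simp: T_def y_def)
  ultimately show thesis by (rule that)
qed

text \<open>The value of \<open>lam\<close> is forced, because \<open>r\<close> equals
  \<open>lam powr (1 / \<kappa>)\<close> where \<open>w = 1\<close>. The delicate point is the
  continuity of \<open>P\<close> at 0: \<open>exp y + \<sigma> / \<beta> * w\<close> is
  nondecreasing, so \<open>exp y\<close> is bounded near \<open>a\<close>, and \<open>P\<close> is
  \<open>exp (\<beta> * y) * s powr \<sigma>\<close> with \<open>\<sigma> > 0\<close>.\<close>

lemma sol_imp_prof:
  assumes sol: "sol a T y"
  obtains w P where "prof (exp (\<kappa> * T 1)) a w P" "\<And>s. 0 < s \<Longrightarrow> s \<le> 1 \<Longrightarrow> T (w s) = ln s + T 1"
proof -
  note D = solD[OF sol]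
  \<comment> \<open>\<open>s\<close> as a function of \<open>w\<close>. The value 0 at
    \<open>a\<close> is put in by hand, as \<open>T\<close> carries no information at
    \<open>a\<close>.\<close>
  define \<phi> where "\<phi> x = (if x = a then 0 else exp (T x - T 1))" for x
  have "continuous_on {a<..1} \<phi>"
    by (subst continuous_on_cong[of _ _ _ "\<lambda>x. exp (T x - T 1)"]) (auto simp: \<phi>_def intro!: continuous_intros D(5))
  moreover have "(\<phi> \<longlongrightarrow> 0) (at a within {a..1})"
  proof -
    have "filterlim (\<lambda>x. - T 1 + T x) at_bot (at_right a)" unfolding filterlim_tendsto_add_at_bot_iff[OF tendsto_const] by (rule D(9))
    from filterlim_compose[OF exp_at_bot this] have "((\<lambda>x. exp (T x - T 1)) \<longlongrightarrow> 0) (at_right a)" by simp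
    hence "((\<lambda>x. exp (T x - T 1)) \<longlongrightarrow> 0) (at a within {a<..1})" by (rule tendsto_within_subset) auto
    hence "((\<lambda>x. exp (T x - T 1)) \<longlongrightarrow> 0) (at a within {a..1})"
    proof -
      have "{a..1} - {a} = {a<..1} - {a}" by auto
      thus ?thesis using \<open>((\<lambda>x. exp (T x - T 1)) \<longlongrightarrow> 0) (at a within {a<..1})\<close> by (simp only: at_within_def)
    qed
    thus ?thesis by (rule Lim_transform_eventually) (auto simp: \<phi>_def eventually_at_filter)
  qed
  ultimately have cont: "continuous_on {a..1} \<phi>"
  proof -
    assume c: "continuous_on {a<..1} \<phi>" and l: "(\<phi> \<longlongrightarrow> 0) (at a within {a..1})"
    show ?thesis unfolding continuous_on_def
    proof
      fix x assume x: "x \<in> {a..1}"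
      show "(\<phi> \<longlongrightarrow> \<phi> x) (at x within {a..1})"
      proof (cases "x = a")
        case True thus ?thesis using l by (simp add: \<phi>_def)
      next
        case False
        hence "at x within {a..1} = at x within {a<..1}" by (intro at_within_nhd[of _ "{a<..}"]) (use x in auto)
        thus ?thesis using c x False by (auto simp: continuous_on_def)
      qed
    qed
  qed
  have der: "(\<phi> has_real_derivative exp (T x - T 1) * exp (- y x)) (at x) \<and> 0 < exp (T x - T 1) * exp (- y x)"
    if x: "a < x" "x < 1" for x
  proof -
    have "((\<lambda>x. exp (T x - T 1)) has_real_derivative exp (T x - T 1) * exp (- y x)) (at x)"
      by (rule D(3)[OF x] derivative_eq_intros refl)+ simp
    thus ?thesis
      using has_field_derivative_transform_within_open[of "\<lambda>x. exp (T x - T 1)" _ x "{a<..}" \<phi>] x by (simp add: \<phi>_def)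
  qed
  have \<phi>01: "\<phi> a = 0" "\<phi> 1 = 1" using D(2) by (auto simp: \<phi>_def)
  obtain w where "\<forall>x\<in>{a..1}. w (\<phi> x) = x" and w2: "continuous_on {0..1} w" and "\<forall>s\<in>{0..1}. w s \<in> {a..1} \<and> \<phi> (w s) = s"
    "\<forall>s\<in>{0<..<1}. a < w s \<and> w s < 1 \<and> (w has_real_derivative 1 / (exp (T (w s) - T 1) * exp (- y (w s)))) (at s)"
    using mono_inverse[OF D(2) cont der, unfolded \<phi>01] by blast
  hence w: "\<And>x. x \<in> {a..1} \<Longrightarrow> w (\<phi> x) = x" "continuous_on {0..1} w"
    "\<And>s. s \<in> {0..1} \<Longrightarrow> w s \<in> {a..1} \<and> \<phi> (w s) = s"
    "\<And>s. 0 < s \<Longrightarrow> s < 1 \<Longrightarrow> a < w s \<and> w s < 1 \<and> (w has_real_derivative 1 / (exp (T (w s) - T 1) * exp (- y (w s)))) (at s)"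
    by auto
  have w01: "w 0 = a" "w 1 = 1" using w(1)[of a] w(1)[of 1] D(2) \<phi>01 by auto
  have wr: "a < w s" "w s \<le> 1" if "0 < s" "s \<le> 1" for s using w(4)[of s] w01 D(2) that by (cases "s = 1"; auto)+
  have Tw: "T (w s) = ln s + T 1" if "0 < s" "s \<le> 1" for s
  proof -
    have "exp (T (w s) - T 1) = s" using w(3)[of s] wr[OF that] that by (auto simp: \<phi>_def)
    thus ?thesis by (metis ln_exp add.commute diff_add_cancel)
  qed
  define lam where "lam = exp (\<kappa> * T 1)"
  define P where "P s = (if s = 0 then 0 else exp (\<beta> * y (w s) + \<sigma> * ln s))" for s
  have dw: "(w has_real_derivative exp (y (w s)) / s) (at s)" if s: "0 < s" "s < 1" for s
  proof -
    have "exp (T (w s) - T 1) = s" using Tw[of s] s by simp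
    thus ?thesis using w(4)[OF s] by (simp add: exp_minus field_simps)
  qed
  have contw: "continuous_on {0<..1} w" by (rule continuous_on_subset[OF w(2)]) auto
  have conty: "continuous_on {0<..1} (\<lambda>s. y (w s))"
    by (rule continuous_on_compose2[OF D(6) contw]) (use wr in auto)
  define b where "b = (a + 1) / 2"
  have b: "a < b" "b < 1" using D(2) by (auto simp: b_def)
  have eyb: "exp (y x) \<le> exp (y b) + \<sigma> / \<beta>" if x: "a < x" "x \<le> b" for x
  proof -
    have "exp (y x) + \<sigma> / \<beta> * x \<le> exp (y b) + \<sigma> / \<beta> * b"
    proof (rule le_by_deriv[OF x(2), where h = "\<lambda>x. exp (y x) + \<sigma> / \<beta> * x" and h' = "\<lambda>u. exp (y u) * ((ZZ T y u - \<sigma>) / \<beta> * exp (- y u)) + \<sigma> / \<beta>"])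
      fix u assume u: "x \<le> u" "u \<le> b"
      hence u': "a < u" "u < 1" using x b by auto
      show "((\<lambda>x. exp (y x) + \<sigma> / \<beta> * x) has_real_derivative exp (y u) * ((ZZ T y u - \<sigma>) / \<beta> * exp (- y u)) + \<sigma> / \<beta>) (at u)"
        by (rule D(4)[OF u'] derivative_eq_intros refl)+ simp
    next
      fix u assume u: "x < u" "u < b"
      have "exp (y u) * ((ZZ T y u - \<sigma>) / \<beta> * exp (- y u)) = (ZZ T y u - \<sigma>) / \<beta>" by (simp add: exp_minus)
      note e = this
      have "exp (y u) * ((ZZ T y u - \<sigma>) / \<beta> * exp (- y u)) + \<sigma> / \<beta> = ZZ T y u / \<beta>"
        unfolding e by (simp add: diff_divide_distrib)
      moreover have "ZZ T y u > 0" using u x D(1) by (intro ZZ_pos) auto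
      ultimately show "0 \<le> exp (y u) * ((ZZ T y u - \<sigma>) / \<beta> * exp (- y u)) + \<sigma> / \<beta>" using par_facts by simp
    qed
    moreover have "\<sigma> / \<beta> * (b - x) \<le> \<sigma> / \<beta> * 1" using x b D(1) par_facts by (intro mult_left_mono) auto
    ultimately show ?thesis by (simp add: right_diff_distrib)
  qed
  have contP: "continuous_on {0..1} P"
    unfolding continuous_on_def
  proof
    fix s :: real assume s: "s \<in> {0..1}"
    show "(P \<longlongrightarrow> P s) (at s within {0..1})"
    proof (cases "s = 0")
      case False
      have "continuous_on {0<..1} P"
        by (subst continuous_on_cong[of _ _ _ "\<lambda>s. exp (\<beta> * y (w s) + \<sigma> * ln s)"]) (auto simp: P_def intro!: continuous_intros conty)
      moreover have "at s within {0..1} = at s within {0<..1}" by (intro at_within_nhd[of _ "{0<..}"]) (use s False in auto)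
      ultimately show ?thesis using s False by (auto simp: continuous_on_def)
    next
      case True
      define C where "C = (exp (y b) + \<sigma> / \<beta>) powr \<beta>"
      have le: "0 \<le> P t \<and> P t \<le> C * t powr \<sigma>" if t: "0 < t" "t \<le> \<phi> b" for t
      proof -
        have "\<phi> b < 1"
        proof -
          have "T b < T 1" by (rule sol_T_mono[OF sol b]) simp
          thus ?thesis using b by (simp add: \<phi>_def)
        qed
        hence t1: "t \<le> 1" using t by simp
        have "w t \<le> b"
        proof (rule ccontr)
          assume "\<not> w t \<le> b"
          hence "T b < T (w t)" using wr[OF t(1) t1] b by (intro sol_T_mono[OF sol]) auto
          hence "\<phi> b < \<phi> (w t)" using b wr[OF t(1) t1] by (simp add: \<phi>_def)
          thus False using w(3)[of t] t t1 by auto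
        qed
        hence "exp (y (w t)) \<le> exp (y b) + \<sigma> / \<beta>" using eyb wr[OF t(1) t1] by simp
        hence "exp (y (w t)) powr \<beta> \<le> C" unfolding C_def using par_facts by (intro powr_mono2) auto
        moreover have "exp (y (w t)) powr \<beta> = exp (\<beta> * y (w t))" by (simp add: powr_def)
        ultimately have "exp (\<beta> * y (w t)) * t powr \<sigma> \<le> C * t powr \<sigma>" by (intro mult_right_mono) auto
        thus ?thesis using t by (simp add: P_def powr_def exp_add)
      qed
      have "((\<lambda>t. C * t powr \<sigma>) \<longlongrightarrow> C * 0 powr \<sigma>) (at 0 within {0..1})"
      proof -
        have "continuous_on {0..1::real} (\<lambda>t. C * t powr \<sigma>)"
          using par_facts by (intro continuous_intros continuous_on_powr') auto
        thus ?thesis unfolding continuous_on_def by (rule bspec) simp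
      qed
      hence lim: "((\<lambda>t. C * t powr \<sigma>) \<longlongrightarrow> 0) (at 0 within {0..1})" by simp
      have "0 < \<phi> b" using b by (simp add: \<phi>_def)
      hence "\<forall>\<^sub>F t in at 0 within {0..1}. 0 < t \<and> t \<le> \<phi> b"
        unfolding eventually_at by (intro exI[of _ "\<phi> b"]) (auto simp: dist_real_def)
      hence ev: "\<forall>\<^sub>F t in at 0 within {0..1}. 0 \<le> P t \<and> P t \<le> C * t powr \<sigma>" by eventually_elim (rule le, auto)
      have "(P \<longlongrightarrow> 0) (at 0 within {0..1})"
        by (rule tendsto_sandwich[OF _ _ tendsto_const lim]) (use ev in \<open>auto elim: eventually_mono\<close>)
      thus ?thesis by (simp add: True P_def)
    qed
  qed
  have lnP: "ln (P s) = \<beta> * y (w s) + \<sigma> * ln s" if "s > 0" for s using that by (simp add: P_def)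
  have "prof lam a w P"
    unfolding prof_def
  proof (intro conjI ballI)
    fix s :: real assume "s \<in> {0<..<1}"
    hence s: "0 < s" "s < 1" "s \<le> 1" by auto
    have "(ln (P s) - \<alpha> * ln s) / \<beta> = y (w s) - ln s"
      unfolding lnP[OF s(1)] using par_facts(1) by (simp add: \<sigma>_def field_simps)
    hence "exp ((ln (P s) - \<alpha> * ln s) / \<beta>) = exp (y (w s)) / s" using s by (simp add: exp_diff)
    thus "(w has_real_derivative exp ((ln (P s) - \<alpha> * ln s) / \<beta>)) (at s)" using dw[OF s(1,2)] by simp
    have dy: "((\<lambda>s. y (w s)) has_real_derivative (ZZ T y (w s) - \<sigma>) / \<beta> * exp (- y (w s)) * (exp (y (w s)) / s)) (at s)"
      using w(4)[OF s(1,2)] by (intro DERIV_chain2[where f = y and g = w] D(4) dw[OF s(1,2)]) auto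
    have "((\<lambda>s. exp (\<beta> * y (w s) + \<sigma> * ln s)) has_real_derivative
      exp (\<beta> * y (w s) + \<sigma> * ln s) * (\<beta> * ((ZZ T y (w s) - \<sigma>) / \<beta> * exp (- y (w s)) * (exp (y (w s)) / s)) + \<sigma> * (1 / s))) (at s)"
      by (rule dy derivative_eq_intros refl)+ (use s in auto)
    moreover have "exp (\<beta> * y (w s) + \<sigma> * ln s) * (\<beta> * ((ZZ T y (w s) - \<sigma>) / \<beta> * exp (- y (w s)) * (exp (y (w s)) / s)) + \<sigma> * (1 / s))
       = lam * s powr (\<gamma> - 1) / f (w s)"
    proof -
      have 1: "\<beta> * ((ZZ T y (w s) - \<sigma>) / \<beta> * exp (- y (w s)) * (exp (y (w s)) / s)) + \<sigma> * (1 / s) = ZZ T y (w s) / s"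
        using par_facts(1) s by (simp add: exp_minus field_simps)
      have "(\<kappa> + \<sigma>) * ln s = \<gamma> * ln s" by (simp only: par_facts(6))
      hence "\<beta> * y (w s) + \<sigma> * ln s + (\<kappa> * T (w s) - \<beta> * y (w s)) = \<kappa> * T 1 + \<gamma> * ln s"
        unfolding Tw[OF s(1,3)] by (simp add: algebra_simps)
      hence "exp (\<beta> * y (w s) + \<sigma> * ln s) * exp (\<kappa> * T (w s) - \<beta> * y (w s)) = exp (\<kappa> * T 1 + \<gamma> * ln s)"
        by (simp flip: exp_add)
      also have "\<dots> = lam * s powr \<gamma>" using s by (simp add: lam_def powr_def exp_add)
      finally have 2: "exp (\<beta> * y (w s) + \<sigma> * ln s) * exp (\<kappa> * T (w s) - \<beta> * y (w s)) = lam * s powr \<gamma>" .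
      have "exp (\<beta> * y (w s) + \<sigma> * ln s) * (ZZ T y (w s) / s) = lam * s powr \<gamma> / (f (w s) * s)"
        unfolding 2[symmetric] ZZ_def by simp
      also have "\<dots> = lam * s powr (\<gamma> - 1) / f (w s)" using s by (simp add: powr_diff)
      finally show ?thesis unfolding 1 .
    qed
    ultimately have "((\<lambda>s. exp (\<beta> * y (w s) + \<sigma> * ln s)) has_real_derivative lam * s powr (\<gamma> - 1) / f (w s)) (at s)" by simp
    thus "(P has_real_derivative lam * s powr (\<gamma> - 1) / f (w s)) (at s)"
      by (rule has_field_derivative_transform_within_open[of _ _ _ "{0<..}"]) (use s in \<open>auto simp: P_def\<close>)
  qed (use D w w01 contP in \<open>auto simp: lam_def P_def\<close>)
  thus thesis using that Tw unfolding lam_def by blast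
qed

end

text \<open>\<open>h - C * ln\<close> is nondecreasing, so \<open>h\<close> falls at least
  logarithmically towards 0; \<open>s\<close> is the point where \<open>C * ln\<close> has dropped
  by the required amount plus 1.\<close>

lemma log_growth_unbounded:
  fixes h :: "real \<Rightarrow> real"
  assumes "0 < s1" "0 < C" and der: "\<And>s. 0 < s \<Longrightarrow> s \<le> s1 \<Longrightarrow> (h has_real_derivative h' s) (at s) \<and> C / s \<le> h' s"
  obtains s where "0 < s" "s \<le> s1" "h s < B"
proof -
  define s where "s = s1 * exp (- ((\<bar>h s1 - B\<bar> + 1) / C))"
  have "(\<bar>h s1 - B\<bar> + 1) / C \<ge> 0" using assms by simp
  hence s: "0 < s" "s \<le> s1" using assms by (auto simp: s_def mult_le_cancel_left1)
  have "h s - C * ln s \<le> h s1 - C * ln s1"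
  proof (rule le_by_deriv[OF s(2), where h = "\<lambda>s. h s - C * ln s" and h' = "\<lambda>s. h' s - C * (1 / s)"])
    fix w assume w: "s \<le> w" "w \<le> s1"
    hence "0 < w" using s by simp
    thus "((\<lambda>s. h s - C * ln s) has_real_derivative h' w - C * (1 / w)) (at w)"
      using der[of w] w by (intro DERIV_diff DERIV_cmult DERIV_ln_divide) auto
  next
    fix w assume "s < w" "w < s1"
    thus "0 \<le> h' w - C * (1 / w)" using der[of w] s by auto
  qed
  moreover have "ln s = ln s1 - (\<bar>h s1 - B\<bar> + 1) / C" using assms by (simp add: s_def ln_mult)
  hence "C * ln s = C * ln s1 - (\<bar>h s1 - B\<bar> + 1)" using assms by (simp add: right_diff_distrib)
  ultimately have "h s < B" by linarith
  thus thesis using that s by blast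
qed

section \<open>Profiles versus solutions of the problem\<close>

context mems
begin

text \<open>No boundary condition is imposed at \<open>s = 0\<close>; that the flux vanishes there
  has to be derived. The flux \<open>F\<close> is strictly decreasing. If its sign or its limit were
  wrong, \<open>deriv v\<close> would be at least a multiple of \<open>1 / s\<close> in absolute
  value, because \<open>\<alpha> > \<beta>\<close>, and \<open>v\<close> would diverge
  logarithmically, in conflict with \<open>0 < v < 1\<close>.\<close>

lemma solves_imp_prof:
  assumes solves: "solves_problem \<alpha> \<beta> \<gamma> f lam v" and lam: "lam > 0" and lt: "\<forall>s\<in>{0<..1}. v s < 1" and v0: "v 0 \<le> 1" "0 < v 0"
  obtains P where "prof lam (1 - v 0) (\<lambda>s. 1 - v s) P"
proof -
  note S = solves[unfolded solves_problem_def]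
  define F where "F = flux \<alpha> \<beta> v"
  have v1: "v 1 = 0" and contv: "continuous_on {0..1} v" and vpos: "\<And>s. 0 < s \<Longrightarrow> s < 1 \<Longrightarrow> v s > 0" using S by auto
  have dv: "(v has_real_derivative deriv v s) (at s)" if "0 < s" "s < 1" for s
    using S that by (auto simp: C2_on_def DERIV_deriv_iff_real_differentiable)
  have fpos: "f (1 - v s) > 0" if "0 < s" "s \<le> 1" for s using lt f_pos[of "1 - v s"] that by auto
  have dF: "(F has_real_derivative - (lam * s powr (\<gamma> - 1) / f (1 - v s))) (at s)" if s: "0 < s" "s < 1" for s
  proof -
    have "flux \<alpha> \<beta> v differentiable (at s)" "s powr (- (\<gamma> - 1)) * deriv (flux \<alpha> \<beta> v) s + lam / f (1 - v s) = 0" using S s by auto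
    hence d: "(F has_real_derivative deriv F s) (at s)" "s powr (- (\<gamma> - 1)) * deriv F s = - (lam / f (1 - v s))"
      by (auto simp: F_def DERIV_deriv_iff_real_differentiable)
    have "s powr (\<gamma> - 1) * (s powr (- (\<gamma> - 1)) * deriv F s) = deriv F s" using s by (simp add: mult.assoc[symmetric] flip: powr_add)
    hence "deriv F s = - (lam * s powr (\<gamma> - 1) / f (1 - v s))" unfolding d(2) by (simp add: mult.commute)
    thus ?thesis using d(1) by simp
  qed
  have Fdec: "F t < F s" if st: "0 < s" "s < t" "t < 1" for s t
  proof (rule DERIV_neg_imp_decreasing[OF st(2)])
    fix x assume "s \<le> x" "x \<le> t"
    hence x: "0 < x" "x < 1" using st by auto
    have "0 < lam * x powr (\<gamma> - 1) / f (1 - v x)" using lam x fpos[of x] by simp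
    thus "\<exists>y. (F has_real_derivative y) (at x) \<and> y < 0" using dF[OF x] by force
  qed
  have absF: "\<bar>F s\<bar> = s powr \<alpha> * \<bar>deriv v s\<bar> powr \<beta>" if "0 < s" for s
  proof -
    have "\<bar>deriv v s\<bar> powr (\<beta> - 1) * \<bar>deriv v s\<bar> = \<bar>deriv v s\<bar> powr \<beta>"
      by (cases "deriv v s = 0") (use params in \<open>auto simp: powr_diff\<close>)
    thus ?thesis by (simp add: F_def flux_def abs_mult mult.assoc)
  qed
  have sgnF: "sgn (F s) = sgn (deriv v s)" if "0 < s" for s
  proof (cases "deriv v s = 0")
    case False
    thus ?thesis using that by (simp add: F_def flux_def sgn_mult sgn_1_pos)
  qed (simp add: F_def flux_def)
  \<comment> \<open>For \<open>s < 1\<close> one has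
    \<open>s powr \<alpha> \<le> s powr \<beta>\<close>, so a flux of size \<open>c\<close> makes
    the power \<open>\<beta>\<close> of \<open>s\<close> times the absolute slope at least
    \<open>c\<close>.\<close>
  have big: "c powr (1 / \<beta>) / s \<le> \<bar>deriv v s\<bar>" if s: "0 < s" "s < 1" and c: "0 < c" "c \<le> \<bar>F s\<bar>" for s c
  proof -
    have "s powr \<alpha> \<le> s powr \<beta>" using s params by (intro powr_mono') auto
    hence "c \<le> s powr \<beta> * \<bar>deriv v s\<bar> powr \<beta>" using c mult_right_mono[of "s powr \<alpha>" "s powr \<beta>" "\<bar>deriv v s\<bar> powr \<beta>"] unfolding absF[OF s(1)] by simp
    also have "\<dots> = (s * \<bar>deriv v s\<bar>) powr \<beta>" using s by (simp add: powr_mult)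
    finally have "c powr (1 / \<beta>) \<le> ((s * \<bar>deriv v s\<bar>) powr \<beta>) powr (1 / \<beta>)" using c par_facts by (intro powr_mono2) auto
    also have "\<dots> = s * \<bar>deriv v s\<bar>" using s par_facts by (simp add: powr_powr)
    finally show ?thesis using s by (simp add: pos_divide_le_eq mult.commute)
  qed
  \<comment> \<open>A nonnegative value at \<open>s\<close> would mean a positive lower bound for
    \<open>F\<close> on all of \<open>0 < t \<le> s / 2\<close>, and \<open>v\<close> would become
    negative near 0.\<close>
  have Fneg: "F s < 0" if s: "0 < s" "s < 1" for s
  proof (rule ccontr)
    assume "\<not> F s < 0"
    define s1 where "s1 = s / 2"
    have s1: "0 < s1" "s1 < s" "s1 < 1" using s by (auto simp: s1_def)
    define c where "c = F s1"
    have c: "c > 0" using Fdec[OF s1(1,2) s(2)] \<open>\<not> F s < 0\<close> by (simp add: c_def)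
    have ge: "c \<le> F t" if "0 < t" "t \<le> s1" for t using Fdec[of t s1] that s1 by (cases "t = s1") (auto simp: c_def)
    obtain t where t: "0 < t" "t \<le> s1" "v t < 0"
    proof (rule log_growth_unbounded[OF s1(1), of "c powr (1 / \<beta>)" v "deriv v" 0])
      fix t assume t: "0 < t" "t \<le> s1"
      have "sgn (F t) = 1" using ge[OF t] c by simp
      hence "deriv v t > 0" unfolding sgnF[OF t(1)] by (simp add: sgn_1_pos)
      thus "(v has_real_derivative deriv v t) (at t) \<and> c powr (1 / \<beta>) / t \<le> deriv v t"
        using big[of t c] dv[of t] t s1 c ge[OF t] by auto
    qed (use c in auto)
    show False using vpos[of t] t s1 by auto
  qed
  have vneg: "deriv v s < 0" if "0 < s" "s < 1" for s
    using sgnF[OF that(1)] Fneg[OF that] by (simp add: sgn_1_neg) (metis sgn_1_neg sgn_neg)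
  have Fsmall: "\<exists>s. 0 < s \<and> s < 1 \<and> - F s < c" if c: "c > 0" for c
  proof (rule ccontr)
    assume neg: "\<not> ?thesis"
    have ge: "c \<le> \<bar>F t\<bar>" if "0 < t" "t < 1" for t
      using neg that by force
    have s1: "0 < (1 / 2 :: real)" by simp
    obtain t where t: "0 < t" "t \<le> 1 / 2" "- v t < - 1"
    proof (rule log_growth_unbounded[OF s1, of "c powr (1 / \<beta>)" "\<lambda>s. - v s" "\<lambda>s. - deriv v s" "- 1"])
      fix t :: real assume t: "0 < t" "t \<le> 1 / 2"
      have "c powr (1 / \<beta>) / t \<le> \<bar>deriv v t\<bar>" using big[of t c] ge[of t] t c by auto
      moreover have "deriv v t < 0" using vneg[of t] t by auto
      ultimately show "((\<lambda>s. - v s) has_real_derivative - deriv v t) (at t) \<and> c powr (1 / \<beta>) / t \<le> - deriv v t"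
        using dv[of t] t by (auto intro!: DERIV_minus)
    qed (use c in auto)
    show False using lt t by force
  qed
  \<comment> \<open>\<open>deriv v\<close> need not exist at 1. Hence \<open>P\<close> is continued
    to \<open>s = 1\<close> by integrating its derivative, which is continuous on
    \<open>{1/2..1}\<close> because \<open>1 - v\<close> stays positive there.\<close>
  define Q where "Q s = integral {1/2..s} (\<lambda>t. lam * t powr (\<gamma> - 1) / f (1 - v t))" for s
  have contint: "continuous_on {1/2..1} (\<lambda>t. lam * t powr (\<gamma> - 1) / f (1 - v t))"
  proof -
    have "continuous_on {1/2..1} v" by (rule continuous_on_subset[OF contv]) auto
    hence c1: "continuous_on {1/2..1} (\<lambda>t. 1 - v t)" by (intro continuous_intros)
    have c2: "continuous_on {0<..} f" by (intro continuous_at_imp_continuous_on ballI f_isCont) auto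
    have "continuous_on {1/2..1} (\<lambda>t. f (1 - v t))"
    proof (rule continuous_on_compose2[OF c2 c1])
      show "(\<lambda>t. 1 - v t) ` {1/2..1} \<subseteq> {0<..}"
      proof
        fix y assume "y \<in> (\<lambda>t. 1 - v t) ` {1/2..1}"
        then obtain t where t: "1/2 \<le> t" "t \<le> 1" "y = 1 - v t" by auto
        hence "v t < 1" by (intro bspec[OF lt]) auto
        thus "y \<in> {0<..}" using t by simp
      qed
    qed
    moreover have "f (1 - v t) \<noteq> 0" if "t \<in> {1/2..1}" for t using fpos[of t] that by simp
    ultimately show ?thesis by (intro continuous_intros) auto
  qed
  have contQ: "continuous_on {1/2..1} Q"
    unfolding Q_def by (rule indefinite_integral_continuous_1[OF integrable_continuous_interval[OF contint]])
  have dQ: "(Q has_real_derivative lam * s powr (\<gamma> - 1) / f (1 - v s)) (at s)" if s: "1/2 < s" "s < 1" for s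
  proof -
    have "(Q has_real_derivative lam * s powr (\<gamma> - 1) / f (1 - v s)) (at s within {1/2..1})"
      unfolding Q_def by (rule integral_has_real_derivative[OF contint]) (use s in auto)
    moreover have "at s within {1/2..1} = at s" using s by (intro at_within_interior) auto
    ultimately show ?thesis by simp
  qed
  define h :: real where "h = 3/4"
  have FQ: "- F s = - F h + (Q s - Q h)" if s: "1/2 < s" "s < 1" for s
  proof -
    have "\<exists>c. \<forall>x\<in>{1/2<..<1}. - F x - Q x = c"
    proof (rule has_field_derivative_zero_constant)
      fix x :: real assume "x \<in> {1/2<..<1}"
      hence x: "1/2 < x" "x < 1" "0 < x" by auto
      have "((\<lambda>x. - F x - Q x) has_real_derivative - (- (lam * x powr (\<gamma> - 1) / f (1 - v x))) - lam * x powr (\<gamma> - 1) / f (1 - v x)) (at x)"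
        by (intro DERIV_diff DERIV_minus dF dQ x)
      thus "((\<lambda>x. - F x - Q x) has_real_derivative 0) (at x within {1/2<..<1})" by (simp add: has_field_derivative_at_within)
    qed auto
    then obtain c where "\<And>x. x \<in> {1/2<..<1} \<Longrightarrow> - F x - Q x = c" by blast
    from this[of s] this[of h] s show ?thesis by (simp add: h_def)
  qed
  define P where "P s = (if s = 0 then 0 else if s = 1 then - F h + (Q 1 - Q h) else - F s)" for s
  have Ppos: "P s > 0" if s: "0 < s" "s \<le> 1" for s
  proof (cases "s = 1")
    case False thus ?thesis using Fneg[of s] s by (simp add: P_def)
  next
    case True
    have "Q h \<le> Q 1"
    proof (rule le_by_deriv_open[where h = Q and h' = "\<lambda>s. lam * s powr (\<gamma> - 1) / f (1 - v s)"])
      show "continuous_on {h..1} Q" by (rule continuous_on_subset[OF contQ]) (auto simp: h_def)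
      fix w assume w: "h < w" "w < 1"
      hence w': "1/2 < w" "0 < w" "w \<le> 1" by (auto simp: h_def)
      show "(Q has_real_derivative lam * w powr (\<gamma> - 1) / f (1 - v w)) (at w)" by (rule dQ[OF w'(1) w(2)])
      show "0 \<le> lam * w powr (\<gamma> - 1) / f (1 - v w)" using lam fpos[OF w'(2,3)] by simp
    qed (simp add: h_def)
    moreover have "F h < 0" by (rule Fneg) (auto simp: h_def)
    ultimately show ?thesis by (simp add: P_def True)
  qed
  have dP: "(P has_real_derivative lam * s powr (\<gamma> - 1) / f (1 - v s)) (at s)" if s: "0 < s" "s < 1" for s
  proof (rule has_field_derivative_transform_within_open[of "\<lambda>s. - F s" _ _ "{0<..<1}"])
    show "((\<lambda>s. - F s) has_real_derivative lam * s powr (\<gamma> - 1) / f (1 - v s)) (at s)"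
      using DERIV_minus[OF dF[OF s]] by simp
  qed (use s in \<open>auto simp: P_def\<close>)
  have contP: "continuous_on {0..1} P"
    unfolding continuous_on_def
  proof
    fix s :: real assume s: "s \<in> {0..1}"
    consider "s = 0" | "s = 1" | "0 < s" "s < 1" using s by force
    thus "(P \<longlongrightarrow> P s) (at s within {0..1})"
    proof cases
      case 1
      have "(P \<longlongrightarrow> 0) (at 0 within {0..1})"
      proof (rule tendstoI)
        fix e :: real assume "e > 0"
        then obtain s1 where s1: "0 < s1" "s1 < 1" "- F s1 < e" using Fsmall by blast
        have "\<forall>\<^sub>F t in at 0 within {0..1}. 0 < t \<and> t < s1"
          unfolding eventually_at using s1 by (intro exI[of _ s1]) (auto simp: dist_real_def)
        thus "\<forall>\<^sub>F t in at 0 within {0..1}. dist (P t) 0 < e"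
        proof eventually_elim
          case (elim t)
          have "- F t < - F s1" using Fdec[of t s1] elim s1 by auto
          moreover have "F t < 0" using Fneg elim s1 by auto
          ultimately show ?case using elim s1 by (simp add: P_def dist_real_def)
        qed
      qed
      thus ?thesis by (simp add: 1 P_def)
    next
      case 2
      have "continuous_on {1/2<..1} P"
      proof (subst continuous_on_cong[of _ _ _ "\<lambda>s. - F h + (Q s - Q h)"])
        show "P x = - F h + (Q x - Q h)" if "x \<in> {1/2<..1}" for x
          using FQ[of x] that by (cases "x = 1") (auto simp: P_def)
        show "continuous_on {1/2<..1} (\<lambda>s. - F h + (Q s - Q h))"
          by (intro continuous_intros continuous_on_subset[OF contQ]) auto
      qed simp
      moreover have "at s within {0..1} = at s within {1/2<..1}" by (intro at_within_nhd[of _ "{1/2<..}"]) (use 2 in auto)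
      ultimately show ?thesis using 2 by (auto simp: continuous_on_def)
    next
      case 3
      hence "(P \<longlongrightarrow> P s) (at s)" using DERIV_isCont[OF dP[OF 3]] by (simp add: isCont_def)
      thus ?thesis by (rule tendsto_within_subset) auto
    qed
  qed
  have "prof lam (1 - v 0) (\<lambda>s. 1 - v s) P"
    unfolding prof_def
  proof (intro conjI ballI)
    fix s :: real assume "s \<in> {0<..<1}"
    hence s: "0 < s" "s < 1" by auto
    have "P s = s powr \<alpha> * (- deriv v s) powr \<beta>"
      using absF[OF s(1)] Fneg[OF s] vneg[OF s] s by (simp add: P_def)
    hence "ln (P s) = \<alpha> * ln s + \<beta> * ln (- deriv v s)" using s vneg[OF s] by (simp add: ln_mult ln_powr)
    hence "(ln (P s) - \<alpha> * ln s) / \<beta> = ln (- deriv v s)" using par_facts by simp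
    hence e: "exp ((ln (P s) - \<alpha> * ln s) / \<beta>) = - deriv v s" using vneg[OF s] by simp
    show "((\<lambda>s. 1 - v s) has_real_derivative exp ((ln (P s) - \<alpha> * ln s) / \<beta>)) (at s)"
      unfolding e using DERIV_diff[OF DERIV_const dv[OF s], of 1] by simp
    show "(P has_real_derivative lam * s powr (\<gamma> - 1) / f (1 - v s)) (at s)" by (rule dP[OF s])
  qed (use lam v0 v1 contv contP Ppos in \<open>auto simp: P_def intro!: continuous_intros\<close>)
  thus thesis by (rule that)
qed

lemma regular_imp_prof:
  assumes "regular_solution \<alpha> \<beta> \<gamma> f lam v" "v 0 > 0"
  obtains P where "prof lam (1 - v 0) (\<lambda>s. 1 - v s) P"
proof -
  have *: "solves_problem \<alpha> \<beta> \<gamma> f lam v" "lam > 0" "\<forall>s\<in>{0<..1}. v s < 1" "v 0 \<le> 1"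
    using assms(1) by (auto simp: regular_solution_def less_imp_le)
  show thesis using solves_imp_prof[OF * assms(2)] that by blast
qed

lemma degenerate_imp_prof:
  assumes "degenerate_solution \<alpha> \<beta> \<gamma> f lam v"
  obtains P where "prof lam 0 (\<lambda>s. 1 - v s) P"
proof -
  have *: "solves_problem \<alpha> \<beta> \<gamma> f lam v" "lam > 0" "\<forall>s\<in>{0<..1}. v s < 1" "v 0 \<le> 1" "0 < v 0" and 0: "v 0 = 1"
    using assms(1) by (auto simp: degenerate_solution_def)
  obtain P where "prof lam (1 - v 0) (\<lambda>s. 1 - v s) P" using solves_imp_prof[OF *] by blast
  with that show thesis by (simp add: 0)
qed

text \<open>The restriction matches the extensional representation in \<open>solves_problem\<close>,
  so that solutions with equal values on \<open>{0..1}\<close> are equal functions.\<close>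

definition vfun :: "(real \<Rightarrow> real) \<Rightarrow> real \<Rightarrow> real" where "vfun w = restrict (\<lambda>s. 1 - w s) {0..1}"

text \<open>Second derivatives exist because \<open>w'\<close> is an explicit smooth function of
  \<open>s\<close> and \<open>P\<close>, and \<open>P\<close> is differentiable.\<close>

lemma prof_solves:
  assumes p: "prof lam a w P"
  shows "solves_problem \<alpha> \<beta> \<gamma> f lam (vfun w)"
proof -
  note D = profD[OF p]
  define w1 where "w1 s = exp ((ln (P s) - \<alpha> * ln s) / \<beta>)" for s
  define w2 where "w2 s = w1 s * ((lam * s powr (\<gamma> - 1) / f (w s) / P s - \<alpha> / s) / \<beta>)" for s
  have w1pos: "w1 s > 0" for s by (simp add: w1_def)
  have dv: "(vfun w has_real_derivative - w1 s) (at s)" if s: "s \<in> {0<..<1}" for s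
  proof (rule has_field_derivative_transform_within_open[of "\<lambda>s. 1 - w s" _ _ "{0<..<1}"])
    show "((\<lambda>s. 1 - w s) has_real_derivative - w1 s) (at s)"
      using DERIV_diff[OF DERIV_const D(10)[of s], of 1] s by (simp add: w1_def)
  qed (use s in \<open>auto simp: vfun_def\<close>)
  have deriv_v: "deriv (vfun w) s = - w1 s" if "s \<in> {0<..<1}" for s using dv[OF that] by (rule DERIV_imp_deriv)
  have dw1: "(w1 has_real_derivative w2 s) (at s)" if s: "s \<in> {0<..<1}" for s
  proof -
    have P: "P s > 0" and s': "0 < s" "s < 1" using D(9) s by auto
    have "((\<lambda>s. (ln (P s) - \<alpha> * ln s) / \<beta>) has_real_derivative (1 / P s * (lam * s powr (\<gamma> - 1) / f (w s)) - \<alpha> * (1 / s)) / \<beta>) (at s)"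
      by (intro DERIV_cdivide DERIV_diff DERIV_cmult DERIV_chain2[OF DERIV_ln_divide[OF P] D(11)[OF s']] DERIV_ln_divide s')
    from DERIV_chain2[OF DERIV_exp this] show ?thesis
      unfolding w1_def[abs_def] w2_def by (simp add: mult.commute)
  qed
  have ddv: "(deriv (vfun w) has_real_derivative - w2 s) (at s)" if s: "s \<in> {0<..<1}" for s
    by (rule has_field_derivative_transform_within_open[OF DERIV_minus[OF dw1[OF s]], of "{0<..<1}"]) (use s deriv_v in auto)
  have cont_w: "continuous_on {0<..<1} w" by (rule continuous_on_subset[OF D(4)]) auto
  have cont_P: "continuous_on {0<..<1} P" by (rule continuous_on_subset[OF D(7)]) auto
  have w0: "0 < w s" "w s < 1" if "s \<in> {0<..<1}" for s using prof_range[OF p, of s] that by auto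
  have cont_fw: "continuous_on {0<..<1} (\<lambda>s. f (w s))"
  proof -
    have "continuous_on {0<..} f" by (intro continuous_at_imp_continuous_on ballI f_isCont) auto
    thus ?thesis by (rule continuous_on_compose2[OF _ cont_w]) (use w0 in auto)
  qed
  have nz: "\<forall>s\<in>{0<..<1}. f (w s) \<noteq> 0" "\<forall>s\<in>{0<..<1}. P s \<noteq> 0" using f_pos w0 D(9) by force+
  have cont_w1: "continuous_on {0<..<1} w1" by (rule has_derivative_imp_continuous_on[OF dw1])
  have cont_w2: "continuous_on {0<..<1} w2"
    unfolding w2_def using nz par_facts by (intro continuous_intros cont_w1 cont_fw cont_P) auto
  have C2: "C2_on {0<..<1} (vfun w)"
    unfolding C2_on_def
  proof (intro conjI ballI)
    fix s :: real assume s: "s \<in> {0<..<1}"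
    show "vfun w differentiable (at s)" using dv[OF s] by (auto simp: real_differentiable_def)
    show "deriv (vfun w) differentiable (at s)" using ddv[OF s] by (auto simp: real_differentiable_def)
  next
    have "continuous_on {0<..<1} (\<lambda>s. - w2 s)" by (intro continuous_intros cont_w2)
    thus "continuous_on {0<..<1} (deriv (deriv (vfun w)))"
      by (rule continuous_on_eq) (use ddv DERIV_imp_deriv in force)
  qed
  have flux: "flux \<alpha> \<beta> (vfun w) s = - P s" if s: "s \<in> {0<..<1}" for s
  proof -
    have P: "P s > 0" "0 < s" using D(9) s by auto
    have "s powr \<alpha> * w1 s powr (\<beta> - 1) * w1 s = s powr \<alpha> * w1 s powr \<beta>"
      using w1pos[of s] by (simp add: powr_diff)
    also have "\<dots> = exp (\<alpha> * ln s + \<beta> * ((ln (P s) - \<alpha> * ln s) / \<beta>))"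
      using P by (simp add: powr_def w1_def exp_add)
    also have "\<alpha> * ln s + \<beta> * ((ln (P s) - \<alpha> * ln s) / \<beta>) = ln (P s)" using par_facts by simp
    finally show ?thesis using w1pos[of s] P by (simp add: flux_def deriv_v[OF s])
  qed
  have dflux: "(flux \<alpha> \<beta> (vfun w) has_real_derivative - (lam * s powr (\<gamma> - 1) / f (w s))) (at s)" if s: "s \<in> {0<..<1}" for s
    by (rule has_field_derivative_transform_within_open[OF DERIV_minus[OF D(11)], of _ "{0<..<1}"]) (use s flux in auto)
  show ?thesis
    unfolding solves_problem_def
  proof (intro conjI ballI)
    show "vfun w \<in> extensional {0..1}" by (simp add: vfun_def)
    have "continuous_on {0..1} (\<lambda>s. 1 - w s)" by (intro continuous_intros D(4))
    thus "continuous_on {0..1} (vfun w)" by (rule continuous_on_eq) (auto simp: vfun_def)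
    fix s :: real assume s: "s \<in> {0<..<1}"
    show "flux \<alpha> \<beta> (vfun w) differentiable (at s)" using dflux[OF s] by (auto simp: real_differentiable_def)
    have "deriv (flux \<alpha> \<beta> (vfun w)) s = - (lam * s powr (\<gamma> - 1) / f (w s))" using dflux[OF s] by (rule DERIV_imp_deriv)
    moreover have "1 - vfun w s = w s" using s by (simp add: vfun_def)
    moreover have "s powr (- (\<gamma> - 1)) * (lam * s powr (\<gamma> - 1) / f (w s)) = lam / f (w s)"
    proof -
      have "s powr (- (\<gamma> - 1)) * s powr (\<gamma> - 1) = 1" using s by (simp flip: powr_add)
      hence "lam / f (w s) * (s powr (- (\<gamma> - 1)) * s powr (\<gamma> - 1)) = lam / f (w s)" by simp
      thus ?thesis by (simp only: mult_ac times_divide_eq_right times_divide_eq_left)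
    qed
    ultimately show "s powr (- (\<gamma> - 1)) * deriv (flux \<alpha> \<beta> (vfun w)) s + lam / f (1 - vfun w s) = 0"
      by (simp only: mult_minus_right)
    show "vfun w s > 0" using w0[OF s] s by (simp add: vfun_def)
  qed (use C2 D(6) in \<open>auto simp: vfun_def\<close>)
qed

lemma prof_regular:
  assumes p: "prof lam a w P" and a: "0 < a"
  shows "regular_solution \<alpha> \<beta> \<gamma> f lam (vfun w)" "vfun w 0 = 1 - a"
proof -
  have "a \<le> w s \<and> w s \<le> 1" if "s \<in> {0..1}" for s
    using prof_range(1,2)[OF p, of s] profD(3,5)[OF p] that by (cases "s = 0") auto
  thus "regular_solution \<alpha> \<beta> \<gamma> f lam (vfun w)"
    unfolding regular_solution_def using prof_solves[OF p] profD(1)[OF p] a by (force simp: vfun_def)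
  show "vfun w 0 = 1 - a" using profD(5)[OF p] by (simp add: vfun_def)
qed

lemma prof_degenerate:
  assumes p: "prof lam 0 w P"
  shows "degenerate_solution \<alpha> \<beta> \<gamma> f lam (vfun w)"
  unfolding degenerate_solution_def using prof_solves[OF p] profD(1,5)[OF p] prof_range(3)[OF p] by (auto simp: vfun_def)

end

section \<open>The initial value problem\<close>

text \<open>For \<open>p < 1\<close> the slope of the power blows up at 0; the constant is the slope
  at the lower bound \<open>q0\<close>, by the mean value theorem.\<close>

lemma powr_Lipschitz:
  fixes x z p q0 :: real
  assumes p: "0 < p" "p \<le> 1" and q0: "0 < q0" "q0 \<le> x" "q0 \<le> z"
  shows "\<bar>x powr p - z powr p\<bar> \<le> p * q0 powr (p - 1) * \<bar>x - z\<bar>"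
proof -
  have gen: "\<bar>x powr p - z powr p\<bar> \<le> p * q0 powr (p - 1) * \<bar>x - z\<bar>" if zx: "q0 \<le> z" "z < x" for x z
  proof -
    have "\<exists>u>z. u < x \<and> x powr p - z powr p = (x - z) * (p * u powr (p - 1))"
    proof (rule MVT2[OF zx(2)])
      fix u assume "z \<le> u"
      hence "0 < u" using q0(1) zx(1) by linarith
      thus "((\<lambda>x. x powr p) has_real_derivative p * u powr (p - 1)) (at u)" by (rule has_real_derivative_powr)
    qed
    then obtain u where u: "z < u" "u < x" "x powr p - z powr p = (x - z) * (p * u powr (p - 1))" by blast
    have "u powr (p - 1) \<le> q0 powr (p - 1)" using u zx q0 p by (intro powr_mono2') auto
    hence "(x - z) * (p * u powr (p - 1)) \<le> (x - z) * (p * q0 powr (p - 1))" using zx p by (intro mult_left_mono) auto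
    moreover have "0 \<le> (x - z) * (p * u powr (p - 1))" using zx p by simp
    ultimately show ?thesis unfolding u(3) using zx by (simp add: mult.commute)
  qed
  consider "z < x" | "x < z" | "x = z" by linarith
  thus ?thesis using gen[of z x] gen[of x z] q0 by cases (auto simp: abs_minus_commute)
qed

text \<open>The initial value problem on the \<open>r\<close>-axis, as a Volterra equation; \<open>F\<close> is \<open>1/f\<close>, truncated.\<close>

locale picard = pars +
  fixes F :: "real \<Rightarrow> real" and lo hi L :: real
  assumes F_cont: "continuous_on UNIV F" and F_bounds: "\<And>u. lo \<le> F u" "\<And>u. F u \<le> hi" and lo_pos: "lo > 0"
    and F_Lip: "\<And>u v. \<bar>F u - F v\<bar> \<le> L * \<bar>u - v\<bar>" and L_pos: "L > 0"
begin

text \<open>The integrated equation reads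
  \<open>U' = (PI / s powr \<alpha>) powr (1 / \<beta>)\<close>. As
  \<open>\<theta> - 1 = (\<gamma> - \<alpha>) / \<beta>\<close>, it can be written with the quotient
  of \<open>PI\<close> by \<open>s powr \<gamma>\<close>, which stays between
  \<open>lo / \<gamma>\<close> and \<open>hi / \<gamma>\<close>: the root is then taken away from 0,
  where it is Lipschitz.\<close>

definition "PI U r = integral {0..r} (\<lambda>t. t powr (\<gamma> - 1) * F (U t))"
definition "VV U s = s powr (\<theta> - 1) * (PI U s * s powr (- \<gamma>)) powr (1 / \<beta>)"
definition "Phi a U r = a + integral {0..r} (VV U)"

definition "KK = 1 / \<beta> * (lo / \<gamma>) powr (1 / \<beta> - 1) * (L / \<gamma>) / \<theta>"

lemma KK_pos: "KK > 0" using par_facts lo_pos L_pos by (simp add: KK_def)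

lemma powr_cont: "c > 0 \<Longrightarrow> continuous_on {0..R} (\<lambda>t::real. t powr c)"
  by (intro continuous_on_powr' continuous_intros) auto

lemma integrand_cont:
  assumes "continuous_on {0..R} U"
  shows "continuous_on {0..R} (\<lambda>t. t powr (\<gamma> - 1) * F (U t))"
proof -
  have "continuous_on {0..R} (\<lambda>t. F (U t))" by (rule continuous_on_compose2[OF F_cont assms]) auto
  thus ?thesis using params by (intro continuous_intros powr_cont) auto
qed

lemma PI_cont: "continuous_on {0..R} U \<Longrightarrow> continuous_on {0..R} (PI U)"
  unfolding PI_def by (intro indefinite_integral_continuous_1 integrable_continuous_interval integrand_cont)

lemma PI_0: "PI U 0 = 0" by (simp add: PI_def)

lemma integral_deriv:
  fixes h :: "real \<Rightarrow> real"
  assumes "continuous_on {0..R} h" "0 < r" "r < R"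
  shows "((\<lambda>r. integral {0..r} h) has_real_derivative h r) (at r)"
proof -
  have "((\<lambda>r. integral {0..r} h) has_real_derivative h r) (at r within {0..R})"
    by (rule integral_has_real_derivative[OF assms(1)]) (use assms in auto)
  moreover have "at r within {0..R} = at r" using assms by (intro at_within_interior) auto
  ultimately show ?thesis by simp
qed

lemma PI_deriv:
  assumes "continuous_on {0..R} U" "0 < r" "r < R"
  shows "(PI U has_real_derivative r powr (\<gamma> - 1) * F (U r)) (at r)"
  unfolding PI_def[abs_def] by (rule integral_deriv[OF integrand_cont[OF assms(1)] assms(2,3)])

lemma PI_bounds:
  assumes U: "continuous_on {0..R} U" and r: "0 \<le> r" "r \<le> R"
  shows "lo / \<gamma> * r powr \<gamma> \<le> PI U r" "PI U r \<le> hi / \<gamma> * r powr \<gamma>"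
proof -
  have c: "continuous_on {0..r} (PI U)" by (rule continuous_on_subset[OF PI_cont[OF U]]) (use r in auto)
  have "PI U 0 - lo / \<gamma> * 0 powr \<gamma> \<le> PI U r - lo / \<gamma> * r powr \<gamma>"
  proof (rule le_by_deriv_open[OF r(1), where h = "\<lambda>r. PI U r - lo / \<gamma> * r powr \<gamma>" and h' = "\<lambda>r. r powr (\<gamma> - 1) * F (U r) - lo / \<gamma> * (\<gamma> * r powr (\<gamma> - 1))"])
    fix w assume w: "0 < w" "w < r"
    show "((\<lambda>r. PI U r - lo / \<gamma> * r powr \<gamma>) has_real_derivative w powr (\<gamma> - 1) * F (U w) - lo / \<gamma> * (\<gamma> * w powr (\<gamma> - 1))) (at w)"
      using w r by (intro DERIV_diff DERIV_cmult PI_deriv[OF U] has_real_derivative_powr) auto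
    have "lo * w powr (\<gamma> - 1) \<le> F (U w) * w powr (\<gamma> - 1)" by (intro mult_right_mono F_bounds) auto
    thus "0 \<le> w powr (\<gamma> - 1) * F (U w) - lo / \<gamma> * (\<gamma> * w powr (\<gamma> - 1))" using par_facts by (simp add: mult.commute)
  qed (use par_facts in \<open>intro continuous_intros c powr_cont\<close>)
  thus "lo / \<gamma> * r powr \<gamma> \<le> PI U r" by (simp add: PI_0)
  have "hi / \<gamma> * 0 powr \<gamma> - PI U 0 \<le> hi / \<gamma> * r powr \<gamma> - PI U r"
  proof (rule le_by_deriv_open[OF r(1), where h = "\<lambda>r. hi / \<gamma> * r powr \<gamma> - PI U r" and h' = "\<lambda>r. hi / \<gamma> * (\<gamma> * r powr (\<gamma> - 1)) - r powr (\<gamma> - 1) * F (U r)"])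
    fix w assume w: "0 < w" "w < r"
    show "((\<lambda>r. hi / \<gamma> * r powr \<gamma> - PI U r) has_real_derivative hi / \<gamma> * (\<gamma> * w powr (\<gamma> - 1)) - w powr (\<gamma> - 1) * F (U w)) (at w)"
      using w r by (intro DERIV_diff DERIV_cmult PI_deriv[OF U] has_real_derivative_powr) auto
    have "F (U w) * w powr (\<gamma> - 1) \<le> hi * w powr (\<gamma> - 1)" by (intro mult_right_mono F_bounds) auto
    thus "0 \<le> hi / \<gamma> * (\<gamma> * w powr (\<gamma> - 1)) - w powr (\<gamma> - 1) * F (U w)" using par_facts by (simp add: mult.commute)
  qed (use par_facts in \<open>intro continuous_intros c powr_cont\<close>)
  thus "PI U r \<le> hi / \<gamma> * r powr \<gamma>" by (simp add: PI_0)
qed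

lemma quot_bounds:
  assumes U: "continuous_on {0..R} U" and r: "0 < r" "r \<le> R"
  shows "lo / \<gamma> \<le> PI U r * r powr (- \<gamma>)" "PI U r * r powr (- \<gamma>) \<le> hi / \<gamma>"
proof -
  have e: "r powr \<gamma> * r powr (- \<gamma>) = 1" using r by (simp flip: powr_add)
  have "lo / \<gamma> * r powr \<gamma> * r powr (- \<gamma>) \<le> PI U r * r powr (- \<gamma>)"
    using PI_bounds(1)[OF U, of r] r by (intro mult_right_mono) auto
  thus "lo / \<gamma> \<le> PI U r * r powr (- \<gamma>)" by (simp only: mult.assoc e mult_1_right)
  have "PI U r * r powr (- \<gamma>) \<le> hi / \<gamma> * r powr \<gamma> * r powr (- \<gamma>)"
    using PI_bounds(2)[OF U, of r] r by (intro mult_right_mono) auto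
  thus "PI U r * r powr (- \<gamma>) \<le> hi / \<gamma>" by (simp only: mult.assoc e mult_1_right)
qed

lemma VV_bounds:
  assumes U: "continuous_on {0..R} U" and r: "0 < r" "r \<le> R"
  shows "(lo / \<gamma>) powr (1 / \<beta>) * r powr (\<theta> - 1) \<le> VV U r" "VV U r \<le> (hi / \<gamma>) powr (1 / \<beta>) * r powr (\<theta> - 1)"
proof -
  have p: "0 < lo / \<gamma>" using lo_pos par_facts by simp
  show "(lo / \<gamma>) powr (1 / \<beta>) * r powr (\<theta> - 1) \<le> VV U r"
    unfolding VV_def using quot_bounds[OF U r] p par_facts by (subst mult.commute) (intro mult_left_mono powr_mono2, auto)
  have "0 \<le> PI U r * r powr (- \<gamma>)" using quot_bounds[OF U r] p by linarith
  thus "VV U r \<le> (hi / \<gamma>) powr (1 / \<beta>) * r powr (\<theta> - 1)"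
    unfolding VV_def using quot_bounds[OF U r] par_facts by (subst (2) mult.commute) (intro mult_left_mono powr_mono2, auto)
qed

lemma VV_cont:
  assumes U: "continuous_on {0..R} U"
  shows "continuous_on {0..R} (VV U)"
  unfolding continuous_on_def
proof
  fix s assume s: "s \<in> {0..R}"
  show "(VV U \<longlongrightarrow> VV U s) (at s within {0..R})"
  proof (cases "s = 0")
    case False
    have pos: "\<forall>r\<in>{0<..R}. PI U r * r powr (- \<gamma>) \<noteq> 0"
      using quot_bounds(1)[OF U] lo_pos par_facts by (force simp: divide_le_0_iff)
    have "continuous_on {0<..R} (PI U)" by (rule continuous_on_subset[OF PI_cont[OF U]]) auto
    hence "continuous_on {0<..R} (VV U)" unfolding VV_def using pos by (intro continuous_intros) auto
    moreover have "at s within {0..R} = at s within {0<..R}" by (intro at_within_nhd[of _ "{0<..}"]) (use s False in auto)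
    ultimately show ?thesis using s False by (auto simp: continuous_on_def)
  next
    case True
    have lim: "((\<lambda>r. (hi / \<gamma>) powr (1 / \<beta>) * r powr (\<theta> - 1)) \<longlongrightarrow> 0) (at 0 within {0..R})"
    proof -
      have "continuous_on {0..R} (\<lambda>r. (hi / \<gamma>) powr (1 / \<beta>) * r powr (\<theta> - 1))"
        using par_facts by (intro continuous_intros powr_cont) auto
      hence "((\<lambda>r. (hi / \<gamma>) powr (1 / \<beta>) * r powr (\<theta> - 1)) \<longlongrightarrow> (hi / \<gamma>) powr (1 / \<beta>) * 0 powr (\<theta> - 1)) (at 0 within {0..R})"
        unfolding continuous_on_def by (rule bspec) (use s in auto)
      thus ?thesis by simp
    qed
    have ev: "\<forall>\<^sub>F r in at 0 within {0..R}. 0 \<le> VV U r \<and> VV U r \<le> (hi / \<gamma>) powr (1 / \<beta>) * r powr (\<theta> - 1)"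
      unfolding eventually_at using VV_bounds(2)[OF U] by (intro exI[of _ 1]) (auto simp: VV_def)
    have "(VV U \<longlongrightarrow> 0) (at 0 within {0..R})"
      by (rule tendsto_sandwich[OF _ _ tendsto_const lim]) (use ev in \<open>auto elim: eventually_mono\<close>)
    moreover have "VV U 0 = 0" by (simp add: VV_def)
    ultimately show ?thesis using True by simp
  qed
qed

lemma Phi_cont: "continuous_on {0..R} U \<Longrightarrow> continuous_on {0..R} (Phi a U)"
  unfolding Phi_def by (intro continuous_intros indefinite_integral_continuous_1 integrable_continuous_interval VV_cont)

lemma Phi_deriv:
  assumes "continuous_on {0..R} U" "0 < r" "r < R"
  shows "(Phi a U has_real_derivative VV U r) (at r)"
  unfolding Phi_def[abs_def] using DERIV_add[OF DERIV_const integral_deriv[OF VV_cont[OF assms(1)] assms(2,3)]] by simp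

text \<open>With this (Bielecki) weight \<open>Phi\<close> contracts on every interval \<open>{0..R}\<close>, however large \<open>R\<close> is.\<close>

definition "wt r = exp (2 * KK * r powr \<theta>)"

lemma wt_pos: "wt r > 0" "wt r \<ge> 1" using KK_pos by (auto simp: wt_def)

lemma wt_mono: "0 \<le> s \<Longrightarrow> s \<le> t \<Longrightarrow> wt s \<le> wt t"
  unfolding wt_def using KK_pos par_facts by (auto intro!: mult_left_mono powr_mono2)

lemma wt_cont: "continuous_on {0..R} wt"
  unfolding wt_def using par_facts by (intro continuous_intros powr_cont) auto

lemma PI_Lip:
  assumes U: "continuous_on {0..R} U" and V: "continuous_on {0..R} V" and s: "0 \<le> s" "s \<le> R"
    and D: "\<And>t. t \<in> {0..s} \<Longrightarrow> \<bar>U t - V t\<bar> \<le> D"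
  shows "\<bar>PI U s - PI V s\<bar> \<le> L / \<gamma> * D * s powr \<gamma>"
proof -
  have gen: "PI U s - PI V s \<le> L / \<gamma> * D * s powr \<gamma>"
    if U: "continuous_on {0..R} U" and V: "continuous_on {0..R} V" and D: "\<And>t. t \<in> {0..s} \<Longrightarrow> \<bar>U t - V t\<bar> \<le> D" for U V
  proof -
    have c: "continuous_on {0..s} (PI U)" "continuous_on {0..s} (PI V)"
      by (rule continuous_on_subset[OF PI_cont[OF U]], use s in auto)
         (rule continuous_on_subset[OF PI_cont[OF V]], use s in auto)
    have "L / \<gamma> * D * 0 powr \<gamma> - (PI U 0 - PI V 0) \<le> L / \<gamma> * D * s powr \<gamma> - (PI U s - PI V s)"
    proof (rule le_by_deriv_open[OF s(1), where h = "\<lambda>s. L / \<gamma> * D * s powr \<gamma> - (PI U s - PI V s)" and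
          h' = "\<lambda>t. L / \<gamma> * D * (\<gamma> * t powr (\<gamma> - 1)) - (t powr (\<gamma> - 1) * F (U t) - t powr (\<gamma> - 1) * F (V t))"])
      fix t assume t: "0 < t" "t < s"
      show "((\<lambda>s. L / \<gamma> * D * s powr \<gamma> - (PI U s - PI V s)) has_real_derivative
        L / \<gamma> * D * (\<gamma> * t powr (\<gamma> - 1)) - (t powr (\<gamma> - 1) * F (U t) - t powr (\<gamma> - 1) * F (V t))) (at t)"
        using t s by (intro DERIV_diff DERIV_cmult PI_deriv[OF U] PI_deriv[OF V] has_real_derivative_powr) auto
      have "F (U t) - F (V t) \<le> L * \<bar>U t - V t\<bar>" using F_Lip[of "U t" "V t"] by linarith
      also have "\<dots> \<le> L * D" using D[of t] t L_pos by (intro mult_left_mono) auto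
      finally have "t powr (\<gamma> - 1) * (F (U t) - F (V t)) \<le> t powr (\<gamma> - 1) * (L * D)" by (rule mult_left_mono) simp
      thus "0 \<le> L / \<gamma> * D * (\<gamma> * t powr (\<gamma> - 1)) - (t powr (\<gamma> - 1) * F (U t) - t powr (\<gamma> - 1) * F (V t))"
        using par_facts(3) by (simp add: right_diff_distrib mult.commute)
    qed (use par_facts in \<open>intro continuous_intros c powr_cont\<close>)
    thus ?thesis by (simp add: PI_0)
  qed
  have "PI V s - PI U s \<le> L / \<gamma> * D * s powr \<gamma>" using D by (intro gen V U) (simp add: abs_minus_commute)
  thus ?thesis using gen[OF U V D] by (simp add: abs_le_iff)
qed

text \<open>The constant combines that of the root at \<open>lo / \<gamma>\<close> with the constant
  \<open>L / \<gamma>\<close> of the quotient. The factor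
  \<open>\<theta> * s powr (\<theta> - 1)\<close> is the derivative of
  \<open>s powr \<theta>\<close>, which explains the exponent of \<open>wt\<close>.\<close>

lemma VV_Lip:
  assumes U: "continuous_on {0..R} U" and V: "continuous_on {0..R} V" and s: "0 < s" "s \<le> R"
    and D: "\<And>t. t \<in> {0..s} \<Longrightarrow> \<bar>U t - V t\<bar> \<le> D"
  shows "\<bar>VV U s - VV V s\<bar> \<le> KK * \<theta> * s powr (\<theta> - 1) * D"
proof -
  let ?x = "PI U s * s powr (- \<gamma>)" and ?z = "PI V s * s powr (- \<gamma>)"
  have e: "s powr \<gamma> * s powr (- \<gamma>) = 1" using s by (simp flip: powr_add)
  have "\<bar>?x - ?z\<bar> = \<bar>PI U s - PI V s\<bar> * s powr (- \<gamma>)" by (simp add: abs_mult flip: left_diff_distrib)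
  also have "\<dots> \<le> L / \<gamma> * D * s powr \<gamma> * s powr (- \<gamma>)"
    using PI_Lip[OF U V _ s(2) D] s by (intro mult_right_mono) auto
  also have "\<dots> = L / \<gamma> * D" by (simp only: mult.assoc e mult_1_right)
  finally have xz: "\<bar>?x - ?z\<bar> \<le> L / \<gamma> * D" .
  have "\<bar>?x powr (1 / \<beta>) - ?z powr (1 / \<beta>)\<bar> \<le> 1 / \<beta> * (lo / \<gamma>) powr (1 / \<beta> - 1) * \<bar>?x - ?z\<bar>"
    using quot_bounds(1)[OF U s] quot_bounds(1)[OF V s] lo_pos par_facts params by (intro powr_Lipschitz) auto
  also have "\<dots> \<le> 1 / \<beta> * (lo / \<gamma>) powr (1 / \<beta> - 1) * (L / \<gamma> * D)"
    using xz par_facts by (intro mult_left_mono) auto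
  also have "\<dots> = KK * \<theta> * D" using par_facts(9) by (simp add: KK_def)
  finally have le: "\<bar>?x powr (1 / \<beta>) - ?z powr (1 / \<beta>)\<bar> \<le> KK * \<theta> * D" .
  have "\<bar>VV U s - VV V s\<bar> = s powr (\<theta> - 1) * \<bar>?x powr (1 / \<beta>) - ?z powr (1 / \<beta>)\<bar>"
    unfolding VV_def by (simp add: abs_mult flip: right_diff_distrib)
  also have "\<dots> \<le> s powr (\<theta> - 1) * (KK * \<theta> * D)" using le by (intro mult_left_mono) auto
  finally show ?thesis by (simp add: mult_ac)
qed

lemma Phi_contracts:
  assumes U: "continuous_on {0..R} U" and V: "continuous_on {0..R} V" and D0: "D \<ge> 0"
    and D: "\<And>t. t \<in> {0..R} \<Longrightarrow> \<bar>U t - V t\<bar> \<le> D * wt t" and r: "r \<in> {0..R}"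
  shows "\<bar>Phi a U r - Phi b V r\<bar> \<le> \<bar>a - b\<bar> + D / 2 * wt r"
proof -
  have gen: "(Phi a U r - a) - (Phi b V r - b) \<le> D / 2 * wt r"
    if U: "continuous_on {0..R} U" and V: "continuous_on {0..R} V" and D: "\<And>t. t \<in> {0..R} \<Longrightarrow> \<bar>U t - V t\<bar> \<le> D * wt t" for U V a b
  proof -
    have c: "continuous_on {0..r} (Phi a U)" "continuous_on {0..r} (Phi b V)"
      by (rule continuous_on_subset[OF Phi_cont[OF U]], use r in auto)
         (rule continuous_on_subset[OF Phi_cont[OF V]], use r in auto)
    have "D / 2 * wt 0 - (Phi a U 0 - Phi b V 0) \<le> D / 2 * wt r - (Phi a U r - Phi b V r)"
    proof (rule le_by_deriv_open[where h = "\<lambda>r. D / 2 * wt r - (Phi a U r - Phi b V r)" and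
          h' = "\<lambda>s. D / 2 * (wt s * (2 * KK * (\<theta> * s powr (\<theta> - 1)))) - (VV U s - VV V s)"])
      fix s assume s: "0 < s" "s < r"
      have sR: "s < R" "s \<le> R" using s r by auto
      have "(wt has_real_derivative wt s * (2 * KK * (\<theta> * s powr (\<theta> - 1)))) (at s)"
        unfolding wt_def[abs_def] by (intro DERIV_chain2[OF DERIV_exp] DERIV_cmult has_real_derivative_powr s)
      thus "((\<lambda>r. D / 2 * wt r - (Phi a U r - Phi b V r)) has_real_derivative
        D / 2 * (wt s * (2 * KK * (\<theta> * s powr (\<theta> - 1)))) - (VV U s - VV V s)) (at s)"
        using s sR by (intro DERIV_diff DERIV_cmult Phi_deriv[OF U] Phi_deriv[OF V]) auto
      have "\<bar>U t - V t\<bar> \<le> D * wt s" if "t \<in> {0..s}" for t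
      proof -
        have "\<bar>U t - V t\<bar> \<le> D * wt t" using that sR by (intro D) auto
        also have "\<dots> \<le> D * wt s" using that D0 by (intro mult_left_mono wt_mono) auto
        finally show ?thesis .
      qed
      from VV_Lip[OF U V s(1) sR(2) this] have "VV U s - VV V s \<le> KK * \<theta> * s powr (\<theta> - 1) * (D * wt s)" by linarith
      thus "0 \<le> D / 2 * (wt s * (2 * KK * (\<theta> * s powr (\<theta> - 1)))) - (VV U s - VV V s)" by (simp add: mult_ac)
    qed (use r c in \<open>auto intro!: continuous_intros wt_cont\<close>)
    moreover have "Phi a U 0 = a" "Phi b V 0 = b" by (simp_all add: Phi_def)
    moreover have "0 \<le> D / 2 * wt 0" using D0 wt_pos[of 0] by simp
    ultimately show ?thesis by linarith
  qed
  have "(Phi b V r - b) - (Phi a U r - a) \<le> D / 2 * wt r" using D by (intro gen V U) (simp add: abs_minus_commute)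
  thus ?thesis using gen[OF U V D, of a b] by linarith
qed

definition "fixpt R a U \<longleftrightarrow> continuous_on {0..R} U \<and> (\<forall>r\<in>{0..R}. U r = Phi a U r)"

text \<open>At the maximum of the weighted distance the contraction returns half of that distance,
  which is absorbed on the left. With \<open>a = b\<close> this is uniqueness.\<close>

lemma fixpt_Lip:
  assumes U: "fixpt R a U" and V: "fixpt R b V" and r: "r \<in> {0..R}"
  shows "\<bar>U r - V r\<bar> \<le> 2 * wt R * \<bar>a - b\<bar>"
proof -
  have c: "continuous_on {0..R} U" "continuous_on {0..R} V" using U V by (auto simp: fixpt_def)
  have "continuous_on {0..R} (\<lambda>t. \<bar>U t - V t\<bar> / wt t)"
    using wt_pos by (intro continuous_intros c wt_cont) (auto simp: less_imp_neq[symmetric])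
  then obtain t0 where t0: "t0 \<in> {0..R}" "\<And>t. t \<in> {0..R} \<Longrightarrow> \<bar>U t - V t\<bar> / wt t \<le> \<bar>U t0 - V t0\<bar> / wt t0"
    using continuous_attains_sup[of "{0..R}" "\<lambda>t. \<bar>U t - V t\<bar> / wt t"] r by auto
  define D where "D = \<bar>U t0 - V t0\<bar> / wt t0"
  have D: "\<bar>U t - V t\<bar> \<le> D * wt t" if "t \<in> {0..R}" for t
    using t0(2)[OF that] wt_pos[of t] by (simp add: D_def pos_divide_le_eq)
  have D0: "0 \<le> D" using wt_pos[of t0] by (simp add: D_def)
  have "\<bar>U t0 - V t0\<bar> \<le> \<bar>a - b\<bar> + D / 2 * wt t0"
    using Phi_contracts[OF c D0 D t0(1), of a b] U V t0(1) by (auto simp: fixpt_def)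
  also have "\<bar>a - b\<bar> \<le> \<bar>a - b\<bar> * wt t0" using wt_pos[of t0] by (simp add: mult_le_cancel_left1)
  finally have "\<bar>U t0 - V t0\<bar> \<le> (\<bar>a - b\<bar> + D / 2) * wt t0" by (simp add: distrib_right)
  hence "D \<le> \<bar>a - b\<bar> + D / 2" using wt_pos[of t0] by (simp add: D_def pos_divide_le_eq)
  hence "D \<le> 2 * \<bar>a - b\<bar>" by simp
  hence "D * wt r \<le> 2 * \<bar>a - b\<bar> * wt R" using r wt_pos[of r] by (intro mult_mono wt_mono) auto
  thus ?thesis using D[OF r] by (simp add: mult_ac)
qed

lemma fixpt_exists: "\<exists>U. fixpt R a U"
proof -
  define Y where "Y n = (Phi a ^^ n) (\<lambda>_. a)" for n
  have Y0: "Y 0 = (\<lambda>_. a)" and YS: "\<And>n. Y (Suc n) = Phi a (Y n)" by (auto simp: Y_def)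
  have c: "continuous_on {0..R} (Y n)" for n by (induction n) (auto simp: Y0 YS intro: Phi_cont)
  have "bounded ((\<lambda>t. Y 1 t - Y 0 t) ` {0..R})"
    by (intro compact_imp_bounded compact_continuous_image continuous_intros c) auto
  then obtain D where D: "\<forall>t\<in>{0..R}. \<bar>Y (Suc 0) t - Y 0 t\<bar> \<le> D" by (auto simp: bounded_real)
  define D0 where "D0 = max D 0"
  have D0: "D0 \<ge> 0" by (simp add: D0_def)
  have step: "\<bar>Y (Suc n) t - Y n t\<bar> \<le> D0 / 2 ^ n * wt t" if "t \<in> {0..R}" for n t
    using that
  proof (induction n arbitrary: t)
    case 0
    have "\<bar>Y (Suc 0) t - Y 0 t\<bar> \<le> D0 * 1" using bspec[OF D 0] by (simp add: D0_def)
    also have "\<dots> \<le> D0 * wt t" using D0 wt_pos by (intro mult_left_mono) auto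
    finally show ?case by simp
  next
    case (Suc n)
    have "\<bar>Phi a (Y (Suc n)) t - Phi a (Y n) t\<bar> \<le> \<bar>a - a\<bar> + D0 / 2 ^ n / 2 * wt t"
      by (rule Phi_contracts[OF c c]) (use Suc D0 in auto)
    thus ?case by (simp add: YS)
  qed
  \<comment> \<open>The exact partial sum of the geometric series is what makes the induction on
    \<open>k\<close> close.\<close>
  have tele: "\<bar>Y (n + k) t - Y n t\<bar> \<le> (2 * D0 / 2 ^ n - 2 * D0 / 2 ^ (n + k)) * wt t" if "t \<in> {0..R}" for n k t
  proof (induction k)
    case (Suc k)
    have "\<bar>Y (n + Suc k) t - Y n t\<bar> \<le> \<bar>Y (Suc (n + k)) t - Y (n + k) t\<bar> + \<bar>Y (n + k) t - Y n t\<bar>" by simp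
    also have "\<dots> \<le> D0 / 2 ^ (n + k) * wt t + (2 * D0 / 2 ^ n - 2 * D0 / 2 ^ (n + k)) * wt t"
      by (intro add_mono step that Suc)
    also have "\<dots> = (2 * D0 / 2 ^ n - 2 * D0 / 2 ^ (n + Suc k)) * wt t" by (simp add: algebra_simps)
    finally show ?case .
  qed simp
  have tele': "\<bar>Y k t - Y n t\<bar> \<le> 2 * D0 / 2 ^ n * wt t" if "t \<in> {0..R}" "n \<le> k" for n k t
  proof -
    have "\<bar>Y (n + (k - n)) t - Y n t\<bar> \<le> (2 * D0 / 2 ^ n - 2 * D0 / 2 ^ (n + (k - n))) * wt t" by (rule tele[OF that(1)])
    also have "\<dots> \<le> 2 * D0 / 2 ^ n * wt t" using D0 wt_pos[of t] by (intro mult_right_mono) auto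
    finally show ?thesis using that by simp
  qed
  have to0: "(\<lambda>n. 2 * D0 / 2 ^ n * C) \<longlonglongrightarrow> 0" for C
  proof -
    have "(\<lambda>n. 2 * D0 * C * inverse (2 ^ n)) \<longlonglongrightarrow> 2 * D0 * C * 0" by (intro tendsto_intros LIMSEQ_inverse_realpow_zero) simp
    thus ?thesis by (simp add: divide_inverse mult_ac)
  qed
  have "uniformly_Cauchy_on {0..R} Y"
    unfolding uniformly_Cauchy_on_def
  proof (intro allI impI)
    fix e :: real assume "e > 0"
    then obtain M where M: "2 * D0 / 2 ^ M * wt R < e / 2"
      using order_tendstoD(2)[OF to0[of "wt R"], of "e / 2"] by (auto simp: eventually_sequentially)
    have "dist (Y n t) (Y M t) < e / 2" if "t \<in> {0..R}" "M \<le> n" for n t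
    proof -
      have "\<bar>Y n t - Y M t\<bar> \<le> 2 * D0 / 2 ^ M * wt t" by (rule tele'[OF that])
      also have "\<dots> \<le> 2 * D0 / 2 ^ M * wt R" using that D0 by (intro mult_left_mono wt_mono) auto
      finally show ?thesis using M by (simp add: dist_real_def)
    qed
    note h = this
    have "dist (Y n t) (Y k t) < e" if t: "t \<in> {0..R}" "M \<le> n" "M \<le> k" for n k t
      by (rule dist_triangle_half_l[OF h[OF t(1,2)] h[OF t(1,3)]])
    thus "\<exists>M. \<forall>x\<in>{0..R}. \<forall>m\<ge>M. \<forall>n\<ge>M. dist (Y m x) (Y n x) < e" by blast
  qed
  then obtain U where U: "uniform_limit {0..R} Y U sequentially"
    using Cauchy_uniformly_convergent[of "{0..R}" Y] unfolding uniformly_convergent_on_def by auto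
  have cU: "continuous_on {0..R} U" by (rule uniform_limit_theorem[OF always_eventually U]) (auto intro: c)
  have UY: "\<bar>U t - Y n t\<bar> \<le> 2 * D0 / 2 ^ n * wt t" if "t \<in> {0..R}" for n t
  proof (rule LIMSEQ_le_const2)
    show "(\<lambda>k. \<bar>Y k t - Y n t\<bar>) \<longlonglongrightarrow> \<bar>U t - Y n t\<bar>" by (intro tendsto_intros tendsto_uniform_limitI[OF U that])
    show "\<exists>N. \<forall>k\<ge>N. \<bar>Y k t - Y n t\<bar> \<le> 2 * D0 / 2 ^ n * wt t" using tele'[OF that] by blast
  qed
  have "U r = Phi a U r" if r: "r \<in> {0..R}" for r
  proof -
    have "\<bar>U r - Phi a U r\<bar> \<le> 2 * D0 / 2 ^ n * (2 * wt r)" for n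
    proof -
      have "\<bar>Phi a U r - Phi a (Y n) r\<bar> \<le> \<bar>a - a\<bar> + 2 * D0 / 2 ^ n / 2 * wt r"
        by (rule Phi_contracts[OF cU c _ UY r]) (use D0 in auto)
      moreover have "\<bar>U r - Y (Suc n) r\<bar> \<le> 2 * D0 / 2 ^ Suc n * wt r" by (rule UY[OF r])
      moreover have "2 * D0 / 2 ^ Suc n * wt r = 2 * D0 / 2 ^ n / 2 * wt r" by simp
      moreover have "0 \<le> 2 * D0 / 2 ^ n * wt r" using D0 wt_pos[of r] by simp
      ultimately show ?thesis unfolding YS by simp
    qed
    hence "\<bar>U r - Phi a U r\<bar> \<le> 0" by (intro LIMSEQ_le_const[OF to0[of "2 * wt r"]]) blast
    thus ?thesis by simp
  qed
  with cU show ?thesis by (auto simp: fixpt_def)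
qed

end

lemma eq_by_deriv:
  fixes h1 h2 :: "real \<Rightarrow> real"
  assumes "continuous_on {0..R} h1" "continuous_on {0..R} h2" "h1 0 = h2 0"
    and "\<And>r. 0 < r \<Longrightarrow> r < R \<Longrightarrow> (h1 has_real_derivative d r) (at r)"
    and "\<And>r. 0 < r \<Longrightarrow> r < R \<Longrightarrow> (h2 has_real_derivative d r) (at r)"
    and r: "r \<in> {0..R}"
  shows "h1 r = h2 r"
proof -
  have c: "continuous_on {0..r} (\<lambda>r. h1 r - h2 r)"
    using r by (intro continuous_intros continuous_on_subset[OF assms(1)] continuous_on_subset[OF assms(2)]) auto
  have d: "((\<lambda>r. h1 r - h2 r) has_real_derivative 0) (at w)" if "0 < w" "w < r" for w
    using DERIV_diff[OF assms(4,5), of w] that r by auto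
  have "h1 0 - h2 0 \<le> h1 r - h2 r" "h1 r - h2 r \<le> h1 0 - h2 0"
    using le_by_deriv_open[OF _ c d] ge_by_deriv_open[OF _ c d] r by auto
  thus ?thesis using assms(3) by simp
qed

lemma joint_continuity:
  fixes G :: "real \<Rightarrow> real \<Rightarrow> real"
  assumes G: "\<And>a. a \<in> A \<Longrightarrow> continuous_on B (G a)"
    and Lip: "\<And>a a' r. a \<in> A \<Longrightarrow> a' \<in> A \<Longrightarrow> r \<in> B \<Longrightarrow> \<bar>G a r - G a' r\<bar> \<le> C * \<bar>a - a'\<bar>"
  shows "continuous_on (A \<times> B) (\<lambda>p. G (fst p) (snd p))"
  unfolding continuous_on_def
proof
  fix p assume p: "p \<in> A \<times> B"
  define a r where "a = fst p" and "r = snd p"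
  have ar: "a \<in> A" "r \<in> B" using p by (auto simp: a_def r_def)
  let ?F = "at p within A \<times> B"
  have ft: "((\<lambda>x. fst x) \<longlongrightarrow> a) ?F" "((\<lambda>x. snd x) \<longlongrightarrow> r) ?F" unfolding a_def r_def by (auto intro!: tendsto_intros)
  have evm: "\<forall>\<^sub>F x in ?F. x \<in> A \<times> B" by (simp add: eventually_at_filter)
  have 1: "((\<lambda>x. G a (snd x)) \<longlongrightarrow> G a r) ?F"
    by (rule continuous_on_tendsto_compose[OF G[OF ar(1)] ft(2) ar(2)]) (use evm in \<open>auto elim: eventually_mono\<close>)
  have 2: "((\<lambda>x. C * \<bar>fst x - a\<bar>) \<longlongrightarrow> 0) ?F"
    using tendsto_mult[OF tendsto_const tendsto_rabs[OF tendsto_diff[OF ft(1) tendsto_const]], of C a] by simp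
  have "((\<lambda>x. G (fst x) (snd x) - G a (snd x)) \<longlongrightarrow> 0) ?F"
    by (rule Lim_null_comparison[OF _ 2]) (use evm in \<open>auto elim!: eventually_mono intro!: Lip ar\<close>)
  from tendsto_add[OF this 1] show "((\<lambda>p. G (fst p) (snd p)) \<longlongrightarrow> G (fst p) (snd p)) ?F"
    by (simp add: a_def r_def)
qed

section \<open>Profiles as rescaled solutions of the initial value problem\<close>

context mems
begin

text \<open>Outside \<open>{c..1}\<close> the function \<open>1 / f\<close> is continued by
  constants, which makes it bounded and Lipschitz. Solutions with \<open>c \<le> a\<close> do not
  notice this before they reach 1, and a single \<open>c\<close> serves all
  \<open>a \<ge> c\<close>.\<close>

definition "Fc c u = 1 / f (max c (min u 1))"

lemma Fc_eq: "c \<le> u \<Longrightarrow> u \<le> 1 \<Longrightarrow> Fc c u = 1 / f u" by (simp add: Fc_def)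

lemma Fc_picard:
  assumes c: "0 < c" "c < 1"
  obtains L where "picard \<alpha> \<beta> \<gamma> (Fc c) (1 / f 1) (1 / f c) L"
proof -
  have "continuous_on {c..1} (deriv f)"
    by (rule has_derivative_imp_continuous_on[OF f'_deriv]) (use c in auto)
  hence "bounded (deriv f ` {c..1})" by (intro compact_imp_bounded compact_continuous_image) auto
  then obtain B where B: "\<forall>x\<in>{c..1}. \<bar>deriv f x\<bar> \<le> B" by (auto simp: bounded_real)
  have fc: "f c > 0" using f_pos c by simp
  define cl where "cl u = max c (min u 1)" for u
  have cl: "c \<le> cl u" "cl u \<le> 1" for u using c by (auto simp: cl_def)
  have clL: "\<bar>cl u - cl v\<bar> \<le> \<bar>u - v\<bar>" for u v by (auto simp: cl_def max_def min_def)
  have fl: "f c \<le> f (cl u)" "f (cl u) \<le> f 1" "f (cl u) > 0" for u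
    using f_mono[of c "cl u"] f_mono[of "cl u" 1] cl[of u] c fc by auto
  have fLip: "\<bar>f x - f y\<bar> \<le> B * \<bar>x - y\<bar>" if "c \<le> x" "x \<le> 1" "c \<le> y" "y \<le> 1" for x y
  proof -
    have "norm (f x - f y) \<le> B * norm (x - y)"
    proof (rule field_differentiable_bound[of "{c..1}" f "deriv f"])
      show "(f has_field_derivative deriv f z) (at z within {c..1})" if "z \<in> {c..1}" for z
        by (rule has_field_derivative_at_within[OF f_deriv]) (use that c in auto)
    qed (use that B in auto)
    thus ?thesis by simp
  qed
  have B0: "0 \<le> B" using bspec[OF B, of 1] c by (auto intro: order_trans[OF abs_ge_zero])
  define L where "L = (B + 1) / (f c * f c)"
  have Fcl: "Fc c u = 1 / f (cl u)" for u by (simp add: Fc_def cl_def)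
  have "picard \<alpha> \<beta> \<gamma> (Fc c) (1 / f 1) (1 / f c) L"
  proof
    show "continuous_on UNIV (Fc c)"
    proof -
      have cf: "continuous_on {c..1} f" by (rule has_derivative_imp_continuous_on[OF f_deriv]) (use c in auto)
      have ccl: "continuous_on UNIV cl" unfolding cl_def by (intro continuous_intros)
      have "continuous_on UNIV (\<lambda>u. f (cl u))" by (rule continuous_on_compose2[OF cf ccl]) (use cl in auto)
      thus ?thesis unfolding Fcl using fl(3) by (intro continuous_intros) (auto simp: less_imp_neq[symmetric])
    qed
    show "1 / f 1 \<le> Fc c u" for u unfolding Fcl using fl(2,3)[of u] by (intro divide_left_mono) (auto intro!: mult_pos_pos f_pos)
    show "Fc c u \<le> 1 / f c" for u unfolding Fcl using fl(1,3)[of u] fc by (intro divide_left_mono) auto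
    show "1 / f 1 > 0" using f_pos by simp
    show "L > 0" using B0 fc by (simp add: L_def)
    show "\<bar>Fc c u - Fc c v\<bar> \<le> L * \<bar>u - v\<bar>" for u v
    proof -
      have "Fc c u - Fc c v = (f (cl v) - f (cl u)) / (f (cl u) * f (cl v))"
        unfolding Fcl using fl(3)[of u] fl(3)[of v] by (simp add: field_simps)
      hence "\<bar>Fc c u - Fc c v\<bar> = \<bar>f (cl v) - f (cl u)\<bar> / (f (cl u) * f (cl v))" using fl(3)[of u] fl(3)[of v] by (simp add: abs_mult)
      also have "\<dots> \<le> (B * \<bar>u - v\<bar>) / (f c * f c)"
      proof (rule frac_le)
        have "B * \<bar>cl v - cl u\<bar> \<le> B * \<bar>u - v\<bar>" using clL[of v u] B0 by (intro mult_left_mono) (auto simp: abs_minus_commute)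
        thus "\<bar>f (cl v) - f (cl u)\<bar> \<le> B * \<bar>u - v\<bar>" using fLip[OF cl cl, of v u] by linarith
        show "f c * f c \<le> f (cl u) * f (cl v)" using fl fc by (intro mult_mono) (auto intro: less_imp_le)
      qed (use B0 fc in auto)
      also have "\<dots> \<le> ((B + 1) * \<bar>u - v\<bar>) / (f c * f c)" using fc by (intro divide_right_mono mult_right_mono) auto
      finally show ?thesis by (simp add: L_def)
    qed
  qed
  thus thesis by (rule that)
qed

abbreviation "FIX c \<equiv> picard.fixpt \<alpha> \<beta> \<gamma> (Fc c)"
abbreviation "PIc c \<equiv> picard.PI \<gamma> (Fc c)"

text \<open>Each fixed point satisfies \<open>U' \<ge> K * r powr (\<theta> - 1)\<close> with
  \<open>K = (1 / f 1 / \<gamma>) powr (1 / \<beta>)\<close>. At \<open>Rm\<close> the integral of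
  this bound is 1, so that \<open>U\<close> has exceeded 1 there, uniformly in
  \<open>a\<close>.\<close>

definition "Rm = (\<theta> * (\<gamma> * f 1) powr (1 / \<beta>)) powr (1 / \<theta>)"

lemma Rm: "Rm > 0" "Rm powr \<theta> = \<theta> * (\<gamma> * f 1) powr (1 / \<beta>)"
proof -
  have "\<theta> * (\<gamma> * f 1) powr (1 / \<beta>) > 0" using par_facts f_pos[of 1] by simp
  thus "Rm > 0" "Rm powr \<theta> = \<theta> * (\<gamma> * f 1) powr (1 / \<beta>)" using par_facts by (auto simp: Rm_def powr_powr)
qed

lemma fix_shape:
  assumes c: "0 < c" "c < 1" and U: "FIX c Rm a U" and a: "c \<le> a" "a < 1"
  shows "U 0 = a" "\<And>x y. 0 \<le> x \<Longrightarrow> x < y \<Longrightarrow> y \<le> Rm \<Longrightarrow> U x < U y" "1 < U Rm" "continuous_on {0..Rm} U"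
    "\<And>r. 0 < r \<Longrightarrow> r < Rm \<Longrightarrow> (U has_real_derivative picard.VV \<alpha> \<beta> \<gamma> (Fc c) U r) (at r)"
proof -
  obtain L where "picard \<alpha> \<beta> \<gamma> (Fc c) (1 / f 1) (1 / f c) L" using Fc_picard[OF c] .
  then interpret P: picard \<alpha> \<beta> \<gamma> "Fc c" "1 / f 1" "1 / f c" L .
  show cU: "continuous_on {0..Rm} U" using U by (simp add: P.fixpt_def)
  have eq: "U r = P.Phi a U r" if "r \<in> {0..Rm}" for r using U that by (auto simp: P.fixpt_def)
  show U0: "U 0 = a" using eq[of 0] Rm by (simp add: P.Phi_def)
  show d: "(U has_real_derivative P.VV U r) (at r)" if r: "0 < r" "r < Rm" for r
    by (rule has_field_derivative_transform_within_open[OF P.Phi_deriv[OF cU r], of "{0<..<Rm}" a]) (use r eq in auto)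
  have lo: "(1 / f 1 / \<gamma>) powr (1 / \<beta>) * r powr (\<theta> - 1) \<le> P.VV U r" "0 < P.VV U r" if r: "0 < r" "r < Rm" for r
  proof -
    show *: "(1 / f 1 / \<gamma>) powr (1 / \<beta>) * r powr (\<theta> - 1) \<le> P.VV U r" using P.VV_bounds(1)[OF cU, of r] r by simp
    have "0 < (1 / f 1 / \<gamma>) powr (1 / \<beta>) * r powr (\<theta> - 1)" using r f_pos[of 1] par_facts by simp
    thus "0 < P.VV U r" using * by linarith
  qed
  show "U x < U y" if "0 \<le> x" "x < y" "y \<le> Rm" for x y
  proof (rule DERIV_pos_imp_increasing_open[OF that(2)])
    show "continuous_on {x..y} U" by (rule continuous_on_subset[OF cU]) (use that in auto)
    show "\<exists>e. (U has_real_derivative e) (at u) \<and> 0 < e" if "x < u" "u < y" for u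
      using d[of u] lo(2)[of u] that \<open>0 \<le> x\<close> \<open>y \<le> Rm\<close> by force
  qed
  define K where "K = (1 / f 1 / \<gamma>) powr (1 / \<beta>)"
  have "U 0 - K / \<theta> * 0 powr \<theta> \<le> U Rm - K / \<theta> * Rm powr \<theta>"
  proof (rule le_by_deriv_open[where h = "\<lambda>r. U r - K / \<theta> * r powr \<theta>" and h' = "\<lambda>r. P.VV U r - K / \<theta> * (\<theta> * r powr (\<theta> - 1))"])
    show "continuous_on {0..Rm} (\<lambda>r. U r - K / \<theta> * r powr \<theta>)" using par_facts by (intro continuous_intros cU P.powr_cont) auto
    fix r assume r: "0 < r" "r < Rm"
    show "((\<lambda>r. U r - K / \<theta> * r powr \<theta>) has_real_derivative P.VV U r - K / \<theta> * (\<theta> * r powr (\<theta> - 1))) (at r)"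
      by (intro DERIV_diff DERIV_cmult d r has_real_derivative_powr)
    show "0 \<le> P.VV U r - K / \<theta> * (\<theta> * r powr (\<theta> - 1))" using lo(1)[OF r] par_facts by (simp add: K_def)
  qed (use Rm in simp)
  moreover have "K / \<theta> * Rm powr \<theta> = 1"
  proof -
    have "K * (\<gamma> * f 1) powr (1 / \<beta>) = ((1 / f 1 / \<gamma>) * (\<gamma> * f 1)) powr (1 / \<beta>)"
      unfolding K_def using f_pos[of 1] par_facts by (subst powr_mult) auto
    also have "(1 / f 1 / \<gamma>) * (\<gamma> * f 1) = 1" using f_pos[of 1] par_facts by simp
    finally have "K * (\<gamma> * f 1) powr (1 / \<beta>) = 1" by simp
    thus ?thesis unfolding Rm(2) using par_facts(9) by simp
  qed
  ultimately show "1 < U Rm" using U0 a c by simp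
qed

text \<open>\<open>R\<close> is the radius with \<open>U R = 1\<close>, and scaling by
  \<open>R\<close> moves it to \<open>s = 1\<close>; counting powers of \<open>R\<close> in the two
  equations gives \<open>lam = R powr \<kappa>\<close> and the factor of \<open>P\<close>.\<close>

lemma fix_prof:
  assumes c: "0 < c" "c < 1" and U: "FIX c Rm a U" and a: "c \<le> a" "a < 1"
  shows "\<exists>R. 0 < R \<and> R < Rm \<and> U R = 1 \<and> prof (R powr \<kappa>) a (\<lambda>s. U (R * s)) (\<lambda>s. R powr (\<beta> - \<alpha>) * PIc c U (R * s))"
proof -
  obtain L where "picard \<alpha> \<beta> \<gamma> (Fc c) (1 / f 1) (1 / f c) L" using Fc_picard[OF c] .
  then interpret P: picard \<alpha> \<beta> \<gamma> "Fc c" "1 / f 1" "1 / f c" L .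
  note S = fix_shape[OF c U a]
  obtain R where R: "0 \<le> R" "R \<le> Rm" "U R = 1"
    using IVT'[of U 0 1 Rm] S(1,3,4) a Rm by auto
  have R': "0 < R" "R < Rm" using R S(1,3) a by (auto simp: less_le)
  have img: "R * s \<in> {0..R}" if "s \<in> {0..1}" for s using that R' by (auto simp: mult_le_cancel_left1)
  have cs: "continuous_on {0..1} (\<lambda>s. R * s)" by (intro continuous_intros)
  have sub: "(\<lambda>s. R * s) ` {0..1} \<subseteq> {0..Rm}"
  proof (rule image_subsetI)
    fix s :: real assume "s \<in> {0..1}"
    from img[OF this] show "R * s \<in> {0..Rm}" using R' unfolding atLeastAtMost_iff by linarith
  qed
  have cP: "continuous_on {0..Rm} (P.PI U)" by (rule P.PI_cont[OF S(4)])
  have rng: "c \<le> U r" "U r \<le> 1" if "r \<in> {0..R}" for r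
  proof -
    show "c \<le> U r" using S(2)[of 0 r] that R' S(1) a by (cases "r = 0") auto
    show "U r \<le> 1" using S(2)[of r R] that R' R(3) by (cases "r = R") auto
  qed
  have PIpos: "P.PI U r > 0" if "0 < r" "r \<le> R" for r
  proof -
    have "0 < 1 / f 1 / \<gamma> * r powr \<gamma>" using that f_pos[of 1] par_facts by simp
    thus ?thesis using P.PI_bounds(1)[OF S(4), of r] that R' by simp
  qed
  have "prof (R powr \<kappa>) a (\<lambda>s. U (R * s)) (\<lambda>s. R powr (\<beta> - \<alpha>) * P.PI U (R * s))"
    unfolding prof_def
  proof (intro conjI ballI)
    show "continuous_on {0..1} (\<lambda>s. U (R * s))" by (rule continuous_on_compose2[OF S(4) cs sub])
    have "continuous_on {0..1} (\<lambda>s. P.PI U (R * s))" by (rule continuous_on_compose2[OF cP cs sub])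
    thus "continuous_on {0..1} (\<lambda>s. R powr (\<beta> - \<alpha>) * P.PI U (R * s))" by (intro continuous_intros)
    fix s :: real assume "s \<in> {0<..1}"
    hence "0 < R * s" "R * s \<le> R" using R' by (auto simp: mult_le_cancel_left1)
    thus "0 < R powr (\<beta> - \<alpha>) * P.PI U (R * s)" using PIpos R' by simp
  next
    fix s :: real assume "s \<in> {0<..<1}"
    hence s: "0 < s" "s < 1" by auto
    hence r: "0 < R * s" "R * s < R" using R' by auto
    hence r: "0 < R * s" "R * s < R" "R * s < Rm" using R' by linarith+
    have dm: "((\<lambda>s. R * s) has_real_derivative R) (at s)" using DERIV_cmult[OF DERIV_ident, of R s] by simp
    have pp: "P.PI U (R * s) > 0" by (rule PIpos[OF r(1) less_imp_le[OF r(2)]])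
    have "R * P.VV U (R * s) = exp ((ln (R powr (\<beta> - \<alpha>) * P.PI U (R * s)) - \<alpha> * ln s) / \<beta>)"
    proof -
      have "R * P.VV U (R * s) > 0" unfolding P.VV_def using pp R' s by simp
      moreover have "ln (R * P.VV U (R * s)) = ln R + ((\<theta> - 1) * (ln R + ln s) + (ln (P.PI U (R * s)) - \<gamma> * (ln R + ln s)) / \<beta>)"
      proof -
        have "ln (P.PI U (R * s) * (R * s) powr - \<gamma>) = ln (P.PI U (R * s)) - \<gamma> * (ln R + ln s)"
          using pp R' s by (simp add: ln_mult ln_powr)
        moreover have "P.PI U (R * s) * (R * s) powr - \<gamma> > 0" using pp R' s by simp
        moreover have "ln (R * ((R * s) powr (\<theta> - 1) * x powr (1 / \<beta>))) = ln R + ((\<theta> - 1) * (ln R + ln s) + ln x / \<beta>)" if "x > 0" for x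
          using R' s that by (simp add: ln_mult ln_powr)
        ultimately show ?thesis unfolding P.VV_def by (simp only:)
      qed
      moreover have "ln R + ((\<theta> - 1) * (ln R + ln s) + (ln (P.PI U (R * s)) - \<gamma> * (ln R + ln s)) / \<beta>)
         = (((\<beta> - \<alpha>) * ln R + ln (P.PI U (R * s))) - \<alpha> * ln s) / \<beta>"
        using par_facts(1) by (simp add: \<theta>_def \<kappa>_def field_simps)
      moreover have "ln (R powr (\<beta> - \<alpha>) * P.PI U (R * s)) = (\<beta> - \<alpha>) * ln R + ln (P.PI U (R * s))"
        using pp R' by (simp add: ln_mult ln_powr)
      ultimately show ?thesis by (metis exp_ln)
    qed
    thus "((\<lambda>s. U (R * s)) has_real_derivative exp ((ln (R powr (\<beta> - \<alpha>) * P.PI U (R * s)) - \<alpha> * ln s) / \<beta>)) (at s)"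
      using DERIV_chain2[OF S(5)[OF r(1,3)] dm] by (simp add: mult.commute)
    have F: "Fc c (U (R * s)) = 1 / f (U (R * s))" using rng[OF img[of s]] s by (intro Fc_eq) auto
    have "R powr (\<beta> - \<alpha>) * ((R * s) powr (\<gamma> - 1) * Fc c (U (R * s)) * R) = R powr \<kappa> * s powr (\<gamma> - 1) / f (U (R * s))"
    proof -
      have "R powr (\<beta> - \<alpha>) * R powr (\<gamma> - 1) * R powr 1 = R powr \<kappa>" unfolding powr_add[symmetric] by (simp add: \<kappa>_def algebra_simps)
      hence "R powr (\<beta> - \<alpha>) * R powr (\<gamma> - 1) * R = R powr \<kappa>" using R' by simp
      moreover have "(R * s) powr (\<gamma> - 1) = R powr (\<gamma> - 1) * s powr (\<gamma> - 1)" using R' s by (simp add: powr_mult)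
      ultimately show ?thesis unfolding F by (simp add: mult_ac)
    qed
    moreover have "((\<lambda>s. R powr (\<beta> - \<alpha>) * P.PI U (R * s)) has_real_derivative R powr (\<beta> - \<alpha>) * ((R * s) powr (\<gamma> - 1) * Fc c (U (R * s)) * R)) (at s)"
      by (intro DERIV_cmult DERIV_chain2[OF P.PI_deriv[OF S(4) r(1,3)] dm])
    ultimately show "((\<lambda>s. R powr (\<beta> - \<alpha>) * P.PI U (R * s)) has_real_derivative R powr \<kappa> * s powr (\<gamma> - 1) / f (U (R * s))) (at s)" by simp
  qed (use R R' S(1) a c P.PI_0 in auto)
  thus ?thesis using R R' by blast
qed

text \<open>The converse scaling. The second statement expresses \<open>P\<close> through the fixed
  point, so that continuity of \<open>P\<close> in \<open>a\<close> can be deduced from that of the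
  fixed points.\<close>

lemma prof_fix:
  assumes p: "prof lam a w P" and c: "0 < c" "c < 1" "c \<le> a"
  defines "R \<equiv> lam powr (1 / \<kappa>)"
  shows "FIX c R a (\<lambda>r. w (r / R))" "\<And>s. s \<in> {0..1} \<Longrightarrow> P s = R powr (\<beta> - \<alpha>) * PIc c (\<lambda>r. w (r / R)) (R * s)"
proof -
  obtain L where "picard \<alpha> \<beta> \<gamma> (Fc c) (1 / f 1) (1 / f c) L" using Fc_picard[OF c(1,2)] .
  then interpret P: picard \<alpha> \<beta> \<gamma> "Fc c" "1 / f 1" "1 / f c" L .
  note D = profD[OF p]
  have R: "R > 0" "R powr \<kappa> = lam" using D(1) par_facts by (auto simp: R_def powr_powr)
  define U where "U r = w (r / R)" for r
  have img: "r / R \<in> {0..1}" if "r \<in> {0..R}" for r using that R by (auto simp: divide_le_eq)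
  have cs: "continuous_on {0..R} (\<lambda>r. r / R)" using R by (intro continuous_intros) auto
  have cU: "continuous_on {0..R} U" unfolding U_def by (rule continuous_on_compose2[OF D(4) cs]) (use img in auto)
  have cP: "continuous_on {0..R} (\<lambda>r. R powr (\<alpha> - \<beta>) * P (r / R))"
    by (intro continuous_intros continuous_on_compose2[OF D(7) cs]) (use img in auto)
  have dm: "((\<lambda>r. r / R) has_real_derivative 1 / R) (at r)" for r using DERIV_cdivide[OF DERIV_ident, of R] by simp
  have PIeq: "P.PI U r = R powr (\<alpha> - \<beta>) * P (r / R)" if r: "r \<in> {0..R}" for r
  proof (rule eq_by_deriv[OF P.PI_cont[OF cU] cP _ P.PI_deriv[OF cU] _ r])
    fix r assume r: "0 < r" "r < R"
    hence s: "0 < r / R" "r / R < 1" using R by auto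
    have F: "Fc c (U r) = 1 / f (w (r / R))" unfolding U_def
      using prof_range[OF p, of "r / R"] s c by (intro Fc_eq) auto
    have "R powr (\<alpha> - \<beta>) * (lam * (r / R) powr (\<gamma> - 1) / f (w (r / R)) * (1 / R)) = r powr (\<gamma> - 1) * Fc c (U r)"
    proof -
      have "R powr (\<alpha> - \<beta>) * R powr \<kappa> * R powr - (\<gamma> - 1) * R powr - 1 = R powr 0"
        unfolding powr_add[symmetric] by (simp add: \<kappa>_def algebra_simps)
      hence 1: "R powr (\<alpha> - \<beta>) * lam * R powr - (\<gamma> - 1) / R = 1" using R by (simp add: powr_minus divide_inverse)
      have "(r / R) powr (\<gamma> - 1) = r powr (\<gamma> - 1) / R powr (\<gamma> - 1)" using r R by (simp add: powr_divide)
      also have "\<dots> = r powr (\<gamma> - 1) * R powr - (\<gamma> - 1)" by (simp only: powr_minus divide_inverse)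
      finally have "(r / R) powr (\<gamma> - 1) = r powr (\<gamma> - 1) * R powr - (\<gamma> - 1)" .
      hence "R powr (\<alpha> - \<beta>) * (lam * (r / R) powr (\<gamma> - 1) / f (w (r / R)) * (1 / R))
         = (R powr (\<alpha> - \<beta>) * lam * R powr - (\<gamma> - 1) / R) * (r powr (\<gamma> - 1) / f (w (r / R)))"
        by (simp only:) (simp add: mult_ac)
      thus ?thesis unfolding 1 F by simp
    qed
    moreover have "((\<lambda>r. R powr (\<alpha> - \<beta>) * P (r / R)) has_real_derivative R powr (\<alpha> - \<beta>) * (lam * (r / R) powr (\<gamma> - 1) / f (w (r / R)) * (1 / R))) (at r)"
      by (intro DERIV_cmult DERIV_chain2[OF D(11)[OF s] dm])
    ultimately show "((\<lambda>r. R powr (\<alpha> - \<beta>) * P (r / R)) has_real_derivative r powr (\<gamma> - 1) * Fc c (U r)) (at r)" by simp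
  qed (use D(8) in \<open>auto simp: P.PI_0\<close>)
  have "U r = P.Phi a U r" if r: "r \<in> {0..R}" for r
  proof (rule eq_by_deriv[OF cU P.Phi_cont[OF cU] _ _ P.Phi_deriv[OF cU] r])
    fix r assume r: "0 < r" "r < R"
    hence s: "0 < r / R" "r / R < 1" using R by auto
    have Ps: "P (r / R) > 0" using D(9) s by simp
    have PI: "P.PI U r = R powr (\<alpha> - \<beta>) * P (r / R)" using PIeq r by simp
    have "exp ((ln (P (r / R)) - \<alpha> * ln (r / R)) / \<beta>) * (1 / R) = P.VV U r"
    proof -
      have "P.VV U r > 0" unfolding P.VV_def PI using Ps R r by simp
      moreover have "ln (P.VV U r) = (\<theta> - 1) * ln r + ((\<alpha> - \<beta>) * ln R + ln (P (r / R)) - \<gamma> * ln r) / \<beta>"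
      proof -
        have "ln (R powr (\<alpha> - \<beta>) * P (r / R) * r powr - \<gamma>) = (\<alpha> - \<beta>) * ln R + ln (P (r / R)) - \<gamma> * ln r"
          using Ps R r by (simp add: ln_mult ln_powr)
        moreover have "R powr (\<alpha> - \<beta>) * P (r / R) * r powr - \<gamma> > 0" using Ps R r by simp
        moreover have "ln (r powr (\<theta> - 1) * x powr (1 / \<beta>)) = (\<theta> - 1) * ln r + ln x / \<beta>" if "x > 0" for x
          using r that by (simp add: ln_mult ln_powr)
        ultimately show ?thesis unfolding P.VV_def PI by (simp only:)
      qed
      moreover have "(\<theta> - 1) * ln r + ((\<alpha> - \<beta>) * ln R + ln (P (r / R)) - \<gamma> * ln r) / \<beta> = (ln (P (r / R)) - \<alpha> * (ln r - ln R)) / \<beta> - ln R"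
        using par_facts(1) by (simp add: \<theta>_def \<kappa>_def field_simps)
      moreover have "ln (r / R) = ln r - ln R" using r R by (simp add: ln_div)
      moreover have "exp ((ln (P (r / R)) - \<alpha> * (ln r - ln R)) / \<beta> - ln R) = exp ((ln (P (r / R)) - \<alpha> * (ln r - ln R)) / \<beta>) * (1 / R)"
        using R by (simp add: exp_diff)
      ultimately show ?thesis by (metis exp_ln)
    qed
    thus "(U has_real_derivative P.VV U r) (at r)"
      unfolding U_def[abs_def] using DERIV_chain2[OF D(10)[OF s] dm] by (simp add: U_def[abs_def])
  qed (use D(5) in \<open>auto simp: U_def P.Phi_def\<close>)
  with cU have "P.fixpt R a U" by (auto simp: P.fixpt_def)
  thus "FIX c R a (\<lambda>r. w (r / R))" by (simp add: U_def[abs_def])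
  fix s :: real assume s: "s \<in> {0..1}"
  hence "R * s \<in> {0..R}" using R by (auto simp: mult_le_cancel_left1)
  from PIeq[OF this] have "P.PI U (R * s) = R powr (\<alpha> - \<beta>) * P s" using R by simp
  moreover have "R powr (\<beta> - \<alpha>) * R powr (\<alpha> - \<beta>) = 1" using R by (simp flip: powr_add)
  ultimately show "P s = R powr (\<beta> - \<alpha>) * PIc c (\<lambda>r. w (r / R)) (R * s)"
    by (simp add: U_def[abs_def] mult.assoc[symmetric])
qed

lemma fixpt_restrict: "FIX c R a U \<Longrightarrow> R' \<le> R \<Longrightarrow> 0 < c \<Longrightarrow> c < 1 \<Longrightarrow> FIX c R' a U"
proof -
  assume U: "FIX c R a U" "R' \<le> R" and c: "0 < c" "c < 1"
  obtain L where "picard \<alpha> \<beta> \<gamma> (Fc c) (1 / f 1) (1 / f c) L" using Fc_picard[OF c(1,2)] .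
  then interpret P: picard \<alpha> \<beta> \<gamma> "Fc c" "1 / f 1" "1 / f c" L .
  show ?thesis using U by (auto simp: P.fixpt_def intro: continuous_on_subset)
qed

lemma fixpt_unique:
  assumes c: "0 < c" "c < 1" and U: "FIX c R a U" and V: "FIX c R a V" and r: "r \<in> {0..R}"
  shows "U r = V r"
proof -
  obtain L where "picard \<alpha> \<beta> \<gamma> (Fc c) (1 / f 1) (1 / f c) L" using Fc_picard[OF c(1,2)] .
  then interpret P: picard \<alpha> \<beta> \<gamma> "Fc c" "1 / f 1" "1 / f c" L .
  show ?thesis using P.fixpt_Lip[OF U V r] by simp
qed

text \<open>After scaling, both profiles solve the same initial value problem and hence agree on the
  interval of the smaller radius \<open>R1\<close>. So the second one takes the value 1 at
  \<open>R1\<close> too, and by strict monotonicity the radii are equal.\<close>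

lemma prof_unique_aux:
  assumes p1: "prof lam1 a w1 P1" and p2: "prof lam2 a w2 P2" and a: "0 < a" and le: "lam1 \<le> lam2"
  shows "lam1 = lam2 \<and> (\<forall>s\<in>{0..1}. w1 s = w2 s)"
proof -
  define R1 R2 where "R1 = lam1 powr (1 / \<kappa>)" and "R2 = lam2 powr (1 / \<kappa>)"
  have a1: "a < 1" using profD(3)[OF p1] .
  have R: "0 < R1" "R1 \<le> R2" using profD(1)[OF p1] le par_facts by (auto simp: R1_def R2_def powr_mono2)
  have F1: "FIX a R1 a (\<lambda>r. w1 (r / R1))" unfolding R1_def by (rule prof_fix(1)[OF p1 a a1]) simp
  have F2: "FIX a R1 a (\<lambda>r. w2 (r / R2))"
    unfolding R2_def by (rule fixpt_restrict[OF prof_fix(1)[OF p2 a a1 order_refl] _ a a1]) (use R in \<open>simp add: R2_def\<close>)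
  have eq: "w1 (r / R1) = w2 (r / R2)" if "r \<in> {0..R1}" for r
    using fixpt_unique[OF a a1 F1 F2 that] .
  have "w2 (R1 / R2) = 1" using eq[of R1] R profD(6)[OF p1] by simp
  hence "\<not> R1 / R2 < 1" using prof_mono[OF p2 _ _ order_refl, of "R1 / R2"] profD(6)[OF p2] R
    by (metis divide_nonneg_nonneg less_imp_le less_irrefl order_trans)
  hence "\<not> R1 < R2" using R by (simp add: divide_less_eq)
  hence RR: "R1 = R2" using R by linarith
  have "lam1 = R1 powr \<kappa>" "lam2 = R2 powr \<kappa>" using profD(1)[OF p1] profD(1)[OF p2] par_facts by (auto simp: R1_def R2_def powr_powr)
  hence "lam1 = lam2" using RR by simp
  moreover have "w1 s = w2 s" if "s \<in> {0..1}" for s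
    using eq[of "R1 * s"] R RR that by (auto simp: mult_le_cancel_left1)
  ultimately show ?thesis by blast
qed

lemma prof_unique:
  assumes "prof lam1 a w1 P1" "prof lam2 a w2 P2" "0 < a"
  shows "lam1 = lam2" "\<And>s. s \<in> {0..1} \<Longrightarrow> w1 s = w2 s"
proof -
  have "lam1 = lam2 \<and> (\<forall>s\<in>{0..1}. w1 s = w2 s)"
  proof (cases "lam1 \<le> lam2")
    case True thus ?thesis by (rule prof_unique_aux[OF assms])
  next
    case False
    hence "lam2 = lam1 \<and> (\<forall>s\<in>{0..1}. w2 s = w1 s)" by (intro prof_unique_aux[OF assms(2,1,3)]) simp
    thus ?thesis by simp
  qed
  thus "lam1 = lam2" "\<And>s. s \<in> {0..1} \<Longrightarrow> w1 s = w2 s" by auto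
qed

lemma prof_exists:
  assumes "0 < a" "a < 1"
  shows "\<exists>lam w P. prof lam a w P"
proof -
  obtain L where "picard \<alpha> \<beta> \<gamma> (Fc a) (1 / f 1) (1 / f a) L" using Fc_picard[OF assms] .
  then interpret P: picard \<alpha> \<beta> \<gamma> "Fc a" "1 / f 1" "1 / f a" L .
  obtain U where "FIX a Rm a U" using P.fixpt_exists by blast
  from fix_prof[OF assms this order_refl assms(2)] show ?thesis by blast
qed

end

section \<open>The bifurcation curve and its limit\<close>

text \<open>For monotone functions, closeness at the points of a finite grid controls all values in
  between, since the limit varies little from one grid point to the next.\<close>

lemma monotone_pointwise_imp_uniform_limit:
  fixes W :: "'a \<Rightarrow> real \<Rightarrow> real"
  assumes mono: "\<forall>\<^sub>F a in F. mono_on {0..1} (W a)" and cont: "continuous_on {0..1} W0"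
    and lim: "\<And>s. s \<in> {0..1} \<Longrightarrow> ((\<lambda>a. W a s) \<longlongrightarrow> W0 s) F"
  shows "uniform_limit {0..1} W W0 F"
proof (rule uniform_limitI)
  fix e :: real assume e: "e > 0"
  have "uniformly_continuous_on {0..1} W0" by (rule compact_uniformly_continuous[OF cont]) simp
  then obtain d where d: "d > 0" "\<And>x y. x \<in> {0..1} \<Longrightarrow> y \<in> {0..1} \<Longrightarrow> dist y x < d \<Longrightarrow> dist (W0 y) (W0 x) < e / 2"
    unfolding uniformly_continuous_on_def using half_gt_zero[OF e] by metis
  obtain n :: nat where n: "1 / d < real n" using reals_Archimedean2 by blast
  have n0: "0 < real n" using n d by (meson divide_pos_pos less_trans zero_less_one)
  have nd: "1 / real n < d" using n n0 d by (simp add: field_simps)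
  define pt where "pt i = real i / real n" for i
  have pt01: "pt i \<in> {0..1}" if "i \<le> n" for i using that n0 by (auto simp: pt_def)
  have "\<forall>\<^sub>F a in F. \<forall>i\<in>{..n}. dist (W a (pt i)) (W0 (pt i)) < e / 2"
    using e pt01 by (intro eventually_ball_finite ballI tendstoD[OF lim]) auto
  with mono show "\<forall>\<^sub>F a in F. \<forall>x\<in>{0..1}. dist (W a x) (W0 x) < e"
  proof eventually_elim
    case (elim a)
    show ?case
    proof
      fix x :: real assume x: "x \<in> {0..1}"
      \<comment> \<open>At \<open>x = 1\<close> the floor would be \<open>n\<close>, one more than
        \<open>Suc i \<le> n\<close> permits.\<close>
      define i where "i = (if x = 1 then n - 1 else nat \<lfloor>real n * x\<rfloor>)"
      have i: "pt i \<le> x" "x \<le> pt (Suc i)" "Suc i \<le> n"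
      proof -
        have "pt i \<le> x \<and> x \<le> pt (Suc i) \<and> Suc i \<le> n"
        proof (cases "x = 1")
          case True
          thus ?thesis using n0 by (simp add: i_def pt_def Suc_diff_1)
        next
          case False
          have fl: "real i = of_int \<lfloor>real n * x\<rfloor>" using False x n0 by (simp add: i_def)
          have "real n * x < real n * 1" using False x n0 by (intro mult_strict_left_mono) auto
          hence "real i < real n" using of_int_floor_le[of "real n * x"] unfolding fl by linarith
          moreover have "real i \<le> real n * x" "real n * x \<le> real i + 1" unfolding fl by linarith+
          ultimately show ?thesis using n0 by (auto simp: pt_def divide_le_eq le_divide_eq mult.commute)
        qed
        thus "pt i \<le> x" "x \<le> pt (Suc i)" "Suc i \<le> n" by auto
      qed
      have in01: "pt i \<in> {0..1}" "pt (Suc i) \<in> {0..1}" using pt01[of i] pt01[of "Suc i"] i by auto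
      have gap: "pt (Suc i) - pt i < d" using nd by (simp add: pt_def add_divide_distrib)
      have "W a (pt i) \<le> W a x" "W a x \<le> W a (pt (Suc i))"
        using mono_onD[OF elim(1), of "pt i" x] mono_onD[OF elim(1), of x "pt (Suc i)"] in01 x i by auto
      moreover have "dist (W a (pt i)) (W0 (pt i)) < e / 2" "dist (W a (pt (Suc i))) (W0 (pt (Suc i))) < e / 2"
        using elim(2) i by auto
      moreover have "dist (W0 (pt i)) (W0 x) < e / 2" "dist (W0 (pt (Suc i))) (W0 x) < e / 2"
        using d(2)[OF x in01(1)] d(2)[OF x in01(2)] gap i by (auto simp: dist_real_def)
      ultimately show "dist (W a x) (W0 x) < e" unfolding dist_real_def by linarith
    qed
  qed
qed

lemma eventually_at_left_1_iff: "eventually Q (at_left (1::real)) \<longleftrightarrow> eventually (\<lambda>a. Q (1 - a)) (at_right (0::real))"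
proof -
  have "eventually Q (at_left (1::real)) \<longleftrightarrow> (\<exists>b<1. \<forall>y>b. y < 1 \<longrightarrow> Q y)" by (rule eventually_at_left_field)
  also have "\<dots> \<longleftrightarrow> (\<exists>b>0. \<forall>y>0. y < b \<longrightarrow> Q (1 - y))"
  proof
    assume "\<exists>b<1. \<forall>y>b. y < 1 \<longrightarrow> Q y"
    then obtain b where "b < 1" "\<forall>y>b. y < 1 \<longrightarrow> Q y" by blast
    thus "\<exists>b>0. \<forall>y>0. y < b \<longrightarrow> Q (1 - y)" by (intro exI[of _ "1 - b"]) auto
  next
    assume "\<exists>b>0. \<forall>y>0. y < b \<longrightarrow> Q (1 - y)"
    then obtain b where b: "b > 0" "\<And>y. y > 0 \<Longrightarrow> y < b \<Longrightarrow> Q (1 - y)" by blast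
    have "Q y" if "1 - b < y" "y < 1" for y using b(2)[of "1 - y"] that by simp
    thus "\<exists>b<1. \<forall>y>b. y < 1 \<longrightarrow> Q y" using b(1) by (intro exI[of _ "1 - b"]) auto
  qed
  also have "\<dots> \<longleftrightarrow> eventually (\<lambda>a. Q (1 - a)) (at_right (0::real))" by (rule eventually_at_right_field[symmetric])
  finally show ?thesis .
qed

context mems
begin

text \<open>\<open>a = 1 - \<tau>\<close>, so that \<open>\<tau> \<rightarrow> 1\<close> becomes \<open>a \<rightarrow> 0\<close>.\<close>

definition "Lam a = (SOME l. \<exists>w P. prof l a w P)"
definition "Wf a = (SOME w. \<exists>P. prof (Lam a) a w P)"
definition "Pf a = (SOME P. prof (Lam a) a (Wf a) P)"

lemma fam: assumes "0 < a" "a < 1" shows "prof (Lam a) a (Wf a) (Pf a)"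
proof -
  have "\<exists>w P. prof (Lam a) a w P" unfolding Lam_def by (rule someI_ex) (rule prof_exists[OF assms])
  hence "\<exists>P. prof (Lam a) a (Wf a) P" unfolding Wf_def by (rule someI_ex)
  thus ?thesis unfolding Pf_def by (rule someI_ex)
qed

text \<open>For all \<open>a \<ge> c\<close> the same truncation \<open>Fc c\<close> and the same
  interval \<open>{0..Rm}\<close> can be used, so the fixed points \<open>U a\<close> are Lipschitz
  in \<open>a\<close>. The radius \<open>R a\<close> is the place where the increasing function
  \<open>U a\<close> equals 1; its continuity follows by comparing \<open>U\<close> with 1 slightly
  before and after that place.\<close>

lemma fam_cont_local:
  assumes c: "0 < c" "c < 1"
  shows "continuous_on {c..<1} Lam" "continuous_on ({c..<1} \<times> {0..1}) (\<lambda>p. Wf (fst p) (snd p))"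
    "continuous_on ({c..<1} \<times> {0..1}) (\<lambda>p. Pf (fst p) (snd p))"
proof -
  obtain L where "picard \<alpha> \<beta> \<gamma> (Fc c) (1 / f 1) (1 / f c) L" using Fc_picard[OF c] .
  then interpret P: picard \<alpha> \<beta> \<gamma> "Fc c" "1 / f 1" "1 / f c" L .
  define U where "U a = (SOME U. P.fixpt Rm a U)" for a
  have U: "P.fixpt Rm a (U a)" for a unfolding U_def using P.fixpt_exists by (rule someI_ex)
  define R where "R a = Lam a powr (1 / \<kappa>)" for a
  let ?A = "{c..<1}"
  note S = fix_shape[OF c U]
  \<comment> \<open>By uniqueness, the profiles selected by \<open>SOME\<close> are the rescaled
    fixed points \<open>U a\<close>.\<close>
  have link: "0 < R a \<and> R a < Rm \<and> U a (R a) = 1 \<and> Lam a = R a powr \<kappa> \<and> (\<forall>s\<in>{0..1}. Wf a s = U a (R a * s)) \<and>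
      (\<forall>s\<in>{0..1}. Pf a s = R a powr (\<beta> - \<alpha>) * P.PI (U a) (R a * s))" if a: "a \<in> ?A" for a
  proof -
    have a': "c \<le> a" "a < 1" "0 < a" using a c by auto
    obtain R' where R': "0 < R'" "R' < Rm" "U a R' = 1" "prof (R' powr \<kappa>) a (\<lambda>s. U a (R' * s)) (\<lambda>s. R' powr (\<beta> - \<alpha>) * P.PI (U a) (R' * s))"
      using fix_prof[OF c U a'(1,2)] by blast
    note un = prof_unique[OF fam[OF a'(3,2)] R'(4) a'(3)]
    have RR: "R a = R'" using R'(1) par_facts unfolding R_def un(1) by (simp add: powr_powr)
    have Pe: "Pf a s = R a powr (\<beta> - \<alpha>) * P.PI (U a) (R a * s)" if s: "s \<in> {0..1}" for s
    proof -
      have "P.PI (\<lambda>r. Wf a (r / R a)) (R a * s) = P.PI (U a) (R a * s)"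
        unfolding P.PI_def
      proof (rule integral_cong)
        fix t assume t: "t \<in> {0..R a * s}"
        have "R a * s \<le> R a * 1" using s R' RR by (intro mult_left_mono) auto
        hence "t \<le> R a" "0 \<le> t" using t unfolding atLeastAtMost_iff mult_1_right by linarith+
        hence "t / R a \<in> {0..1}" using R' RR by (auto simp: divide_le_eq)
        from un(2)[OF this] have "Wf a (t / R a) = U a t" using R' RR by simp
        thus "t powr (\<gamma> - 1) * Fc c (Wf a (t / R a)) = t powr (\<gamma> - 1) * Fc c (U a t)" by simp
      qed
      thus ?thesis using prof_fix(2)[OF fam[OF a'(3,2)] c a'(1) s] unfolding R_def[symmetric] by simp
    qed
    show ?thesis using R' un RR Pe by auto
  qed
  define C where "C = 2 * P.wt Rm"
  have ULip: "\<bar>U a r - U a' r\<bar> \<le> C * \<bar>a - a'\<bar>" if "r \<in> {0..Rm}" for a a' r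
    using P.fixpt_Lip[OF U U that] by (simp add: C_def)
  have C0: "C \<ge> 0" using P.wt_pos[of Rm] by (simp add: C_def)
  have cU: "continuous_on {0..Rm} (U a)" for a using U by (simp add: P.fixpt_def)
  have Ujoint: "continuous_on (?A \<times> {0..Rm}) (\<lambda>p. U (fst p) (snd p))"
    by (rule joint_continuity[OF cU ULip])
  have Pjoint: "continuous_on (?A \<times> {0..Rm}) (\<lambda>p. P.PI (U (fst p)) (snd p))"
  proof (rule joint_continuity[where G = "\<lambda>a. P.PI (U a)" and C = "L / \<gamma> * C * Rm powr \<gamma>"])
    show "continuous_on {0..Rm} (P.PI (U a))" for a by (rule P.PI_cont[OF cU])
    fix a a' r assume r: "r \<in> {0..Rm}"
    have "\<bar>P.PI (U a) r - P.PI (U a') r\<bar> \<le> L / \<gamma> * (C * \<bar>a - a'\<bar>) * r powr \<gamma>"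
      using r by (intro P.PI_Lip[OF cU cU] ULip) auto
    also have "\<dots> \<le> L / \<gamma> * (C * \<bar>a - a'\<bar>) * Rm powr \<gamma>"
      using r C0 P.L_pos par_facts by (intro mult_left_mono powr_mono2) auto
    finally show "\<bar>P.PI (U a) r - P.PI (U a') r\<bar> \<le> L / \<gamma> * C * Rm powr \<gamma> * \<bar>a - a'\<bar>" by (simp add: mult_ac)
  qed
  have Rcont: "continuous_on ?A R"
    unfolding continuous_on_def
  proof
    fix a assume a: "a \<in> ?A"
    note la = link[OF a]
    have tend: "((\<lambda>a'. U a' r) \<longlongrightarrow> U a r) (at a within ?A)" if "r \<in> {0..Rm}" for r
    proof -
      have "((\<lambda>a'. C * \<bar>a' - a\<bar>) \<longlongrightarrow> 0) (at a within ?A)"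
        using tendsto_mult[OF tendsto_const tendsto_rabs[OF tendsto_diff[OF tendsto_ident_at tendsto_const]], of C a a ?A] by simp
      hence "((\<lambda>a'. U a' r - U a r) \<longlongrightarrow> 0) (at a within ?A)"
        by (rule Lim_null_comparison[rotated]) (use ULip[OF that] in \<open>auto intro!: always_eventually\<close>)
      thus ?thesis by (simp add: LIM_zero_iff)
    qed
    have evA: "\<forall>\<^sub>F a' in at a within ?A. a' \<in> ?A" by (auto simp: eventually_at_filter)
    show "(R \<longlongrightarrow> R a) (at a within ?A)"
    proof (rule order_tendstoI)
      fix l assume l: "l < R a"
      define r where "r = max l (R a / 2)"
      have r: "0 < r" "r < R a" "l \<le> r" using l la by (auto simp: r_def)
      have "U a r < 1" using S(2)[of a r "R a"] a la r by auto
      hence "\<forall>\<^sub>F a' in at a within ?A. U a' r < 1" using r la by (intro order_tendstoD(2)[OF tend]) auto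
      with evA show "\<forall>\<^sub>F a' in at a within ?A. l < R a'"
      proof eventually_elim
        case (elim a')
        note l' = link[OF elim(1)]
        have "r < R a'"
        proof (rule ccontr)
          assume "\<not> r < R a'"
          hence "R a' = r \<or> U a' (R a') < U a' r" using S(2)[of a' "R a'" r] elim l' r la by fastforce
          thus False using l' elim by auto
        qed
        thus ?case using r by simp
      qed
    next
      fix h assume h: "R a < h"
      define r where "r = min h ((R a + Rm) / 2)"
      have r: "R a < r" "r < Rm" "r \<le> h" using h la by (auto simp: r_def min_def)
      have "1 < U a r" using S(2)[of a "R a" r] a la r by auto
      hence "\<forall>\<^sub>F a' in at a within ?A. 1 < U a' r" using r la by (intro order_tendstoD(1)[OF tend]) auto
      with evA show "\<forall>\<^sub>F a' in at a within ?A. R a' < h"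
      proof eventually_elim
        case (elim a')
        note l' = link[OF elim(1)]
        have "R a' < r"
        proof (rule ccontr)
          assume "\<not> R a' < r"
          hence "R a' = r \<or> U a' r < U a' (R a')" using S(2)[of a' r "R a'"] elim l' r la by fastforce
          thus False using l' elim by auto
        qed
        thus ?case using r by simp
      qed
    qed
  qed
  show "continuous_on ?A Lam"
    by (rule continuous_on_eq[of _ "\<lambda>a. R a powr \<kappa>"]) (use link Rcont in \<open>force intro!: continuous_intros\<close>)+
  have cR: "continuous_on (?A \<times> {0..1}) (\<lambda>p. R (fst p))"
    by (rule continuous_on_compose2[OF Rcont]) (auto intro!: continuous_intros)
  have cm: "continuous_on (?A \<times> {0..1}) (\<lambda>p. (fst p, R (fst p) * snd p))"
    by (intro continuous_intros cR)
  have im: "(\<lambda>p. (fst p, R (fst p) * snd p)) ` (?A \<times> {0..1}) \<subseteq> ?A \<times> {0..Rm}"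
  proof (rule image_subsetI)
    fix p assume p: "p \<in> ?A \<times> {0..1::real}"
    obtain a s where as: "p = (a, s)" "a \<in> ?A" "0 \<le> s" "s \<le> 1" using p by auto
    have l: "0 < R a" "R a < Rm" using link[OF as(2)] by auto
    have "R a * s \<le> R a * 1" "0 \<le> R a * s" using as l by (auto intro!: mult_left_mono)
    hence "R a * s \<in> {0..Rm}" using l unfolding atLeastAtMost_iff mult_1_right by linarith
    thus "(fst p, R (fst p) * snd p) \<in> ?A \<times> {0..Rm}" using as by auto
  qed
  show "continuous_on (?A \<times> {0..1}) (\<lambda>p. Wf (fst p) (snd p))"
    by (rule continuous_on_eq[OF continuous_on_compose2[OF Ujoint cm im]]) (use link in auto)
  have nz: "R (fst p) \<noteq> 0" if "p \<in> ?A \<times> {0..1::real}" for p using link[of "fst p"] that by auto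
  show "continuous_on (?A \<times> {0..1}) (\<lambda>p. Pf (fst p) (snd p))"
    by (rule continuous_on_eq[of _ "\<lambda>p. R (fst p) powr (\<beta> - \<alpha>) * P.PI (U (fst p)) (R (fst p) * snd p)"])
       (use link nz continuous_on_compose2[OF Pjoint cm im] cR in \<open>auto intro!: continuous_intros\<close>)
qed

lemma fam_cont:
  shows "continuous_on {0<..<1} Lam" "continuous_on ({0<..<1} \<times> {0..1}) (\<lambda>p. Wf (fst p) (snd p))"
    "continuous_on ({0<..<1} \<times> {0..1}) (\<lambda>p. Pf (fst p) (snd p))"
proof -
  show "continuous_on {0<..<1} Lam"
    unfolding continuous_on_def
  proof
    fix a :: real assume a: "a \<in> {0<..<1}"
    have "(Lam \<longlongrightarrow> Lam a) (at a within {a/2..<1})" using fam_cont_local(1)[of "a/2"] a by (auto simp: continuous_on_def)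
    moreover have "at a within {a/2..<1} = at a within {0<..<1}" by (rule at_within_nhd[of _ "{a/2<..}"]) (use a in auto)
    ultimately show "(Lam \<longlongrightarrow> Lam a) (at a within {0<..<1})" by simp
  qed
  have gen: "continuous_on ({0<..<1} \<times> {0..1}) G" if "\<And>c. 0 < c \<Longrightarrow> c < 1 \<Longrightarrow> continuous_on ({c..<1} \<times> {0..1}) G" for G :: "real \<times> real \<Rightarrow> real"
    unfolding continuous_on_def
  proof
    fix p :: "real \<times> real" assume p: "p \<in> {0<..<1} \<times> {0..1}"
    let ?c = "fst p / 2"
    have "(G \<longlongrightarrow> G p) (at p within {?c..<1} \<times> {0..1})" using that[of ?c] p by (auto simp: continuous_on_def)
    moreover have "at p within {?c..<1} \<times> {0..1} = at p within {0<..<1} \<times> {0..1}"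
      by (rule at_within_nhd[of _ "{?c<..} \<times> UNIV"]) (use p in \<open>auto intro: open_Times\<close>)
    ultimately show "(G \<longlongrightarrow> G p) (at p within {0<..<1} \<times> {0..1})" by simp
  qed
  show "continuous_on ({0<..<1} \<times> {0..1}) (\<lambda>p. Wf (fst p) (snd p))"
    "continuous_on ({0<..<1} \<times> {0..1}) (\<lambda>p. Pf (fst p) (snd p))"
    by (rule gen, rule fam_cont_local, assumption, assumption)+
qed

lemma vfun_unique:
  assumes "v \<in> extensional {0..1}" "\<And>s. s \<in> {0..1} \<Longrightarrow> 1 - v s = w s"
  shows "v = vfun w"
proof
  fix x show "v x = vfun w x"
  proof (cases "x \<in> {0..1}")
    case True
    thus ?thesis using assms(2)[OF True] by (simp add: vfun_def)
  next
    case False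
    thus ?thesis using extensional_arb[OF assms(1) False] by (auto simp: vfun_def)
  qed
qed

lemma regular_unique:
  assumes reg: "regular_solution \<alpha> \<beta> \<gamma> f l v" and a: "0 < a" "a < 1" "v 0 = 1 - a"
  shows "l = Lam a" "v = vfun (Wf a)"
proof -
  obtain P where "prof l (1 - v 0) (\<lambda>s. 1 - v s) P" using regular_imp_prof[OF reg] a by auto
  hence p: "prof l a (\<lambda>s. 1 - v s) P" using a by simp
  show "l = Lam a" by (rule prof_unique(1)[OF p fam[OF a(1,2)] a(1)])
  show "v = vfun (Wf a)"
    using reg prof_unique(2)[OF p fam[OF a(1,2)] a(1)] by (intro vfun_unique) (auto simp: regular_solution_def solves_problem_def)
qed

text \<open>Existence and uniqueness for given \<open>v 0\<close> turn the definite description in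
  \<open>curve_point\<close> into the family \<open>Lam\<close>, \<open>Wf\<close>.\<close>

lemma curve_eq:
  assumes "0 < a" "a < 1"
  shows "curve_lambda \<alpha> \<beta> \<gamma> f (1 - a) = Lam a" "curve_v \<alpha> \<beta> \<gamma> f (1 - a) = vfun (Wf a)"
proof -
  have "curve_point \<alpha> \<beta> \<gamma> f (1 - a) = (Lam a, vfun (Wf a))"
    unfolding curve_point_def
  proof (rule the_equality)
    show "regular_solution \<alpha> \<beta> \<gamma> f (fst (Lam a, vfun (Wf a))) (snd (Lam a, vfun (Wf a))) \<and> snd (Lam a, vfun (Wf a)) 0 = 1 - a"
      using prof_regular[OF fam[OF assms] assms(1)] by simp
    fix p assume "regular_solution \<alpha> \<beta> \<gamma> f (fst p) (snd p) \<and> snd p 0 = 1 - a"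
    thus "p = (Lam a, vfun (Wf a))" using regular_unique[of "fst p" "snd p" a] assms by (simp add: prod_eq_iff)
  qed
  thus "curve_lambda \<alpha> \<beta> \<gamma> f (1 - a) = Lam a" "curve_v \<alpha> \<beta> \<gamma> f (1 - a) = vfun (Wf a)"
    by (simp_all add: curve_lambda_def curve_v_def)
qed

lemma sol_exists: assumes "0 < a" "a < 1" shows "\<exists>T y. sol a T y"
  by (rule prof_imp_sol[OF fam[OF assms]]) blast

lemma degenerate_exists: "\<exists>lam v. degenerate_solution \<alpha> \<beta> \<gamma> f lam v"
proof -
  obtain T y where s: "sol 0 T y" using sol_limit[OF sol_exists] .
  obtain w P where "prof (exp (\<kappa> * T 1)) 0 w P" by (rule sol_imp_prof[OF s]) blast
  thus ?thesis using prof_degenerate by blast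
qed

lemma lam_T1:
  assumes p: "prof lam a w P" and T: "T (w 1) = ln 1 + ln lam / \<kappa>"
  shows "T 1 = ln lam / \<kappa>" "lam = exp (\<kappa> * T 1)"
  using profD(1,6)[OF p] T par_facts by auto

text \<open>At \<open>a = 0\<close> the initial value problem is singular, as \<open>1 / f\<close>
  blows up. Instead, two solutions with \<open>a = 0\<close> satisfy the premises of
  \<open>sol_close\<close> for every \<open>\<eta>\<close>, so that their \<open>T\<close> agree. At
  \<open>w = 1\<close> this gives equality of \<open>lam\<close>, and injectivity of
  \<open>T\<close> that of \<open>v\<close>.\<close>

lemma degenerate_unique:
  assumes d1: "degenerate_solution \<alpha> \<beta> \<gamma> f lam1 v1" and d2: "degenerate_solution \<alpha> \<beta> \<gamma> f lam2 v2"
  shows "lam1 = lam2 \<and> v1 = v2"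
proof -
  obtain P1 P2 where p: "prof lam1 0 (\<lambda>s. 1 - v1 s) P1" "prof lam2 0 (\<lambda>s. 1 - v2 s) P2"
    using degenerate_imp_prof[OF d1] degenerate_imp_prof[OF d2] by metis
  obtain T1 y1 where s1: "sol 0 T1 y1" "\<And>s. 0 < s \<Longrightarrow> s \<le> 1 \<Longrightarrow> T1 (1 - v1 s) = ln s + ln lam1 / \<kappa>" using prof_imp_sol[OF p(1)] by metis
  obtain T2 y2 where s2: "sol 0 T2 y2" "\<And>s. 0 < s \<Longrightarrow> s \<le> 1 \<Longrightarrow> T2 (1 - v2 s) = ln s + ln lam2 / \<kappa>" using prof_imp_sol[OF p(2)] by metis
  have eq: "T1 w = T2 w" if w: "0 < w" "w \<le> 1" for w
  proof (rule ccontr)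
    assume ne: "T1 w \<noteq> T2 w"
    define \<eta> where "\<eta> = \<bar>T1 w - T2 w\<bar> / 2"
    have \<eta>: "\<eta> > 0" using ne by (simp add: \<eta>_def)
    obtain a0 where a0: "0 < a0" "\<And>a T1 y1 b T2 y2 u. sol a T1 y1 \<Longrightarrow> a < a0 \<Longrightarrow> sol b T2 y2 \<Longrightarrow> b < a0 \<Longrightarrow> u \<in> {w..1} \<Longrightarrow>
      \<bar>T1 u - T2 u\<bar> \<le> \<eta> \<and> \<bar>y1 u - y2 u\<bar> \<le> \<eta>" using sol_close[OF w \<eta>] by metis
    have "\<bar>T1 w - T2 w\<bar> \<le> \<eta>" using a0(2)[OF s1(1) a0(1) s2(1) a0(1), of w] w by auto
    thus False using ne by (simp add: \<eta>_def)
  qed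
  have l: "lam1 = exp (\<kappa> * T1 1)" "lam2 = exp (\<kappa> * T2 1)"
    using lam_T1(2)[OF p(1), of T1] lam_T1(2)[OF p(2), of T2] s1(2)[of 1] s2(2)[of 1] by auto
  hence lam: "lam1 = lam2" using eq[of 1] by simp
  have "1 - v1 s = 1 - v2 s" if s: "s \<in> {0..1}" for s
  proof (cases "s = 0")
    case True thus ?thesis using d1 d2 by (simp add: degenerate_solution_def)
  next
    case False
    hence s': "0 < s" "s \<le> 1" using s by auto
    note r1 = prof_range[OF p(1) s'] and r2 = prof_range[OF p(2) s']
    have "T1 (1 - v1 s) = T1 (1 - v2 s)" using s1(2)[OF s'] s2(2)[OF s'] eq[of "1 - v2 s"] r2 lam by auto
    thus ?thesis using sol_T_mono[OF s1(1), of "1 - v1 s" "1 - v2 s"] sol_T_mono[OF s1(1), of "1 - v2 s" "1 - v1 s"] r1 r2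
      by (cases "1 - v1 s" "1 - v2 s" rule: linorder_cases) auto
  qed
  hence "v1 s = v2 s" if "s \<in> {0..1}" for s using that by force
  hence "v1 = v2" using d1 d2 by (intro extensionalityI[of _ "{0..1}"]) (auto simp: degenerate_solution_def solves_problem_def)
  thus ?thesis using lam by simp
qed

lemma fam_sol:
  "\<exists>Ta ya. \<forall>a. 0 < a \<and> a < 1 \<longrightarrow> sol a (Ta a) (ya a) \<and>
     (\<forall>s. 0 < s \<and> s \<le> 1 \<longrightarrow> Ta a (Wf a s) = ln s + ln (Lam a) / \<kappa> \<and> ya a (Wf a s) = (ln (Pf a s) - \<sigma> * ln s) / \<beta>)"
proof -
  have "\<forall>a. \<exists>T y. 0 < a \<and> a < 1 \<longrightarrow> sol a T y \<and> (\<forall>s. 0 < s \<and> s \<le> 1 \<longrightarrow> T (Wf a s) = ln s + ln (Lam a) / \<kappa> \<and> y (Wf a s) = (ln (Pf a s) - \<sigma> * ln s) / \<beta>)"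
  proof
    fix a :: real
    show "\<exists>T y. 0 < a \<and> a < 1 \<longrightarrow> sol a T y \<and> (\<forall>s. 0 < s \<and> s \<le> 1 \<longrightarrow> T (Wf a s) = ln s + ln (Lam a) / \<kappa> \<and> y (Wf a s) = (ln (Pf a s) - \<sigma> * ln s) / \<beta>)"
    proof (cases "0 < a \<and> a < 1")
      case True
      then obtain T y where "sol a T y" "\<And>s. 0 < s \<Longrightarrow> s \<le> 1 \<Longrightarrow> T (Wf a s) = ln s + ln (Lam a) / \<kappa>"
        "\<And>s. 0 < s \<Longrightarrow> s \<le> 1 \<Longrightarrow> y (Wf a s) = (ln (Pf a s) - \<sigma> * ln s) / \<beta>"
        using prof_imp_sol[OF fam[of a]] by blast
      thus ?thesis by blast
    qed blast
  qed
  thus ?thesis by metis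
qed

text \<open>\<open>sol_close\<close> yields convergence of \<open>T\<close> at each
  \<open>w\<close>; at \<open>w = 1\<close> this is convergence of \<lambda>. For fixed
  \<open>s\<close> the profile takes the value at which \<open>T - T 1\<close> equals
  \<open>ln s\<close>; this value converges because \<open>T\<close> is strictly increasing.
  Monotone profiles then converge uniformly.\<close>

lemma curve_converges:
  assumes deg: "degenerate_solution \<alpha> \<beta> \<gamma> f lamb vb"
  shows "(curve_lambda \<alpha> \<beta> \<gamma> f \<longlongrightarrow> lamb) (at_left 1)" "uniform_limit {0..1} (curve_v \<alpha> \<beta> \<gamma> f) vb (at_left 1)"
proof -
  obtain P where p: "prof lamb 0 (\<lambda>s. 1 - vb s) P" using degenerate_imp_prof[OF deg] .
  obtain T y where s: "sol 0 T y" "\<And>s. 0 < s \<Longrightarrow> s \<le> 1 \<Longrightarrow> T (1 - vb s) = ln s + ln lamb / \<kappa>" using prof_imp_sol[OF p] by metis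
  have lb: "T 1 = ln lamb / \<kappa>" "lamb = exp (\<kappa> * T 1)" using lam_T1[OF p, of T] s(2)[of 1] by auto
  obtain Ta ya where "\<forall>a. 0 < a \<and> a < 1 \<longrightarrow> sol a (Ta a) (ya a) \<and>
     (\<forall>s. 0 < s \<and> s \<le> 1 \<longrightarrow> Ta a (Wf a s) = ln s + ln (Lam a) / \<kappa> \<and> ya a (Wf a s) = (ln (Pf a s) - \<sigma> * ln s) / \<beta>)"
    using fam_sol by blast
  hence fs: "\<And>a. 0 < a \<Longrightarrow> a < 1 \<Longrightarrow> sol a (Ta a) (ya a)"
    "\<And>a s. 0 < a \<Longrightarrow> a < 1 \<Longrightarrow> 0 < s \<Longrightarrow> s \<le> 1 \<Longrightarrow> Ta a (Wf a s) = ln s + ln (Lam a) / \<kappa>"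
    by auto
  have la: "Ta a 1 = ln (Lam a) / \<kappa>" "Lam a = exp (\<kappa> * Ta a 1)" if "0 < a" "a < 1" for a
    using lam_T1[OF fam[OF that], of "Ta a"] fs(2)[OF that, of 1] by auto
  have Tconv: "((\<lambda>a. Ta a w) \<longlongrightarrow> T w) (at_right 0)" if w: "0 < w" "w \<le> 1" for w
  proof (rule tendstoI)
    fix e :: real assume e: "e > 0"
    obtain a0 where a0: "0 < a0" "a0 < w" "\<And>a T1 y1 b T2 y2 u. sol a T1 y1 \<Longrightarrow> a < a0 \<Longrightarrow> sol b T2 y2 \<Longrightarrow> b < a0 \<Longrightarrow> u \<in> {w..1} \<Longrightarrow>
      \<bar>T1 u - T2 u\<bar> \<le> e / 2 \<and> \<bar>y1 u - y2 u\<bar> \<le> e / 2" using sol_close[OF w half_gt_zero[OF e]] by metis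
    have "\<forall>\<^sub>F a in at_right 0. a \<in> {0<..<a0}" by (rule eventually_at_right_real[OF a0(1)])
    thus "\<forall>\<^sub>F a in at_right 0. dist (Ta a w) (T w) < e"
    proof eventually_elim
      case (elim a)
      hence a: "0 < a" "a < a0" "a < 1" using a0 w by auto
      have "\<bar>Ta a w - T w\<bar> \<le> e / 2" using a0(3)[OF fs(1)[OF a(1,3)] a(2) s(1) a0(1), of w] w by auto
      thus ?case using e by (simp add: dist_real_def)
    qed
  qed
  have ev01: "\<forall>\<^sub>F a in at_right (0::real). 0 < a \<and> a < 1" using eventually_at_right_real[of 0 1] by (auto elim: eventually_mono)
  have "((\<lambda>a. exp (\<kappa> * Ta a 1)) \<longlongrightarrow> exp (\<kappa> * T 1)) (at_right 0)" by (intro tendsto_intros Tconv) auto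
  hence Llim: "(Lam \<longlongrightarrow> lamb) (at_right 0)"
    unfolding lb(2)[symmetric]
    by (rule Lim_transform_eventually) (use ev01 in eventually_elim, use la(2) in auto)
  show "(curve_lambda \<alpha> \<beta> \<gamma> f \<longlongrightarrow> lamb) (at_left 1)"
  proof (rule tendstoI)
    fix e :: real assume "e > 0"
    from tendstoD[OF Llim this] ev01 show "\<forall>\<^sub>F t in at_left 1. dist (curve_lambda \<alpha> \<beta> \<gamma> f t) lamb < e"
      unfolding eventually_at_left_1_iff by eventually_elim (simp add: curve_eq)
  qed
  have ptw: "((\<lambda>a. Wf a s) \<longlongrightarrow> 1 - vb s) (at_right 0)" if s01: "s \<in> {0..1}" for s
  proof -
    consider "s = 0" | "s = 1" | "0 < s" "s < 1" using s01 by force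
    thus ?thesis
    proof cases
      case 1
      have "((\<lambda>a. a) \<longlongrightarrow> 0) (at_right (0::real))" by (rule tendsto_ident_at)
      hence "((\<lambda>a. Wf a 0) \<longlongrightarrow> 0) (at_right 0)"
        by (rule Lim_transform_eventually) (use ev01 in eventually_elim, use profD(5)[OF fam] in auto)
      thus ?thesis using profD(5)[OF p] 1 by simp
    next
      case 2
      have "((\<lambda>a. 1) \<longlongrightarrow> (1::real)) (at_right (0::real))" by (rule tendsto_const)
      hence "((\<lambda>a. Wf a 1) \<longlongrightarrow> 1) (at_right 0)"
        by (rule Lim_transform_eventually) (use ev01 in eventually_elim, use profD(6)[OF fam] in auto)
      thus ?thesis using profD(6)[OF p] 2 by simp
    next
      case 3
      define w where "w = 1 - vb s"
      have w: "0 < w" "w < 1"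
        using prof_range(3)[OF p 3(1) less_imp_le[OF 3(2)]] prof_range(4)[OF p 3(1) less_imp_le[OF 3(2)] 3(2)] by (simp_all add: w_def)
      have Tw: "T w = ln s + T 1" using s(2)[OF 3(1)] 3 lb(1) by (simp add: w_def)
      have lim: "((\<lambda>a. Ta a u - Ta a 1) \<longlongrightarrow> T u - T 1) (at_right 0)" if "0 < u" "u \<le> 1" for u
        by (intro tendsto_intros Tconv that) auto
      have Taw: "Ta a (Wf a s) - Ta a 1 = ln s \<and> a < Wf a s \<and> Wf a s \<le> 1" if "0 < a" "a < 1" for a
        using fs(2)[OF that 3(1)] 3 la(1)[OF that] prof_range(1,2)[OF fam[OF that] 3(1)] by auto
      show ?thesis unfolding w_def[symmetric]
      proof (rule order_tendstoI)
        fix l assume l: "l < w"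
        define u where "u = max l (w / 2)"
        have u: "0 < u" "u < w" "l \<le> u" using l w by (auto simp: u_def)
        have "T u - T 1 < ln s" using sol_T_mono[OF s(1) u(1,2)] w Tw by simp
        moreover have "u \<le> 1" using u w by simp
        ultimately have "\<forall>\<^sub>F a in at_right 0. Ta a u - Ta a 1 < ln s" using u by (intro order_tendstoD(2)[OF lim]) auto
        with ev01 show "\<forall>\<^sub>F a in at_right 0. l < Wf a s"
        proof eventually_elim
          case (elim a)
          hence a: "0 < a" "a < 1" by auto
          have "u < Wf a s"
          proof (rule ccontr)
            assume "\<not> u < Wf a s"
            hence "Wf a s = u \<or> Ta a (Wf a s) < Ta a u"
              using sol_T_mono[OF fs(1)[OF a], of "Wf a s" u] Taw[OF a] u w by fastforce
            thus False using Taw[OF a] elim by auto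
          qed
          thus ?case using u by simp
        qed
      next
        fix h assume h: "w < h"
        define u where "u = min h 1"
        have u: "w < u" "u \<le> 1" "u \<le> h" "0 < u" using h w by (auto simp: u_def)
        have "ln s < T u - T 1" using sol_T_mono[OF s(1) w(1) u(1,2)] Tw by simp
        hence "\<forall>\<^sub>F a in at_right 0. ln s < Ta a u - Ta a 1" using u by (intro order_tendstoD(1)[OF lim]) auto
        moreover have "\<forall>\<^sub>F a in at_right 0. a \<in> {0<..<u}" by (rule eventually_at_right_real[OF u(4)])
        ultimately show "\<forall>\<^sub>F a in at_right 0. Wf a s < h" using ev01
        proof eventually_elim
          case (elim a)
          hence a: "0 < a" "a < 1" "a < u" by auto
          have "Wf a s < u"
          proof (rule ccontr)
            assume "\<not> Wf a s < u"
            hence "Wf a s = u \<or> Ta a u < Ta a (Wf a s)"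
              using sol_T_mono[OF fs(1)[OF a(1,2)], of u "Wf a s"] Taw[OF a(1,2)] a by fastforce
            thus False using Taw[OF a(1,2)] elim by auto
          qed
          thus ?case using u by simp
        qed
      qed
    qed
  qed
  have "uniform_limit {0..1} Wf (\<lambda>s. 1 - vb s) (at_right 0)"
  proof (rule monotone_pointwise_imp_uniform_limit[OF _ profD(4)[OF p] ptw])
    show "\<forall>\<^sub>F a in at_right 0. mono_on {0..1} (Wf a)"
      using ev01
    proof eventually_elim
      case (elim a)
      show ?case
      proof (rule mono_onI)
        fix r s :: real assume "r \<in> {0..1}" "s \<in> {0..1}" "r \<le> s"
        thus "Wf a r \<le> Wf a s" using prof_mono[OF fam[of a], of r s] elim by (cases "r = s") auto
      qed
    qed
  qed
  note ul = this
  show "uniform_limit {0..1} (curve_v \<alpha> \<beta> \<gamma> f) vb (at_left 1)"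
  proof (rule uniform_limitI)
    fix e :: real assume "e > 0"
    from uniform_limitD[OF ul this] ev01 show "\<forall>\<^sub>F t in at_left 1. \<forall>x\<in>{0..1}. dist (curve_v \<alpha> \<beta> \<gamma> f t x) (vb x) < e"
      unfolding eventually_at_left_1_iff
    proof eventually_elim
      case (elim a)
      show ?case
      proof
        fix x :: real assume x: "x \<in> {0..1}"
        have "dist (Wf a x) (1 - vb x) < e" using elim(1) x by blast
        thus "dist (curve_v \<alpha> \<beta> \<gamma> f (1 - a) x) (vb x) < e" using elim(2) x by (simp add: curve_eq vfun_def dist_real_def abs_minus_commute)
      qed
    qed
  qed
qed

end

section \<open>Oscillation around the degenerate solution\<close>

text \<open>Near \<open>w\<close> the continuous logarithm coincides with
  \<open>L w + Ln (\<zeta> u / \<zeta> w)\<close>: the argument of \<open>Ln\<close> is close to 1,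
  off the branch cut, and by continuity the imaginary part of \<open>L u - L w\<close> is less than
  pi in absolute value.\<close>

lemma continuous_log_has_vector_derivative:
  fixes L \<zeta> :: "real \<Rightarrow> complex"
  assumes d: "(\<zeta> has_vector_derivative \<zeta>') (at w)" and cont: "isCont L w" and U: "open U" "w \<in> U" and ex: "\<And>u. u \<in> U \<Longrightarrow> exp (L u) = \<zeta> u"
  shows "(L has_vector_derivative \<zeta>' / \<zeta> w) (at w)"
proof -
  have nz: "\<zeta> w \<noteq> 0" using ex[OF U(2)] by (metis exp_not_eq_zero)
  have "((\<lambda>u. \<zeta> u / \<zeta> w) has_vector_derivative \<zeta>' / \<zeta> w) (at w)"
    using has_vector_derivative_mult_left[OF d, of "1 / \<zeta> w"] by simp
  moreover have "(Ln has_field_derivative inverse (\<zeta> w / \<zeta> w)) (at (\<zeta> w / \<zeta> w))"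
    using nz by (intro has_field_derivative_Ln) auto
  ultimately have "((Ln \<circ> (\<lambda>u. \<zeta> u / \<zeta> w)) has_vector_derivative \<zeta>' / \<zeta> w * inverse (\<zeta> w / \<zeta> w)) (at w)"
    by (rule field_vector_diff_chain_at)
  hence "((\<lambda>u. Ln (\<zeta> u / \<zeta> w)) has_vector_derivative \<zeta>' / \<zeta> w) (at w)" using nz by (simp add: o_def)
  from has_vector_derivative_add[OF has_vector_derivative_const[of "L w"] this]
  have "((\<lambda>u. L w + Ln (\<zeta> u / \<zeta> w)) has_vector_derivative \<zeta>' / \<zeta> w) (at w)" by simp
  moreover have "\<forall>\<^sub>F u in nhds w. L w + Ln (\<zeta> u / \<zeta> w) = L u"
  proof -
    have "((\<lambda>u. L u - L w) \<longlongrightarrow> L w - L w) (nhds w)"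
      using cont by (intro tendsto_intros) (simp add: isCont_def tendsto_at_iff_tendsto_nhds)
    hence "\<forall>\<^sub>F u in nhds w. dist (L u - L w) 0 < pi" by (intro tendstoD) auto
    moreover have "\<forall>\<^sub>F u in nhds w. u \<in> U" using U by (rule eventually_nhds_in_open)
    ultimately show ?thesis
    proof eventually_elim
      case (elim u)
      have "\<bar>Im (L u - L w)\<bar> < pi" using elim(1) abs_Im_le_cmod[of "L u - L w"] by simp
      hence "Ln (exp (L u - L w)) = L u - L w" by (intro Ln_exp) auto
      thus ?case using ex[OF elim(2)] ex[OF U(2)] by (simp add: exp_diff)
    qed
  qed
  then obtain V where V: "open V" "w \<in> V" "\<And>u. u \<in> V \<Longrightarrow> L w + Ln (\<zeta> u / \<zeta> w) = L u" by (auto simp: eventually_nhds)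
  ultimately show ?thesis by (rule has_vector_derivative_transform_within_open)
qed

text \<open>The levels \<open>pi / 2 + j * pi\<close> can be crossed upwards only. The largest one
  not above \<open>\<phi> s\<close> is less than pi away from it and is a barrier: to end below it,
  \<open>\<phi>\<close> would have to leave it downwards after a last visit, where its derivative is
  positive. Nothing is asked at \<open>t\<close> itself, so that \<open>t = 1\<close> is
  admissible.\<close>

lemma angle_drop_less_pi:
  fixes \<phi> :: "real \<Rightarrow> real"
  assumes st: "s \<le> t" and cont: "continuous_on {s..t} \<phi>"
    and up: "\<And>w. s \<le> w \<Longrightarrow> w < t \<Longrightarrow> cos (\<phi> w) = 0 \<Longrightarrow> \<exists>d>0. (\<phi> has_real_derivative d) (at w)"
  shows "\<phi> s - pi < \<phi> t"
proof (rule ccontr)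
  assume neg: "\<not> ?thesis"
  define k where "k = \<lfloor>(\<phi> s - pi / 2) / pi\<rfloor>"
  define l where "l = pi / 2 + of_int k * pi"
  have "of_int k \<le> (\<phi> s - pi / 2) / pi" "(\<phi> s - pi / 2) / pi < of_int k + 1" by (auto simp: k_def)
  hence "of_int k * pi \<le> \<phi> s - pi / 2" "\<phi> s - pi / 2 < (of_int k + 1) * pi" by (simp_all add: pos_le_divide_eq pos_divide_less_eq)
  hence l: "l \<le> \<phi> s" "\<phi> s < l + pi" by (auto simp: l_def algebra_simps)
  have c: "continuous_on {s..t} (\<lambda>w. - \<phi> w)" using cont by (intro continuous_intros)
  have "- \<phi> s \<le> - l" "- l < - \<phi> t" using l neg by auto
  then obtain t0 where t0: "s \<le> t0" "t0 < t" "- \<phi> t0 = - l" "\<And>u. t0 \<le> u \<Longrightarrow> u \<le> t \<Longrightarrow> - l \<le> - \<phi> u"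
    using last_time_at_level[OF c st] by metis
  have "cos (\<phi> t0) = 0"
  proof -
    have "\<phi> t0 = pi / 2 + of_int k * pi" using t0(3) by (simp add: l_def)
    thus ?thesis by (simp add: cos_add sin_times_pi_eq_0)
  qed
  then obtain d where "d > 0" "(\<phi> has_real_derivative d) (at t0)" using up t0 by blast
  then obtain e where e: "e > 0" "\<And>h. h > 0 \<Longrightarrow> h < e \<Longrightarrow> \<phi> t0 < \<phi> (t0 + h)" using DERIV_pos_inc_right by blast
  define h where "h = min (e / 2) (t - t0)"
  have "h > 0" "h < e" "t0 + h \<le> t" using e t0 by (auto simp: h_def)
  thus False using e(2)[of h] t0(3) t0(4)[of "t0 + h"] by simp
qed

section \<open>The angle of the difference vector\<close>

context mems
begin

text \<open>The angular velocity is the imaginary part of the logarithmic derivative of the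
  difference, viewed as a complex number.\<close>

lemma angle_deriv:
  assumes s1: "sol a T1 y1" "0 < a" and s2: "sol 0 T2 y2" and w: "a < w" "w < 1"
    and cont: "continuous_on {a<..1} L" and ex: "\<And>u. a < u \<Longrightarrow> u \<le> 1 \<Longrightarrow> exp (L u) = Complex (T1 u - T2 u) (y1 u - y2 u)"
  defines "D \<equiv> T1 w - T2 w" and "E \<equiv> y1 w - y2 w"
  assumes dT: "((\<lambda>u. T1 u - T2 u) has_real_derivative d) (at w)" and dy: "((\<lambda>u. y1 u - y2 u) has_real_derivative e) (at w)"
  shows "((\<lambda>u. Im (L u)) has_real_derivative (D * e - E * d) / (D\<^sup>2 + E\<^sup>2)) (at w)"
proof -
  have "((\<lambda>u. Complex (T1 u - T2 u) (y1 u - y2 u)) has_vector_derivative Complex d e) (at w)"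
  proof -
    have "((\<lambda>u. of_real (T1 u - T2 u) + \<i> * of_real (y1 u - y2 u)) has_vector_derivative of_real d + \<i> * of_real e) (at w)"
      by (intro has_vector_derivative_add has_vector_derivative_mult_right has_vector_derivative_of_real)
         (use dT dy in \<open>simp_all add: has_real_derivative_iff_has_vector_derivative\<close>)
    thus ?thesis by (simp add: Complex_eq)
  qed
  moreover have "isCont L w"
  proof -
    have "continuous_on {a<..<1} L" by (rule continuous_on_subset[OF cont]) auto
    thus ?thesis using w by (simp add: continuous_on_eq_continuous_at)
  qed
  ultimately have "(L has_vector_derivative Complex d e / Complex D E) (at w)"
    unfolding D_def E_def by (rule continuous_log_has_vector_derivative[of _ _ _ _ "{a<..<1}"]) (use w ex in auto)
  hence "((\<lambda>u. Im (L u)) has_vector_derivative Im (Complex d e / Complex D E)) (at w)"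
    by (rule bounded_linear.has_vector_derivative[OF bounded_linear_Im])
  thus ?thesis by (simp add: has_real_derivative_iff_has_vector_derivative Im_divide mult.commute)
qed

text \<open>Where \<open>T1 = T2\<close>, the vector is vertical and only its horizontal velocity
  \<open>exp (- y1) - exp (- y2)\<close> turns it. The sign of this is opposite to that of
  \<open>y1 - y2\<close>, which is nonzero by \<open>sol_no_meet\<close>.\<close>

lemma angle_increases_at_axis:
  assumes s1: "sol a T1 y1" "0 < a" and s2: "sol 0 T2 y2" and w: "a < w" "w < 1"
    and cont: "continuous_on {a<..1} L" and ex: "\<And>u. a < u \<Longrightarrow> u \<le> 1 \<Longrightarrow> exp (L u) = Complex (T1 u - T2 u) (y1 u - y2 u)"
    and cos0: "cos (Im (L w)) = 0"
  shows "\<exists>d>0. ((\<lambda>u. Im (L u)) has_real_derivative d) (at w)"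
proof -
  have w0: "0 < w" using s1 w by simp
  have "Re (exp (L w)) = 0" using cos0 by (simp add: Re_exp)
  hence T: "T1 w = T2 w" using ex[of w] w by simp
  hence ne: "y1 w \<noteq> y2 w" using sol_no_meet[OF s1 s2 w(1)] w by auto
  note d = angle_deriv[OF s1 s2 w cont ex DERIV_diff[OF solD(3)[OF s1(1) w] solD(3)[OF s2 w0 w(2)]]
      DERIV_diff[OF solD(4)[OF s1(1) w] solD(4)[OF s2 w0 w(2)]]]
  have "(y1 w - y2 w) * (exp (- y1 w) - exp (- y2 w)) < 0"
    using ne by (cases "y1 w < y2 w") (auto simp: mult_less_0_iff)
  moreover have "0 < (y1 w - y2 w)\<^sup>2" using ne by simp
  ultimately have "0 < ((T1 w - T2 w) * x - (y1 w - y2 w) * (exp (- y1 w) - exp (- y2 w))) / ((T1 w - T2 w)\<^sup>2 + (y1 w - y2 w)\<^sup>2)" for x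
    unfolding T by (intro divide_pos_pos) simp_all
  with d show ?thesis by blast
qed

text \<open>Once the regular solution is older than \<open>S\<close>, and as long as
  \<open>w \<le> w1\<close>, both solutions are near the equilibrium and \<open>winding_rate\<close>
  applies; \<open>XX_diff\<close> and \<open>ZZ_diff\<close> translate it to the plane of
  \<open>T\<close> and \<open>y\<close>.\<close>

lemma angle_fast:
  assumes disc: "(k - \<delta>)\<^sup>2 < 4 * k"
  obtains w1 c S where "0 < w1" "w1 \<le> w0" "0 < c" "\<And>a T1 y1 T2 y2 L s t. sol a T1 y1 \<Longrightarrow> 0 < a \<Longrightarrow> sol 0 T2 y2 \<Longrightarrow>
     continuous_on {a<..1} L \<Longrightarrow> (\<And>u. a < u \<Longrightarrow> u \<le> 1 \<Longrightarrow> exp (L u) = Complex (T1 u - T2 u) (y1 u - y2 u)) \<Longrightarrow>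
     a < s \<Longrightarrow> s \<le> t \<Longrightarrow> t \<le> w1 \<Longrightarrow> S < N s - N a \<Longrightarrow> Im (L s) + c * (N t - N s) \<le> Im (L t)"
proof -
  obtain \<rho> c where wr: "\<rho> > 0" "c > 0" "\<And>N m e X1 Z1 X2 Z2 w. LV N m e X1 Z1 {w} \<Longrightarrow> LV N m e X2 Z2 {w} \<Longrightarrow>
     near \<rho> (X1 w) (Z1 w) \<Longrightarrow> near \<rho> (X2 w) (Z2 w) \<Longrightarrow>
     \<exists>a' b'. ((\<lambda>w. ln (X1 w) - ln (X2 w)) has_real_derivative a') (at w) \<and>
       ((\<lambda>w. ln (Z1 w) - ln (Z2 w)) has_real_derivative b') (at w) \<and>
       (let a = ln (X1 w) - ln (X2 w); D = (\<beta> * a + (ln (Z1 w) - ln (Z2 w))) / \<kappa> in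
          m w * (c * (D\<^sup>2 + a\<^sup>2)) \<le> D * a' - a * ((\<beta> * a' + b') / \<kappa>))"
    using winding_rate[OF disc] by blast
  obtain S w1 where S: "S > 0" "0 < w1" "w1 \<le> w0"
    "\<And>a T y t. sol a T y \<Longrightarrow> a < t \<Longrightarrow> t \<le> w1 \<Longrightarrow> a = 0 \<or> S < N t - N a \<Longrightarrow> near \<rho> (XX y t) (ZZ T y t)"
    using sol_near[OF wr(1)] by blast
  show thesis
  proof (rule that[OF S(2,3) wr(2), where S = S])
    fix a T1 y1 T2 y2 L s t
    assume s1: "sol a T1 y1" "0 < a" and s2: "sol 0 T2 y2" and cont: "continuous_on {a<..1} L"
      and ex: "\<And>u. a < u \<Longrightarrow> u \<le> 1 \<Longrightarrow> exp (L u) = Complex (T1 u - T2 u) (y1 u - y2 u)"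
      and st: "a < s" "s \<le> t" "t \<le> w1" and SN: "S < N s - N a"
    have der: "\<exists>d. ((\<lambda>u. Im (L u)) has_real_derivative d) (at w) \<and> m w * c \<le> d" if w: "s \<le> w" "w \<le> t" for w
    proof -
      have w': "a < w" "w < 1" "0 < w" "w \<le> w0" "w \<le> w1" using w st S w0 s1 by auto
      have "N s \<le> N w" using N_less[of s w] w st s1 by (cases "s = w") auto
      hence near: "near \<rho> (XX y1 w) (ZZ T1 y1 w)" "near \<rho> (XX y2 w) (ZZ T2 y2 w)"
        using S(4)[OF s1(1) w'(1,5)] S(4)[OF s2 w'(3,5)] SN by auto
      obtain a' b' where ab: "((\<lambda>w. ln (XX y1 w) - ln (XX y2 w)) has_real_derivative a') (at w)"
        "((\<lambda>w. ln (ZZ T1 y1 w) - ln (ZZ T2 y2 w)) has_real_derivative b') (at w)"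
        "let a = ln (XX y1 w) - ln (XX y2 w); D = (\<beta> * a + (ln (ZZ T1 y1 w) - ln (ZZ T2 y2 w))) / \<kappa> in
          m w * (c * (D\<^sup>2 + a\<^sup>2)) \<le> D * a' - a * ((\<beta> * a' + b') / \<kappa>)"
        using wr(3)[OF sol_LV_at[OF s1(1) w'(1,4)] sol_LV_at[OF s2 w'(3,4)] near] by blast
      have dy: "((\<lambda>u. y1 u - y2 u) has_real_derivative a') (at w)"
        by (rule has_field_derivative_transform_within_open[OF ab(1), of "{0<..}"]) (use w' XX_diff in auto)
      have "((\<lambda>u. (\<beta> * (y1 u - y2 u) + (ln (ZZ T1 y1 u) - ln (ZZ T2 y2 u))) / \<kappa>) has_real_derivative (\<beta> * a' + b') / \<kappa>) (at w)"
        by (intro DERIV_cdivide DERIV_add DERIV_cmult dy ab(2))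
      hence dT: "((\<lambda>u. T1 u - T2 u) has_real_derivative (\<beta> * a' + b') / \<kappa>) (at w)"
        by (rule has_field_derivative_transform_within_open[of _ _ _ "{0<..}"]) (use w' ZZ_diff par_facts(5) in auto)
      define D E where "D = T1 w - T2 w" and "E = y1 w - y2 w"
      have e: "ln (XX y1 w) - ln (XX y2 w) = E" "(\<beta> * E + (ln (ZZ T1 y1 w) - ln (ZZ T2 y2 w))) / \<kappa> = D"
        using XX_diff[OF w'(3)] ZZ_diff[OF w'(3)] par_facts(5) by (auto simp: D_def E_def)
      have le: "m w * (c * (D\<^sup>2 + E\<^sup>2)) \<le> D * a' - E * ((\<beta> * a' + b') / \<kappa>)" using ab(3) unfolding Let_def e .
      have "D \<noteq> 0 \<or> E \<noteq> 0" using sol_no_meet[OF s1 s2 w'(1)] w' by (auto simp: D_def E_def)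
      hence pos: "0 < D\<^sup>2 + E\<^sup>2" by (simp add: sum_power2_gt_zero_iff)
      have "m w * c \<le> (D * a' - E * ((\<beta> * a' + b') / \<kappa>)) / (D\<^sup>2 + E\<^sup>2)"
        using le pos by (simp add: pos_le_divide_eq mult.assoc)
      thus ?thesis using angle_deriv[OF s1 s2 w'(1,2) cont ex dT dy] unfolding D_def[symmetric] E_def[symmetric] by blast
    qed
    then obtain d where d: "\<And>w. s \<le> w \<Longrightarrow> w \<le> t \<Longrightarrow> ((\<lambda>u. Im (L u)) has_real_derivative d w) (at w)" "\<And>w. s \<le> w \<Longrightarrow> w \<le> t \<Longrightarrow> m w * c \<le> d w"
      by metis
    have "Im (L s) - c * N s \<le> Im (L t) - c * N t"
    proof (rule le_by_deriv[OF st(2), where h = "\<lambda>w. Im (L w) - c * N w" and h' = "\<lambda>w. d w - c * m w"])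
      fix w assume w: "s \<le> w" "w \<le> t"
      hence "0 < w" using st s1 by simp
      thus "((\<lambda>w. Im (L w) - c * N w) has_real_derivative d w - c * m w) (at w)" by (intro DERIV_diff DERIV_cmult d w N_deriv)
    next
      fix w assume "s < w" "w < t"
      thus "0 \<le> d w - c * m w" using d(2)[of w] by (simp add: mult.commute)
    qed
    thus "Im (L s) + c * (N t - N s) \<le> Im (L t)" by (simp add: right_diff_distrib)
  qed
qed

text \<open>The angle has to be chosen continuously in \<open>a\<close>. Therefore the difference
  vector is parametrized by \<open>s\<close> instead of \<open>w\<close>, which makes its domain a
  fixed rectangle, on which a continuous logarithm exists. Along each solution the angle starts
  above a constant \<open>B\<close>, loses less than pi before the fast phase and less than pi after
  it, and gains arbitrarily much during it. So at \<open>w = 1\<close> it passes through 0 and pi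
  modulo \<open>2 * pi\<close> for arbitrarily small \<open>a\<close>, which gives the two signs of
  \<open>Lam a - lamb\<close>.\<close>

lemma oscillation:
  assumes disc: "(k - \<delta>)\<^sup>2 < 4 * k" and deg: "degenerate_solution \<alpha> \<beta> \<gamma> f lamb vb" and a0: "0 < a0"
  shows "\<exists>a. 0 < a \<and> a < a0 \<and> a < 1 \<and> lamb < Lam a" "\<exists>a. 0 < a \<and> a < a0 \<and> a < 1 \<and> Lam a < lamb"
proof -
  obtain P where p: "prof lamb 0 (\<lambda>s. 1 - vb s) P" using degenerate_imp_prof[OF deg] .
  obtain T y where s: "sol 0 T y" "\<And>s. 0 < s \<Longrightarrow> s \<le> 1 \<Longrightarrow> T (1 - vb s) = ln s + ln lamb / \<kappa>" using prof_imp_sol[OF p] by metis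
  have lb: "T 1 = ln lamb / \<kappa>" using lam_T1(1)[OF p, of T] s(2)[of 1] by auto
  have lb0: "lamb > 0" using profD(1)[OF p] .
  obtain Ta ya where "\<forall>a. 0 < a \<and> a < 1 \<longrightarrow> sol a (Ta a) (ya a) \<and>
     (\<forall>s. 0 < s \<and> s \<le> 1 \<longrightarrow> Ta a (Wf a s) = ln s + ln (Lam a) / \<kappa> \<and> ya a (Wf a s) = (ln (Pf a s) - \<sigma> * ln s) / \<beta>)"
    using fam_sol by blast
  hence fs: "\<And>a. 0 < a \<Longrightarrow> a < 1 \<Longrightarrow> sol a (Ta a) (ya a)"
    "\<And>a s. 0 < a \<Longrightarrow> a < 1 \<Longrightarrow> 0 < s \<Longrightarrow> s \<le> 1 \<Longrightarrow> Ta a (Wf a s) = ln s + ln (Lam a) / \<kappa>"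
    "\<And>a s. 0 < a \<Longrightarrow> a < 1 \<Longrightarrow> 0 < s \<Longrightarrow> s \<le> 1 \<Longrightarrow> ya a (Wf a s) = (ln (Pf a s) - \<sigma> * ln s) / \<beta>"
    by auto
  have la: "Ta a 1 = ln (Lam a) / \<kappa>" if "0 < a" "a < 1" for a
    using lam_T1(1)[OF fam[OF that], of "Ta a"] fs(2)[OF that, of 1] by auto
  let ?S = "{0<..1/2::real} \<times> {0<..1::real}"
  have rngW: "a < Wf a r" "Wf a r \<le> 1" "0 < Wf a r" "0 < Pf a r" if "0 < a" "a < 1" "0 < r" "r \<le> 1" for a r
    using prof_range[OF fam[OF that(1,2)] that(3,4)] profD(9)[OF fam[OF that(1,2)] that(3,4)] by auto
  \<comment> \<open>Written with \<open>Lam\<close>, \<open>Wf\<close> and \<open>Pf\<close>, whose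
    continuity in both variables is known, rather than with \<open>Ta\<close> and \<open>ya\<close>.
    The components of \<open>x\<close> are \<open>a\<close> and \<open>s\<close>.\<close>
  define \<zeta> where "\<zeta> x = complex_of_real (ln (snd x) + ln (Lam (fst x)) / \<kappa> - T (Wf (fst x) (snd x))) +
      \<i> * complex_of_real ((ln (Pf (fst x) (snd x)) - \<sigma> * ln (snd x)) / \<beta> - y (Wf (fst x) (snd x)))" for x
  have \<zeta>_eq: "\<zeta> (a, r) = Complex (Ta a (Wf a r) - T (Wf a r)) (ya a (Wf a r) - y (Wf a r))"
    if "0 < a" "a < 1" "0 < r" "r \<le> 1" for a r
    using fs(2,3)[OF that] by (simp add: \<zeta>_def Complex_eq)
  have c\<zeta>: "continuous_on ?S \<zeta>"
  proof -
    have cW: "continuous_on ?S (\<lambda>x. Wf (fst x) (snd x))" by (rule continuous_on_subset[OF fam_cont(2)]) auto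
    have cP: "continuous_on ?S (\<lambda>x. Pf (fst x) (snd x))" by (rule continuous_on_subset[OF fam_cont(3)]) auto
    have im: "(\<lambda>x. Wf (fst x) (snd x)) ` ?S \<subseteq> {0<..1}" using rngW by force
    have cL: "continuous_on ?S (\<lambda>x. Lam (fst x))"
      by (rule continuous_on_compose2[OF fam_cont(1)]) (auto intro!: continuous_intros)
    have nz: "\<forall>x\<in>?S. Lam (fst x) \<noteq> 0" "\<forall>x\<in>?S. snd x \<noteq> 0" "\<forall>x\<in>?S. Pf (fst x) (snd x) \<noteq> 0"
      using profD(1)[OF fam] rngW(4) by force+
    have cTW: "continuous_on ?S (\<lambda>x. T (Wf (fst x) (snd x)))" by (rule continuous_on_compose2[OF solD(5)[OF s(1)] cW im])
    have cyW: "continuous_on ?S (\<lambda>x. y (Wf (fst x) (snd x)))" by (rule continuous_on_compose2[OF solD(6)[OF s(1)] cW im])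
    have ls: "continuous_on ?S (\<lambda>x. ln (snd x))" by (intro continuous_intros nz(2))
    have lL: "continuous_on ?S (\<lambda>x. ln (Lam (fst x)))" by (rule continuous_on_ln[OF cL nz(1)])
    have lP: "continuous_on ?S (\<lambda>x. ln (Pf (fst x) (snd x)))" by (rule continuous_on_ln[OF cP nz(3)])
    have bk: "\<beta> \<noteq> 0" "\<kappa> \<noteq> 0" using par_facts by auto
    have 1: "continuous_on ?S (\<lambda>x. ln (snd x) + ln (Lam (fst x)) / \<kappa> - T (Wf (fst x) (snd x)))"
      using bk by (intro continuous_on_diff continuous_on_add continuous_on_divide continuous_on_const ls lL cTW) auto
    have 2: "continuous_on ?S (\<lambda>x. (ln (Pf (fst x) (snd x)) - \<sigma> * ln (snd x)) / \<beta> - y (Wf (fst x) (snd x)))"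
      using bk by (intro continuous_on_diff continuous_on_mult continuous_on_divide continuous_on_const ls lP cyW) auto
    show ?thesis unfolding \<zeta>_def[abs_def]
      by (intro continuous_on_add continuous_on_mult continuous_on_const continuous_on_of_real 1 2)
  qed
  have nz: "\<zeta> x \<noteq> 0" if x: "x \<in> ?S" for x
  proof -
    obtain a r where ar: "x = (a, r)" "0 < a" "a < 1" "0 < r" "r \<le> 1" using x by auto
    have "Ta a (Wf a r) \<noteq> T (Wf a r) \<or> ya a (Wf a r) \<noteq> y (Wf a r)"
      by (rule sol_no_meet[OF fs(1)[OF ar(2,3)] ar(2) s(1) rngW(1,2)[OF ar(2-5)]])
    thus ?thesis unfolding ar(1) \<zeta>_eq[OF ar(2-5)] by (auto simp: complex_eq_iff)
  qed
  have "contractible ?S" by (intro convex_imp_contractible convex_Times) auto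
  \<comment> \<open>In this proof \<open>g\<close> is the continuous logarithm of
    \<open>\<zeta>\<close> and hides the power of \<open>f\<close>.\<close>
  then obtain g where g: "continuous_on ?S g" "\<And>x. x \<in> ?S \<Longrightarrow> \<zeta> x = exp (g x)"
    using continuous_logarithm_on_contractible[OF c\<zeta> _ nz] by blast
  have Re\<zeta>: "Re (\<zeta> x) = exp (Re (g x)) * cos (Im (g x))" if "x \<in> ?S" for x using g(2)[OF that] by (simp add: Re_exp)
  \<comment> \<open>The value of \<open>s\<close> at which the profile equals \<open>u\<close>; it
    converts between the two parametrizations.\<close>
  define sg where "sg a u = exp (Ta a u - Ta a 1)" for a u
  have sgr: "0 < sg a u" "sg a u \<le> 1" "Wf a (sg a u) = u" if "0 < a" "a < 1" "a < u" "u \<le> 1" for a u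
  proof -
    show "0 < sg a u" by (simp add: sg_def)
    have "Ta a u \<le> Ta a 1" using sol_T_mono[OF fs(1)[OF that(1,2)] that(3), of 1] that(4) by (cases "u < 1") auto
    thus le: "sg a u \<le> 1" by (simp add: sg_def)
    have eq: "Ta a (Wf a (sg a u)) = Ta a u" using fs(2)[OF that(1,2) _ le] la[OF that(1,2)] by (simp add: sg_def)
    note r = rngW(1,2)[OF that(1,2) \<open>0 < sg a u\<close> le]
    show "Wf a (sg a u) = u"
      using sol_T_mono[OF fs(1)[OF that(1,2)] r(1) _ that(4)] sol_T_mono[OF fs(1)[OF that(1,2)] that(3) _ r(2)] eq
      by (cases "Wf a (sg a u)" u rule: linorder_cases) auto
  qed
  define La where "La a u = g (a, sg a u)" for a u
  have La: "continuous_on {a<..1} (La a)" "\<And>u. a < u \<Longrightarrow> u \<le> 1 \<Longrightarrow> exp (La a u) = Complex (Ta a u - T u) (ya a u - y u)"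
    if a: "0 < a" "a \<le> 1/2" for a
  proof -
    have a1: "a < 1" using a by simp
    have "continuous_on {a<..1} (\<lambda>u. (a, sg a u))" unfolding sg_def by (intro continuous_intros solD(5)[OF fs(1)] a a1)
    thus "continuous_on {a<..1} (La a)" unfolding La_def by (rule continuous_on_compose2[OF g(1)]) (use sgr[OF a(1) a1] a in auto)
    fix u assume u: "a < u" "u \<le> 1"
    note r = sgr[OF a(1) a1 u]
    show "exp (La a u) = Complex (Ta a u - T u) (ya a u - y u)"
      using g(2)[of "(a, sg a u)"] \<zeta>_eq[OF a(1) a1 r(1,2)] r a by (simp add: La_def)
  qed
  define \<phi> where "\<phi> a = Im (g (a, 1))" for a
  have c\<phi>: "continuous_on {0<..1/2} \<phi>"
  proof -
    have "continuous_on {0<..1/2} (\<lambda>a. g (a, 1))"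
      by (rule continuous_on_compose2[OF g(1)]) (auto intro!: continuous_intros)
    thus ?thesis unfolding \<phi>_def by (intro continuous_intros)
  qed
  \<comment> \<open>As \<open>s \<rightarrow> 0\<close>, \<open>ln s\<close> tends to minus
    infinity, whereas \<open>T (Wf a s)\<close> stays above \<open>T a1\<close>. So for small
    \<open>s\<close>, uniformly in \<open>a \<ge> a1\<close>, the vector lies in the open left half
    plane, and on a connected set of such points the angle varies by less than pi.\<close>
  have near0: "\<exists>s1. 0 < s1 \<and> s1 \<le> 1 \<and> (\<forall>x1\<in>{a1..1/2} \<times> {0<..s1}. \<forall>x2\<in>{a1..1/2} \<times> {0<..s1}. Im (g x1) - pi < Im (g x2))"
    if a1: "0 < a1" "a1 \<le> 1/2" for a1
  proof -
    have "continuous_on {a1..1/2} (\<lambda>a. ln (Lam a))"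
    proof (intro continuous_on_ln continuous_on_subset[OF fam_cont(1)] ballI)
      show "{a1..1/2} \<subseteq> {0<..<1}" using a1 by auto
      show "Lam a \<noteq> 0" if "a \<in> {a1..1/2}" for a using profD(1)[OF fam[of a]] that a1 by auto
    qed
    hence "bounded ((\<lambda>a. ln (Lam a)) ` {a1..1/2})" by (intro compact_imp_bounded compact_continuous_image) auto
    then obtain M where M: "\<forall>a\<in>{a1..1/2}. \<bar>ln (Lam a)\<bar> \<le> M" by (auto simp: bounded_real)
    define s1 where "s1 = min 1 (exp (T a1 - M / \<kappa> - 1))"
    have s1: "0 < s1" "s1 \<le> 1" by (auto simp: s1_def)
    let ?C = "{a1..1/2} \<times> {0<..s1}"
    have CS: "?C \<subseteq> ?S" using a1 s1 by auto
    have neg: "Re (\<zeta> x) < 0" if x: "x \<in> ?C" for x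
    proof -
      obtain a r where ar: "x = (a, r)" "a1 \<le> a" "a \<le> 1/2" "0 < r" "r \<le> s1" using x by auto
      hence a: "0 < a" "a < 1" "r \<le> 1" using a1 s1 by auto
      have "ln r \<le> ln (exp (T a1 - M / \<kappa> - 1))" using ar by (subst ln_le_cancel_iff) (auto simp: s1_def)
      hence "ln r \<le> T a1 - M / \<kappa> - 1" by simp
      moreover have "ln (Lam a) / \<kappa> \<le> M / \<kappa>"
      proof -
        have "\<bar>ln (Lam a)\<bar> \<le> M" using M ar by simp
        thus ?thesis using par_facts by (intro divide_right_mono) auto
      qed
      moreover have "T a1 < T (Wf a r)"
        using rngW(1,2)[OF a(1,2) ar(4) a(3)] ar a1 by (intro sol_T_mono[OF s(1)]) auto
      ultimately show ?thesis by (simp add: ar(1) \<zeta>_def)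
    qed
    have conn: "connected ((\<lambda>x. Im (g x)) ` ?C)"
    proof (rule connected_continuous_image)
      show "continuous_on ?C (\<lambda>x. Im (g x))" by (intro continuous_intros continuous_on_subset[OF g(1) CS])
      show "connected ?C" by (intro convex_connected convex_Times) auto
    qed
    have "Im (g x1) - pi < Im (g x2)" if x: "x1 \<in> ?C" "x2 \<in> ?C" for x1 x2
    proof (rule ccontr)
      assume "\<not> ?thesis"
      hence le: "Im (g x2) + pi \<le> Im (g x1)" by simp
      define j where "j = \<lceil>(Im (g x2) - pi / 2) / pi\<rceil>"
      define l where "l = pi / 2 + of_int j * pi"
      have "(Im (g x2) - pi / 2) / pi \<le> of_int j" "of_int j < (Im (g x2) - pi / 2) / pi + 1"
        unfolding j_def by linarith+
      hence "Im (g x2) - pi / 2 \<le> of_int j * pi" "of_int j * pi < Im (g x2) - pi / 2 + pi"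
        by (simp_all add: field_simps)
      hence "l \<in> {Im (g x2)..Im (g x1)}" using le by (auto simp: l_def)
      moreover have "{Im (g x2)..Im (g x1)} \<subseteq> (\<lambda>x. Im (g x)) ` ?C"
        using connected_contains_Icc[OF conn] x by blast
      ultimately obtain x where x: "x \<in> ?C" "l = Im (g x)" by blast
      have "cos (Im (g x)) = 0" unfolding x(2)[symmetric] l_def by (simp add: cos_add sin_times_pi_eq_0)
      hence "Re (\<zeta> x) = 0" using Re\<zeta>[of x] x(1) CS by auto
      thus False using neg[OF x(1)] by simp
    qed
    thus ?thesis using s1 by blast
  qed
  obtain sr where sr: "0 < sr" "sr \<le> 1" "\<forall>x1\<in>{1/2..1/2} \<times> {0<..sr}. \<forall>x2\<in>{1/2..1/2} \<times> {0<..sr}. Im (g x1) - pi < Im (g x2)"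
    using near0[of "1/2"] by auto
  \<comment> \<open>Near \<open>s = 0\<close> the curves lie in the left half plane, so the angle there is bounded below uniformly in \<open>a\<close>.\<close>
  define B where "B = Im (g (1/2, sr)) - 2 * pi"
  \<comment> \<open>The comparison of \<open>(a, r)\<close> with \<open>(1/2, sr)\<close> passes
    through \<open>(1/2, min s1 sr)\<close>; each of its two legs costs less than pi.\<close>
  have start: "\<exists>s1. 0 < s1 \<and> s1 \<le> 1 \<and> (\<forall>r. 0 < r \<and> r \<le> s1 \<longrightarrow> B < Im (g (a, r)))" if a: "0 < a" "a \<le> 1/2" for a
  proof -
    obtain s1 where s1: "0 < s1" "s1 \<le> 1" "\<forall>x1\<in>{a..1/2} \<times> {0<..s1}. \<forall>x2\<in>{a..1/2} \<times> {0<..s1}. Im (g x1) - pi < Im (g x2)"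
      using near0[OF a] by blast
    have "B < Im (g (a, r))" if r: "0 < r" "r \<le> s1" for r
    proof -
      let ?x = "(1/2::real, min s1 sr)"
      have "?x \<in> {a..1/2} \<times> {0<..s1}" "(a, r) \<in> {a..1/2} \<times> {0<..s1}" using a r s1 sr by auto
      hence "Im (g ?x) - pi < Im (g (a, r))" using s1(3) by blast
      moreover have "(1/2, sr) \<in> {1/2..1/2::real} \<times> {0<..sr}" "?x \<in> {1/2..1/2::real} \<times> {0<..sr}" using s1 sr by auto
      hence "Im (g (1/2, sr)) - pi < Im (g ?x)" using sr(3) by blast
      ultimately show ?thesis by (simp add: B_def)
    qed
    thus ?thesis using s1 by blast
  qed
  obtain w1 c S where fast: "0 < w1" "w1 \<le> w0" "0 < c" "\<And>a T1 y1 T2 y2 L s t. sol a T1 y1 \<Longrightarrow> 0 < a \<Longrightarrow> sol 0 T2 y2 \<Longrightarrow>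
     continuous_on {a<..1} L \<Longrightarrow> (\<And>u. a < u \<Longrightarrow> u \<le> 1 \<Longrightarrow> exp (L u) = Complex (T1 u - T2 u) (y1 u - y2 u)) \<Longrightarrow>
     a < s \<Longrightarrow> s \<le> t \<Longrightarrow> t \<le> w1 \<Longrightarrow> S < N s - N a \<Longrightarrow> Im (L s) + c * (N t - N s) \<le> Im (L t)"
  proof (rule angle_fast[OF disc], goal_cases)
    case (1 w1 c S)
    note H = 1
    show ?case
    proof (rule H(1))
      fix a T1 y1 T2 y2 L s t
      assume "sol a T1 y1" "0 < a" "sol 0 T2 y2" "continuous_on {a<..1} L"
        "\<And>u. a < u \<Longrightarrow> u \<le> 1 \<Longrightarrow> exp (L u) = Complex (T1 u - T2 u) (y1 u - y2 u)" "a < s" "s \<le> t" "t \<le> w1" "S < N s - N a"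
      thus "Im (L s) + c * (N t - N s) \<le> Im (L t)" by (rule H(5))
    qed (rule H)+
  qed
  have large: "\<exists>b. 0 < b \<and> b \<le> 1/2 \<and> (\<forall>a. 0 < a \<and> a < b \<longrightarrow> M \<le> \<phi> a)" for M
  proof -
    \<comment> \<open>The gain \<open>c * (N w1 - N ws)\<close> has to make up for two drops by pi
      and for the low start at \<open>B\<close>. Then \<open>b\<close> is chosen such that every
      solution with \<open>a < b\<close> is older than \<open>S\<close> at
      \<open>ws\<close>.\<close>
    obtain ws where ws: "0 < ws" "ws < w1" "N ws \<le> N w1 - (M - B + 2 * pi) / c" using N_small[OF fast(1)] by metis
    have "0 < min ws (1/2)" using ws by simp
    then obtain b where b: "0 < b" "b < min ws (1/2)" "N b \<le> N ws - \<bar>S\<bar> - 1" using N_small by metis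
    have "M \<le> \<phi> a" if a: "0 < a" "a < b" for a
    proof -
      have a': "a < 1" "a \<le> 1/2" "a < ws" "ws \<le> 1" "a < w1" "w1 < 1" using a b ws fast w0 by auto
      note L = La[OF a(1) a'(2)]
      have drop: "Im (La a u) - pi < Im (La a v)" if uv: "a < u" "u \<le> v" "v \<le> 1" for u v
      proof (rule angle_drop_less_pi[OF uv(2), where \<phi> = "\<lambda>w. Im (La a w)"])
        show "continuous_on {u..v} (\<lambda>w. Im (La a w))" using uv by (intro continuous_intros continuous_on_subset[OF L(1)]) auto
        show "\<exists>d>0. ((\<lambda>w. Im (La a w)) has_real_derivative d) (at w)" if "u \<le> w" "w < v" "cos (Im (La a w)) = 0" for w
          using that uv by (intro angle_increases_at_axis[OF fs(1)[OF a(1) a'(1)] a(1) s(1) _ _ L]) auto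
      qed
      obtain s1 where s1: "0 < s1" "s1 \<le> 1" "\<And>r. 0 < r \<Longrightarrow> r \<le> s1 \<Longrightarrow> B < Im (g (a, r))" using start[OF a(1) a'(2)] by blast
      define r where "r = min s1 (sg a ws)"
      note sw = sgr[OF a(1) a'(1,3,4)]
      have r: "0 < r" "r \<le> s1" "r \<le> 1" "r \<le> sg a ws" using s1 sw by (auto simp: r_def)
      have Wr: "a < Wf a r" "Wf a r \<le> ws"
        using rngW(1)[OF a(1) a'(1) r(1,3)] prof_mono[OF fam[OF a(1) a'(1)], of r "sg a ws"] r sw by (cases "r = sg a ws"; auto)+
      have "sg a (Wf a r) = r" using fs(2)[OF a(1) a'(1) r(1,3)] la[OF a(1) a'(1)] r by (simp add: sg_def)
      hence 1: "B < Im (La a (Wf a r))" using s1(3)[OF r(1,2)] by (simp add: La_def)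
      have 2: "Im (La a (Wf a r)) - pi < Im (La a ws)" using drop[OF Wr a'(4)] .
      have Na: "S < N ws - N a" using N_less[OF a] b by linarith
      have 3: "Im (La a ws) + c * (N w1 - N ws) \<le> Im (La a w1)"
        using fast(4)[OF fs(1)[OF a(1) a'(1)] a(1) s(1) L a'(3) less_imp_le[OF ws(2)] order_refl Na] .
      have 4: "Im (La a w1) - pi < Im (La a 1)" using drop[of w1 1] a' by auto
      have "(M - B + 2 * pi) / c \<le> N w1 - N ws" using ws by linarith
      hence "M - B + 2 * pi \<le> c * (N w1 - N ws)" using fast(3) by (simp add: pos_divide_le_eq mult.commute)
      moreover have "Im (La a 1) = \<phi> a" by (simp add: La_def sg_def \<phi>_def)
      ultimately show ?thesis using 1 2 3 4 by linarith
    qed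
    thus ?thesis using b by (intro exI[of _ b]) auto
  qed
  have hit: "\<exists>a j. 0 < a \<and> a < a0 \<and> a \<le> 1/2 \<and> \<phi> a = t + of_int j * (2 * pi)" for t
  proof -
    define a1 where "a1 = min a0 (1/2) / 2"
    have a1: "0 < a1" "a1 < a0" "a1 \<le> 1/2" using a0 by (auto simp: a1_def min_def)
    define j where "j = \<lceil>(\<phi> a1 - t) / (2 * pi)\<rceil>"
    define l where "l = t + of_int j * (2 * pi)"
    have "(\<phi> a1 - t) / (2 * pi) \<le> of_int j" by (simp add: j_def)
    hence l: "\<phi> a1 \<le> l" by (simp add: l_def pos_divide_le_eq algebra_simps)
    obtain b where b: "0 < b" "b \<le> 1/2" "\<And>a. 0 < a \<Longrightarrow> a < b \<Longrightarrow> l \<le> \<phi> a" using large by blast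
    define a2 where "a2 = min a1 b / 2"
    have a2: "0 < a2" "a2 \<le> a1" "a2 < b" using a1 b by (auto simp: a2_def min_def)
    have "\<exists>x\<ge>a2. x \<le> a1 \<and> \<phi> x = l"
      using l b(3)[OF a2(1,3)] a1 a2 by (intro IVT2' continuous_on_subset[OF c\<phi>]) auto
    thus ?thesis using a1 a2 unfolding l_def by (metis le_less_trans less_le_trans order_trans)
  qed
  have val: "Re (\<zeta> (a, 1)) = (ln (Lam a) - ln lamb) / \<kappa>" if "0 < a" "a < 1" for a
  proof -
    have "Wf a 1 = 1" using profD(6)[OF fam[OF that]] .
    thus ?thesis by (simp add: \<zeta>_def lb diff_divide_distrib)
  qed
  have sgn: "Lam a > 0" if "0 < a" "a < 1" for a using profD(1)[OF fam[OF that]] .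
  have cosper: "cos (t + of_int j * (2 * pi)) = cos t" for t j
    by (simp only: mult.commute[of _ "2 * pi"] cos_add cos_int_2pin sin_int_2pin mult_1_right mult_zero_right diff_zero)
  obtain a j where a: "0 < a" "a < a0" "a \<le> 1/2" "\<phi> a = 0 + of_int j * (2 * pi)" using hit by blast
  have "Re (\<zeta> (a, 1)) > 0" using Re\<zeta>[of "(a, 1)"] a cosper[of 0 j] by (simp add: \<phi>_def)
  hence "ln lamb < ln (Lam a)" using val[of a] a par_facts(5) by (simp add: zero_less_divide_iff)
  hence "lamb < Lam a" using lb0 sgn[of a] a by simp
  thus "\<exists>a. 0 < a \<and> a < a0 \<and> a < 1 \<and> lamb < Lam a" using a by (intro exI[of _ a]) auto
  obtain a j where a: "0 < a" "a < a0" "a \<le> 1/2" "\<phi> a = pi + of_int j * (2 * pi)" using hit by blast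
  have "Re (\<zeta> (a, 1)) < 0" using Re\<zeta>[of "(a, 1)"] a cosper[of pi j] by (simp add: \<phi>_def)
  hence "ln (Lam a) < ln lamb" using val[of a] a par_facts(5) by (simp add: divide_less_0_iff)
  hence "Lam a < lamb" using lb0 sgn[of a] a by simp
  thus "\<exists>a. 0 < a \<and> a < a0 \<and> a < 1 \<and> Lam a < lamb" using a by (intro exI[of _ a]) auto
qed

end

lemma frequently_at_left_1:
  assumes "\<And>a0. 0 < a0 \<Longrightarrow> a0 \<le> 1 \<Longrightarrow> \<exists>a. 0 < a \<and> a < a0 \<and> Q (1 - a)"
  shows "\<exists>\<^sub>F \<tau> in at_left (1::real). Q \<tau>"
  unfolding frequently_def eventually_at_left_1_iff eventually_at_right_field
proof (rule notI)
  assume "\<exists>b>0. \<forall>y>0. y < b \<longrightarrow> \<not> Q (1 - y)"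
  then obtain b where b: "b > 0" "\<And>y. y > 0 \<Longrightarrow> y < b \<Longrightarrow> \<not> Q (1 - y)" by blast
  obtain a where "0 < a" "a < min b 1" "Q (1 - a)" using assms[of "min b 1"] b(1) by auto
  thus False using b(2) by auto
qed

text \<open>A point above \<open>c\<close> is enclosed by two points below \<open>c\<close>. The
  maximum over the interval between these two exceeds \<open>c\<close>, so it is taken in the
  interior and is a local one.\<close>

lemma oscillation_imp_extremum:
  fixes L :: "real \<Rightarrow> real"
  assumes cont: "continuous_on {0<..<1} L"
    and above: "\<And>a0. 0 < a0 \<Longrightarrow> a0 \<le> 1 \<Longrightarrow> \<exists>a. 0 < a \<and> a < a0 \<and> c < L a"
    and below: "\<And>a0. 0 < a0 \<Longrightarrow> a0 \<le> 1 \<Longrightarrow> \<exists>a. 0 < a \<and> a < a0 \<and> L a < c"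
    and a0: "0 < a0" "a0 \<le> 1"
  shows "\<exists>a. 0 < a \<and> a < a0 \<and> c < L a \<and> (\<forall>\<^sub>F t in at a. L t \<le> L a)"
proof -
  obtain a1 where a1: "0 < a1" "a1 < a0" "L a1 < c" using below[OF a0] by blast
  obtain a2 where a2: "0 < a2" "a2 < a1" "c < L a2" using above[of a1] a1 a0 by auto
  obtain a3 where a3: "0 < a3" "a3 < a2" "L a3 < c" using below[of a2] a2 a1 a0 by auto
  have "continuous_on {a3..a1} L" by (rule continuous_on_subset[OF cont]) (use a3 a1 a0 in auto)
  then obtain b where b: "b \<in> {a3..a1}" "\<And>t. t \<in> {a3..a1} \<Longrightarrow> L t \<le> L b"
    using continuous_attains_sup[of "{a3..a1}" L] a2 a3 by auto
  have cb: "c < L b" using b(2)[of a2] a2 a3 by auto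
  hence "b \<noteq> a3" "b \<noteq> a1" using a3 a1 by auto
  hence b': "a3 < b" "b < a1" using b(1) by auto
  have "\<forall>\<^sub>F t in at b. t \<in> {a3<..<a1}" using b' by (intro eventually_at_in_open') auto
  hence "\<forall>\<^sub>F t in at b. L t \<le> L b" by eventually_elim (use b(2) in auto)
  thus ?thesis using b' a3 a1 cb by (intro exI[of _ b]) auto
qed

lemma eventually_at_flip: "eventually Q (at (1 - a)) \<longleftrightarrow> eventually (\<lambda>t. Q (1 - t)) (at (a::real))"
proof -
  have gen: "eventually (\<lambda>t. Q (1 - t)) (at a)" if "eventually Q (at (1 - a))" for Q and a :: real
  proof -
    obtain d where d: "d > 0" "\<And>t. t \<noteq> 1 - a \<Longrightarrow> dist t (1 - a) < d \<Longrightarrow> Q t" using \<open>eventually Q (at (1 - a))\<close> by (auto simp: eventually_at)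
    have "Q (1 - t)" if "t \<noteq> a" "dist t a < d" for t
      using d(2)[of "1 - t"] that by (auto simp: dist_real_def abs_minus_commute)
    thus ?thesis using d(1) by (auto simp: eventually_at)
  qed
  show ?thesis
  proof
    show "eventually Q (at (1 - a)) \<Longrightarrow> eventually (\<lambda>t. Q (1 - t)) (at a)" by (rule gen)
    assume "eventually (\<lambda>t. Q (1 - t)) (at a)"
    thus "eventually Q (at (1 - a))" using gen[of "\<lambda>t. Q (1 - t)" "1 - a"] by simp
  qed
qed

section \<open>The spiral condition and the turning points\<close>

context mems
begin

text \<open>A negative denominator would give \<open>qc < 1 / 2\<close>, against
  \<open>q \<ge> 1\<close>; so it is positive, and \<open>q < qc\<close> becomes
  \<open>(1 + \<delta>) * S < E\<close>. With \<open>t = sqrt (t0 / \<theta>)\<close> and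
  \<open>d = sqrt (1 + \<delta>)\<close> this reads \<open>d * (t - 1) < \<beta> + 1\<close> and
  yields \<open>k < (1 + d)^2\<close>. As \<open>\<delta> < k\<close>, the claim amounts to
  \<open>k - \<delta> < 2 * sqrt k\<close>, that is, to \<open>sqrt k\<close> being closer to 1 than
  \<open>d\<close>.\<close>

lemma spiral_condition:
  assumes "qc_denom \<alpha> \<beta> \<gamma> \<noteq> 0" and q: "q < qc \<alpha> \<beta> \<gamma>"
  shows "(k - \<delta>)\<^sup>2 < 4 * k"
proof -
  define E where "E = \<theta> * (\<beta> + 1)\<^sup>2"
  define t0 where "t0 = tau0 \<alpha> \<beta> \<gamma>"
  define S where "S = (sqrt t0 - sqrt \<theta>)\<^sup>2"
  define Dn where "Dn = 4 * S - 2 * E"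
  have th: "Defs.theta \<alpha> \<beta> \<gamma> = \<theta>" using par_facts(1) by (simp add: Defs.theta_def \<theta>_def \<kappa>_def field_simps)
  have Dn: "qc_denom \<alpha> \<beta> \<gamma> = Dn" by (simp add: qc_denom_def Dn_def S_def E_def t0_def th mult.assoc)
  have qc: "q - 1 / 2 < E / Dn" using q by (simp add: qc_def Dn E_def th)
  have q1: "q \<ge> 1" by (rule q_ge_1)
  have E: "E > 0" using par_facts by (simp add: E_def)
  have "0 < E / Dn" using qc q1 by linarith
  hence Dpos: "Dn > 0" using E by (simp add: zero_less_divide_iff)
  have "(q - 1 / 2) * Dn < E" using qc Dpos by (simp add: pos_less_divide_eq)
  hence "(2 * q - 1) * S < q * E" by (simp add: Dn_def algebra_simps)
  hence "(2 * q - 1) / q * S < E" using q1 by (simp add: pos_divide_less_eq mult.commute)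
  moreover have "(2 * q - 1) / q = 1 + \<delta>" using q1 by (simp add: field_simps)
  ultimately have main: "(1 + \<delta>) * S < E" by simp
  have d0: "0 \<le> \<delta>" using q1 by simp
  define d where "d = sqrt (1 + \<delta>)"
  have d: "d \<ge> 1" "d\<^sup>2 = 1 + \<delta>" using d0 by (auto simp: d_def)
  have t0eq: "t0 = \<gamma> * (1 + \<beta>) - \<beta> * \<theta>" unfolding par_facts(7) by (simp add: t0_def tau0_def \<kappa>_def algebra_simps)
  have g\<theta>: "\<beta> * \<theta> < \<gamma>" unfolding par_facts(7) using par_facts by linarith
  have "\<theta> * 1 \<le> \<beta> * \<theta>" using params par_facts(9) by simp
  hence \<theta>\<gamma>: "\<theta> < \<gamma>" using g\<theta> by linarith
  have "\<theta> * (1 + \<beta>) < \<gamma> * (1 + \<beta>)" using \<theta>\<gamma> par_facts by simp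
  hence t0\<theta>: "\<theta> < t0" unfolding t0eq by (simp add: algebra_simps)
  define t where "t = sqrt (t0 / \<theta>)"
  have t: "t > 1" "t\<^sup>2 = t0 / \<theta>" using t0\<theta> par_facts(9) by (auto simp: t_def)
  have "sqrt t0 = sqrt \<theta> * t" using par_facts(9) t0\<theta> by (simp add: t_def real_sqrt_divide)
  hence "sqrt t0 - sqrt \<theta> = sqrt \<theta> * (t - 1)" by (simp add: algebra_simps)
  hence "S = \<theta> * (t - 1)\<^sup>2" using par_facts(9) by (simp add: S_def power_mult_distrib)
  hence "\<theta> * (d * (t - 1))\<^sup>2 < \<theta> * (\<beta> + 1)\<^sup>2" using main d by (simp add: E_def power_mult_distrib mult_ac)
  hence "(d * (t - 1))\<^sup>2 < (\<beta> + 1)\<^sup>2" using par_facts(9) by simp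
  hence dt: "d * (t - 1) < \<beta> + 1" using par_facts(1) by (simp add: power2_less_imp_less)
  have kk: "k = \<gamma> / \<theta> * d\<^sup>2 - \<beta>"
  proof -
    have "k = \<gamma> / X0 - \<beta>" using eq_facts(1) by (simp add: k_def Z0_def diff_divide_distrib)
    thus ?thesis unfolding d(2) X0_def by simp
  qed
  have g: "\<gamma> / \<theta> * (1 + \<beta>) = t\<^sup>2 + \<beta>" unfolding t(2) t0eq using par_facts(9) by (simp add: field_simps)
  have b0: "0 < 1 + \<beta>" using par_facts(1) by simp
  have "k * (1 + \<beta>) = (t\<^sup>2 + \<beta>) * d\<^sup>2 - \<beta> * (1 + \<beta>)"
    unfolding kk g[symmetric] by (simp add: algebra_simps)
  \<comment> \<open>Rearranged, this is exactly
    \<open>(d * t)^2 < (1 + \<beta> + d)^2\<close>.\<close>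
  also have "\<dots> < (1 + d)\<^sup>2 * (1 + \<beta>)"
  proof -
    have "(d * t)\<^sup>2 < (1 + \<beta> + d)\<^sup>2"
      using dt d t par_facts(1) by (intro power_strict_mono) (auto simp: algebra_simps)
    thus ?thesis by (simp add: power2_eq_square algebra_simps)
  qed
  finally have k1: "k < (1 + d)\<^sup>2" using b0 by simp
  have "\<beta> < \<gamma> / \<theta>" using g\<theta> par_facts(9) by (simp add: pos_less_divide_eq)
  hence "\<beta> * d\<^sup>2 < \<gamma> / \<theta> * d\<^sup>2" using d(1) by (intro mult_strict_right_mono) auto
  moreover have "1 * \<delta> \<le> \<beta> * \<delta>" using d0 params by (intro mult_right_mono) auto
  moreover have "\<beta> * d\<^sup>2 = \<beta> + \<beta> * \<delta>" unfolding d(2) by (simp add: algebra_simps)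
  moreover have gen: "e < G - b" if "B < G" "1 * e \<le> F" "B = b + F" for B G e F b :: real using that by simp
  ultimately have k2: "\<delta> < k" unfolding kk by (intro gen)
  define s where "s = sqrt k"
  have s: "s > 0" "s\<^sup>2 = k" using eq_facts(6) by (auto simp: s_def)
  have "s\<^sup>2 < (1 + d)\<^sup>2" using k1 unfolding s(2) .
  hence "s < 1 + d" by (rule power2_less_imp_less) (use d(1) in linarith)
  moreover have "1 - d < s" using s(1) d(1) by linarith
  ultimately have "\<bar>s - 1\<bar> < d" by linarith
  hence "\<bar>s - 1\<bar>\<^sup>2 < d\<^sup>2" by (intro power_strict_mono) auto
  hence "(s - 1)\<^sup>2 < d\<^sup>2" by simp
  hence "s\<^sup>2 - \<delta> < 2 * s" unfolding d(2) by (simp add: power2_eq_square algebra_simps)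
  hence "k - \<delta> < 2 * s" unfolding s(2) .
  hence "(k - \<delta>)\<^sup>2 < (2 * s)\<^sup>2" using k2 by (intro power_strict_mono) auto
  thus ?thesis using s(2) by (simp add: power_mult_distrib)
qed

text \<open>For the last claim: the parameters \<open>a\<close> with \<open>Lam a = lamb\<close>
  accumulate at 0, so a finite set of them would have a positive minimum with a further one below
  it. Different \<open>a\<close> belong to different solutions because
  \<open>v 0 = 1 - a\<close>.\<close>

lemma curve_oscillates:
  assumes deg: "degenerate_solution \<alpha> \<beta> \<gamma> f lamb vb" and disc: "(k - \<delta>)\<^sup>2 < 4 * k"
  shows "infinitely_many_turning_points_around (curve_lambda \<alpha> \<beta> \<gamma> f) lamb"
    "oscillates_around (curve_lambda \<alpha> \<beta> \<gamma> f) lamb"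
    "infinite {v. regular_solution \<alpha> \<beta> \<gamma> f lamb v}"
proof -
  let ?L = "curve_lambda \<alpha> \<beta> \<gamma> f"
  have osc: "\<exists>a. 0 < a \<and> a < a0 \<and> lamb < Lam a" "\<exists>a. 0 < a \<and> a < a0 \<and> Lam a < lamb" if "0 < a0" for a0
    using oscillation[OF disc deg that] by blast+
  have L: "?L (1 - a) = Lam a" if "0 < a" "a < 1" for a by (rule curve_eq(1)[OF that])
  show "oscillates_around ?L lamb"
    unfolding oscillates_around_def
  proof (intro conjI frequently_at_left_1)
    fix a0 :: real assume a0: "0 < a0" "a0 \<le> 1"
    obtain a where "0 < a" "a < a0" "Lam a < lamb" using osc(2)[OF a0(1)] by blast
    thus "\<exists>a. 0 < a \<and> a < a0 \<and> ?L (1 - a) < lamb" using L[of a] a0 by (intro exI[of _ a]) auto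
    obtain a where "0 < a" "a < a0" "lamb < Lam a" using osc(1)[OF a0(1)] by blast
    thus "\<exists>a. 0 < a \<and> a < a0 \<and> lamb < ?L (1 - a)" using L[of a] a0 by (intro exI[of _ a]) auto
  qed
  have ev: "\<forall>\<^sub>F t in at a. ?L (1 - t) = Lam t" if "0 < a" "a < 1" for a
  proof -
    have "\<forall>\<^sub>F t in at a. t \<in> {0<..<1}" using that by (intro eventually_at_in_open') auto
    thus ?thesis by eventually_elim (auto intro: L)
  qed
  show "infinitely_many_turning_points_around ?L lamb"
    unfolding infinitely_many_turning_points_around_def
  proof (intro conjI frequently_at_left_1)
    fix a0 :: real assume a0: "0 < a0" "a0 \<le> 1"
    obtain a where a: "0 < a" "a < a0" "lamb < Lam a" "\<forall>\<^sub>F t in at a. Lam t \<le> Lam a"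
      using oscillation_imp_extremum[OF fam_cont(1) osc a0] by blast
    have "\<forall>\<^sub>F t in at (1 - a). ?L t \<le> ?L (1 - a)"
      unfolding eventually_at_flip by (rule eventually_elim2[OF a(4) ev[of a]]) (use a a0 L[of a] in auto)
    thus "\<exists>a. 0 < a \<and> a < a0 \<and> lamb < ?L (1 - a) \<and> (\<forall>\<^sub>F t in at (1 - a). ?L t \<le> ?L (1 - a))"
      using a a0 L[of a] by (intro exI[of _ a]) auto
    \<comment> \<open>Minima of \<open>Lam\<close> below \<open>lamb\<close> are maxima of
      \<open>- Lam\<close> above \<open>- lamb\<close>.\<close>
    have c': "continuous_on {0<..<1} (\<lambda>a. - Lam a)" by (intro continuous_intros fam_cont)
    have osc': "\<exists>a. 0 < a \<and> a < a0 \<and> - lamb < - Lam a" "\<exists>a. 0 < a \<and> a < a0 \<and> - Lam a < - lamb" if "0 < a0" for a0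
      using osc[OF that] by auto
    obtain a where a: "0 < a" "a < a0" "- lamb < - Lam a" "\<forall>\<^sub>F t in at a. - Lam t \<le> - Lam a"
      using oscillation_imp_extremum[OF c' osc' a0] by blast
    have "\<forall>\<^sub>F t in at (1 - a). ?L t \<ge> ?L (1 - a)"
      unfolding eventually_at_flip by (rule eventually_elim2[OF a(4) ev[of a]]) (use a a0 L[of a] in auto)
    thus "\<exists>a. 0 < a \<and> a < a0 \<and> ?L (1 - a) < lamb \<and> (\<forall>\<^sub>F t in at (1 - a). ?L (1 - a) \<le> ?L t)"
      using a a0 L[of a] by (intro exI[of _ a]) auto
  qed
  have zero: "\<exists>a. 0 < a \<and> a < a0 \<and> a < 1 \<and> Lam a = lamb" if a0: "0 < a0" for a0
  proof -
    have m: "0 < min a0 1" using a0 by simp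
    obtain a1 a2 where a: "0 < a1" "a1 < min a0 1" "lamb < Lam a1" "0 < a2" "a2 < min a0 1" "Lam a2 < lamb"
      using osc[OF m] by blast
    have "connected (Lam ` {min a1 a2..max a1 a2})"
      by (intro connected_continuous_image continuous_on_subset[OF fam_cont(1)]) (use a in auto)
    moreover have "Lam a1 \<in> Lam ` {min a1 a2..max a1 a2}" "Lam a2 \<in> Lam ` {min a1 a2..max a1 a2}" by auto
    ultimately have "{Lam a2..Lam a1} \<subseteq> Lam ` {min a1 a2..max a1 a2}" using connected_contains_Icc by blast
    hence "lamb \<in> Lam ` {min a1 a2..max a1 a2}" using a by auto
    then obtain b where "lamb = Lam b" "min a1 a2 \<le> b" "b \<le> max a1 a2" by auto
    thus ?thesis using a by (intro exI[of _ b]) auto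
  qed
  show "infinite {v. regular_solution \<alpha> \<beta> \<gamma> f lamb v}"
  proof
    assume fin: "finite {v. regular_solution \<alpha> \<beta> \<gamma> f lamb v}"
    define A where "A = {a. 0 < a \<and> a < 1 \<and> Lam a = lamb}"
    have "A \<subseteq> (\<lambda>v. 1 - v 0) ` {v. regular_solution \<alpha> \<beta> \<gamma> f lamb v}"
    proof
      fix a assume "a \<in> A"
      hence a: "0 < a" "a < 1" "Lam a = lamb" by (auto simp: A_def)
      have "regular_solution \<alpha> \<beta> \<gamma> f lamb (vfun (Wf a))" "vfun (Wf a) 0 = 1 - a"
        using prof_regular[OF fam[OF a(1,2)] a(1)] a(3) by auto
      thus "a \<in> (\<lambda>v. 1 - v 0) ` {v. regular_solution \<alpha> \<beta> \<gamma> f lamb v}" by (intro image_eqI[of _ _ "vfun (Wf a)"]) auto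
    qed
    hence finA: "finite A" using fin finite_surj by blast
    have neA: "A \<noteq> {}" using zero[of 1] by (auto simp: A_def)
    have "Min A \<in> A" using finA neA by (rule Min_in)
    hence "0 < Min A" by (simp add: A_def)
    then obtain a where "0 < a" "a < Min A" "a < 1" "Lam a = lamb" using zero by blast
    hence "a \<in> A" "a < Min A" by (auto simp: A_def)
    thus False using Min_le[OF finA, of a] by simp
  qed
qed

end

theorem corollary1p3:
  fixes \<alpha> \<beta> \<gamma> q ubar :: real and f g :: "real \<Rightarrow> real"
  defines "g \<equiv> \<lambda>u. f u powr (1 / \<beta>)"
  assumes params: "\<gamma> > \<alpha>" "\<alpha> > \<beta>" "\<beta> \<ge> 1"
    and f_C2: "C2_on {0<..} f"
    and f_C0: "continuous_on {0..} f"
    and f_zero: "f 0 = 0"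
    and f_pos: "\<And>u. u > 0 \<Longrightarrow> f u > 0"
    and ubar_pos: "ubar > 0"
    and G1: "\<And>u. 0 < u \<Longrightarrow> u < ubar \<Longrightarrow> deriv g u > 0 \<and> deriv (deriv g) u > 0"
    and G2: "((\<lambda>u. (deriv g u)\<^sup>2 / (g u * deriv (deriv g) u)) \<longlongrightarrow> q) (at_right 0)"
    and G3: "q = 1 \<Longrightarrow>
               (\<forall>\<^sub>F u in at_right 0. (deriv g u)\<^sup>2 / (g u * deriv (deriv g) u) \<ge> 1)"
    and G4: "\<And>u. 0 < u \<Longrightarrow> deriv g u > 0"
  shows "(\<exists>!p. degenerate_solution \<alpha> \<beta> \<gamma> f (fst p) (snd p)) \<and>
    (\<forall>lambar vbar. degenerate_solution \<alpha> \<beta> \<gamma> f lambar vbar \<longrightarrow>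
       (curve_lambda \<alpha> \<beta> \<gamma> f \<longlongrightarrow> lambar) (at_left 1) \<and>
       uniform_limit {0..1} (curve_v \<alpha> \<beta> \<gamma> f) vbar (at_left 1) \<and>
       (qc_denom \<alpha> \<beta> \<gamma> \<noteq> 0 \<and> q < qc \<alpha> \<beta> \<gamma> \<longrightarrow>
          infinitely_many_turning_points_around (curve_lambda \<alpha> \<beta> \<gamma> f) lambar \<and>
          oscillates_around (curve_lambda \<alpha> \<beta> \<gamma> f) lambar \<and>
          infinite {v. regular_solution \<alpha> \<beta> \<gamma> f lambar v}))"
proof -
  interpret mems \<alpha> \<beta> \<gamma> q ubar f g
    by (rule mems.intro; unfold_locales) (use params f_C2 f_C0 f_zero f_pos ubar_pos G1 G2 G3 G4 in \<open>auto simp only: g_def\<close>)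
  show ?thesis
  proof (intro conjI allI impI)
    obtain lam v where d: "degenerate_solution \<alpha> \<beta> \<gamma> f lam v" using degenerate_exists by blast
    show "\<exists>!p. degenerate_solution \<alpha> \<beta> \<gamma> f (fst p) (snd p)"
    proof (rule ex1I[of _ "(lam, v)"])
      fix p assume "degenerate_solution \<alpha> \<beta> \<gamma> f (fst p) (snd p)"
      thus "p = (lam, v)" using degenerate_unique[OF d] by (auto simp: prod_eq_iff)
    qed (use d in simp)
  next
    fix lambar vbar assume d: "degenerate_solution \<alpha> \<beta> \<gamma> f lambar vbar"
    show "(curve_lambda \<alpha> \<beta> \<gamma> f \<longlongrightarrow> lambar) (at_left 1)" "uniform_limit {0..1} (curve_v \<alpha> \<beta> \<gamma> f) vbar (at_left 1)"
      by (rule curve_converges[OF d])+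
    assume "qc_denom \<alpha> \<beta> \<gamma> \<noteq> 0 \<and> q < qc \<alpha> \<beta> \<gamma>"
    hence disc: "(k - \<delta>)\<^sup>2 < 4 * k" by (intro spiral_condition) auto
    show "infinitely_many_turning_points_around (curve_lambda \<alpha> \<beta> \<gamma> f) lambar"
      "oscillates_around (curve_lambda \<alpha> \<beta> \<gamma> f) lambar" "infinite {v. regular_solution \<alpha> \<beta> \<gamma> f lambar v}"
      by (rule curve_oscillates[OF d disc])+
  qed
qed

end
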